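(* Let $W$ be a finite-dimensional complex vector space and let $Y\subset\mathbb P W$ be an irreducible cubic hypersurface. Assume that (a) $Y$ is not polar defective; (b) the reduced singular locus $Y'=(\operatorname{Sing} Y)_{\mathrm{red}}$ is smooth; (c) $\mathfrak{aut}^1(\hat Y)\neq 0$. Then $Y$ is the secant variety of a Severi variety, i.e. there is a Severi variety $V\subset\mathbb P W$ with $Y=SV$.
   Context: Everything is over $\mathbb C$. Polar defective: a hypersurface in $\mathbb P W$ defined by a homogeneous polynomial $F$ is polar defective if the Hessian determinant of $F$ (the determinant of the matrix of second order partial derivatives) vanishes identically; equivalently, the polar map $\mathbb P W\dashrightarrow\mathbb P W^*$ given by the first partial derivatives of $F$ is not dominant. Prolongations: for a projective variety $T\subset\mathbb P W$, let $\hat T\subset W$ be its affine cone, and let $\mathfrak{aut}(\hat T)=\{g\in\mathfrak{gl}(W)\mid g(v)\in T_{\hat T,v}\ \text{for every smooth point } v\in\hat T\}$ be the Lie algebra of infinitesimal linear automorphisms of $\hat T$. Let $\mathfrak{aut}^1(\hat T)$ be the vector space of all $A\in\operatorname{Hom}(\operatorname{Sym}^2W,W)$ such that $A(w,\cdot)\in\mathfrak{aut}(\hat T)$ for all $w\in W$ (prolongations). For a cubic $Y$ defined by an irreducible symmetric trilinear form $F$, $A\in\mathfrak{aut}^1(\hat Y)$ iff $F(A(y,w),y,y)=0$ for all smooth points $y\in\hat Y$ and all $w\in W$. Secant variety: $SV$ is the closure of the union of the lines joining two distinct points of $V$. Severi variety: an irreducible nondegenerate smooth projective variety $V\subset\mathbb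 P^N$ of dimension $m=\frac{2N-4}{3}$ with $SV\ne\mathbb P^N$. *)

theory Defs
  imports
    "HOL-Analysis.Analysis"
    "HOL-Library.Poly_Mapping"
    "HOL-Computational_Algebra.Factorial_Ring"
begin

section \<open>Polynomials on \<open>W = complex ^ 'n\<close>\<close>

text \<open>
  The monomial \<open>\<Prod>i. x i ^ lookup m i\<close> is represented by its exponent vector
  \<open>m :: 'n \<Rightarrow>\<^sub>0 nat\<close>; the ring structure is the convolution product of
  \<^theory>\<open>HOL-Library.Poly_Mapping\<close>.
\<close>

type_synonym 'n cpoly = "('n \<Rightarrow>\<^sub>0 nat) \<Rightarrow>\<^sub>0 complex"

definition peval :: "'n::finite cpoly \<Rightarrow> complex ^ 'n \<Rightarrow> complex" where
  "peval p x = (\<Sum>m\<in>Poly_Mapping.keys p.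
     Poly_Mapping.lookup p m * (\<Prod>i\<in>UNIV. (x $ i) ^ Poly_Mapping.lookup m i))"

definition homogeneous :: "nat \<Rightarrow> 'n::finite cpoly \<Rightarrow> bool" where
  "homogeneous d p \<longleftrightarrow>
     (\<forall>m\<in>Poly_Mapping.keys p. (\<Sum>i\<in>UNIV. Poly_Mapping.lookup m i) = d)"

text \<open>Monomials not involving \<open>x i\<close> get the coefficient \<open>0\<close>, so the truncated
  subtraction on exponents is harmless.\<close>

definition partial :: "'n \<Rightarrow> 'n::finite cpoly \<Rightarrow> 'n cpoly" where
  "partial i p = (\<Sum>m\<in>Poly_Mapping.keys p.
     Poly_Mapping.single (m - Poly_Mapping.single i 1)
       (of_nat (Poly_Mapping.lookup m i) * Poly_Mapping.lookup p m))"

definition hessian_det :: "'n::finite cpoly \<Rightarrow> 'n cpoly" where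
  "hessian_det F = det (\<chi> i j. partial i (partial j F))"

definition polar_defective :: "'n::finite cpoly \<Rightarrow> bool" where
  "polar_defective F \<longleftrightarrow> hessian_det F = 0"


section \<open>Irreducible sets and dimension in a topological space\<close>

definition irreducible_closed :: "'a topology \<Rightarrow> 'a set \<Rightarrow> bool" where
  "irreducible_closed X Z \<longleftrightarrow> closedin X Z \<and> Z \<noteq> {} \<and>
     (\<forall>A B. closedin X A \<and> closedin X B \<and> Z \<subseteq> A \<union> B \<longrightarrow> Z \<subseteq> A \<or> Z \<subseteq> B)"

definition krull_dim :: "'a topology \<Rightarrow> enat" where
  "krull_dim X = Sup {enat k | k. \<exists>Z :: nat \<Rightarrow> 'a set.
     (\<forall>i\<le>k. irreducible_closed X (Z i)) \<and> (\<forall>i<k. Z i \<subset> Z (Suc i))}"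

text \<open>Local dimension: the largest dimension of an irreducible component through the point.\<close>

definition local_dim :: "'a topology \<Rightarrow> 'a \<Rightarrow> enat" where
  "local_dim X p =
     Sup {krull_dim (subtopology X Z) | Z. irreducible_closed X Z \<and> p \<in> Z}"


section \<open>The Zariski topologies on \<open>W\<close> and on the projective space of lines in \<open>W\<close>\<close>

definition zeros :: "'n::finite cpoly set \<Rightarrow> (complex ^ 'n) set" where
  "zeros P = {v. \<forall>f\<in>P. peval f v = 0}"

definition zariski :: "(complex ^ 'n::finite) topology" where
  "zariski = topology (\<lambda>U. \<exists>P. U = - zeros P)"

definition proj_space :: "(complex ^ 'n::finite) set set" where
  "proj_space = {L. vec.subspace L \<and> vec.dim L = 1}"

definition proj_zeros :: "'n::finite cpoly set \<Rightarrow> (complex ^ 'n) set set" where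
  "proj_zeros P = {L \<in> proj_space. L \<subseteq> zeros P}"

definition proj_zariski :: "(complex ^ 'n::finite) set topology" where
  "proj_zariski = topology (\<lambda>U. \<exists>P. (\<forall>f\<in>P. \<exists>d. homogeneous d f) \<and>
     U = proj_space - proj_zeros P)"

definition affine_cone :: "(complex ^ 'n::finite) set set \<Rightarrow> (complex ^ 'n) set" where
  "affine_cone T = insert 0 (\<Union>T)"


section \<open>Tangent spaces and smoothness\<close>

definition vanishing_ideal :: "(complex ^ 'n::finite) set \<Rightarrow> 'n cpoly set" where
  "vanishing_ideal S = {f. \<forall>v\<in>S. peval f v = 0}"

text \<open>Zariski tangent space at \<open>v\<close> of \<open>S\<close> with its reduced structure, as a linear subspace of
  \<open>W\<close>.\<close>

definition tangent_space ::
    "(complex ^ 'n::finite) set \<Rightarrow> complex ^ 'n \<Rightarrow> (complex ^ 'n) set" where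
  "tangent_space S v =
     {u. \<forall>f\<in>vanishing_ideal S. (\<Sum>i\<in>UNIV. peval (partial i f) v * u $ i) = 0}"

definition smooth_point :: "(complex ^ 'n::finite) set \<Rightarrow> complex ^ 'n \<Rightarrow> bool" where
  "smooth_point S v \<longleftrightarrow> v \<in> S \<and>
     enat (vec.dim (tangent_space S v)) = local_dim (subtopology zariski S) v"

text \<open>A projective variety is smooth at a point iff its affine cone is smooth at the nonzero
  vectors over that point.\<close>

definition proj_smooth_at ::
    "(complex ^ 'n::finite) set set \<Rightarrow> (complex ^ 'n) set \<Rightarrow> bool" where
  "proj_smooth_at T L \<longleftrightarrow> (\<forall>v\<in>L - {0}. smooth_point (affine_cone T) v)"

definition proj_smooth :: "(complex ^ 'n::finite) set set \<Rightarrow> bool" where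
  "proj_smooth T \<longleftrightarrow> (\<forall>L\<in>T. proj_smooth_at T L)"

definition sing_locus :: "(complex ^ 'n::finite) set set \<Rightarrow> (complex ^ 'n) set set" where
  "sing_locus T = {L \<in> T. \<not> proj_smooth_at T L}"


section \<open>Infinitesimal automorphisms and prolongations\<close>

definition aut :: "(complex ^ 'n::finite) set \<Rightarrow> (complex ^ 'n \<Rightarrow> complex ^ 'n) set" where
  "aut S = {g. Vector_Spaces.linear (*s) (*s) g \<and>
     (\<forall>v. smooth_point S v \<longrightarrow> g v \<in> tangent_space S v)}"

text \<open>Elements of \<open>Hom(Sym\<^sup>2 W, W)\<close> are symmetric bilinear maps; linearity in the second
  argument, and hence by symmetry in the first, is part of membership in \<^const>\<open>aut\<close>.\<close>

definition aut1 ::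
    "(complex ^ 'n::finite) set \<Rightarrow> (complex ^ 'n \<Rightarrow> complex ^ 'n \<Rightarrow> complex ^ 'n) set" where
  "aut1 S = {A. (\<forall>w w'. A w w' = A w' w) \<and> (\<forall>w. A w \<in> aut S)}"


section \<open>Secant varieties and Severi varieties\<close>

definition secant_variety :: "(complex ^ 'n::finite) set set \<Rightarrow> (complex ^ 'n) set set" where
  "secant_variety V = proj_zariski closure_of
     {K \<in> proj_space. \<exists>L\<in>V. \<exists>M\<in>V. L \<noteq> M \<and> K \<subseteq> vec.span (L \<union> M)}"

definition nondegenerate :: "(complex ^ 'n::finite) set set \<Rightarrow> bool" where
  "nondegenerate V \<longleftrightarrow>
     \<not> (\<exists>H. vec.subspace H \<and> vec.dim H + 1 = CARD('n) \<and> (\<forall>L\<in>V. L \<subseteq> H))"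

definition severi_variety :: "(complex ^ 'n::finite) set set \<Rightarrow> bool" where
  "severi_variety V \<longleftrightarrow>
     irreducible_closed proj_zariski V \<and> nondegenerate V \<and> proj_smooth V \<and>
     (\<exists>m N. N + 1 = CARD('n) \<and> krull_dim (subtopology proj_zariski V) = enat m \<and>
        real m = (2 * real N - 4) / 3) \<and>
     secant_variety V \<noteq> proj_space"


section \<open>The topologies are well defined\<close>

lemma peval_superset:
  assumes "finite K" "Poly_Mapping.keys p \<subseteq> K"
  shows "peval p x = (\<Sum>m\<in>K. Poly_Mapping.lookup p m *
    (\<Prod>i\<in>UNIV. (x $ i) ^ Poly_Mapping.lookup m i))"
  unfolding peval_def by (rule sum.mono_neutral_left) (use assms in \<open>auto simp: in_keys_iff\<close>)

lemma peval_zero [simp]: "peval 0 x = 0"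
  by (simp add: peval_def)

lemma peval_single:
  "peval (Poly_Mapping.single m c) x = c * (\<Prod>i\<in>UNIV. (x $ i) ^ Poly_Mapping.lookup m i)"
  by (subst peval_superset[of "{m}"]) auto

lemma peval_one [simp]: "peval 1 x = 1"
  by (simp flip: single_one add: peval_single)

lemma peval_add: "peval (p + q) x = peval p x + peval q x"
proof -
  let ?K = "Poly_Mapping.keys p \<union> Poly_Mapping.keys q"
  have "Poly_Mapping.keys (p + q) \<subseteq> ?K"
    by (rule Poly_Mapping.keys_add)
  then show ?thesis
    by (simp add: peval_superset[of ?K] lookup_add distrib_right sum.distrib)
qed

lemma peval_sum: "peval (\<Sum>a\<in>A. f a) x = (\<Sum>a\<in>A. peval (f a) x)"
  by (induction A rule: infinite_finite_induct) (auto simp: peval_add)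

lemma cpoly_eq_sum_single:
  fixes p :: "'n cpoly"
  shows "p = (\<Sum>m\<in>Poly_Mapping.keys p. Poly_Mapping.single m (Poly_Mapping.lookup p m))"
  by (rule poly_mapping_eqI)
     (simp add: lookup_sum lookup_single when_def in_keys_iff sum.delta')

lemma peval_mult: "peval (p * q) x = peval p x * peval q x"
proof -
  have "p * q = (\<Sum>m\<in>Poly_Mapping.keys p. \<Sum>m'\<in>Poly_Mapping.keys q.
      Poly_Mapping.single (m + m') (Poly_Mapping.lookup p m * Poly_Mapping.lookup q m'))"
    using arg_cong2[OF cpoly_eq_sum_single[of p] cpoly_eq_sum_single[of q], of "(*)"]
    unfolding sum_product mult_single .
  then have "peval (p * q) x = (\<Sum>m\<in>Poly_Mapping.keys p. \<Sum>m'\<in>Poly_Mapping.keys q.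
      (Poly_Mapping.lookup p m * (\<Prod>i\<in>UNIV. (x $ i) ^ Poly_Mapping.lookup m i)) *
      (Poly_Mapping.lookup q m' * (\<Prod>i\<in>UNIV. (x $ i) ^ Poly_Mapping.lookup m' i)))"
    by (simp add: peval_sum peval_single lookup_add power_add prod.distrib mult_ac)
  then show ?thesis
    by (simp add: peval_def sum_product)
qed

lemma peval_scale:
  assumes "homogeneous d p"
  shows "peval p (c *s x) = c ^ d * peval p x"
proof -
  have "(\<Prod>i\<in>UNIV. ((c *s x) $ i) ^ Poly_Mapping.lookup m i) =
        c ^ d * (\<Prod>i\<in>UNIV. (x $ i) ^ Poly_Mapping.lookup m i)"
    if "m \<in> Poly_Mapping.keys p" for m
  proof -
    have "(\<Sum>i\<in>UNIV. Poly_Mapping.lookup m i) = d"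
      using assms that by (auto simp: homogeneous_def)
    then show ?thesis
      by (simp add: power_mult_distrib prod.distrib flip: power_sum)
  qed
  then show ?thesis
    by (auto simp: peval_def sum_distrib_left intro!: sum.cong)
qed

lemma homogeneous_mult:
  assumes "homogeneous d p" "homogeneous e q"
  shows "homogeneous (d + e) (p * q)"
  unfolding homogeneous_def
proof
  fix m assume "m \<in> Poly_Mapping.keys (p * q)"
  then obtain a b where "a \<in> Poly_Mapping.keys p" "b \<in> Poly_Mapping.keys q" "m = a + b"
    using keys_mult[of p q] by blast
  with assms show "(\<Sum>i\<in>UNIV. Poly_Mapping.lookup m i) = d + e"
    by (simp add: homogeneous_def lookup_add sum.distrib)
qed

lemma zeros_Un: "zeros P \<union> zeros Q = zeros {f * g | f g. f \<in> P \<and> g \<in> Q}"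
proof -
  have "v \<in> zeros P \<or> v \<in> zeros Q \<longleftrightarrow> (\<forall>f\<in>P. \<forall>g\<in>Q. peval f v * peval g v = 0)" for v
    unfolding zeros_def mult_eq_0_iff by blast
  moreover have "v \<in> zeros {f * g | f g. f \<in> P \<and> g \<in> Q} \<longleftrightarrow>
      (\<forall>f\<in>P. \<forall>g\<in>Q. peval f v * peval g v = 0)" for v
    unfolding zeros_def peval_mult[symmetric] by blast
  ultimately show ?thesis
    by blast
qed

lemma zeros_UNION: "(\<Inter>i\<in>I. zeros (P i)) = zeros (\<Union>i\<in>I. P i)"
  by (auto simp: zeros_def)

lemma openin_zariski: "openin zariski U \<longleftrightarrow> (\<exists>P. U = - zeros P)"
proof -
  have "istopology (\<lambda>U. \<exists>P. U = - zeros P)"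
    unfolding istopology_def
  proof (intro conjI allI impI)
    fix S T :: "(complex ^ 'n) set"
    assume "\<exists>P. S = - zeros P" "\<exists>P. T = - zeros P"
    then obtain P Q where "S = - zeros P" "T = - zeros Q"
      by blast
    then have "S \<inter> T = - zeros {f * g | f g. f \<in> P \<and> g \<in> Q}"
      by (simp flip: zeros_Un)
    then show "\<exists>P. S \<inter> T = - zeros P"
      by blast
  next
    fix \<K> :: "(complex ^ 'n) set set"
    assume "\<forall>K\<in>\<K>. \<exists>P. K = - zeros P"
    then obtain P where P: "\<forall>K\<in>\<K>. K = - zeros (P K)"
      by (rule bchoice[THEN exE])
    have "\<Union>\<K> = (\<Union>K\<in>\<K>. - zeros (P K))"
      using P by auto
    then have "\<Union>\<K> = - (\<Inter>K\<in>\<K>. zeros (P K))"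
      by simp
    then show "\<exists>P. \<Union>\<K> = - zeros P"
      unfolding zeros_UNION by blast
  qed
  then show ?thesis
    unfolding zariski_def by (subst topology_inverse') auto
qed

lemma topspace_zariski [simp]: "topspace zariski = UNIV"
proof -
  have "openin zariski (- zeros {1})"
    using openin_zariski by blast
  then show ?thesis
    using openin_subset by (fastforce simp: zeros_def)
qed

lemma closedin_zariski: "closedin zariski S \<longleftrightarrow> (\<exists>P. S = zeros P)"
  by (simp add: closedin_def openin_zariski Compl_eq_Diff_UNIV[symmetric])

lemma proj_space_cases:
  assumes "L \<in> proj_space"
  obtains v where "v \<noteq> 0" "L = range (\<lambda>c. c *s v)"
proof -
  have L: "vec.subspace L" "vec.dim L = 1"
    using assms by (auto simp: proj_space_def)
  obtain B where B: "B \<subseteq> L" "vec.independent B" "L \<subseteq> vec.span B" "card B = vec.dim L"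
    using vec.basis_exists by blast
  then obtain v where "B = {v}"
    using L by (metis card_1_singletonE)
  moreover have "L = vec.span B"
    using B L by (simp add: vec.span_minimal subset_antisym)
  ultimately show thesis
    using that[of v] B by (auto simp: vec.span_singleton)
qed

lemma proj_zeros_Un:
  fixes P Q :: "'n::finite cpoly set"
  assumes "\<forall>f\<in>P. \<exists>d. homogeneous d f" "\<forall>f\<in>Q. \<exists>d. homogeneous d f"
  shows "proj_zeros P \<union> proj_zeros Q = proj_zeros {f * g | f g. f \<in> P \<and> g \<in> Q}"
proof -
  have "L \<subseteq> zeros P \<or> L \<subseteq> zeros Q"
    if "L \<in> proj_space" "L \<subseteq> zeros {f * g | f g. f \<in> P \<and> g \<in> Q}" for L
  proof -
    obtain v where v: "v \<noteq> 0" "L = range (\<lambda>c. c *s v)"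
      using proj_space_cases[OF \<open>L \<in> proj_space\<close>] .
    have line: "L \<subseteq> zeros R" if "\<forall>f\<in>R. \<exists>d. homogeneous d f" "v \<in> zeros R" for R
      using that peval_scale unfolding v zeros_def by fastforce
    have "v \<in> L"
      using v(2) by (metis rangeI vector_smult_lid)
    then have "v \<in> zeros P \<or> v \<in> zeros Q"
      using that(2) zeros_Un by blast
    then show ?thesis
      using line assms by blast
  qed
  moreover have "zeros P \<union> zeros Q = zeros {f * g | f g. f \<in> P \<and> g \<in> Q}"
    by (rule zeros_Un)
  ultimately show ?thesis
    unfolding proj_zeros_def by blast
qed

lemma openin_proj_zariski:
  fixes U :: "(complex ^ 'n::finite) set set"
  shows
  "openin proj_zariski U \<longleftrightarrow>
     (\<exists>P. (\<forall>f\<in>P. \<exists>d. homogeneous d f) \<and> U = proj_space - proj_zeros P)"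
proof -
  let ?hom = "\<lambda>P :: 'n cpoly set. \<forall>f\<in>P. \<exists>d. homogeneous d f"
  have "istopology (\<lambda>U. \<exists>P. ?hom P \<and> U = proj_space - proj_zeros P)"
    unfolding istopology_def
  proof (intro conjI allI impI)
    fix S T :: "(complex ^ 'n) set set"
    assume "\<exists>P. ?hom P \<and> S = proj_space - proj_zeros P"
      and "\<exists>P. ?hom P \<and> T = proj_space - proj_zeros P"
    then obtain P Q where PQ: "?hom P" "S = proj_space - proj_zeros P"
        "?hom Q" "T = proj_space - proj_zeros Q"
      by blast
    then have "S \<inter> T = proj_space - proj_zeros {f * g | f g. f \<in> P \<and> g \<in> Q}"
      using proj_zeros_Un[of P Q] by blast
    moreover have "?hom {f * g | f g. f \<in> P \<and> g \<in> Q}"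
      using PQ homogeneous_mult by blast
    ultimately show "\<exists>P. ?hom P \<and> S \<inter> T = proj_space - proj_zeros P"
      by blast
  next
    fix \<K> :: "(complex ^ 'n) set set set"
    assume "\<forall>K\<in>\<K>. \<exists>P. ?hom P \<and> K = proj_space - proj_zeros P"
    then obtain P where P: "\<forall>K\<in>\<K>. ?hom (P K) \<and> K = proj_space - proj_zeros (P K)"
      by (rule bchoice[THEN exE])
    have "\<Union>\<K> = (\<Union>K\<in>\<K>. proj_space - proj_zeros (P K))"
      using P by auto
    also have "\<dots> = proj_space - proj_zeros (\<Union>K\<in>\<K>. P K)"
      by (auto simp: proj_zeros_def zeros_def subset_eq)
    finally show "\<exists>P. ?hom P \<and> \<Union>\<K> = proj_space - proj_zeros P"
      using P by (intro exI[of _ "\<Union>K\<in>\<K>. P K"]) blast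
  qed
  then show ?thesis
    unfolding proj_zariski_def by (subst topology_inverse') auto
qed

lemma topspace_proj_zariski [simp]:
  "topspace proj_zariski = (proj_space :: (complex ^ 'n::finite) set set)"
proof (rule subset_antisym)
  have "homogeneous 0 (1 :: 'n cpoly)"
    by (simp add: homogeneous_def flip: single_one)
  then have "openin proj_zariski (proj_space - proj_zeros {1 :: 'n cpoly})"
    unfolding openin_proj_zariski by blast
  moreover have "proj_zeros {1 :: 'n cpoly} = {}"
    by (auto simp: proj_zeros_def zeros_def elim!: proj_space_cases)
  ultimately show "proj_space \<subseteq> topspace (proj_zariski :: (complex ^ 'n) set topology)"
    using openin_subset by fastforce
next
  have "openin proj_zariski (topspace (proj_zariski :: (complex ^ 'n) set topology))"
    by simp
  then show "topspace proj_zariski \<subseteq> (proj_space :: (complex ^ 'n) set set)"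
    unfolding openin_proj_zariski by blast
qed

lemma closedin_proj_zariski:
  fixes T :: "(complex ^ 'n::finite) set set"
  shows
  "closedin proj_zariski T \<longleftrightarrow>
     (\<exists>P. (\<forall>f\<in>P. \<exists>d. homogeneous d f) \<and> T = proj_zeros P)"
proof -
  have "T \<subseteq> proj_space \<and> proj_space - T = proj_space - proj_zeros P \<longleftrightarrow> T = proj_zeros P"
    for P :: "'n cpoly set"
    unfolding proj_zeros_def by blast
  then show ?thesis
    unfolding closedin_def openin_proj_zariski topspace_proj_zariski by blast
qed

end

theory Submission
  imports Defs "HOL-Computational_Algebra.Fundamental_Theorem_Algebra" "HOL-Library.Function_Algebras"
begin

text \<open>
  Let \<open>f\<close> be the symmetric trilinear form of the cubic. A prolongation \<open>A\<close> satisfies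
  \<open>f x x (A w x) = l w * f x x x\<close> for a linear form \<open>l\<close>, and \<open>l\<close> does not vanish if the Hessian does
  not. Then there is a singular point \<open>c\<close> with \<open>l c = 1\<close>, and the eigenspaces of \<open>A c\<close> split the space
  into \<open>\<complex>c \<oplus> W\<^sub>1 \<oplus> W\<^sub>0\<close> such that, for \<open>v = t c + x + y\<close>, the cubic becomes
  \<open>t Q(y, y) - 2 Q(b(x, x), y)\<close>, with \<open>Q\<close> nondegenerate on \<open>W\<^sub>0\<close> and \<open>b\<close> a quadratic map from \<open>W\<^sub>1\<close> to
  the cone \<open>E\<close> of isotropic vectors of \<open>W\<^sub>0\<close>. The singular points with \<open>t \<noteq> 0\<close> are the
  \<open>t c + x + b(x, x) / t\<close>, and \<open>E\<close> is singular, too. Smoothness of the singular locus along \<open>E\<close> bounds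
  its tangent spaces there; counting isotropic dimensions for the forms \<open>Q(b(u, w), y)\<close> then yields that \<open>b\<close> maps onto \<open>E\<close>
  and that \<open>dim W\<^sub>1 + 4 = 2 dim W\<^sub>0\<close>. Hence the singular cone is the closure of the image of
  \<open>(t, x) \<mapsto> t\<^sup>2 c + t x + b(x, x)\<close>, so it is irreducible of the dimension required of a Severi variety, and
  every point of the cubic with \<open>t \<noteq> 0\<close> is the sum of \<open>t c + x + b(x, x) / t\<close> and a vector of \<open>E\<close>.
\<close>

section \<open>Polynomial functions\<close>

text \<open>Nondegeneracy enters through single forms: where the Hessian is nonzero,
  \<open>f v u\<close> determines \<open>u\<close>, and identities spread by density. So a
  prolongation with \<open>l = 0\<close> vanishes and \<open>A\<close> is determined by
  \<open>l\<close>. The point \<open>c\<close> comes from the quadratic map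
  \<open>q x = 3 l(x) x - 2 A x x\<close>, for which \<open>f (q x) x w = l w * f x x x\<close>: for
  suitable \<open>v\<close> on the cubic, the line through \<open>v\<close> and \<open>q v\<close>
  carries two singular points. Bracketing with \<open>A c\<close> makes the prolongation homogeneous
  for the weights 3, 3/2, 0 of \<open>A c\<close>; comparing weights leaves only \<open>Q\<close>
  and \<open>b\<close>. Smoothness is a statement about chains of closed sets, and nothing prevents
  at the outset a component of the singular cone inside \<open>\<tau> = 0\<close>. Hence lengths of
  chains are bounded by counting independent functions, and such components are excluded by
  deforming tangent vectors to nearby points of \<open>E\<close>. The relation between the
  dimensions expresses that, for non-orthogonal \<open>y\<close>, \<open>y'\<close> in the image of
  \<open>b\<close>, the radicals of \<open>Q(b(u, w), y)\<close> and \<open>Q(b(u, w), y')\<close>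
  are complementary in \<open>W1\<close>, each of dimension
  \<open>dim W1 + 2 - dim W0\<close>.\<close>

definition polyfun :: "(complex ^ 'n::finite \<Rightarrow> complex) \<Rightarrow> bool" where
  "polyfun f \<longleftrightarrow> (\<exists>p. f = peval p)"

lemma polyfun_peval [simp, intro]: "polyfun (peval p)" "polyfun (\<lambda>x. peval p x)"
  by (auto simp: polyfun_def)

lemma polyfun_const [simp, intro]: "polyfun (\<lambda>x. c)"
  unfolding polyfun_def by (rule exI[of _ "Poly_Mapping.single 0 c"]) (auto simp: peval_single)

lemma polyfun_coord [simp, intro]:
  fixes i :: "'n::finite"
  shows "polyfun (\<lambda>x. x $ i)"
proof -
  have "(\<Prod>j\<in>UNIV. (x $ j) ^ Poly_Mapping.lookup (Poly_Mapping.single i 1) j) = x $ i"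
    for x :: "complex ^ 'n"
  proof -
    have "(\<Prod>j\<in>UNIV. (x $ j) ^ Poly_Mapping.lookup (Poly_Mapping.single i 1) j) =
        (\<Prod>j\<in>UNIV. if j = i then x $ j else 1)"
      by (rule prod.cong) (auto simp: lookup_single)
    then show ?thesis by simp
  qed
  then show ?thesis
    unfolding polyfun_def
    by (intro exI[of _ "Poly_Mapping.single (Poly_Mapping.single i 1) 1"]) (auto simp: peval_single)
qed

lemma polyfun_add [simp, intro]: "polyfun f \<Longrightarrow> polyfun g \<Longrightarrow> polyfun (\<lambda>x. f x + g x)"
  unfolding polyfun_def by (auto simp flip: peval_add)

lemma polyfun_mult [simp, intro]: "polyfun f \<Longrightarrow> polyfun g \<Longrightarrow> polyfun (\<lambda>x. f x * g x)"
  unfolding polyfun_def by (auto simp flip: peval_mult)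

lemma polyfun_minus [simp, intro]: "polyfun f \<Longrightarrow> polyfun (\<lambda>x. - f x)"
  using polyfun_mult[OF polyfun_const[of "-1"], of f] by simp

lemma polyfun_diff [simp, intro]: "polyfun f \<Longrightarrow> polyfun g \<Longrightarrow> polyfun (\<lambda>x. f x - g x)"
  using polyfun_add[OF _ polyfun_minus, of f g] by simp

lemma polyfun_divide_const [simp, intro]: "polyfun f \<Longrightarrow> polyfun (\<lambda>x. f x / c)"
  using polyfun_mult[OF _ polyfun_const[of "1 / c"], of f] by simp

lemma polyfun_power [simp, intro]: "polyfun f \<Longrightarrow> polyfun (\<lambda>x. f x ^ k)"
  by (induction k) auto

lemma polyfun_sum [simp, intro]: "(\<And>i. i \<in> I \<Longrightarrow> polyfun (f i)) \<Longrightarrow> polyfun (\<lambda>x. \<Sum>i\<in>I. f i x)"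
  by (induction I rule: infinite_finite_induct) auto

lemma polyfun_prod [simp, intro]: "(\<And>i. i \<in> I \<Longrightarrow> polyfun (f i)) \<Longrightarrow> polyfun (\<lambda>x. \<Prod>i\<in>I. f i x)"
  by (induction I rule: infinite_finite_induct) auto

text \<open>\<open>N\<close> is an upper bound for the degree, read off from a way of building the
  function. Such bounds are what the later counting of independent functions requires, and they
  yield the induction rule for \<open>polyfun\<close>.\<close>

inductive pdeg :: "nat \<Rightarrow> (complex ^ 'n::finite \<Rightarrow> complex) \<Rightarrow> bool" where
  const: "pdeg N (\<lambda>x. c)"
| coord: "1 \<le> N \<Longrightarrow> pdeg N (\<lambda>x. x $ i)"
| add: "pdeg N f \<Longrightarrow> pdeg N g \<Longrightarrow> pdeg N (\<lambda>x. f x + g x)"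
| mult: "pdeg M f \<Longrightarrow> pdeg N g \<Longrightarrow> M + N \<le> K \<Longrightarrow> pdeg K (\<lambda>x. f x * g x)"

lemma pdeg_mono: "pdeg M f \<Longrightarrow> M \<le> N \<Longrightarrow> pdeg N f"
  using pdeg.mult[OF pdeg.const[of 0 1], of M f N] by simp

lemma pdeg_sum: "(\<And>i. i \<in> I \<Longrightarrow> pdeg N (f i)) \<Longrightarrow> pdeg N (\<lambda>x. \<Sum>i\<in>I. f i x)"
  by (induction I rule: infinite_finite_induct) (auto intro: pdeg.intros)

lemma pdeg_prod:
  "(\<And>i. i \<in> I \<Longrightarrow> \<exists>N. pdeg N (f i)) \<Longrightarrow> \<exists>N. pdeg N (\<lambda>x. \<Prod>i\<in>I. f i x)"
proof (induction I rule: infinite_finite_induct)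
  case (insert a I)
  then obtain M N where "pdeg M (f a)" "pdeg N (\<lambda>x. \<Prod>i\<in>I. f i x)"
    by (meson insertCI)
  then show ?case
    using insert pdeg.mult[of M "f a" N _ "M + N"] by auto
qed (auto intro: pdeg.intros)

lemma pdeg_power: "\<exists>N. pdeg N (\<lambda>x. (x $ i) ^ k)"
proof (induction k)
  case (Suc k)
  then obtain N where "pdeg N (\<lambda>x. (x $ i) ^ k)" by blast
  then have "pdeg (1 + N) (\<lambda>x. x $ i * (x $ i) ^ k)"
    by (intro pdeg.mult pdeg.coord) auto
  then show ?case by auto
qed (auto intro: pdeg.intros)

lemma polyfun_iff_pdeg:
  fixes f :: "complex ^ 'n::finite \<Rightarrow> complex"
  shows "polyfun f \<longleftrightarrow> (\<exists>N. pdeg N f)"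
proof
  assume "polyfun f"
  then obtain p where p: "f = peval p" by (auto simp: polyfun_def)
  have "\<exists>N. pdeg N (\<lambda>x. \<Prod>i\<in>UNIV. (x $ i) ^ Poly_Mapping.lookup m i)"
    for m :: "'n \<Rightarrow>\<^sub>0 nat"
    by (intro pdeg_prod pdeg_power)
  then obtain D where D: "\<And>m :: 'n \<Rightarrow>\<^sub>0 nat. pdeg (D m) (\<lambda>x. \<Prod>i\<in>UNIV. (x $ i) ^ Poly_Mapping.lookup m i)"
    by metis
  define N where "N = (\<Sum>m\<in>Poly_Mapping.keys p. D m)"
  have "pdeg N (\<lambda>x. \<Sum>m\<in>Poly_Mapping.keys p.
     Poly_Mapping.lookup p m * (\<Prod>i\<in>UNIV. (x $ i) ^ Poly_Mapping.lookup m i))"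
  proof (intro pdeg_sum)
    fix m assume "m \<in> Poly_Mapping.keys p"
    then have "D m \<le> N"
      unfolding N_def by (simp add: member_le_sum)
    then show "pdeg N (\<lambda>x. Poly_Mapping.lookup p m * (\<Prod>i\<in>UNIV. (x $ i) ^ Poly_Mapping.lookup m i))"
      by (intro pdeg.mult[OF pdeg.const[of 0] D]) auto
  qed
  then show "\<exists>N. pdeg N f"
    using p by (auto simp: peval_def[abs_def])
next
  assume "\<exists>N. pdeg N f"
  then obtain N where "pdeg N f" by blast
  then show "polyfun f"
    by induction auto
qed

lemma polyfun_induct [consumes 1, case_names const coord add mult]:
  assumes "polyfun f"
    and "\<And>c. P (\<lambda>x. c)" and "\<And>i. P (\<lambda>x. x $ i)"
    and "\<And>f g. polyfun f \<Longrightarrow> polyfun g \<Longrightarrow> P f \<Longrightarrow> P g \<Longrightarrow> P (\<lambda>x. f x + g x)"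
    and "\<And>f g. polyfun f \<Longrightarrow> polyfun g \<Longrightarrow> P f \<Longrightarrow> P g \<Longrightarrow> P (\<lambda>x. f x * g x)"
  shows "P f"
proof -
  obtain N where "pdeg N f" using assms(1) polyfun_iff_pdeg by blast
  then show ?thesis
  proof induction
    case (add N f g)
    then show ?case using assms(4) polyfun_iff_pdeg by metis
  next
    case (mult M f N g K)
    then show ?case using assms(5) polyfun_iff_pdeg by metis
  qed (use assms(2,3) in blast)+
qed

section \<open>Polynomial maps, linear forms and linear maps\<close>

definition polymap :: "(complex ^ 'n::finite \<Rightarrow> complex ^ 'm::finite) \<Rightarrow> bool" where
  "polymap h \<longleftrightarrow> (\<forall>i. polyfun (\<lambda>x. h x $ i))"

lemma polymapI: "(\<And>i. polyfun (\<lambda>x. h x $ i)) \<Longrightarrow> polymap h"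
  by (auto simp: polymap_def)

lemma polyfun_nth [simp, intro]: "polymap h \<Longrightarrow> polyfun (\<lambda>x. h x $ i)"
  by (auto simp: polymap_def)

lemma polymap_id [simp, intro]: "polymap (\<lambda>x. x)"
  by (auto simp: polymap_def)

lemma polymap_const [simp, intro]: "polymap (\<lambda>x. a)"
  by (auto simp: polymap_def)

lemma polymap_add [simp, intro]: "polymap f \<Longrightarrow> polymap g \<Longrightarrow> polymap (\<lambda>x. f x + g x)"
  by (auto simp: polymap_def)

lemma polymap_diff [simp, intro]: "polymap f \<Longrightarrow> polymap g \<Longrightarrow> polymap (\<lambda>x. f x - g x)"
  by (auto simp: polymap_def)

lemma polymap_scale [simp, intro]: "polyfun f \<Longrightarrow> polymap g \<Longrightarrow> polymap (\<lambda>x. f x *s g x)"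
  by (auto simp: polymap_def)

lemma polymap_sum [simp, intro]: "(\<And>i. i \<in> I \<Longrightarrow> polymap (f i)) \<Longrightarrow> polymap (\<lambda>x. \<Sum>i\<in>I. f i x)"
  by (auto simp: polymap_def)

lemma polyfun_comp: "polyfun f \<Longrightarrow> polymap h \<Longrightarrow> polyfun (\<lambda>x. f (h x))"
  by (induction f rule: polyfun_induct) auto

lemma polymap_comp: "polymap f \<Longrightarrow> polymap h \<Longrightarrow> polymap (\<lambda>x. f (h x))"
  unfolding polymap_def using polyfun_comp polymap_def by blast

definition lfun :: "(complex ^ 'n::finite \<Rightarrow> complex) \<Rightarrow> bool" where
  "lfun l \<longleftrightarrow> (\<forall>x y. l (x + y) = l x + l y) \<and> (\<forall>c x. l (c *s x) = c * l x)"

definition lmap :: "(complex ^ 'n::finite \<Rightarrow> complex ^ 'm::finite) \<Rightarrow> bool" where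
  "lmap g \<longleftrightarrow> (\<forall>x y. g (x + y) = g x + g y) \<and> (\<forall>c x. g (c *s x) = c *s g x)"

lemma lmap_iff_linear: "lmap g \<longleftrightarrow> Vector_Spaces.linear (*s) (*s) g"
  unfolding lmap_def Vector_Spaces.linear_iff
  by (simp add: vec.vector_space_axioms)

lemma lfun_add: "lfun l \<Longrightarrow> l (x + y) = l x + l y"
  and lfun_scale: "lfun l \<Longrightarrow> l (c *s x) = c * l x"
  by (auto simp: lfun_def)

lemma lmap_add: "lmap g \<Longrightarrow> g (x + y) = g x + g y"
  and lmap_scale: "lmap g \<Longrightarrow> g (c *s x) = c *s g x"
  by (auto simp: lmap_def)

lemma lfun_0: "lfun l \<Longrightarrow> l 0 = 0"
  using lfun_scale[of l 0 0] by simp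

lemma lmap_0: "lmap g \<Longrightarrow> g 0 = 0"
  using lmap_scale[of g 0 0] by simp

lemma lfun_minus: "lfun l \<Longrightarrow> l (- x) = - l x"
  using lfun_scale[of l "-1" x] by simp

lemma lmap_minus: "lmap g \<Longrightarrow> g (- x) = - g x"
  using lmap_scale[of g "-1" x] by (simp add: vector_sneg_minus1[symmetric])

lemma lfun_diff: "lfun l \<Longrightarrow> l (x - y) = l x - l y"
  using lfun_add[of l x "- y"] lfun_minus[of l y] by simp

lemma lmap_diff: "lmap g \<Longrightarrow> g (x - y) = g x - g y"
  using lmap_add[of g x "- y"] lmap_minus[of g y] by simp

lemma lfun_sum: "lfun l \<Longrightarrow> l (\<Sum>i\<in>I. f i) = (\<Sum>i\<in>I. l (f i))"
  by (induction I rule: infinite_finite_induct) (auto simp: lfun_0 lfun_add)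

lemma lmap_sum: "lmap g \<Longrightarrow> g (\<Sum>i\<in>I. f i) = (\<Sum>i\<in>I. g (f i))"
  by (induction I rule: infinite_finite_induct) (auto simp: lmap_0 lmap_add)

lemma lfun_expand: "lfun l \<Longrightarrow> l x = (\<Sum>i\<in>UNIV. x $ i * l (axis i 1))"
  using lfun_sum[of l "\<lambda>i. x $ i *s axis i 1" UNIV] basis_expansion[of x]
  by (simp add: lfun_scale)

lemma lmap_nth: "lmap g \<Longrightarrow> lfun (\<lambda>x. g x $ i)"
  by (auto simp: lmap_def lfun_def)

lemma lfun_polyfun: "lfun l \<Longrightarrow> polyfun l"
proof -
  assume "lfun l"
  then have "l = (\<lambda>x. \<Sum>i\<in>UNIV. x $ i * l (axis i 1))" using lfun_expand by blast
  moreover have "polyfun (\<lambda>x. \<Sum>i\<in>UNIV. x $ i * l (axis i 1))" by auto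
  ultimately show ?thesis by metis
qed

lemma lmap_polymap: "lmap g \<Longrightarrow> polymap g"
  by (intro polymapI lfun_polyfun lmap_nth)

section \<open>Vanishing of polynomial functions on lines and subspaces\<close>

lemma polyfun_on_line:
  assumes "polyfun f"
  obtains P where "\<And>t. f (a + t *s b) = poly P t"
proof -
  have "\<exists>P. \<forall>t. f (a + t *s b) = poly P t"
    using assms
  proof (induction f rule: polyfun_induct)
    case (const c)
    show ?case by (rule exI[of _ "[:c:]"]) simp
  next
    case (coord i)
    show ?case by (rule exI[of _ "[:a $ i, b $ i:]"]) simp
  next
    case (add f g)
    then show ?case by (metis poly_add)
  next
    case (mult f g)
    then show ?case by (metis poly_mult)
  qed
  then show thesis using that by blast
qed

text \<open>A subspace contains the line through a point where \<open>f\<close> is nonzero and a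
  point where \<open>g\<close> is; the restrictions to this line multiply in the integral domain of
  univariate polynomials.\<close>

lemma polyfun_mult_eq_0_on:
  assumes U: "vec.subspace U" and "polyfun f" "polyfun g"
    and fg: "\<And>u. u \<in> U \<Longrightarrow> f u * g u = 0"
  shows "(\<forall>u\<in>U. f u = 0) \<or> (\<forall>u\<in>U. g u = 0)"
proof (rule ccontr)
  assume "\<not> ?thesis"
  then obtain u v where uv: "u \<in> U" "f u \<noteq> 0" "v \<in> U" "g v \<noteq> 0" by blast
  obtain P where P: "\<And>t. f (u + t *s (v - u)) = poly P t"
    using polyfun_on_line[OF assms(2)] by metis
  obtain R where R: "\<And>t. g (u + t *s (v - u)) = poly R t"
    using polyfun_on_line[OF assms(3)] by metis
  have "poly (P * R) t = 0" for t
    using fg[of "u + t *s (v - u)"] U uv P R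
    by (simp add: vec.subspace_add vec.subspace_scale vec.subspace_diff)
  then have "P * R = 0" by (metis poly_all_0_iff_0)
  moreover have "P \<noteq> 0" using P[of 0] uv by auto
  moreover have "R \<noteq> 0" using R[of 1] uv by auto
  ultimately show False by simp
qed

lemma polyfun_eq_0_dense:
  assumes U: "vec.subspace U" and f: "polyfun f" and g: "polyfun g"
    and u: "u \<in> U" "g u \<noteq> 0" and *: "\<And>v. v \<in> U \<Longrightarrow> g v \<noteq> 0 \<Longrightarrow> f v = 0" and v: "v \<in> U"
  shows "f v = 0"
  using polyfun_mult_eq_0_on[OF U f g] * u v by (metis mult_eq_0_iff)

text \<open>Induction on the set of variables: with all variables but one fixed, the function is a
  univariate polynomial, and each of its coefficients is a polynomial in fewer variables that again
  vanishes everywhere.\<close>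

lemma peval_eq_0_imp:
  assumes "\<And>x. peval p x = 0"
  shows "p = (0 :: 'n::finite cpoly)"
proof -
  \<comment> \<open>The exponent vectors in \<open>K\<close> are assumed to be distinguished by
    their entries in \<open>A\<close>. Restricting to the vectors with a fixed entry at
    \<open>a\<close> preserves this for the smaller set of variables.\<close>
  have key: "\<forall>m\<in>K. c m = 0"
    if "finite A" "finite K" "\<And>m m'. m \<in> K \<Longrightarrow> m' \<in> K \<Longrightarrow> (\<forall>i\<in>A. m i = m' i) \<Longrightarrow> m = m'"
      "\<And>x. (\<Sum>m\<in>K. c m * (\<Prod>i\<in>A. (x i) ^ (m i))) = 0"
    for A :: "'n set" and K :: "('n \<Rightarrow> nat) set" and c :: "('n \<Rightarrow> nat) \<Rightarrow> complex"
    using that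
  proof (induction A arbitrary: K c rule: finite_induct)
    case empty
    have "card K \<le> 1" using empty by (metis card_le_Suc0_iff_eq One_nat_def empty_iff)
    then consider "K = {}" | m where "K = {m}"
      using empty(1) by (metis card_0_eq card_1_singletonE le_less less_one)
    then show ?case using empty(3)[of undefined] by cases auto
  next
    case (insert a A)
    show ?case
    proof
      fix m0 assume m0: "m0 \<in> K"
      define e where "e = m0 a"
      define K' where "K' = {m\<in>K. m a = e}"
      have "\<forall>m\<in>K'. c m = 0"
      proof (rule insert.IH)
        show "finite K'" using insert.prems K'_def by auto
        show "m = m'" if "m \<in> K'" "m' \<in> K'" "\<forall>i\<in>A. m i = m' i" for m m'
          using that insert.prems(2)[of m m'] by (auto simp: K'_def)
        fix x :: "'n \<Rightarrow> complex"
        define P where "P = (\<Sum>m\<in>K. monom (c m * (\<Prod>i\<in>A. (x i) ^ (m i))) (m a))"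
        have "poly P t = 0" for t
        proof -
          have "(\<Sum>m\<in>K. c m * (\<Prod>i\<in>insert a A. ((x(a := t)) i) ^ (m i))) = 0"
            using insert.prems(3) by blast
          moreover have "(\<Prod>i\<in>insert a A. ((x(a := t)) i) ^ (m i)) = t ^ m a * (\<Prod>i\<in>A. (x i) ^ (m i))" for m
          proof -
            have "(\<Prod>i\<in>A. ((x(a := t)) i) ^ (m i)) = (\<Prod>i\<in>A. (x i) ^ (m i))"
              by (rule prod.cong) (use insert.hyps in auto)
            then show ?thesis
              using insert.hyps by simp
          qed
          ultimately show ?thesis
            by (simp add: P_def poly_sum poly_monom mult_ac)
        qed
        then have "P = 0" by (metis poly_all_0_iff_0)
        then have "coeff P e = 0" by simp
        then have "(\<Sum>m\<in>K. if m a = e then c m * (\<Prod>i\<in>A. (x i) ^ (m i)) else 0) = 0"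
          by (simp add: P_def coeff_sum)
        then show "(\<Sum>m\<in>K'. c m * (\<Prod>i\<in>A. (x i) ^ (m i))) = 0"
          using insert.prems(1) by (simp add: K'_def sum.inter_filter)
      qed
      then show "c m0 = 0" using m0 by (simp add: K'_def e_def)
    qed
  qed
  have "\<forall>m\<in>Poly_Mapping.lookup ` Poly_Mapping.keys p.
      Poly_Mapping.lookup p (inv_into (Poly_Mapping.keys p) Poly_Mapping.lookup m) = 0"
  proof (rule key[of UNIV])
    have inj: "inj_on Poly_Mapping.lookup (Poly_Mapping.keys p)"
      by (auto simp: inj_on_def intro: poly_mapping_eqI)
    fix x :: "'n \<Rightarrow> complex"
    show "(\<Sum>m\<in>Poly_Mapping.lookup ` Poly_Mapping.keys p.
      Poly_Mapping.lookup p (inv_into (Poly_Mapping.keys p) Poly_Mapping.lookup m) * (\<Prod>i\<in>UNIV. x i ^ m i)) = 0"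
      using assms[of "\<chi> i. x i"] inj
      by (simp add: sum.reindex peval_def inv_into_f_f)
  qed auto
  moreover have "inj_on Poly_Mapping.lookup (Poly_Mapping.keys p)"
    by (auto simp: inj_on_def intro: poly_mapping_eqI)
  ultimately have "\<forall>m\<in>Poly_Mapping.keys p. Poly_Mapping.lookup p m = 0"
    by (simp add: inv_into_f_f)
  then have "Poly_Mapping.keys p = {}"
    by (metis in_keys_iff all_not_in_conv)
  then show ?thesis by simp
qed

lemma peval_uminus: "peval (- p) x = - peval p x"
proof -
  have "peval (- p) x + peval p x = 0"
    by (simp flip: peval_add)
  then show ?thesis by (simp add: eq_neg_iff_add_eq_0)
qed

lemma peval_diff: "peval (p - q) x = peval p x - peval q x"
  using peval_add[of p "- q" x] by (simp add: peval_uminus)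

lemma peval_inject: "peval p = peval q \<longleftrightarrow> p = q"
  using peval_eq_0_imp[of "p - q"] by (auto simp: peval_diff)

lemma polyfun_cramer:
  fixes A :: "complex ^ 'm::finite \<Rightarrow> complex ^ 'n ^ 'n::finite"
  assumes "\<And>i j. polyfun (\<lambda>x. A x $ i $ j)"
  shows "polyfun (\<lambda>x. det (A x))"
  unfolding det_def using assms by auto

section \<open>Derivatives along curves\<close>

lemma peval_partial:
  "peval (partial i p) x = (\<Sum>m\<in>Poly_Mapping.keys p. Poly_Mapping.lookup p m *
     (of_nat (Poly_Mapping.lookup m i) * x $ i ^ (Poly_Mapping.lookup m i - 1) *
      (\<Prod>j\<in>UNIV - {i}. x $ j ^ Poly_Mapping.lookup m j)))"
proof -
  have "(\<Prod>j\<in>UNIV. x $ j ^ Poly_Mapping.lookup (m - Poly_Mapping.single i 1) j) =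
      x $ i ^ (Poly_Mapping.lookup m i - 1) * (\<Prod>j\<in>UNIV - {i}. x $ j ^ Poly_Mapping.lookup m j)" for m
    by (subst prod.remove[of _ i]) (auto simp: lookup_minus lookup_single intro!: prod.cong)
  then show ?thesis
    unfolding partial_def by (simp add: peval_sum peval_single mult_ac)
qed

lemma peval_curve_deriv:
  assumes "\<And>i. ((\<lambda>t. g t $ i) has_field_derivative d i) (at t0)"
  shows "((\<lambda>t. peval p (g t)) has_field_derivative (\<Sum>i\<in>UNIV. peval (partial i p) (g t0) * d i)) (at t0)"
proof -
  have "((\<lambda>t. \<Prod>i\<in>UNIV. g t $ i ^ m i) has_field_derivative
     (\<Sum>i\<in>UNIV. (of_nat (m i) * g t0 $ i ^ (m i - 1) * d i) * (\<Prod>j\<in>UNIV - {i}. g t0 $ j ^ m j))) (at t0)"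
    for m
    by (rule has_field_derivative_prod) (auto intro!: derivative_eq_intros assms)
  then have "((\<lambda>t. peval p (g t)) has_field_derivative
     (\<Sum>m\<in>Poly_Mapping.keys p. Poly_Mapping.lookup p m * (\<Sum>i\<in>UNIV.
      (of_nat (Poly_Mapping.lookup m i) * g t0 $ i ^ (Poly_Mapping.lookup m i - 1) * d i) *
      (\<Prod>j\<in>UNIV - {i}. g t0 $ j ^ Poly_Mapping.lookup m j)))) (at t0)"
    unfolding peval_def by (intro DERIV_sum DERIV_cmult)
  moreover have "(\<Sum>m\<in>Poly_Mapping.keys p. Poly_Mapping.lookup p m * (\<Sum>i\<in>UNIV.
      (of_nat (Poly_Mapping.lookup m i) * g t0 $ i ^ (Poly_Mapping.lookup m i - 1) * d i) *
      (\<Prod>j\<in>UNIV - {i}. g t0 $ j ^ Poly_Mapping.lookup m j))) =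
      (\<Sum>i\<in>UNIV. peval (partial i p) (g t0) * d i)"
    unfolding peval_partial sum_distrib_left sum_distrib_right
    by (subst sum.swap) (simp add: mult_ac)
  ultimately show ?thesis by simp
qed

section \<open>Linear algebra\<close>

lemma lfun_axis: "lfun (\<lambda>x. x $ i)"
  by (auto simp: lfun_def)

lemma lfun_addI [intro]: "lfun f \<Longrightarrow> lfun g \<Longrightarrow> lfun (\<lambda>x. f x + g x)"
  by (auto simp: lfun_def algebra_simps)

lemma lfun_diffI [intro]: "lfun f \<Longrightarrow> lfun g \<Longrightarrow> lfun (\<lambda>x. f x - g x)"
  by (auto simp: lfun_def algebra_simps)

lemma lfun_cmultI [intro]: "lfun f \<Longrightarrow> lfun (\<lambda>x. c * f x)"
  by (auto simp: lfun_def algebra_simps)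

lemma lfun_zeroI [intro, simp]: "lfun (\<lambda>x. 0)"
  by (auto simp: lfun_def)

lemma lfun_sumI [intro]: "(\<And>i. i \<in> I \<Longrightarrow> lfun (f i)) \<Longrightarrow> lfun (\<lambda>x. \<Sum>i\<in>I. f i x)"
  by (auto simp: lfun_def sum.distrib sum_distrib_left)

lemma lfun_compI: "lfun f \<Longrightarrow> lmap g \<Longrightarrow> lfun (\<lambda>x. f (g x))"
  by (auto simp: lfun_def lmap_def)

lemma subspace_lfun_eq_0:
  assumes "vec.subspace V" "\<And>l. l \<in> \<Phi> \<Longrightarrow> lfun l"
  shows "vec.subspace {v \<in> V. \<forall>l\<in>\<Phi>. l v = 0}"
  using assms by (auto intro!: vec.subspaceI simp: vec.subspace_0 vec.subspace_add vec.subspace_scale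
      lfun_0 lfun_add lfun_scale)

lemma dim_subspace_lker:
  assumes V: "vec.subspace V" and l: "lfun l" and v0: "v0 \<in> V" "l v0 \<noteq> 0"
  shows "vec.dim V = vec.dim {v \<in> V. l v = 0} + 1"
proof -
  let ?V0 = "{v \<in> V. l v = 0}"
  have sub: "vec.subspace ?V0"
    using subspace_lfun_eq_0[OF V, of "{l}"] l by simp
  have "vec.span ?V0 = ?V0"
    by (rule vec.span_eq_iff[THEN iffD2, OF sub])
  then have "v0 \<notin> vec.span ?V0"
    using v0 by (metis (mono_tags, lifting) mem_Collect_eq)
  then have "vec.dim (insert v0 ?V0) = vec.dim ?V0 + 1"
    by (simp add: vec.dim_insert)
  moreover have "vec.span (insert v0 ?V0) = V"
  proof
    show "vec.span (insert v0 ?V0) \<subseteq> V"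
      using V v0 by (intro vec.span_minimal) auto
    show "V \<subseteq> vec.span (insert v0 ?V0)"
    proof
      fix v assume v: "v \<in> V"
      define w where "w = v - (l v / l v0) *s v0"
      have "w \<in> ?V0"
        using v v0 V l by (auto simp: w_def vec.subspace_diff vec.subspace_scale lfun_diff lfun_scale)
      then have "w + (l v / l v0) *s v0 \<in> vec.span (insert v0 ?V0)"
        by (intro vec.span_add vec.span_scale vec.span_base) auto
      then show "v \<in> vec.span (insert v0 ?V0)" by (simp add: w_def)
    qed
  qed
  ultimately show ?thesis by (metis vec.dim_span)
qed

lemma dim_le_lkers:
  assumes "finite \<Phi>" "vec.subspace V" "\<And>l. l \<in> \<Phi> \<Longrightarrow> lfun l"
  shows "vec.dim V \<le> vec.dim {v \<in> V. \<forall>l\<in>\<Phi>. l v = 0} + card \<Phi>"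
  using assms
proof (induction \<Phi> rule: finite_induct)
  case empty
  then show ?case by simp
next
  case (insert l \<Phi>)
  let ?V = "{v \<in> V. \<forall>l\<in>\<Phi>. l v = 0}"
  have sub: "vec.subspace ?V"
    by (rule subspace_lfun_eq_0) (use insert in auto)
  have eq: "{v \<in> V. \<forall>k\<in>insert l \<Phi>. k v = 0} = {v \<in> ?V. l v = 0}" by auto
  have "vec.dim ?V \<le> vec.dim {v \<in> ?V. l v = 0} + 1"
  proof (cases "\<exists>v0\<in>?V. l v0 \<noteq> 0")
    case True
    then show ?thesis using dim_subspace_lker[OF sub, of l] insert.prems by auto
  next
    case False
    then have "{v \<in> ?V. l v = 0} = ?V" by auto
    then show ?thesis by simp
  qed
  moreover have "vec.dim V \<le> vec.dim ?V + card \<Phi>"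
    using insert by auto
  ultimately show ?case
    unfolding eq using insert.hyps by simp
qed

lemma basis_extend:
  assumes "vec.subspace M0" "vec.subspace M" "M0 \<subseteq> M"
  obtains B0 B where "B0 \<subseteq> B" "B0 \<subseteq> M0" "B \<subseteq> M" "vec.independent B" "vec.span B0 = M0" "vec.span B = M"
    "card B0 = vec.dim M0" "card B = vec.dim M" "finite B"
proof -
  obtain B0 where B0: "B0 \<subseteq> M0" "vec.independent B0" "M0 \<subseteq> vec.span B0" "card B0 = vec.dim M0"
    using vec.basis_exists by blast
  obtain B where B: "B0 \<subseteq> B" "B \<subseteq> M" "vec.independent B" "M \<subseteq> vec.span B"
    using vec.maximal_independent_subset_extend[of B0 M] B0 assms(3) by blast
  have "vec.span B0 = M0" "vec.span B = M"
    using B0 B assms vec.span_minimal by (metis subset_antisym)+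
  moreover have "card B = vec.dim M"
    using B vec.basis_card_eq_dim by blast
  moreover have "finite B"
    using B vec.finiteI_independent by blast
  ultimately show thesis using that B0 B by blast
qed

lemma span_lfun_eq_0:
  assumes "lfun l" "\<And>b. b \<in> B \<Longrightarrow> l b = 0" "x \<in> vec.span B"
  shows "l x = 0"
proof -
  have "vec.subspace {v \<in> UNIV. \<forall>k\<in>{l}. k v = 0}"
    by (rule subspace_lfun_eq_0) (use assms in auto)
  then have "vec.span B \<subseteq> {v. l v = 0}"
    using assms by (intro vec.span_minimal) auto
  then show ?thesis using assms by auto
qed

text \<open>Choose a basis of \<open>M\<close> extending a basis of the subspace annihilated by all
  of \<open>V\<close>. The vectors of the latter impose no condition on \<open>V\<close>, so the
  annihilator of \<open>M\<close> in \<open>V\<close> is cut out by the remaining basis vectors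
  alone.\<close>

lemma dim_pairing_le:
  fixes \<beta> :: "complex ^ 'n::finite \<Rightarrow> complex ^ 'm::finite \<Rightarrow> complex"
  assumes l1: "\<And>m. lfun (\<lambda>v. \<beta> v m)" and l2: "\<And>v. lfun (\<beta> v)"
    and V: "vec.subspace V" and M: "vec.subspace M"
  shows "vec.dim V + vec.dim {m \<in> M. \<forall>v\<in>V. \<beta> v m = 0} \<le>
         vec.dim M + vec.dim {v \<in> V. \<forall>m\<in>M. \<beta> v m = 0}"
proof -
  let ?M0 = "{m \<in> M. \<forall>v\<in>V. \<beta> v m = 0}"
  have "vec.subspace ?M0"
    using subspace_lfun_eq_0[OF M, of "\<beta> ` V"] l2 by auto
  then obtain B0 B where B: "B0 \<subseteq> B" "B0 \<subseteq> ?M0" "B \<subseteq> M" "vec.span B = M"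
      "card B0 = vec.dim ?M0" "card B = vec.dim M" "finite B"
    by (rule basis_extend[of ?M0 M]) (use M in auto)
  let ?\<Phi> = "(\<lambda>m v. \<beta> v m) ` (B - B0)"
  have "vec.dim V \<le> vec.dim {v \<in> V. \<forall>l\<in>?\<Phi>. l v = 0} + card ?\<Phi>"
    by (rule dim_le_lkers) (use B V l1 in auto)
  also have "{v \<in> V. \<forall>l\<in>?\<Phi>. l v = 0} = {v \<in> V. \<forall>m\<in>M. \<beta> v m = 0}"
  proof -
    have "\<beta> v m = 0" if v: "v \<in> V" "\<forall>l\<in>?\<Phi>. l v = 0" and m: "m \<in> M" for v m
    proof -
      have "\<beta> v b = 0" if "b \<in> B" for b
        using that v B by (cases "b \<in> B0") auto
      then show ?thesis
        using span_lfun_eq_0[OF l2, of B v m] m B by auto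
    qed
    then show ?thesis using B by auto
  qed
  also have "card ?\<Phi> \<le> card (B - B0)"
    using B by (intro card_image_le) auto
  also have "card (B - B0) = vec.dim M - vec.dim ?M0"
    using B by (simp add: card_Diff_subset finite_subset)
  finally show ?thesis
    using B card_mono[of B B0] by simp
qed

lemma dim_pairing:
  fixes \<beta> :: "complex ^ 'n::finite \<Rightarrow> complex ^ 'm::finite \<Rightarrow> complex"
  assumes l1: "\<And>m. lfun (\<lambda>v. \<beta> v m)" and l2: "\<And>v. lfun (\<beta> v)"
    and V: "vec.subspace V" and M: "vec.subspace M"
  shows "vec.dim V + vec.dim {m \<in> M. \<forall>v\<in>V. \<beta> v m = 0} =
         vec.dim M + vec.dim {v \<in> V. \<forall>m\<in>M. \<beta> v m = 0}"
  using dim_pairing_le[of \<beta>, OF l1 l2 V M] dim_pairing_le[of "\<lambda>m v. \<beta> v m", OF l2 l1 M V]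
  by linarith

text \<open>The standard bilinear form is nondegenerate, so the double annihilator of
  \<open>V\<close> has the dimension of \<open>V\<close> and equals it. A vector outside
  \<open>V\<close> therefore pairs nontrivially with some element of the annihilator.\<close>

lemma separating_lfun:
  fixes x :: "complex ^ 'n::finite"
  assumes V: "vec.subspace V" and x: "x \<notin> V"
  obtains l where "lfun l" "\<And>v. v \<in> V \<Longrightarrow> l v = 0" "l x \<noteq> 0"
proof -
  define \<beta> :: "complex ^ 'n \<Rightarrow> complex ^ 'n \<Rightarrow> complex" where "\<beta> v w = (\<Sum>i\<in>UNIV. v $ i * w $ i)" for v w
  have sym: "\<beta> v w = \<beta> w v" for v w by (simp add: \<beta>_def mult.commute)
  have l: "lfun (\<beta> v)" for v
    by (auto simp: lfun_def \<beta>_def sum.distrib sum_distrib_left algebra_simps)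
  have l': "lfun (\<lambda>v. \<beta> v w)" for w using l[of w] sym by (simp add: lfun_def)
  have "\<beta> (axis i 1) w = w $ i" for w i
  proof -
    have "\<beta> (axis i 1) w = (\<Sum>j\<in>UNIV. if j = i then w $ j else 0)"
      unfolding \<beta>_def by (rule sum.cong) (auto simp: axis_def)
    then show ?thesis by simp
  qed
  then have nondeg: "{m \<in> M. \<forall>v\<in>UNIV. \<beta> v m = 0} = {0}" if "vec.subspace M" for M
    using that by (auto simp: vec.subspace_0 lfun_0[OF l] vec_eq_iff) metis
  let ?P = "\<lambda>M. {v. \<forall>m\<in>M. \<beta> v m = 0}"
  have d: "vec.dim (?P M) + vec.dim M = CARD('n)" if "vec.subspace M" for M
    using dim_pairing[of \<beta> UNIV M, OF l' l vec.subspace_UNIV that] nondeg[OF that]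
    by (simp add: card_cart_basis)
  have sP: "vec.subspace (?P M)" for M
    using subspace_lfun_eq_0[OF vec.subspace_UNIV, of "(\<lambda>m v. \<beta> v m) ` M"] l' by auto
  have "vec.dim (?P (?P V)) = vec.dim V"
    using d[OF V] d[OF sP, of V] by linarith
  moreover have "V \<subseteq> ?P (?P V)" using sym by auto
  ultimately have "V = ?P (?P V)"
    by (intro vec.subspace_dim_equal[OF V sP]) auto
  then obtain m where "m \<in> ?P V" "\<beta> x m \<noteq> 0" using x by blast
  then show thesis using that[of "\<lambda>v. \<beta> v m"] l' sym by auto
qed

text \<open>The new vector minus its components along the old ones is nonzero, so some functional of
  the family detects it; subtracting old dual functionals makes this one vanish on the old vectors.
  Keeping the family arbitrary allows the dual functionals to be differentials of equations or
  contractions of a bilinear form.\<close>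

lemma dual_basis:
  assumes "finite C" and "vec.independent C"
    and lf: "\<And>g. g \<in> \<Phi> \<Longrightarrow> lfun g"
    and z: "(\<lambda>_. 0) \<in> \<Phi>"
    and add: "\<And>f g. f \<in> \<Phi> \<Longrightarrow> g \<in> \<Phi> \<Longrightarrow> (\<lambda>x. f x + g x) \<in> \<Phi>"
    and scale: "\<And>c g. g \<in> \<Phi> \<Longrightarrow> (\<lambda>x. c * g x) \<in> \<Phi>"
    and sep: "\<And>u. u \<in> vec.span C \<Longrightarrow> (\<And>g. g \<in> \<Phi> \<Longrightarrow> g u = 0) \<Longrightarrow> u = 0"
  shows "\<exists>h. \<forall>c\<in>C. h c \<in> \<Phi> \<and> (\<forall>c'\<in>C. h c c' = (if c = c' then 1 else (0::complex)))"
  using assms(1,2) sep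
proof (induction C rule: finite_induct)
  case empty
  then show ?case by simp
next
  case (insert a C)
  have ind: "vec.independent C"
    using insert.prems(1) vec.independent_mono by blast
  have "vec.span C \<subseteq> vec.span (insert a C)" by (intro vec.span_mono) auto
  then obtain h where h: "\<And>c. c \<in> C \<Longrightarrow> h c \<in> \<Phi>"
      "\<And>c c'. c \<in> C \<Longrightarrow> c' \<in> C \<Longrightarrow> h c c' = (if c = c' then 1 else 0)"
    using insert.IH[OF ind] insert.prems(2) by blast
  define a' where "a' = a - (\<Sum>c\<in>C. h c a *s c)"
  have inC: "(\<Sum>c\<in>C. h c a *s c) \<in> vec.span C"
    by (intro vec.span_sum vec.span_scale vec.span_base)
  have "a \<notin> vec.span C"
    using insert.prems(1) insert.hyps by (simp add: vec.independent_insert)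
  then have "a' \<noteq> 0" using inC by (auto simp: a'_def)
  moreover have "a' \<in> vec.span (insert a C)"
    unfolding a'_def using inC vec.span_mono[of C "insert a C"]
    by (intro vec.span_diff) (auto intro: vec.span_base)
  ultimately obtain g where g: "g \<in> \<Phi>" "g a' \<noteq> 0" using insert.prems(2) by blast
  have sumPhi: "(\<lambda>x. \<Sum>c\<in>D. f c * h c x) \<in> \<Phi>" if "finite D" "D \<subseteq> C" for D and f :: "_ \<Rightarrow> complex"
    using that
  proof (induction D rule: finite_induct)
    case empty
    then show ?case using z by simp
  next
    case (insert d D)
    then show ?case using add[OF scale[OF h(1), of d "f d"]] by simp
  qed
  define k where "k = (\<lambda>x. (1 / g a') * (g x + (-1) * (\<Sum>c\<in>C. g c * h c x)))"
  have k: "k \<in> \<Phi>"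
    unfolding k_def by (intro add scale g sumPhi insert.hyps order_refl)
  have ga': "g a' = g a - (\<Sum>c\<in>C. h c a * g c)"
    unfolding a'_def by (simp add: lfun_diff[OF lf[OF g(1)]] lfun_sum[OF lf[OF g(1)]] lfun_scale[OF lf[OF g(1)]])
  have ka: "k a = 1"
    using g(2) ga' by (simp add: k_def mult.commute)
  have kc: "k c = 0" if "c \<in> C" for c
  proof -
    have "(\<Sum>d\<in>C. g d * h d c) = (\<Sum>d\<in>C. if d = c then g d else 0)"
      by (rule sum.cong) (use h that in auto)
    then show ?thesis using that insert.hyps by (simp add: k_def)
  qed
  define H where "H = (\<lambda>c. if c = a then k else (\<lambda>x. h c x + (- h c a) * k x))"
  have "H c \<in> \<Phi>" if "c \<in> insert a C" for c
  proof (cases "c = a")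
    case False
    then have "(\<lambda>x. h c x + (- h c a) * k x) \<in> \<Phi>"
      using that by (intro add h(1) scale[OF k]) auto
    then show ?thesis using False by (simp add: H_def)
  qed (use k in \<open>simp add: H_def\<close>)
  moreover have "H c c' = (if c = c' then 1 else 0)" if "c \<in> insert a C" "c' \<in> insert a C" for c c'
    using that ka kc h insert.hyps unfolding H_def by auto
  ultimately show ?case by blast
qed

text \<open>Take a polynomial of least degree with \<open>p(T) v = 0\<close>, a root
  \<open>s\<close> of it and the cofactor \<open>q\<close>. Then \<open>q(T) v\<close> is nonzero by
  minimality, is killed by \<open>T - s\<close>, and lies in \<open>V\<close> as a combination of
  iterates.\<close>

lemma exists_eigenvector:
  fixes T :: "complex ^ 'n::finite \<Rightarrow> complex ^ 'n"
  assumes T: "lmap T" and V: "vec.subspace V" and inv: "\<And>x. x \<in> V \<Longrightarrow> T x \<in> V"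
    and v: "v \<in> V" "v \<noteq> 0"
  obtains x \<mu> where "x \<in> V" "x \<noteq> 0" "T x = \<mu> *s x"
proof -
  have inV: "(T ^^ i) v \<in> V" for i
    by (induction i) (use v inv in auto)
  define ev where "ev p = (\<Sum>i\<le>degree p. coeff p i *s (T ^^ i) v)" for p
  have ev_sup: "ev p = (\<Sum>i\<le>N. coeff p i *s (T ^^ i) v)" if "degree p \<le> N" for p N
    unfolding ev_def by (rule sum.mono_neutral_left) (use that in \<open>auto simp: coeff_eq_0\<close>)
  have evV: "ev p \<in> V" for p
    unfolding ev_def using V inV by (intro vec.subspace_sum vec.subspace_scale)
  have ev_mult: "ev ([:- s, 1:] * p) = T (ev p) - s *s ev p" for p s
  proof -
    let ?N = "degree p"
    have cf: "coeff ([:- s, 1:] * p) i = coeff (pCons 0 p) i - s * coeff p i" for i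
      by simp
    have "degree ([:- s, 1:] * p) \<le> Suc ?N"
      using degree_mult_le[of "[:- s, 1:]" p] by simp
    then have "ev ([:- s, 1:] * p) = (\<Sum>i\<le>Suc ?N. coeff ([:- s, 1:] * p) i *s (T ^^ i) v)"
      by (rule ev_sup)
    also have "\<dots> = (\<Sum>i\<le>Suc ?N. coeff (pCons 0 p) i *s (T ^^ i) v) -
        (\<Sum>i\<le>Suc ?N. (s * coeff p i) *s (T ^^ i) v)"
      by (simp only: cf vec.scale_left_diff_distrib sum_subtractf)
    also have "(\<Sum>i\<le>Suc ?N. coeff (pCons 0 p) i *s (T ^^ i) v) =
        (\<Sum>i\<le>?N. coeff p i *s (T ^^ Suc i) v)"
      by (subst sum.atMost_Suc_shift) simp
    also have "\<dots> = T (ev p)"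
      by (simp add: ev_def lmap_sum[OF T] lmap_scale[OF T])
    also have "(\<Sum>i\<le>Suc ?N. (s * coeff p i) *s (T ^^ i) v) = s *s ev p"
      by (simp add: ev_def vec.scale_sum_right coeff_eq_0)
    finally show ?thesis .
  qed
  \<comment> \<open>Among the first \<open>CARD('n) + 1\<close> iterates either two coincide, or
    they are too many to be independent.\<close>
  have "\<exists>p. p \<noteq> 0 \<and> ev p = 0"
  proof (cases "inj_on (\<lambda>i. (T ^^ i) v) {..CARD('n)}")
    case True
    let ?S = "(\<lambda>i. (T ^^ i) v) ` {..CARD('n)}"
    have "card ?S = CARD('n) + 1" using True by (simp add: card_image)
    then have "vec.dependent ?S"
      using vec.independent_card_le_dim[of ?S UNIV] by (auto simp: card_cart_basis)
    then obtain u where u: "\<exists>w\<in>?S. u w \<noteq> 0" "(\<Sum>w\<in>?S. u w *s w) = 0"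
      using vec.dependent_finite[of ?S] by auto
    define p where "p = (\<Sum>i\<le>CARD('n). monom (u ((T ^^ i) v)) i)"
    have cp: "coeff p i = (if i \<le> CARD('n) then u ((T ^^ i) v) else 0)" for i
      by (simp add: p_def coeff_sum)
    have "degree p \<le> CARD('n)"
      by (rule degree_le) (simp add: cp)
    then have "ev p = (\<Sum>i\<le>CARD('n). u ((T ^^ i) v) *s (T ^^ i) v)"
      by (simp add: ev_sup cp)
    also have "\<dots> = (\<Sum>w\<in>?S. u w *s w)"
      using True by (simp add: sum.reindex)
    finally have "ev p = 0" using u by simp
    moreover have "p \<noteq> 0"
    proof -
      obtain i where "i \<le> CARD('n)" "u ((T ^^ i) v) \<noteq> 0" using u by auto
      then have "coeff p i \<noteq> 0" by (simp add: cp)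
      then show ?thesis by auto
    qed
    ultimately show ?thesis by blast
  next
    case False
    then obtain i j where ij: "i \<noteq> j" "(T ^^ i) v = (T ^^ j) v" by (auto simp: inj_on_def)
    define p where "p = monom (1::complex) i - monom 1 j"
    have "degree p \<le> max i j" unfolding p_def
      by (rule degree_diff_le) (auto simp: degree_monom_eq)
    then have "ev p = (\<Sum>k\<le>max i j. coeff p k *s (T ^^ k) v)" by (rule ev_sup)
    also have "\<dots> = (\<Sum>k\<le>max i j. (if k = i then (T ^^ k) v else 0) - (if k = j then (T ^^ k) v else 0))"
      by (rule sum.cong) (auto simp: p_def)
    also have "\<dots> = 0" using ij by (simp add: sum_subtractf)
    finally have "ev p = 0" .
    moreover have "coeff p i \<noteq> 0" using ij by (simp add: p_def)
    then have "p \<noteq> 0" by auto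
    ultimately show ?thesis by blast
  qed
  then obtain p where p: "p \<noteq> 0" "ev p = 0" and min: "\<And>q. q \<noteq> 0 \<Longrightarrow> ev q = 0 \<Longrightarrow> degree p \<le> degree q"
    using exists_least_iff[of "\<lambda>d. \<exists>p. p \<noteq> 0 \<and> ev p = 0 \<and> degree p = d"] by (metis not_less)
  have "degree p \<noteq> 0"
  proof
    assume "degree p = 0"
    then obtain a where a: "p = [:a:]" by (rule degree_eq_zeroE)
    then have "ev p = a *s v" by (simp add: ev_def)
    then show False using p a v by simp
  qed
  then obtain s where "poly p s = 0"
    using fundamental_theorem_of_algebra[of p] by (metis constant_degree)
  then obtain q where q: "p = [:- s, 1:] * q" using poly_eq_0_iff_dvd by (metis dvdE)
  have "q \<noteq> 0" using q p by auto
  then have "degree ([:- s, 1:] * q) = Suc (degree q)" by (subst degree_mult_eq) auto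
  then have "degree p = Suc (degree q)" using q by metis
  then have "ev q \<noteq> 0" using min[of q] \<open>q \<noteq> 0\<close> by auto
  moreover have "T (ev q) = s *s ev q"
    using ev_mult[of s q] q p by simp
  ultimately show thesis using that evV by blast
qed

section \<open>Zariski closed sets\<close>

definition zcl :: "(complex ^ 'n::finite) set \<Rightarrow> (complex ^ 'n) set" where
  "zcl A = zeros (vanishing_ideal A)"

lemma in_zcl: "v \<in> zcl A \<longleftrightarrow> (\<forall>f. polyfun f \<longrightarrow> (\<forall>a\<in>A. f a = 0) \<longrightarrow> f v = 0)"
  by (auto simp: zcl_def zeros_def vanishing_ideal_def polyfun_def)

lemma zclD: "v \<in> zcl A \<Longrightarrow> polyfun f \<Longrightarrow> (\<And>a. a \<in> A \<Longrightarrow> f a = 0) \<Longrightarrow> f v = 0"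
  by (auto simp: in_zcl)

lemma zcl_superset: "A \<subseteq> zcl A"
  by (auto simp: in_zcl)

lemma zcl_mono: "A \<subseteq> B \<Longrightarrow> zcl A \<subseteq> zcl B"
  by (auto simp: in_zcl subset_iff)

lemma zcl_zcl [simp]: "zcl (zcl A) = zcl A"
  by (auto simp: in_zcl)

lemma closedin_zcl [simp]: "closedin zariski (zcl A)"
  by (auto simp: closedin_zariski zcl_def)

lemma closedin_zariski_iff: "closedin zariski Z \<longleftrightarrow> zcl Z = Z"
proof
  assume "closedin zariski Z"
  then obtain P where P: "Z = zeros P" by (auto simp: closedin_zariski)
  have "zcl Z \<subseteq> Z"
  proof
    fix v assume v: "v \<in> zcl Z"
    have "peval f v = 0" if "f \<in> P" for f
      by (rule zclD[OF v]) (use that P in \<open>auto simp: zeros_def\<close>)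
    then show "v \<in> Z" using P by (auto simp: zeros_def)
  qed
  then show "zcl Z = Z" using zcl_superset by blast
next
  assume "zcl Z = Z"
  then show "closedin zariski Z" using closedin_zcl[of Z] by simp
qed

lemma zcl_minimal: "A \<subseteq> Z \<Longrightarrow> closedin zariski Z \<Longrightarrow> zcl A \<subseteq> Z"
  using zcl_mono closedin_zariski_iff by blast

lemma closedin_zariskiI:
  assumes "\<And>v. v \<notin> Z \<Longrightarrow> \<exists>f. polyfun f \<and> (\<forall>a\<in>Z. f a = 0) \<and> f v \<noteq> 0"
  shows "closedin zariski Z"
  unfolding closedin_zariski_iff
proof (rule subset_antisym)
  show "zcl Z \<subseteq> Z"
    using assms unfolding subset_iff in_zcl by blast
qed (rule zcl_superset)

lemma not_in_closed:
  assumes "closedin zariski Z" "v \<notin> Z"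
  obtains f where "polyfun f" "\<And>a. a \<in> Z \<Longrightarrow> f a = 0" "f v \<noteq> 0"
proof -
  have "v \<notin> zcl Z" using assms by (simp add: closedin_zariski_iff)
  then obtain f where "polyfun f" "\<forall>a\<in>Z. f a = 0" "f v \<noteq> 0" unfolding in_zcl by blast
  then show thesis using that by blast
qed

abbreviation irr :: "(complex ^ 'n::finite) set \<Rightarrow> bool" where
  "irr Z \<equiv> irreducible_closed zariski Z"

lemma irr_mult:
  assumes "irr Z" "polyfun f" "polyfun g" "\<And>v. v \<in> Z \<Longrightarrow> f v * g v = 0"
  shows "(\<forall>v\<in>Z. f v = 0) \<or> (\<forall>v\<in>Z. g v = 0)"
proof -
  have cl: "closedin zariski {v. h v = 0}" if "polyfun h" for h
    by (rule closedin_zariskiI) (use that in auto)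
  have "Z \<subseteq> {v. f v = 0} \<union> {v. g v = 0}" using assms(4) by auto
  then have "Z \<subseteq> {v. f v = 0} \<or> Z \<subseteq> {v. g v = 0}"
    using assms(1) cl[OF assms(2)] cl[OF assms(3)] unfolding irreducible_closed_def by blast
  then show ?thesis by auto
qed

lemma irr_zclI:
  assumes ne: "A \<noteq> {}"
    and prime: "\<And>f g. polyfun f \<Longrightarrow> polyfun g \<Longrightarrow> (\<And>a. a \<in> A \<Longrightarrow> f a * g a = 0) \<Longrightarrow>
        (\<forall>a\<in>A. f a = 0) \<or> (\<forall>a\<in>A. g a = 0)"
  shows "irr (zcl A)"
  unfolding irreducible_closed_def
proof (intro conjI allI impI)
  show "closedin zariski (zcl A)" by simp
  show "zcl A \<noteq> {}" using ne zcl_superset by blast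
  fix X Y :: "(complex ^ 'a) set"
  assume *: "closedin zariski X \<and> closedin zariski Y \<and> zcl A \<subseteq> X \<union> Y"
  show "zcl A \<subseteq> X \<or> zcl A \<subseteq> Y"
  proof (rule ccontr)
    assume "\<not> ?thesis"
    then obtain u v where uv: "u \<in> zcl A" "u \<notin> X" "v \<in> zcl A" "v \<notin> Y" by blast
    obtain f where f: "polyfun f" "\<And>a. a \<in> X \<Longrightarrow> f a = 0" "f u \<noteq> 0"
      using not_in_closed[of X u] * uv by metis
    obtain g where g: "polyfun g" "\<And>a. a \<in> Y \<Longrightarrow> g a = 0" "g v \<noteq> 0"
      using not_in_closed[of Y v] * uv by metis
    have "f a * g a = 0" if "a \<in> A" for a
      using that zcl_superset * f g by (metis Un_iff mult_eq_0_iff subset_iff)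
    then have "(\<forall>a\<in>A. f a = 0) \<or> (\<forall>a\<in>A. g a = 0)"
      using prime[OF f(1) g(1)] by blast
    then show False using zclD[OF uv(1) f(1)] zclD[OF uv(3) g(1)] f(3) g(3) by blast
  qed
qed

text \<open>A product vanishing on the image pulls back to a product of polynomial functions
  vanishing on a linear space.\<close>

lemma irr_zcl_image:
  assumes U: "vec.subspace U" and h: "polymap h"
  shows "irr (zcl (h ` U))"
proof (rule irr_zclI)
  show "h ` U \<noteq> {}" using vec.subspace_0[OF U] by blast
  fix f g assume "polyfun f" "polyfun g" "\<And>a. a \<in> h ` U \<Longrightarrow> f a * g a = 0"
  then show "(\<forall>a\<in>h ` U. f a = 0) \<or> (\<forall>a\<in>h ` U. g a = 0)"
    using polyfun_mult_eq_0_on[OF U polyfun_comp[OF _ h] polyfun_comp[OF _ h], of f g] by blast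
qed

lemma closedin_subspace: "vec.subspace V \<Longrightarrow> closedin zariski V"
  by (rule closedin_zariskiI) (metis separating_lfun lfun_polyfun)

lemma irr_subspace: "vec.subspace V \<Longrightarrow> irr V"
  using irr_zcl_image[of V "\<lambda>x. x"] closedin_subspace[of V]
  by (simp add: closedin_zariski_iff)

section \<open>Chains of irreducible closed sets\<close>

text \<open>\<open>k\<close> counts inclusions, so a single irreducible set gives a chain of length
  0. The sets only have to lie inside \<open>X\<close>, which makes the notion monotone in
  \<open>X\<close>.\<close>

definition has_chain :: "(complex ^ 'n::finite) set \<Rightarrow> nat \<Rightarrow> bool" where
  "has_chain X k \<longleftrightarrow> (\<exists>Z. (\<forall>i\<le>k. irr (Z i) \<and> Z i \<subseteq> X) \<and> (\<forall>i<k. Z i \<subset> Z (Suc i)))"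

lemma has_chain_mono: "has_chain X k \<Longrightarrow> X \<subseteq> Y \<Longrightarrow> has_chain Y k"
  unfolding has_chain_def by (meson order_trans)

lemma has_chain_0: "irr X \<Longrightarrow> has_chain X 0"
  unfolding has_chain_def by (rule exI[of _ "\<lambda>_. X"]) auto

lemma has_chain_Suc:
  assumes "has_chain Z k" "Z \<subset> X" "irr X"
  shows "has_chain X (Suc k)"
proof -
  obtain C where C: "\<And>i. i \<le> k \<Longrightarrow> irr (C i) \<and> C i \<subseteq> Z" "\<And>i. i < k \<Longrightarrow> C i \<subset> C (Suc i)"
    using assms(1) by (auto simp: has_chain_def)
  let ?D = "\<lambda>i. if i \<le> k then C i else X"
  have "(\<forall>i\<le>Suc k. irr (?D i) \<and> ?D i \<subseteq> X) \<and> (\<forall>i<Suc k. ?D i \<subset> ?D (Suc i))"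
  proof (intro conjI allI impI)
    fix i assume "i \<le> Suc k"
    then show "irr (?D i)" "?D i \<subseteq> X"
      using C(1)[of i] assms(2,3) by auto
  next
    fix i assume "i < Suc k"
    then show "?D i \<subset> ?D (Suc i)"
      using C(1)[of k] C(2)[of i] assms(2) by (cases "i = k") auto
  qed
  then show ?thesis unfolding has_chain_def by (rule exI[of _ ?D])
qed

lemma has_chain_le:
  assumes "has_chain X k" "j \<le> k"
  shows "has_chain X j"
proof -
  obtain C where C: "\<And>i. i \<le> k \<Longrightarrow> irr (C i) \<and> C i \<subseteq> X" "\<And>i. i < k \<Longrightarrow> C i \<subset> C (Suc i)"
    using assms(1) by (auto simp: has_chain_def)
  show ?thesis
    unfolding has_chain_def
  proof (intro exI[of _ C] conjI allI impI)
    fix i assume "i < j"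
    then show "C i \<subset> C (Suc i)" using C(2)[of i] assms(2) by simp
  next
    fix i assume "i \<le> j"
    then show "irr (C i)" "C i \<subseteq> X" using C(1)[of i] assms(2) by simp_all
  qed
qed

text \<open>A chain of length \<open>k\<close> makes the Hilbert function grow at least like \<open>N ^ k\<close>, whereas on the image
  of a \<open>d\<close>-dimensional space it grows at most like \<open>N ^ d\<close>.\<close>

definition hilbert_ge :: "(complex ^ 'n::finite) set \<Rightarrow> nat \<Rightarrow> nat \<Rightarrow> bool" where
  "hilbert_ge X N a \<longleftrightarrow> (\<exists>f. (\<forall>i<a. pdeg N (f i)) \<and>
     (\<forall>c. (\<forall>x\<in>X. (\<Sum>i<a. c i * f i x) = 0) \<longrightarrow> (\<forall>i<a. c i = 0)))"

lemma pdeg_polyfun: "pdeg N f \<Longrightarrow> polyfun f"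
  using polyfun_iff_pdeg by blast

text \<open>A relation among the \<open>f i\<close> and \<open>g\<close> times the previous
  functions restricts on \<open>Z'\<close> to a relation among the \<open>f i\<close>, which kills
  their coefficients; irreducibility of \<open>Z\<close> then permits cancelling \<open>g\<close>.
  Each round gains \<open>a\<close> functions at the cost of degree \<open>e\<close>.\<close>

lemma hilbert_ge_step:
  assumes Z: "irr Z" "Z' \<subseteq> Z" and H: "hilbert_ge Z' N a"
    and g: "pdeg e g" "\<And>x. x \<in> Z' \<Longrightarrow> g x = 0" "z \<in> Z" "g z \<noteq> 0"
  shows "hilbert_ge Z (N + J * e) (J * a)"
proof (induction J)
  case 0
  then show ?case by (simp add: hilbert_ge_def)
next
  case (Suc J)
  obtain f where f: "\<And>i. i < a \<Longrightarrow> pdeg N (f i)"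
    "\<And>c i. (\<forall>x\<in>Z'. (\<Sum>i<a. c i * f i x) = 0) \<Longrightarrow> i < a \<Longrightarrow> c i = 0"
    using H unfolding hilbert_ge_def by metis
  obtain h where h: "\<And>i. i < J * a \<Longrightarrow> pdeg (N + J * e) (h i)"
    "\<And>c i. (\<forall>x\<in>Z. (\<Sum>i<J * a. c i * h i x) = 0) \<Longrightarrow> i < J * a \<Longrightarrow> c i = 0"
    using Suc unfolding hilbert_ge_def by metis
  define k where "k i = (if i < a then f i else (\<lambda>x. g x * h (i - a) x))" for i
  have deg: "pdeg (N + Suc J * e) (k i)" if "i < Suc J * a" for i
  proof (cases "i < a")
    case True
    then show ?thesis using pdeg_mono[OF f(1)] by (simp add: k_def)
  next
    case False
    then show ?thesis using that pdeg.mult[OF g(1) h(1)[of "i - a"], of "N + Suc J * e"]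
      by (simp add: k_def)
  qed
  have "c i = 0" if c: "\<forall>x\<in>Z. (\<Sum>i<Suc J * a. c i * k i x) = 0" and i: "i < Suc J * a" for c i
  proof -
    have split: "(\<Sum>i<Suc J * a. c i * k i x) =
        (\<Sum>i<a. c i * f i x) + g x * (\<Sum>i<J * a. c (a + i) * h i x)" for x
    proof -
      have "(\<Sum>i<Suc J * a. c i * k i x) = (\<Sum>i<a. c i * k i x) + (\<Sum>i=a..<a + J * a. c i * k i x)"
        by (simp add: lessThan_atLeast0 sum.atLeastLessThan_concat)
      also have "(\<Sum>i=a..<a + J * a. c i * k i x) = (\<Sum>i<J * a. c (a + i) * k (a + i) x)"
        using sum.shift_bounds_nat_ivl[of "\<lambda>i. c i * k i x" 0 a "J * a"]
        by (simp add: lessThan_atLeast0 add.commute)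
      finally show ?thesis
        by (simp add: k_def sum_distrib_left mult_ac)
    qed
    have c1: "c i = 0" if "i < a" for i
    proof (rule f(2)[OF _ that], intro ballI)
      fix x assume "x \<in> Z'"
      then show "(\<Sum>i<a. c i * f i x) = 0"
        using c split[of x] g(2) Z(2) by auto
    qed
    have "\<forall>x\<in>Z. g x * (\<Sum>i<J * a. c (a + i) * h i x) = 0"
      using c split c1 by simp
    moreover have "polyfun (\<lambda>x. \<Sum>i<J * a. c (a + i) * h i x)"
      using h(1) by (intro polyfun_sum polyfun_mult polyfun_const) (auto intro: pdeg_polyfun)
    ultimately have "\<forall>x\<in>Z. (\<Sum>i<J * a. c (a + i) * h i x) = 0"
      using irr_mult[OF Z(1) pdeg_polyfun[OF g(1)], of "\<lambda>x. \<Sum>i<J * a. c (a + i) * h i x"] g(3,4) by blast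
    then have c2: "c (a + i) = 0" if "i < J * a" for i
      using h(2)[of "\<lambda>i. c (a + i)"] that by blast
    show ?thesis
    proof (cases "i < a")
      case False
      then show ?thesis using c2[of "i - a"] i by auto
    qed (use c1 in auto)
  qed
  then show ?case using deg unfolding hilbert_ge_def by blast
qed

text \<open>Every inclusion of the chain is used with \<open>J = N\<close>: the number of
  independent functions is multiplied by \<open>N\<close>, while the degree grows by a fixed
  multiple of \<open>N\<close>.\<close>

lemma has_chain_hilbert_ge:
  assumes "has_chain X k"
  obtains C where "\<And>N. 1 \<le> N \<Longrightarrow> hilbert_ge X (C * N) (N ^ k)"
proof -
  obtain Z where Z: "\<And>i. i \<le> k \<Longrightarrow> irr (Z i) \<and> Z i \<subseteq> X" "\<And>i. i < k \<Longrightarrow> Z i \<subset> Z (Suc i)"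
    using assms by (auto simp: has_chain_def)
  have "\<exists>C. \<forall>N\<ge>1. hilbert_ge (Z i) (C * N) (N ^ i)" if "i \<le> k" for i
    using that
  proof (induction i)
    case 0
    obtain z where "z \<in> Z 0" using Z(1)[of 0] by (auto simp: irreducible_closed_def)
    then have "hilbert_ge (Z 0) (0 * N) (N ^ 0)" for N
      unfolding hilbert_ge_def by (intro exI[of _ "\<lambda>_ _. 1"]) (auto intro: pdeg.intros)
    then show ?case by blast
  next
    case (Suc i)
    then obtain C where C: "\<And>N. 1 \<le> N \<Longrightarrow> hilbert_ge (Z i) (C * N) (N ^ i)" by auto
    obtain z where z: "z \<in> Z (Suc i)" "z \<notin> Z i" using Z(2)[of i] Suc.prems by auto
    have "closedin zariski (Z i)" using Z(1)[of i] Suc.prems by (auto simp: irreducible_closed_def)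
    then obtain g where g: "polyfun g" "\<And>a. a \<in> Z i \<Longrightarrow> g a = 0" "g z \<noteq> 0"
      using not_in_closed z by metis
    obtain e where e: "pdeg e g" using g polyfun_iff_pdeg by blast
    have "hilbert_ge (Z (Suc i)) ((C + e) * N) (N ^ Suc i)" if "1 \<le> N" for N
      using hilbert_ge_step[OF _ _ C[OF that] e g(2) z(1) g(3), of N] Z(1)[of "Suc i"] Z(2)[of i] Suc.prems
      by (simp add: algebra_simps psubset_imp_subset)
    then show ?case by blast
  qed
  then obtain C where C: "\<And>N. 1 \<le> N \<Longrightarrow> hilbert_ge (Z k) (C * N) (N ^ k)" by blast
  have "hilbert_ge X (C * N) (N ^ k)" if N1: "1 \<le> N" for N
  proof -
    obtain f where f: "\<And>i. i < N ^ k \<Longrightarrow> pdeg (C * N) (f i)"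
      "\<And>c i. (\<forall>x\<in>Z k. (\<Sum>i<N ^ k. c i * f i x) = 0) \<Longrightarrow> i < N ^ k \<Longrightarrow> c i = 0"
      using C[OF N1] unfolding hilbert_ge_def by metis
    have "Z k \<subseteq> X" using Z(1)[of k] by simp
    then have "\<forall>x\<in>Z k. (\<Sum>i<N ^ k. c i * f i x) = 0"
      if "\<forall>x\<in>X. (\<Sum>i<N ^ k. c i * f i x) = 0" for c
      using that by blast
    then show ?thesis unfolding hilbert_ge_def using f by (intro exI[of _ f]) blast
  qed
  then show thesis using that by blast
qed

text \<open>Bounding every exponent separately, not their sum, makes the number of monomials at most
  \<open>(b + 1) ^ d\<close>. Exponents are extensional functions so that they form a finite product
  set.\<close>

definition monomials :: "nat \<Rightarrow> nat \<Rightarrow> ((nat \<Rightarrow> complex) \<Rightarrow> complex) set" where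
  "monomials d b = (\<lambda>m z. \<Prod>i<d. z i ^ m i) ` ({..<d} \<rightarrow>\<^sub>E {..b})"

interpretation fvs: vector_space "\<lambda>(c::complex) (f :: 'b \<Rightarrow> complex) x. c * f x"
  by unfold_locales (auto simp: algebra_simps fun_eq_iff)

lemma monomials_card: "finite (monomials d b)" "card (monomials d b) \<le> (b + 1) ^ d"
proof -
  have fin: "finite ({..<d} \<rightarrow>\<^sub>E {..b})" by (intro finite_PiE) auto
  then show "finite (monomials d b)" by (simp add: monomials_def)
  have "card (monomials d b) \<le> card ({..<d} \<rightarrow>\<^sub>E {..b})"
    unfolding monomials_def by (rule card_image_le[OF fin])
  also have "\<dots> = (b + 1) ^ d" by (simp add: card_PiE)
  finally show "card (monomials d b) \<le> (b + 1) ^ d" .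
qed

lemma monomials_mono: "a \<le> b \<Longrightarrow> fvs.span (monomials d a) \<subseteq> fvs.span (monomials d b)"
  unfolding monomials_def by (intro fvs.span_mono image_mono PiE_mono) auto

lemma monomials_const: "(\<lambda>z. c) \<in> fvs.span (monomials d b)"
proof -
  have "(\<lambda>z. \<Prod>i<d. z i ^ (restrict (\<lambda>_. 0) {..<d}) i) \<in> monomials d b"
    unfolding monomials_def by (rule imageI) (auto split: if_splits)
  then have "(\<lambda>z. 1) \<in> monomials d b" by simp
  then show ?thesis using fvs.span_scale[OF fvs.span_base, of "\<lambda>z. 1" "monomials d b" c] by simp
qed

lemma monomials_var:
  assumes "i < d" "1 \<le> b"
  shows "(\<lambda>z. z i) \<in> fvs.span (monomials d b)"
proof -
  let ?m = "restrict (\<lambda>j. if j = i then 1 else 0) {..<d}"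
  have "(\<lambda>z. \<Prod>j<d. z j ^ ?m j) \<in> monomials d b"
    unfolding monomials_def by (rule imageI) (use assms in \<open>auto split: if_splits\<close>)
  moreover have "(\<Prod>j<d. z j ^ ?m j) = z i" for z :: "nat \<Rightarrow> complex"
  proof -
    have "(\<Prod>j<d. z j ^ ?m j) = (\<Prod>j<d. if j = i then z j else 1)"
      by (rule prod.cong) auto
    then show ?thesis using assms by simp
  qed
  ultimately show ?thesis by (simp add: fvs.span_base)
qed

lemma monomials_mult:
  assumes "f \<in> fvs.span (monomials d a)" "g \<in> fvs.span (monomials d b)"
  shows "(\<lambda>z. f z * g z) \<in> fvs.span (monomials d (a + b))"
proof -
  have 1: "(\<lambda>z. f z * g z) \<in> fvs.span (monomials d (a + b))"
    if f: "f \<in> monomials d a" and g: "g \<in> monomials d b" for f g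
  proof -
    obtain m where m: "m \<in> {..<d} \<rightarrow>\<^sub>E {..a}" "f = (\<lambda>z. \<Prod>i<d. z i ^ m i)"
      using f by (auto simp: monomials_def)
    obtain m' where m': "m' \<in> {..<d} \<rightarrow>\<^sub>E {..b}" "g = (\<lambda>z. \<Prod>i<d. z i ^ m' i)"
      using g by (auto simp: monomials_def)
    let ?k = "restrict (\<lambda>i. m i + m' i) {..<d}"
    have "m i + m' i \<le> a + b" if "i < d" for i
      using that PiE_mem[OF m(1), of i] PiE_mem[OF m'(1), of i] by (simp add: add_mono)
    then have "(\<lambda>z. \<Prod>i<d. z i ^ ?k i) \<in> monomials d (a + b)"
      unfolding monomials_def by (intro imageI) (auto split: if_splits)
    moreover have "(\<lambda>z. f z * g z) = (\<lambda>z. \<Prod>i<d. z i ^ ?k i)"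
      by (auto simp: m m' power_add prod.distrib fun_eq_iff)
    ultimately show ?thesis by (simp add: fvs.span_base)
  qed
  have 2: "(\<lambda>z. f z * g z) \<in> fvs.span (monomials d (a + b))"
    if f: "f \<in> monomials d a" for f
    using assms(2)
  proof (induction g rule: fvs.span_induct_alt)
    case base
    then show ?case using fvs.span_zero by (simp add: zero_fun_def)
  next
    case (step c x y)
    then show ?case
      using fvs.span_add[OF fvs.span_scale[OF 1[OF f, of x], of c], of "\<lambda>z. f z * y z"]
      by (simp add: algebra_simps plus_fun_def)
  qed
  show ?thesis
    using assms(1)
  proof (induction f rule: fvs.span_induct_alt)
    case base
    then show ?case using fvs.span_zero by (simp add: zero_fun_def)
  next
    case (step c x y)
    then show ?case
      using fvs.span_add[OF fvs.span_scale[OF 2[of x], of c], of "\<lambda>z. y z * g z"]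
      by (simp add: algebra_simps plus_fun_def)
  qed
qed

lemma monomials_add:
  "f \<in> fvs.span (monomials d a) \<Longrightarrow> g \<in> fvs.span (monomials d a) \<Longrightarrow> (\<lambda>z. f z + g z) \<in> fvs.span (monomials d a)"
  using fvs.span_add[of f "monomials d a" g] by (simp add: plus_fun_def)

lemma pdeg_comp_monos:
  assumes "pdeg N f" and h: "\<And>i. (\<lambda>z. h z $ i) \<in> fvs.span (monomials d b)"
  shows "(\<lambda>z. f (h z)) \<in> fvs.span (monomials d (b * N))"
  using assms(1)
proof induction
  case (const N c)
  show ?case by (rule monomials_const)
next
  case (coord N i)
  then have "b \<le> b * N" by simp
  then show ?case using monomials_mono[of b "b * N"] h by blast
next
  case (add N f g)
  then show ?case by (simp add: monomials_add)
next
  case (mult M f N g K)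
  have "b * M + b * N \<le> b * K" using mult.hyps by (metis add_mult_distrib2 mult_le_mono2)
  then show ?case using monomials_mult[OF mult.IH] monomials_mono by blast
qed

lemma fun_sum_apply: "(\<Sum>i\<in>I. f i) z = (\<Sum>i\<in>I. f i z)"
  for f :: "'i \<Rightarrow> 'a \<Rightarrow> 'b::comm_monoid_add"
  by (induction I rule: infinite_finite_induct) auto

text \<open>Functions independent on the closure stay independent when pulled back along
  \<open>h\<close> and linear coordinates of \<open>U\<close>. There they are combinations of
  boundedly many monomials, with \<open>b\<close> bounding the degrees of the coordinates of
  \<open>h\<close>.\<close>

lemma hilbert_ge_zcl_image:
  fixes h :: "complex ^ 'n::finite \<Rightarrow> complex ^ 'm::finite"
  assumes U: "vec.subspace U" and h: "polymap h"
  obtains b where "\<And>N a. hilbert_ge (zcl (h ` U)) N a \<Longrightarrow> a \<le> (b * N + 1) ^ vec.dim U"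
proof -
  obtain B where B: "B \<subseteq> U" "vec.independent B" "U \<subseteq> vec.span B" "card B = vec.dim U"
    using vec.basis_exists by blast
  have finB: "finite B" using B(2) vec.finiteI_independent by blast
  let ?d = "vec.dim U"
  obtain \<beta> where \<beta>: "bij_betw \<beta> {..<?d} B"
    using ex_bij_betw_nat_finite[OF finB] B(4) by (auto simp: lessThan_atLeast0)
  define L where "L z = (\<Sum>i<?d. z i *s \<beta> i)" for z :: "nat \<Rightarrow> complex"
  have LU: "L z \<in> U" for z
    unfolding L_def using \<beta> B(1) U
    by (intro vec.subspace_sum vec.subspace_scale) (auto simp: bij_betw_def)
  have L1: "(\<lambda>z. L z $ i) \<in> fvs.span (monomials ?d 1)" for i
  proof -
    have "(\<lambda>z. \<Sum>j\<in>J. z j * \<beta> j $ i) \<in> fvs.span (monomials ?d 1)" if "finite J" "J \<subseteq> {..<?d}" for J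
      using that
    proof (induction J rule: finite_induct)
      case empty
      then show ?case using monomials_const[of 0] by simp
    next
      case (insert j J)
      then show ?case
        using fvs.span_scale[OF monomials_var[of j ?d 1], of "\<beta> j $ i"]
        by (simp add: monomials_add mult.commute)
    qed
    from this[of "{..<?d}"] show ?thesis by (simp add: L_def)
  qed
  have surj: "\<exists>z. L z = u" if "u \<in> U" for u
  proof -
    have "u \<in> vec.span B" using B(3) that by auto
    then obtain r where "u = (\<Sum>v\<in>B. r v *s v)"
      using vec.span_finite[OF finB] by auto
    also have "\<dots> = (\<Sum>i<?d. r (\<beta> i) *s \<beta> i)"
      using sum.reindex_bij_betw[OF \<beta>, of "\<lambda>v. r v *s v"] by simp
    finally show ?thesis unfolding L_def by (intro exI[of _ "\<lambda>i. r (\<beta> i)"]) simp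
  qed
  obtain e where e: "\<And>i. pdeg (e i) (\<lambda>x. h x $ i)"
    using h unfolding polymap_def polyfun_iff_pdeg by metis
  define b where "b = (\<Sum>i\<in>UNIV. e i)"
  have hb: "(\<lambda>z. h (L z) $ i) \<in> fvs.span (monomials ?d b)" for i
  proof -
    have "pdeg b (\<lambda>x. h x $ i)"
      by (rule pdeg_mono[OF e]) (auto simp: b_def member_le_sum)
    then show ?thesis using pdeg_comp_monos[OF _ L1, of b "\<lambda>x. h x $ i"] by simp
  qed
  have "a \<le> (b * N + 1) ^ ?d" if H: "hilbert_ge (zcl (h ` U)) N a" for N a
  proof -
    obtain f where f: "\<And>i. i < a \<Longrightarrow> pdeg N (f i)"
      "\<And>c i. (\<forall>x\<in>zcl (h ` U). (\<Sum>i<a. c i * f i x) = 0) \<Longrightarrow> i < a \<Longrightarrow> c i = 0"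
      using H unfolding hilbert_ge_def by metis
    define F where "F i = (\<lambda>z. f i (h (L z)))" for i
    have Fspan: "F i \<in> fvs.span (monomials ?d (b * N))" if "i < a" for i
      unfolding F_def by (rule pdeg_comp_monos[OF f(1)[OF that] hb])
    have ind: "c i = 0" if c: "\<And>z. (\<Sum>i<a. c i * F i z) = 0" and i: "i < a" for c i
    proof (rule f(2)[OF _ i], intro ballI)
      fix x assume x: "x \<in> zcl (h ` U)"
      show "(\<Sum>i<a. c i * f i x) = 0"
      proof (rule zclD[OF x])
        show "polyfun (\<lambda>x. \<Sum>i<a. c i * f i x)"
          using f(1) by (intro polyfun_sum polyfun_mult polyfun_const) (auto intro: pdeg_polyfun)
        fix y assume "y \<in> h ` U"
        then obtain z where "y = h (L z)" using surj by blast
        then show "(\<Sum>i<a. c i * f i y) = 0" using c[of z] by (simp add: F_def)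
      qed
    qed
    have inj: "inj_on F {..<a}"
    proof (rule inj_onI)
      fix i j assume ij: "i \<in> {..<a}" "j \<in> {..<a}" "F i = F j"
      show "i = j"
      proof (rule ccontr)
        assume "i \<noteq> j"
        define c where "c k = (if k = i then 1 else 0) - (if k = j then 1 else (0::complex))" for k
        have "(\<Sum>k<a. c k * F k z) = 0" for z
        proof -
          have "(\<Sum>k<a. c k * F k z) = (\<Sum>k<a. (if k = i then F k z else 0) - (if k = j then F k z else 0))"
            by (rule sum.cong) (auto simp: c_def)
          then show ?thesis using ij by (simp add: sum_subtractf)
        qed
        then have "c i = 0" using ind[of c i] ij by simp
        then show False using \<open>i \<noteq> j\<close> by (simp add: c_def)
      qed
    qed
    have scal: "r (F i) = 0"
      if *: "(\<Sum>x\<in>F ` {..<a}. (\<lambda>y. r x * x y)) = 0" and i: "i < a" for r i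
    proof -
      have "(\<Sum>i<a. (\<lambda>y. r (F i) * F i y)) = 0"
        using * inj by (simp add: sum.reindex)
      then have "(\<Sum>i<a. r (F i) * F i z) = 0" for z
        unfolding fun_sum_apply[of "\<lambda>i y. r (F i) * F i y" "{..<a}" z, symmetric] by simp
      then show ?thesis
        using ind[of "\<lambda>i. r (F i)" i] i by simp
    qed
    have "\<not> fvs.dependent (F ` {..<a})"
    proof
      assume "fvs.dependent (F ` {..<a})"
      then obtain r where "\<exists>x\<in>F ` {..<a}. r x \<noteq> 0" "(\<Sum>x\<in>F ` {..<a}. (\<lambda>y. r x * x y)) = 0"
        using fvs.dependent_finite[of "F ` {..<a}"] by auto
      then show False using scal by blast
    qed
    then have "card (F ` {..<a}) \<le> card (monomials ?d (b * N))"
      using fvs.independent_span_bound[OF monomials_card(1)] Fspan by blast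
    then show ?thesis
      using monomials_card(2)[of ?d "b * N"] inj by (simp add: card_image)
  qed
  then show thesis using that by blast
qed

theorem has_chain_zcl_image_le:
  assumes U: "vec.subspace U" and h: "polymap h" and k: "has_chain (zcl (h ` U)) k"
  shows "k \<le> vec.dim U"
proof (rule ccontr)
  assume "\<not> k \<le> vec.dim U"
  then have "has_chain (zcl (h ` U)) (Suc (vec.dim U))"
    using has_chain_le[OF k] by simp
  then obtain C where C: "\<And>N. 1 \<le> N \<Longrightarrow> hilbert_ge (zcl (h ` U)) (C * N) (N ^ Suc (vec.dim U))"
    using has_chain_hilbert_ge by blast
  obtain b where b: "\<And>N a. hilbert_ge (zcl (h ` U)) N a \<Longrightarrow> a \<le> (b * N + 1) ^ vec.dim U"
    using hilbert_ge_zcl_image[OF U h] by metis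
  let ?d = "vec.dim U"
  \<comment> \<open>With \<open>d = vec.dim U\<close>, the two estimates give
    \<open>N ^ (d + 1) \<le> (b C + 1) ^ d * N ^ d\<close>, which fails as soon as \<open>N\<close>
    exceeds \<open>(b C + 1) ^ d\<close>.\<close>
  define N where "N = (b * C + 1) ^ ?d + 1"
  have "N ^ Suc ?d \<le> (b * (C * N) + 1) ^ ?d"
    using b C[of N] by (simp add: N_def)
  also have "\<dots> \<le> ((b * C + 1) * N) ^ ?d"
    by (rule power_mono) (auto simp: N_def algebra_simps)
  also have "\<dots> = (b * C + 1) ^ ?d * N ^ ?d" by (rule power_mult_distrib)
  also have "\<dots> < N * N ^ ?d"
    by (rule mult_strict_right_mono) (auto simp: N_def)
  finally show False by simp
qed

lemma has_chain_subspace_le: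
  assumes "vec.subspace U" "has_chain U k"
  shows "k \<le> vec.dim U"
  using has_chain_zcl_image_le[OF assms(1) polymap_id, of k] assms closedin_subspace[OF assms(1)]
  by (simp add: closedin_zariski_iff)

section \<open>Cubic forms\<close>

locale cubic =
  fixes f :: "complex ^ 'n::finite \<Rightarrow> complex ^ 'n \<Rightarrow> complex ^ 'n \<Rightarrow> complex"
  assumes lin: "lfun (\<lambda>u. f u v w)" and sym12: "f u v w = f v u w" and sym23: "f u v w = f u w v"
begin

lemmas f_ac = sym12 sym23

lemma lin2: "lfun (\<lambda>v. f u v w)"
  using lin[of u w] sym12 by simp

lemma lin3: "lfun (\<lambda>w. f u v w)"
  using lin2[of u v] sym23 by simp

lemmas f_simps =
  lfun_add[OF lin] lfun_scale[OF lin] lfun_0[OF lin] lfun_minus[OF lin] lfun_diff[OF lin]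
  lfun_add[OF lin2] lfun_scale[OF lin2] lfun_0[OF lin2] lfun_minus[OF lin2] lfun_diff[OF lin2]
  lfun_add[OF lin3] lfun_scale[OF lin3] lfun_0[OF lin3] lfun_minus[OF lin3] lfun_diff[OF lin3]

lemma polyfun_f:
  assumes "polymap a" "polymap b" "polymap c"
  shows "polyfun (\<lambda>x. f (a x) (b x) (c x))"
proof -
  have "f (a x) (b x) (c x) = (\<Sum>i\<in>UNIV. a x $ i * (\<Sum>j\<in>UNIV. b x $ j *
     (\<Sum>k\<in>UNIV. c x $ k * f (axis i 1) (axis j 1) (axis k 1))))" for x
    unfolding lfun_expand[OF lin, of "a x" "b x" "c x"]
    by (intro sum.cong refl arg_cong2[where f = "(*)"], unfold lfun_expand[OF lin2, of _ "b x" "c x"])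
       (intro sum.cong refl arg_cong2[where f = "(*)"] lfun_expand[OF lin3])
  then show ?thesis using assms by simp
qed

definition Yh :: "(complex ^ 'n) set" where "Yh = {v. f v v v = 0}"

lemma closedin_Yh: "closedin zariski Yh"
proof (rule closedin_zariskiI)
  fix v assume "v \<notin> Yh"
  then show "\<exists>g. polyfun g \<and> (\<forall>a\<in>Yh. g a = 0) \<and> g v \<noteq> 0"
    by (intro exI[of _ "\<lambda>v. f v v v"]) (auto simp: Yh_def intro: polyfun_f)
qed

text \<open>The factorisation is relative to a subspace because the dimension count restricts the
  form to hyperplane sections, where it may become reducible.\<close>

definition linear_factor_on :: "(complex ^ 'n) set \<Rightarrow> bool" where
  "linear_factor_on L \<longleftrightarrow> (\<exists>l g. lfun l \<and> (\<exists>v\<in>L. l v \<noteq> 0) \<and> polyfun g \<and> (\<forall>v\<in>L. f v v v = l v * g v))"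

text \<open>On the line through 0 and \<open>v\<close> the left side is a multiple of
  \<open>s ^ k\<close>, whereas the right side is divisible by \<open>s ^ 3\<close>.\<close>

lemma homogeneous_multiple_eq_0:
  assumes L: "vec.subspace L" and q: "polyfun q" and k: "k < 3"
    and h: "\<And>v s. v \<in> L \<Longrightarrow> h (s *s v) = s ^ k * h v"
    and eq: "\<And>v. v \<in> L \<Longrightarrow> h v = q v * f v v v" and v: "v \<in> L"
  shows "h v = 0"
proof -
  obtain Q where Q: "\<And>s. q (0 + s *s v) = poly Q s"
    using polyfun_on_line[OF q] by metis
  have "poly (monom (h v) k) s = poly (monom (f v v v) 3 * Q) s" for s
  proof -
    have "s *s v \<in> L" using L v by (simp add: vec.subspace_scale)
    then have "s ^ k * h v = poly Q s * (s ^ 3 * f v v v)"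
      using h[OF v] eq[of "s *s v"] Q[of s] by (simp add: f_simps power3_eq_cube mult_ac)
    then show ?thesis by (simp add: poly_monom mult_ac)
  qed
  then have "monom (h v) k = monom (f v v v) 3 * Q" by (metis poly_eq_poly_eq_iff ext)
  then have "coeff (monom (h v) k) k = coeff (monom (f v v v) 3 * Q) k" by simp
  then show ?thesis using k by (simp add: coeff_monom_mult)
qed

end

subsection \<open>Rational roots of depressed cubics\<close>

text \<open>Univariate polynomials are integrally closed: by the equation a root of \<open>m\<close>
  is a root of \<open>n\<close>, and cancelling the common linear factor lowers the degree of
  \<open>m\<close>.\<close>

lemma cubic_rational_root_dvd:
  fixes m n p r :: "complex poly"
  assumes "m \<noteq> 0" "n ^ 3 + p * n * m ^ 2 + r * m ^ 3 = 0"
  shows "m dvd n"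
  using assms
proof (induction "degree m" arbitrary: m n)
  case 0
  then show ?case by (metis dvd_0_right is_unit_iff_degree unit_imp_dvd)
next
  case (Suc d)
  then obtain a where a: "poly m a = 0"
    using fundamental_theorem_of_algebra[of m] by (metis constant_degree nat.distinct(1))
  have "poly (n ^ 3 + p * n * m ^ 2 + r * m ^ 3) a = 0" using Suc.prems by simp
  then have "poly n a = 0" using a by simp
  then obtain n' where n': "n = [:- a, 1:] * n'" using poly_eq_0_iff_dvd by (metis dvdE)
  obtain m' where m': "m = [:- a, 1:] * m'" using a poly_eq_0_iff_dvd by (metis dvdE)
  have m'0: "m' \<noteq> 0" using m' Suc.prems by auto
  have "degree ([:- a, 1:] * m') = Suc (degree m')" using m'0 by (subst degree_mult_eq) auto
  then have d: "degree m' = d" using Suc.hyps m' by simp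
  have "[:- a, 1:] ^ 3 * (n' ^ 3 + p * n' * m' ^ 2 + r * m' ^ 3) = n ^ 3 + p * n * m ^ 2 + r * m ^ 3"
    unfolding n' m' by (simp only: power_mult_distrib distrib_left) (simp only: power3_eq_cube power2_eq_square mult_ac)
  then have "n' ^ 3 + p * n' * m' ^ 2 + r * m' ^ 3 = 0" using Suc.prems by simp
  then have "m' dvd n'" using Suc.hyps(1)[OF d[symmetric] m'0] by blast
  then show ?case unfolding n' m' by (rule mult_dvd_mono[OF dvd_refl])
qed

lemma cubic_root_degree_le_1:
  fixes l p r :: "complex poly"
  assumes "l ^ 3 + p * l + r = 0" "degree p \<le> 2" "degree r \<le> 3"
  shows "degree l \<le> 1"
proof (rule ccontr)
  assume "\<not> ?thesis"
  then have d: "degree l \<ge> 2" by simp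
  then have "l \<noteq> 0" by auto
  then have "degree (l ^ 3) = 3 * degree l" by (simp add: degree_power_eq)
  moreover have "degree (p * l + r) < 3 * degree l"
  proof (rule degree_add_less)
    show "degree (p * l) < 3 * degree l" using degree_mult_le[of p l] assms(2) d by linarith
    show "degree r < 3 * degree l" using assms(3) d by linarith
  qed
  moreover have "l ^ 3 = - (p * l + r)" using assms(1) by (simp only: eq_neg_iff_add_eq_0 add.assoc)
  ultimately show False by (metis degree_minus less_irrefl)
qed

text \<open>All three roots are delivered with their symmetric functions, since the resultant below
  is a product over them.\<close>

lemma cubic_roots_exist:
  fixes P R :: complex
  obtains t1 t2 t3 where "t1 + t2 + t3 = 0" "t1 * t2 + t1 * t3 + t2 * t3 = P" "t1 * t2 * t3 = - R"
    "t1 ^ 3 + P * t1 + R = 0"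
proof -
  have "\<exists>t. poly [:R, P, 0, 1:] t = 0"
    by (rule fundamental_theorem_of_algebra) (simp add: constant_degree)
  then obtain t1 where t1: "poly [:R, P, 0, 1:] t1 = 0" by blast
  then have t1: "t1 ^ 3 + P * t1 + R = 0" by (simp add: algebra_simps power3_eq_cube)
  have "\<exists>t. poly [:P + t1 ^ 2, t1, 1:] t = 0"
    by (rule fundamental_theorem_of_algebra) (simp add: constant_degree)
  then obtain t2 where t2: "poly [:P + t1 ^ 2, t1, 1:] t2 = 0" by blast
  then have t2: "t2 ^ 2 + t1 * t2 + t1 ^ 2 + P = 0" by (simp add: algebra_simps power2_eq_square)
  show thesis
  proof (rule that[of t1 t2 "- t1 - t2"])
    show "t1 + t2 + (- t1 - t2) = 0" by simp
    show "t1 * t2 + t1 * (- t1 - t2) + t2 * (- t1 - t2) = P" using t2 by algebra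
    show "t1 * t2 * (- t1 - t2) = - R" using t1 t2 by algebra
  qed (rule t1)
qed

section \<open>Division by the cubic and irreducibility of its zero set\<close>

context cubic
begin

context
  fixes L :: "(complex ^ 'n) set" and e :: "complex ^ 'n"
  assumes L: "vec.subspace L" and eL: "e \<in> L" and fe: "f e e e \<noteq> 0"
begin

text \<open>The coordinate along \<open>e\<close> whose kernel is the polar hyperplane of
  \<open>e\<close>. With this choice the quadratic term disappears, and the form is
  \<open>f e e e\<close> times the depressed cubic \<open>T ^ 3 + P T + R\<close> with coefficients
  on \<open>L'\<close>.\<close>

definition T :: "complex ^ 'n \<Rightarrow> complex" where "T v = f e e v / f e e e"
definition proj :: "complex ^ 'n \<Rightarrow> complex ^ 'n" where "proj v = v - T v *s e"
definition P :: "complex ^ 'n \<Rightarrow> complex" where "P x = 3 * f e x x / f e e e"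
definition R :: "complex ^ 'n \<Rightarrow> complex" where "R x = f x x x / f e e e"
definition L' :: "(complex ^ 'n) set" where "L' = {v \<in> L. T v = 0}"

lemma lfun_T: "lfun T"
  unfolding T_def lfun_def by (simp add: f_simps add_divide_distrib)

lemma T_e: "T e = 1" using fe by (simp add: T_def)

lemma lmap_proj: "lmap proj"
  unfolding proj_def lmap_def by (auto simp: lfun_add[OF lfun_T] lfun_scale[OF lfun_T] vec_eq_iff algebra_simps)

lemma T_proj: "T (proj v) = 0"
  by (simp add: proj_def lfun_diff[OF lfun_T] lfun_scale[OF lfun_T] T_e)

lemma subspace_L': "vec.subspace L'"
  unfolding L'_def using subspace_lfun_eq_0[OF L, of "{T}"] lfun_T by simp

lemma proj_L': "v \<in> L \<Longrightarrow> proj v \<in> L'"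
  using T_proj L eL by (simp add: L'_def proj_def vec.subspace_diff vec.subspace_scale)

lemma T_L': "x \<in> L' \<Longrightarrow> T (x + t *s e) = t" "x \<in> L' \<Longrightarrow> proj (x + t *s e) = x"
  "x \<in> L' \<Longrightarrow> x + t *s e \<in> L"
  using eL L by (simp_all add: L'_def proj_def lfun_add[OF lfun_T] lfun_scale[OF lfun_T] T_e
      vec.subspace_add vec.subspace_scale)

lemma polyfun_PR: "polyfun P" "polyfun R"
  unfolding P_def[abs_def] R_def[abs_def]
  by (intro polyfun_divide_const polyfun_mult polyfun_const polyfun_f polymap_id polymap_const)+

lemma f_eq_cubic: "f v v v = f e e e * (T v ^ 3 + P (proj v) * T v + R (proj v))"
proof -
  have z: "f e e (proj v) = 0" using T_proj[of v] fe by (simp add: T_def)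
  define x where "x = proj v"
  define t where "t = T v"
  have v: "v = x + t *s e" by (simp add: x_def t_def proj_def)
  have z: "f e e x = 0" using z by (simp add: x_def)
  have "f v v v = f x x x + 3 * t * f e x x + 3 * t ^ 2 * f e e x + t ^ 3 * f e e e"
    unfolding v by (simp add: f_simps f_ac algebra_simps power2_eq_square power3_eq_cube)
  then show ?thesis
    using z fe by (simp add: P_def R_def flip: x_def t_def) (simp add: field_simps)
qed

text \<open>The cubic is monic in \<open>T\<close>, so division with remainder introduces no
  denominators, and the coefficients of the remainder depend on the projection only.\<close>

lemma division:
  assumes "polyfun g"
  obtains q r0 r1 r2 where "polyfun q" "polyfun r0" "polyfun r1" "polyfun r2"
    "\<And>v. g v = q v * (T v ^ 3 + P (proj v) * T v + R (proj v)) + r0 (proj v) + r1 (proj v) * T v + r2 (proj v) * T v ^ 2"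
proof -
  have pT: "polyfun T" and pp: "polymap proj"
    using lfun_T lmap_proj by (auto intro: lfun_polyfun lmap_polymap)
  have pc: "polyfun (\<lambda>v. r (proj v))" if "polyfun r" for r
    using that pp by (rule polyfun_comp)
  have "\<exists>q r0 r1 r2. polyfun q \<and> polyfun r0 \<and> polyfun r1 \<and> polyfun r2 \<and>
    (\<forall>v. g v = q v * (T v ^ 3 + P (proj v) * T v + R (proj v)) + r0 (proj v) + r1 (proj v) * T v + r2 (proj v) * T v ^ 2)"
    using assms
  proof (induction g rule: polyfun_induct)
    case (const c)
    show ?case
      by (rule exI[of _ "\<lambda>_. 0"], rule exI[of _ "\<lambda>_. c"], rule exI[of _ "\<lambda>_. 0"], rule exI[of _ "\<lambda>_. 0"]) simp
  next
    case (coord i)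
    show ?case
      by (rule exI[of _ "\<lambda>_. 0"], rule exI[of _ "\<lambda>x. x $ i"], rule exI[of _ "\<lambda>_. e $ i"], rule exI[of _ "\<lambda>_. 0"])
         (simp add: proj_def)
  next
    case (add g h)
    then obtain q r0 r1 r2 q' s0 s1 s2 where
      "polyfun q" "polyfun r0" "polyfun r1" "polyfun r2" "polyfun q'" "polyfun s0" "polyfun s1" "polyfun s2"
      "\<And>v. g v = q v * (T v ^ 3 + P (proj v) * T v + R (proj v)) + r0 (proj v) + r1 (proj v) * T v + r2 (proj v) * T v ^ 2"
      "\<And>v. h v = q' v * (T v ^ 3 + P (proj v) * T v + R (proj v)) + s0 (proj v) + s1 (proj v) * T v + s2 (proj v) * T v ^ 2"
      by metis
    then show ?case
      by (intro exI[of _ "\<lambda>v. q v + q' v"] exI[of _ "\<lambda>v. r0 v + s0 v"] exI[of _ "\<lambda>v. r1 v + s1 v"]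
         exI[of _ "\<lambda>v. r2 v + s2 v"]) (simp add: algebra_simps)
  next
    case (mult g h)
    then obtain q r0 r1 r2 q' s0 s1 s2 where
      p: "polyfun q" "polyfun r0" "polyfun r1" "polyfun r2" "polyfun q'" "polyfun s0" "polyfun s1" "polyfun s2"
      and g: "\<And>v. g v = q v * (T v ^ 3 + P (proj v) * T v + R (proj v)) + r0 (proj v) + r1 (proj v) * T v + r2 (proj v) * T v ^ 2"
      and h: "\<And>v. h v = q' v * (T v ^ 3 + P (proj v) * T v + R (proj v)) + s0 (proj v) + s1 (proj v) * T v + s2 (proj v) * T v ^ 2"
      by metis
    \<comment> \<open>The product of two remainders has degree 4 in \<open>t\<close>; its two top
      terms are removed by \<open>r2 s2 t + (r1 s2 + r2 s1)\<close> times the cubic.\<close>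
    have key: "(q * (t ^ 3 + P * t + R) + r0 + r1 * t + r2 * t ^ 2) * (q' * (t ^ 3 + P * t + R) + s0 + s1 * t + s2 * t ^ 2) =
      (q * q' * (t ^ 3 + P * t + R) + q * (s0 + s1 * t + s2 * t ^ 2) + q' * (r0 + r1 * t + r2 * t ^ 2) + r1 * s2 + r2 * s1 + r2 * s2 * t)
        * (t ^ 3 + P * t + R) +
      (r0 * s0 - R * (r1 * s2 + r2 * s1)) +
      (r0 * s1 + r1 * s0 - P * (r1 * s2 + r2 * s1) - R * (r2 * s2)) * t +
      (r0 * s2 + r1 * s1 + r2 * s0 - P * (r2 * s2)) * t ^ 2" for q q' t P R r0 r1 r2 s0 s1 s2 :: complex
      by algebra
    show ?case
    proof (rule exI[of _ "\<lambda>v. q v * q' v * (T v ^ 3 + P (proj v) * T v + R (proj v)) +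
          q v * (s0 (proj v) + s1 (proj v) * T v + s2 (proj v) * T v ^ 2) +
          q' v * (r0 (proj v) + r1 (proj v) * T v + r2 (proj v) * T v ^ 2) +
          r1 (proj v) * s2 (proj v) + r2 (proj v) * s1 (proj v) + r2 (proj v) * s2 (proj v) * T v"],
        rule exI[of _ "\<lambda>x. r0 x * s0 x - R x * (r1 x * s2 x + r2 x * s1 x)"],
        rule exI[of _ "\<lambda>x. r0 x * s1 x + r1 x * s0 x - P x * (r1 x * s2 x + r2 x * s1 x) - R x * (r2 x * s2 x)"],
        rule exI[of _ "\<lambda>x. r0 x * s2 x + r1 x * s1 x + r2 x * s0 x - P x * (r2 x * s2 x)"], intro conjI allI)
      fix v show "g v * h v = (q v * q' v * (T v ^ 3 + P (proj v) * T v + R (proj v)) +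
          q v * (s0 (proj v) + s1 (proj v) * T v + s2 (proj v) * T v ^ 2) +
          q' v * (r0 (proj v) + r1 (proj v) * T v + r2 (proj v) * T v ^ 2) +
          r1 (proj v) * s2 (proj v) + r2 (proj v) * s1 (proj v) + r2 (proj v) * s2 (proj v) * T v) *
          (T v ^ 3 + P (proj v) * T v + R (proj v)) +
          (r0 (proj v) * s0 (proj v) - R (proj v) * (r1 (proj v) * s2 (proj v) + r2 (proj v) * s1 (proj v))) +
          (r0 (proj v) * s1 (proj v) + r1 (proj v) * s0 (proj v) - P (proj v) * (r1 (proj v) * s2 (proj v) + r2 (proj v) * s1 (proj v)) -
             R (proj v) * (r2 (proj v) * s2 (proj v))) * T v +
          (r0 (proj v) * s2 (proj v) + r1 (proj v) * s1 (proj v) + r2 (proj v) * s0 (proj v) - P (proj v) * (r2 (proj v) * s2 (proj v))) * T v ^ 2"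
        unfolding g h by (rule key)
    qed (intro polyfun_add polyfun_mult polyfun_diff polyfun_power p pc pT polyfun_PR)+
  qed
  then show thesis using that by blast
qed

text \<open>On each line through \<open>x0\<close> the quotient \<open>N / M\<close> is a polynomial
  by integral closedness, and of degree at most 1 by comparing degrees. Its slope is the derivative
  of \<open>N / M\<close> at \<open>x0\<close>, hence linear in the direction; so the root is affine
  linear, and homogeneity of \<open>P\<close> and \<open>R\<close> removes the constant.\<close>

lemma rational_root_imp_linear_root:
  assumes NM: "polyfun N" "polyfun M" and M0: "x0 \<in> L'" "M x0 \<noteq> 0"
    and eq: "\<And>x. x \<in> L' \<Longrightarrow> N x ^ 3 + P x * N x * M x ^ 2 + R x * M x ^ 3 = 0"
  obtains b where "lfun b" "\<And>x. x \<in> L' \<Longrightarrow> b x ^ 3 + P x * b x + R x = 0"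
proof -
  have deriv: "\<exists>D. lfun D \<and> (\<forall>y. ((\<lambda>s. h (x0 + s *s y)) has_field_derivative D y) (at 0))"
    if h: "polyfun h" for h :: "complex ^ 'n \<Rightarrow> complex"
  proof -
    obtain p where p: "h = peval p" using h by (auto simp: polyfun_def)
    define D where "D y = (\<Sum>i\<in>UNIV. peval (partial i p) x0 * y $ i)" for y
    have "lfun D" unfolding D_def[abs_def] by (intro lfun_sumI lfun_cmultI lfun_axis)
    moreover have "((\<lambda>s. h (x0 + s *s y)) has_field_derivative D y) (at 0)" for y
    proof -
      have "((\<lambda>t. (x0 + t *s y) $ i) has_field_derivative y $ i) (at 0)" for i
        by (auto intro!: derivative_eq_intros)
      from peval_curve_deriv[of "\<lambda>s. x0 + s *s y", OF this, of p] show ?thesis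
        unfolding p D_def by simp
    qed
    ultimately show ?thesis by blast
  qed
  obtain DN where DN: "lfun DN" "\<And>y. ((\<lambda>s. N (x0 + s *s y)) has_field_derivative DN y) (at 0)"
    using deriv[OF NM(1)] by blast
  obtain DM where DM: "lfun DM" "\<And>y. ((\<lambda>s. M (x0 + s *s y)) has_field_derivative DM y) (at 0)"
    using deriv[OF NM(2)] by blast
  define \<alpha> where "\<alpha> = N x0 / M x0"
  define b where "b y = (1 / M x0) * (DN y - \<alpha> * DM y)" for y
  have b: "lfun b" unfolding b_def[abs_def] by (intro lfun_cmultI lfun_diffI DN DM)
  have line: "N (x0 + y) = (\<alpha> + b y) * M (x0 + y)" if y: "y \<in> L'" for y
  proof -
    obtain n where n: "\<And>s. N (x0 + s *s y) = poly n s" using polyfun_on_line[OF NM(1)] by metis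
    obtain m where m: "\<And>s. M (x0 + s *s y) = poly m s" using polyfun_on_line[OF NM(2)] by metis
    define p where "p = [:P x0, 6 * f e x0 y / f e e e, P y:]"
    have p: "P (x0 + s *s y) = poly p s" for s
      by (simp add: p_def P_def f_simps f_ac field_simps fe)
    define r where "r = [:R x0, 3 * f x0 x0 y / f e e e, 3 * f x0 y y / f e e e, R y:]"
    have r: "R (x0 + s *s y) = poly r s" for s
      by (simp add: r_def R_def f_simps f_ac field_simps fe)
    have inL: "x0 + s *s y \<in> L'" for s
      using subspace_L' M0 y by (simp add: vec.subspace_add vec.subspace_scale)
    have "poly (n ^ 3 + p * n * m ^ 2 + r * m ^ 3) s = 0" for s
      using eq[OF inL[of s]] by (simp add: n m p r)
    then have z: "n ^ 3 + p * n * m ^ 2 + r * m ^ 3 = 0" by (metis poly_all_0_iff_0)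
    have m0: "poly m 0 = M x0" using m[of 0] by simp
    then have "m \<noteq> 0" using M0 by auto
    then obtain l where l: "n = m * l" using cubic_rational_root_dvd[OF _ z] by (metis dvdE)
    have "m ^ 3 * (l ^ 3 + p * l + r) = 0"
      using z unfolding l by (simp add: algebra_simps power3_eq_cube power2_eq_square)
    then have "l ^ 3 + p * l + r = 0" using \<open>m \<noteq> 0\<close> by simp
    then have "degree l \<le> 1"
      by (rule cubic_root_degree_le_1) (simp_all add: p_def r_def)
    then have "l = [:coeff l 0, coeff l 1:]"
      by (intro poly_eqI) (auto simp: coeff_pCons coeff_eq_0 split: nat.split)
    then obtain a c where ac: "l = [:a, c:]" by blast
    have a: "a = \<alpha>" using n[of 0] m0 l ac M0 by (simp add: \<alpha>_def)
    have "DN y = poly (pderiv n) 0"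
      using DN(2)[of y] poly_DERIV[of n 0] unfolding n by (rule DERIV_unique)
    also have "\<dots> = poly m 0 * poly (pderiv l) 0 + poly l 0 * poly (pderiv m) 0"
      by (simp only: l pderiv_mult poly_add poly_mult)
    also have "\<dots> = \<alpha> * poly (pderiv m) 0 + c * M x0"
      by (simp add: ac pderiv_pCons a m0)
    also have "poly (pderiv m) 0 = DM y"
      using DM(2)[of y] poly_DERIV[of m 0] unfolding m by (rule DERIV_unique[symmetric])
    finally have "b y = c" using M0 by (simp add: b_def)
    then show ?thesis
      using n[of 1] m[of 1] by (simp add: l ac a algebra_simps)
  qed
  define c0 where "c0 = \<alpha> - b x0"
  have N: "N x = (c0 + b x) * M x" if "x \<in> L'" for x
  proof -
    have "x - x0 \<in> L'" using subspace_L' M0 that by (simp add: vec.subspace_diff)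
    then show ?thesis using line[of "x - x0"] by (simp add: c0_def lfun_diff[OF b])
  qed
  have root: "(c0 + b x) ^ 3 + P x * (c0 + b x) + R x = 0" if "x \<in> L'" for x
  proof (rule polyfun_eq_0_dense[OF subspace_L' _ NM(2) M0 _ that])
    show "polyfun (\<lambda>x. (c0 + b x) ^ 3 + P x * (c0 + b x) + R x)"
      by (intro polyfun_add polyfun_mult polyfun_power polyfun_PR lfun_polyfun[OF b] polyfun_const)
    fix v assume v: "v \<in> L'" "M v \<noteq> 0"
    have "M v ^ 3 * ((c0 + b v) ^ 3 + P v * (c0 + b v) + R v) = 0"
      using eq[OF v(1)] N[OF v(1)] by (simp add: algebra_simps power3_eq_cube power2_eq_square)
    then show "(c0 + b v) ^ 3 + P v * (c0 + b v) + R v = 0" using v by simp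
  qed
  have "b x ^ 3 + P x * b x + R x = 0" if x: "x \<in> L'" for x
  proof -
    \<comment> \<open>Evaluating at \<open>s x\<close> turns the equation for \<open>c0 + b\<close>
      into a polynomial identity in \<open>s\<close>, whose coefficient of \<open>s ^ 3\<close> is
      the claim.\<close>
    let ?p = "[:c0 ^ 3, 3 * c0 ^ 2 * b x, 3 * c0 * b x ^ 2 + P x * c0, b x ^ 3 + P x * b x + R x:]"
    have "poly ?p s = 0" for s
    proof -
      have "s *s x \<in> L'" using subspace_L' x by (simp add: vec.subspace_scale)
      from root[OF this] show ?thesis
        by (simp add: lfun_scale[OF b] P_def R_def f_simps algebra_simps power3_eq_cube power2_eq_square)
    qed
    then have "?p = 0" by (metis poly_all_0_iff_0)
    then show ?thesis by simp
  qed
  then show thesis using that b by blast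
qed

text \<open>A common root of the cubic and a nonzero polynomial of degree at most 2 in
  \<open>t\<close> is rational in the coefficients, except when the quadratic divides the cubic;
  then the third root is rational.\<close>

lemma common_root_imp_linear_factor:
  assumes p: "polyfun r0" "polyfun r1" "polyfun r2"
    and nz: "x1 \<in> L'" "r0 x1 \<noteq> 0 \<or> r1 x1 \<noteq> 0 \<or> r2 x1 \<noteq> 0"
    and root: "\<And>x. x \<in> L' \<Longrightarrow> \<exists>t. t ^ 3 + P x * t + R x = 0 \<and> r0 x + r1 x * t + r2 x * t ^ 2 = 0"
  shows "linear_factor_on L"
proof -
  have "\<exists>N M x0. polyfun N \<and> polyfun M \<and> x0 \<in> L' \<and> M x0 \<noteq> 0 \<and>
     (\<forall>x\<in>L'. N x ^ 3 + P x * N x * M x ^ 2 + R x * M x ^ 3 = 0)"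
  proof -
    have fin: "N ^ 3 + P * N * M ^ 2 + R * M ^ 3 = 0" if "t ^ 3 + P * t + R = 0" "M * t = N" for N M P R t :: complex
      using that by algebra
    show ?thesis
    proof (cases "\<exists>x\<in>L'. r2 x \<noteq> 0")
      case False
      then have r: "\<exists>t. t ^ 3 + P x * t + R x = 0 \<and> r1 x * t = - r0 x" if "x \<in> L'" for x
        using root[OF that] that by (auto simp: eq_neg_iff_add_eq_0 add.commute)
      have "\<exists>x\<in>L'. r1 x \<noteq> 0"
      proof (rule ccontr)
        assume "\<not> ?thesis"
        then have "r0 x1 = 0" "r1 x1 = 0" "r2 x1 = 0" using r[OF nz(1)] False nz(1) by auto
        then show False using nz by simp
      qed
      moreover have "\<forall>x\<in>L'. (- r0 x) ^ 3 + P x * (- r0 x) * r1 x ^ 2 + R x * r1 x ^ 3 = 0"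
        using r fin by blast
      ultimately show ?thesis using p by (intro exI[of _ "\<lambda>x. - r0 x"] exI[of _ r1]) auto
    next
      case True
      \<comment> \<open>Reducing \<open>r2 ^ 2\<close> times the cubic modulo the quadratic leaves
        \<open>\<gamma> t + \<delta>\<close>.\<close>
      define \<gamma> where "\<gamma> x = r2 x ^ 2 * P x - r2 x * r0 x + r1 x ^ 2" for x
      define \<delta> where "\<delta> x = r2 x ^ 2 * R x + r0 x * r1 x" for x
      have pg: "polyfun \<gamma>" "polyfun \<delta>"
        unfolding \<gamma>_def[abs_def] \<delta>_def[abs_def]
        by (intro polyfun_add polyfun_mult polyfun_diff polyfun_power p polyfun_PR)+
      have r: "\<exists>t. t ^ 3 + P x * t + R x = 0 \<and> \<gamma> x * t = - \<delta> x" if xL: "x \<in> L'" for x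
      proof -
        obtain t where t: "t ^ 3 + P x * t + R x = 0" "r0 x + r1 x * t + r2 x * t ^ 2 = 0"
          using root[OF xL] by blast
        have "\<gamma> x * t = - \<delta> x" unfolding \<gamma>_def \<delta>_def using t by algebra
        then show ?thesis using t by blast
      qed
      show ?thesis
      proof (cases "\<exists>x\<in>L'. \<gamma> x \<noteq> 0")
        case True
        moreover have "\<forall>x\<in>L'. (- \<delta> x) ^ 3 + P x * (- \<delta> x) * \<gamma> x ^ 2 + R x * \<gamma> x ^ 3 = 0"
          using r fin by blast
        ultimately show ?thesis using pg by (intro exI[of _ "\<lambda>x. - \<delta> x"] exI[of _ \<gamma>]) auto
      next
        case False
        \<comment> \<open>Where \<open>r2\<close> is nonzero the quadratic now divides the cubic.
          Its roots add up to \<open>- r1 / r2\<close> and all three roots to 0, so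
          \<open>r1 / r2\<close> is the third root.\<close>
        have "r1 x ^ 3 + P x * r1 x * r2 x ^ 2 + R x * r2 x ^ 3 = 0" if "x \<in> L'" for x
        proof -
          have "\<gamma> x = 0" "\<delta> x = 0" using False r[OF that] that by auto
          then have "r2 x ^ 2 * P x - r2 x * r0 x + r1 x ^ 2 = 0" "r2 x ^ 2 * R x + r0 x * r1 x = 0"
            by (simp_all add: \<gamma>_def \<delta>_def)
          then show ?thesis by algebra
        qed
        then show ?thesis using p True by (intro exI[of _ r1] exI[of _ r2]) auto
      qed
    qed
  qed
  then obtain N M x0 where NM: "polyfun N" "polyfun M" "x0 \<in> L'" "M x0 \<noteq> 0"
     "\<And>x. x \<in> L' \<Longrightarrow> N x ^ 3 + P x * N x * M x ^ 2 + R x * M x ^ 3 = 0" by blast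
  obtain b where b: "lfun b" "\<And>x. x \<in> L' \<Longrightarrow> b x ^ 3 + P x * b x + R x = 0"
    using rational_root_imp_linear_root[OF NM] by blast
  define l where "l v = T v - b (proj v)" for v
  define g where "g v = f e e e * (T v ^ 2 + b (proj v) * T v + b (proj v) ^ 2 + P (proj v))" for v
  have lb: "lfun (\<lambda>v. b (proj v))" by (rule lfun_compI[OF b(1) lmap_proj])
  have "lfun l" unfolding l_def[abs_def] by (intro lfun_diffI lfun_T lb)
  moreover have "l e \<noteq> 0" by (simp add: l_def T_e proj_def lfun_0[OF b(1)])
  moreover have "polyfun g"
    unfolding g_def[abs_def]
    by (intro polyfun_add polyfun_mult polyfun_power polyfun_const lfun_polyfun[OF lfun_T] lfun_polyfun[OF lb]
        polyfun_comp[OF polyfun_PR(1) lmap_polymap[OF lmap_proj]])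
  moreover have "f v v v = l v * g v" if "v \<in> L" for v
  proof -
    have "b (proj v) ^ 3 + P (proj v) * b (proj v) + R (proj v) = 0" using b(2) proj_L' that by blast
    then have "T v ^ 3 + P (proj v) * T v + R (proj v) =
      (T v - b (proj v)) * (T v ^ 2 + b (proj v) * T v + b (proj v) ^ 2 + P (proj v))" by algebra
    then show ?thesis unfolding f_eq_cubic[of v] l_def g_def by simp
  qed
  ultimately show ?thesis using eL unfolding linear_factor_on_def by blast
qed

text \<open>Every root of the cubic over a point of \<open>L'\<close> is a root of the remainder,
  and a remainder that is not zero would produce a linear factor.\<close>

lemma division_on_zero_set:
  assumes "\<not> linear_factor_on L" "polyfun g" "\<And>v. v \<in> L \<Longrightarrow> f v v v = 0 \<Longrightarrow> g v = 0"
  shows "\<exists>q. polyfun q \<and> (\<forall>v\<in>L. g v = q v * f v v v)"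
proof -
  obtain q r0 r1 r2 where q: "polyfun q" "polyfun r0" "polyfun r1" "polyfun r2"
    "\<And>v. g v = q v * (T v ^ 3 + P (proj v) * T v + R (proj v)) + r0 (proj v) + r1 (proj v) * T v + r2 (proj v) * T v ^ 2"
    using division[OF assms(2)] by metis
  have rt: "r0 x + r1 x * t + r2 x * t ^ 2 = 0" if "x \<in> L'" "t ^ 3 + P x * t + R x = 0" for x t
    using q(5)[of "x + t *s e"] assms(3)[of "x + t *s e"] f_eq_cubic[of "x + t *s e"] that
    by (simp add: T_L')
  have "r0 x = 0 \<and> r1 x = 0 \<and> r2 x = 0" if x: "x \<in> L'" for x
  proof (rule ccontr)
    assume "\<not> ?thesis"
    then have "linear_factor_on L"
    proof (intro common_root_imp_linear_factor[OF q(2-4) x])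
      fix y assume y: "y \<in> L'"
      obtain t where "t ^ 3 + P y * t + R y = 0" using cubic_roots_exist by metis
      then show "\<exists>t. t ^ 3 + P y * t + R y = 0 \<and> r0 y + r1 y * t + r2 y * t ^ 2 = 0" using rt[OF y] by blast
    qed blast
    then show False using assms by simp
  qed
  then have "g v = (q v / f e e e) * f v v v" if "v \<in> L" for v
    using q(5)[of v] proj_L'[OF that] f_eq_cubic[of v] fe by simp
  then show ?thesis using q(1) by (intro exI[of _ "\<lambda>v. q v / f e e e"]) auto
qed

text \<open>A function not vanishing on the zero set has a remainder whose resultant with the cubic
  is not identically zero. Over a point where both resultants are nonzero, neither \<open>g\<close>
  nor \<open>h\<close> vanishes at any root of the cubic.\<close>

lemma prime_on_zero_set:
  assumes nf: "\<not> linear_factor_on L" and g: "polyfun g" "polyfun h"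
    and gh: "\<And>v. v \<in> L \<Longrightarrow> f v v v = 0 \<Longrightarrow> g v * h v = 0"
  shows "(\<forall>v\<in>L \<inter> Yh. g v = 0) \<or> (\<forall>v\<in>L \<inter> Yh. h v = 0)"
proof (rule ccontr)
  assume "\<not> ?thesis"
  then obtain v w where vw: "v \<in> L" "f v v v = 0" "g v \<noteq> 0" "w \<in> L" "f w w w = 0" "h w \<noteq> 0"
    by (auto simp: Yh_def)
  \<comment> \<open>The product of the remainder over the three roots, expanded in their symmetric
    functions so that it is polynomial in \<open>x\<close>.\<close>
  define res where "res r0 r1 r2 x = r0 x ^ 3 - 2 * P x * r0 x ^ 2 * r2 x + P x * r0 x * r1 x ^ 2
     + 3 * R x * r0 x * r1 x * r2 x + P x ^ 2 * r0 x * r2 x ^ 2 - R x * r1 x ^ 3 - P x * R x * r1 x * r2 x ^ 2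
     + R x ^ 2 * r2 x ^ 3" for r0 r1 r2 x
  have res: "res r0 r1 r2 x = (r0 x + r1 x * t1 + r2 x * t1 ^ 2) * (r0 x + r1 x * t2 + r2 x * t2 ^ 2) *
      (r0 x + r1 x * t3 + r2 x * t3 ^ 2)"
    if "t1 + t2 + t3 = 0" "t1 * t2 + t1 * t3 + t2 * t3 = P x" "t1 * t2 * t3 = - R x" for r0 r1 r2 x t1 t2 t3
  proof -
    have t3: "t3 = - t1 - t2" using that(1) by algebra
    have P: "P x = - (t1 ^ 2 + t1 * t2 + t2 ^ 2)"
      using that(2)[symmetric] unfolding t3 by (simp add: algebra_simps power2_eq_square)
    have "R x = - (t1 * t2 * t3)" using that(3) by simp
    then have R: "R x = t1 * t2 * (t1 + t2)" unfolding t3 by (simp add: algebra_simps)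
    show ?thesis unfolding res_def P R t3 by algebra
  qed
  have pres: "polyfun (res r0 r1 r2)" if "polyfun r0" "polyfun r1" "polyfun r2" for r0 r1 r2
    unfolding res_def[abs_def]
    by (intro polyfun_add polyfun_mult polyfun_diff polyfun_power that polyfun_PR polyfun_const)
  have main: "\<exists>q r0 r1 r2. polyfun r0 \<and> polyfun r1 \<and> polyfun r2 \<and> (\<exists>x\<in>L'. res r0 r1 r2 x \<noteq> 0) \<and>
    (\<forall>v. k v = q v * (T v ^ 3 + P (proj v) * T v + R (proj v)) + r0 (proj v) + r1 (proj v) * T v + r2 (proj v) * T v ^ 2)"
    if k: "polyfun k" "v \<in> L" "f v v v = 0" "k v \<noteq> 0" for k v
  proof -
    obtain q r0 r1 r2 where q: "polyfun q" "polyfun r0" "polyfun r1" "polyfun r2"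
      "\<And>v. k v = q v * (T v ^ 3 + P (proj v) * T v + R (proj v)) + r0 (proj v) + r1 (proj v) * T v + r2 (proj v) * T v ^ 2"
      using division[OF k(1)] by metis
    have nz: "r0 (proj v) \<noteq> 0 \<or> r1 (proj v) \<noteq> 0 \<or> r2 (proj v) \<noteq> 0"
      using q(5)[of v] k f_eq_cubic[of v] fe by auto
    obtain x where x: "x \<in> L'" "\<And>t. t ^ 3 + P x * t + R x = 0 \<Longrightarrow> r0 x + r1 x * t + r2 x * t ^ 2 \<noteq> 0"
      using common_root_imp_linear_factor[OF q(2-4) proj_L'[OF k(2)] nz] nf by blast
    obtain t1 t2 t3 where t: "t1 + t2 + t3 = 0" "t1 * t2 + t1 * t3 + t2 * t3 = P x" "t1 * t2 * t3 = - R x"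
      "t1 ^ 3 + P x * t1 + R x = 0" using cubic_roots_exist by metis
    have "t2 ^ 3 + P x * t2 + R x = 0" "t3 ^ 3 + P x * t3 + R x = 0" using t by algebra+
    then have "res r0 r1 r2 x \<noteq> 0" using res[OF t(1-3)] x(2) t(4) by simp
    then show ?thesis using q x by blast
  qed
  obtain q r0 r1 r2 where r: "polyfun r0" "polyfun r1" "polyfun r2" "\<exists>x\<in>L'. res r0 r1 r2 x \<noteq> 0"
    "\<And>v. g v = q v * (T v ^ 3 + P (proj v) * T v + R (proj v)) + r0 (proj v) + r1 (proj v) * T v + r2 (proj v) * T v ^ 2"
    using main[OF g(1) vw(1-3)] by metis
  obtain q' s0 s1 s2 where s: "polyfun s0" "polyfun s1" "polyfun s2" "\<exists>x\<in>L'. res s0 s1 s2 x \<noteq> 0"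
    "\<And>v. h v = q' v * (T v ^ 3 + P (proj v) * T v + R (proj v)) + s0 (proj v) + s1 (proj v) * T v + s2 (proj v) * T v ^ 2"
    using main[OF g(2) vw(4-6)] by metis
  obtain x where x: "x \<in> L'" "res r0 r1 r2 x * res s0 s1 s2 x \<noteq> 0"
    using polyfun_mult_eq_0_on[OF subspace_L' pres[OF r(1-3)] pres[OF s(1-3)]] r(4) s(4) by blast
  obtain t1 t2 t3 where t: "t1 + t2 + t3 = 0" "t1 * t2 + t1 * t3 + t2 * t3 = P x" "t1 * t2 * t3 = - R x"
      "t1 ^ 3 + P x * t1 + R x = 0" using cubic_roots_exist by metis
  have "r0 x + r1 x * t1 + r2 x * t1 ^ 2 \<noteq> 0" "s0 x + s1 x * t1 + s2 x * t1 ^ 2 \<noteq> 0"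
    using x(2) res[OF t(1-3)] by auto
  then have "g (x + t1 *s e) \<noteq> 0" "h (x + t1 *s e) \<noteq> 0"
    using r(5) s(5) t(4) x(1) by (simp_all add: T_L')
  moreover have "f (x + t1 *s e) (x + t1 *s e) (x + t1 *s e) = 0"
    using f_eq_cubic[of "x + t1 *s e"] t(4) x(1) by (simp add: T_L')
  ultimately show False using gh[of "x + t1 *s e"] T_L'(3)[OF x(1)] by auto
qed

end

lemma exists_nonzero_if_no_linear_factor:
  assumes "\<not> linear_factor_on L" "v \<in> L" "v \<noteq> 0"
  obtains e where "e \<in> L" "f e e e \<noteq> 0"
proof -
  obtain i where "v $ i \<noteq> 0" using assms(3) by (auto simp: vec_eq_iff)
  then have "linear_factor_on L" if "\<And>v. v \<in> L \<Longrightarrow> f v v v = 0"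
    unfolding linear_factor_on_def using that assms(2) lfun_axis[of i]
    by (intro exI[of _ "\<lambda>x. x $ i"] exI[of _ "\<lambda>_. 0"]) auto
  then have "\<exists>v\<in>L. f v v v \<noteq> 0" using assms(1) by blast
  then show thesis using that by blast
qed

lemma multiple_of_form:
  assumes "vec.subspace L" "\<not> linear_factor_on L" "v \<in> L" "v \<noteq> 0"
    and "polyfun g" "\<And>v. v \<in> L \<Longrightarrow> f v v v = 0 \<Longrightarrow> g v = 0"
  obtains q where "polyfun q" "\<And>v. v \<in> L \<Longrightarrow> g v = q v * f v v v"
  using exists_nonzero_if_no_linear_factor[OF assms(2-4)]
    division_on_zero_set[OF assms(1) _ _ assms(2,5,6)] by metis

lemma irr_zero_set:
  assumes L: "vec.subspace L" and nf: "\<not> linear_factor_on L" and v: "v \<in> L" "v \<noteq> 0"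
  shows "irr (L \<inter> Yh)"
proof -
  obtain e where e: "e \<in> L" "f e e e \<noteq> 0" using exists_nonzero_if_no_linear_factor[OF nf v] .
  have "irr (zcl (L \<inter> Yh))"
  proof (rule irr_zclI)
    have "0 \<in> L \<inter> Yh" using vec.subspace_0[OF L] by (simp add: Yh_def f_simps)
    then show "L \<inter> Yh \<noteq> {}" by blast
    fix g h assume "polyfun g" "polyfun h" "\<And>a. a \<in> L \<inter> Yh \<Longrightarrow> g a * h a = 0"
    then show "(\<forall>a\<in>L \<inter> Yh. g a = 0) \<or> (\<forall>a\<in>L \<inter> Yh. h a = 0)"
      by (intro prime_on_zero_set[OF L e nf]) (auto simp: Yh_def)
  qed
  moreover have "closedin zariski (L \<inter> Yh)"
    using closedin_subspace[OF L] closedin_Yh by blast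
  ultimately show ?thesis by (simp add: closedin_zariski_iff)
qed

end

section \<open>Long chains in subspaces and in cubic cones\<close>

lemma has_chain_subspace:
  assumes "vec.subspace U"
  shows "has_chain U (vec.dim U)"
  using assms
proof (induction "vec.dim U" arbitrary: U)
  case 0
  then have "vec.dim U = 0" by simp
  then show ?case using has_chain_0[OF irr_subspace[OF 0(2)]] by (simp only:)
next
  case (Suc d)
  then obtain v where v: "v \<in> U" "v \<noteq> 0"
    using vec.dim_eq_0[of U] by (metis insertCI nat.distinct(1) subsetI)
  then obtain i where i: "v $ i \<noteq> 0" by (auto simp: vec_eq_iff)
  let ?V = "{u \<in> U. u $ i = 0}"
  have V: "vec.subspace ?V" using subspace_lfun_eq_0[OF Suc.prems, of "{\<lambda>x. x $ i}"] lfun_axis[of i] by simp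
  have "vec.dim U = vec.dim ?V + 1"
    using dim_subspace_lker[OF Suc.prems lfun_axis v(1), of i] i by simp
  then have "has_chain ?V d" using Suc V by simp
  then have "has_chain U (Suc d)"
    by (rule has_chain_Suc) (use v i irr_subspace[OF Suc.prems] in auto)
  then show ?case using Suc by simp
qed

text \<open>Each cut with a coordinate hyperplane costs one dimension. If the restricted form has a
  linear factor, the zero set contains a hyperplane, and chains of subspaces suffice. Otherwise it
  is irreducible and not inside the coordinate hyperplane, since a linear form is no multiple of a
  cubic.\<close>

lemma (in cubic) has_chain_zero_set:
  assumes "vec.subspace L" "vec.dim L = Suc d"
  shows "has_chain (L \<inter> Yh) d"
  using assms
proof (induction d arbitrary: L)
  case 0
  have "{0} \<subseteq> L \<inter> Yh" using vec.subspace_0[OF 0(1)] by (simp add: Yh_def f_simps)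
  then show ?case
    using has_chain_mono[OF has_chain_0[OF irr_subspace[of "{0}"]]] by auto
next
  case (Suc d)
  have V: "vec.subspace {u \<in> L. l u = 0}" if "lfun l" for l
    using subspace_lfun_eq_0[OF Suc.prems(1), of "{l}"] that by simp
  obtain v where v: "v \<in> L" "v \<noteq> 0"
    using vec.dim_eq_0[of L] Suc.prems by (metis insertCI nat.distinct(1) subsetI)
  show ?case
  proof (cases "linear_factor_on L")
    case True
    then obtain l g u where l: "lfun l" "u \<in> L" "l u \<noteq> 0" "\<And>v. v \<in> L \<Longrightarrow> f v v v = l v * g v"
      unfolding linear_factor_on_def by blast
    have "vec.dim {u \<in> L. l u = 0} = Suc d"
      using dim_subspace_lker[OF Suc.prems(1) l(1-3)] Suc.prems(2) by simp
    then have "has_chain {u \<in> L. l u = 0} (Suc d)" using has_chain_subspace[OF V[OF l(1)]] by simp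
    then show ?thesis by (rule has_chain_mono) (use l(4) in \<open>auto simp: Yh_def\<close>)
  next
    case False
    obtain i where i: "v $ i \<noteq> 0" using v by (auto simp: vec_eq_iff)
    let ?V = "{u \<in> L. u $ i = 0}"
    have "vec.dim ?V = Suc d"
      using dim_subspace_lker[OF Suc.prems(1) lfun_axis v(1), of i] i Suc.prems(2) by simp
    then have chain: "has_chain (?V \<inter> Yh) d" using Suc.IH[OF V[OF lfun_axis]] by simp
    have "\<exists>u\<in>L \<inter> Yh. u $ i \<noteq> 0"
    proof (rule ccontr)
      assume "\<not> ?thesis"
      then have "\<And>u. u \<in> L \<Longrightarrow> f u u u = 0 \<Longrightarrow> u $ i = 0" by (auto simp: Yh_def)
      then obtain q where "polyfun q" "\<And>u. u \<in> L \<Longrightarrow> u $ i = q u * f u u u"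
        using multiple_of_form[OF Suc.prems(1) False v polyfun_coord] by metis
      then have "v $ i = 0"
        by (intro homogeneous_multiple_eq_0[OF Suc.prems(1), of q 1 "\<lambda>u. u $ i"]) (use v in auto)
      then show False using i by simp
    qed
    then have "?V \<inter> Yh \<subset> L \<inter> Yh" by blast
    then show ?thesis using has_chain_Suc[OF chain] irr_zero_set[OF Suc.prems(1) False v] by blast
  qed
qed

section \<open>Prolongations of a cubic form\<close>

context cubic
begin

lemma polarization:
  assumes "\<And>x. f x x x = 0"
  shows "f x y z = 0"
proof -
  have xxy: "f x x y = 0" for x y
  proof -
    have "f (x + y) (x + y) (x + y) = f x x x + 3 * f x x y + 3 * f x y y + f y y y"
      by (simp add: f_simps f_ac)
    moreover have "f (x - y) (x - y) (x - y) = f x x x - 3 * f x x y + 3 * f x y y - f y y y"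
      by (simp add: f_simps f_ac)
    ultimately show ?thesis using assms[of "x + y"] assms[of "x - y"] assms[of x] assms[of y] by algebra
  qed
  have "f (x + y) (x + y) z = f x x z + 2 * f x y z + f y y z"
    by (simp add: f_simps f_ac)
  then show ?thesis using xxy by simp
qed

text \<open>Membership in \<open>aut1 Yh\<close> says that \<open>f x x (A w x)\<close> vanishes on
  the cubic; \<open>l w\<close> is the quotient by the form, which is constant in \<open>x\<close>
  by degrees.\<close>

definition prol :: "(complex ^ 'n \<Rightarrow> complex ^ 'n \<Rightarrow> complex ^ 'n) \<Rightarrow> (complex ^ 'n \<Rightarrow> complex) \<Rightarrow> bool" where
  "prol A l \<longleftrightarrow> (\<forall>w. lmap (A w)) \<and> (\<forall>u w. A u w = A w u) \<and> lfun l \<and>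
     (\<forall>w x. f x x (A w x) = l w * f x x x)"

definition hess :: "complex ^ 'n \<Rightarrow> complex" where
  "hess v = det (\<chi> i j. f v (axis i 1) (axis j 1))"

lemma polyfun_hess: "polyfun hess"
  unfolding hess_def[abs_def] by (rule polyfun_cramer) (simp add: lfun_polyfun[OF lin])

lemma hess_nondegenerate:
  assumes "hess v \<noteq> 0" "\<And>w. f v u w = 0"
  shows "u = 0"
proof -
  let ?A = "\<chi> i j. f v (axis i 1) (axis j 1)"
  have "(?A *v u) $ i = 0" for i
    using assms(2)[of "axis i 1"] lfun_expand[OF lin3, of v "axis i 1" u]
    by (simp add: matrix_vector_mult_def mult.commute sym23[of v u])
  then have "?A *v u = 0" by (simp add: vec_eq_iff)
  moreover have "invertible ?A" using assms(1) by (simp add: hess_def invertible_det_nz)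
  ultimately show ?thesis
    by (metis invertible_def matrix_vector_mul_assoc matrix_vector_mul_lid matrix_vector_mult_0_right)
qed

end

locale nondegenerate_cubic = cubic f
  for f :: "complex ^ 'n::finite \<Rightarrow> complex ^ 'n \<Rightarrow> complex ^ 'n \<Rightarrow> complex" +
  assumes hessian_nonzero: "\<exists>v. hess v \<noteq> 0"
    and no_linear_factor: "\<not> linear_factor_on UNIV"
begin

lemma dense:
  assumes "polyfun g" "\<And>v. hess v \<noteq> 0 \<Longrightarrow> g v = 0"
  shows "g v = 0"
  using polyfun_eq_0_dense[OF vec.subspace_UNIV assms(1) polyfun_hess] hessian_nonzero assms(2) by blast

lemma f_nondegenerate:
  assumes "\<And>v w. f u v w = 0"
  shows "u = 0"
  using hessian_nonzero hess_nondegenerate[of _ u] assms sym12 by metis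

lemma no_factor: "lfun l \<Longrightarrow> polyfun g \<Longrightarrow> (\<And>v. f v v v = l v * g v) \<Longrightarrow> l v = 0"
  using no_linear_factor unfolding linear_factor_on_def by blast

end

section \<open>Identities for a prolongation and its quadratic map\<close>

locale prolonged_cubic = nondegenerate_cubic f
  for f :: "complex ^ 'n::finite \<Rightarrow> complex ^ 'n \<Rightarrow> complex ^ 'n \<Rightarrow> complex" +
  fixes A :: "complex ^ 'n \<Rightarrow> complex ^ 'n \<Rightarrow> complex ^ 'n" and l :: "complex ^ 'n \<Rightarrow> complex"
  assumes prol: "prol A l"
begin

lemma lmap_A: "lmap (A w)" and A_sym: "A u w = A w u" and lfun_l: "lfun l"
  and f_A: "f x x (A w x) = l w * f x x x"
  using prol by (auto simp: prol_def)

lemma lmap_A': "lmap (\<lambda>u. A u w)"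
proof -
  have "(\<lambda>u. A u w) = A w" using A_sym by blast
  then show ?thesis using lmap_A by simp
qed

lemmas A_simps = lmap_add[OF lmap_A] lmap_scale[OF lmap_A] lmap_0[OF lmap_A] lmap_minus[OF lmap_A] lmap_diff[OF lmap_A]
  lmap_add[OF lmap_A'] lmap_scale[OF lmap_A'] lmap_0[OF lmap_A'] lmap_minus[OF lmap_A'] lmap_diff[OF lmap_A']

lemmas l_simps = lfun_add[OF lfun_l] lfun_scale[OF lfun_l] lfun_0[OF lfun_l] lfun_minus[OF lfun_l] lfun_diff[OF lfun_l]

lemma polymap_A: "polymap g \<Longrightarrow> polymap h \<Longrightarrow> polymap (\<lambda>x. A (g x) (h x))"
proof -
  assume gh: "polymap g" "polymap h"
  have "A (g x) (h x) = (\<Sum>i\<in>UNIV. g x $ i *s A (axis i 1) (h x))" for x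
    using lmap_sum[OF lmap_A', of "\<lambda>i. g x $ i *s axis i 1" UNIV "h x"] basis_expansion[of "g x"]
    by (simp add: A_simps)
  moreover have "polymap (\<lambda>x. A (axis i 1) (h x))" for i
    using polymap_comp[OF lmap_polymap[OF lmap_A] gh(2)] .
  ultimately show ?thesis using gh by simp
qed

lemma polyfun_l: "polymap g \<Longrightarrow> polyfun (\<lambda>x. l (g x))"
  using polyfun_comp[OF lfun_polyfun[OF lfun_l]] .

lemma f_A_polarized: "f (A w x) y z + f x (A w y) z + f x y (A w z) = 3 * l w * f x y z"
proof -
  define G where "G x y z = f (A w x) y z + f x (A w y) z + f x y (A w z) - 3 * l w * f x y z" for x y z
  interpret G: cubic G
  proof
    show "lfun (\<lambda>u. G u v z)" for v z
      unfolding lfun_def G_def by (simp add: A_simps f_simps algebra_simps)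
    show "G u v z = G v u z" "G u v z = G u z v" for u v z
      unfolding G_def by (simp_all add: f_ac algebra_simps)
  qed
  have "G x x x = 0" for x
    using f_A[of x w] unfolding G_def by (simp add: f_ac)
  from G.polarization[OF this, of x y z] show ?thesis by (simp add: G_def)
qed

text \<open>The polarized identities at \<open>x\<close>, \<open>u\<close>, \<open>w\<close> involve
  \<open>f (A x u) x w\<close>, \<open>f (A x w) x u\<close> and \<open>f (A u w) x x\<close>; this
  combination eliminates the last two.\<close>

lemma f_A_vv: "f (A x x) u w + 2 * f (A x u) x w =
   3 * l x * f x u w + 3 / 2 * l u * f x x w - 3 / 2 * l w * f x x u"
proof -
  have 1: "f (A x x) u w + f (A x u) x w + f (A x w) x u = 3 * l x * f x u w"
    using f_A_polarized[of x x u w] by (simp add: f_ac)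
  have 2: "2 * f (A x u) x w + f (A u w) x x = 3 * l u * f x x w"
    using f_A_polarized[of u x x w] by (simp add: f_ac A_sym[of u x])
  have 3: "2 * f (A x w) x u + f (A u w) x x = 3 * l w * f x x u"
    using f_A_polarized[of w x x u] by (simp add: f_ac A_sym[of w x] A_sym[of w u])
  show ?thesis using 1 2 3 by algebra
qed

text \<open>By \<open>f_q\<close>, where the Hessian is nonzero, \<open>q x\<close> is
  \<open>f x x x\<close> times the vector representing \<open>l\<close> under the bilinear form
  \<open>f x\<close>. The prolongation is what makes this vector depend quadratically on
  \<open>x\<close>.\<close>

definition q :: "complex ^ 'n \<Rightarrow> complex ^ 'n" where
  "q x = (3 * l x) *s x - 2 *s A x x"

definition q2 :: "complex ^ 'n \<Rightarrow> complex ^ 'n \<Rightarrow> complex ^ 'n" where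
  "q2 x u = (3 * l x) *s u + (3 * l u) *s x - 4 *s A x u"

lemma polymap_q: "polymap q"
  unfolding q_def[abs_def]
  by (intro polymap_diff polymap_scale polyfun_mult polyfun_const polyfun_l polymap_id polymap_A)

lemma f_q: "f (q x) x w = l w * f x x x"
proof -
  have "f (A x x) x w + 2 * f (A x x) x w = 3 * l x * f x x w + 3 / 2 * l x * f x x w - 3 / 2 * l w * f x x x"
    using f_A_vv[of x x w] .
  moreover have "f (q x) x w = 3 * l x * f x x w - 2 * f (A x x) x w"
    by (simp add: q_def f_simps)
  ultimately show ?thesis by algebra
qed

lemma f_q2: "f (q2 x u) x w + f (q x) u w = 3 * l w * f x x u"
proof -
  have "f (q2 x u) x w + f (q x) u w = 3 * l x * f u x w + 3 * l u * f x x w - 4 * f (A x u) x w +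
      3 * l x * f x u w - 2 * f (A x x) u w"
    by (simp add: q_def q2_def f_simps)
  then show ?thesis using f_A_vv[of x u w] sym12[of u x w] by algebra
qed

lemma q_add: "q (x + u) = q x + q2 x u + q u"
  by (simp add: q_def q2_def vec_eq_iff l_simps A_simps A_sym[of u x] algebra_simps)

text \<open>With \<open>l = 0\<close>, \<open>f_A_vv\<close> at \<open>u = x\<close> reads
  \<open>f (A x x) x w = 0\<close>, and nondegeneracy kills \<open>A x x\<close> at a general
  point.\<close>

lemma A_eq_0_if_l_eq_0:
  assumes "\<And>w. l w = 0"
  shows "A x y = 0"
proof -
  have Axx: "A x x = 0" for x
  proof -
    have "A x x $ i = 0" for i
    proof (rule dense[of "\<lambda>x. A x x $ i"])
      show "polyfun (\<lambda>x. A x x $ i)" by (intro polyfun_nth polymap_A polymap_id)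
      fix v assume v: "hess v \<noteq> 0"
      have "f v (A v v) w = 0" for w
        using f_A_vv[of v v w] assms by (simp add: f_ac)
      then show "A v v $ i = 0" using hess_nondegenerate[OF v, of "A v v"] by simp
    qed
    then show ?thesis by (simp add: vec_eq_iff)
  qed
  have "A (x + y) (x + y) = A x x + 2 *s A x y + A y y"
    by (simp add: A_simps A_sym[of y x] vec_eq_iff)
  then show ?thesis using Axx by (simp add: vec.scale_eq_0_iff)
qed

text \<open>If \<open>l\<close> vanishes on the image of \<open>q\<close>, then \<open>q\<close> takes values in the kernel of \<open>A\<close>, and the
  eigenspaces of \<open>A e\<close> for a fixed point \<open>e\<close> show that \<open>l\<close> divides the cubic form.\<close>

lemma l_q_nonzero:
  assumes nz: "l w0 \<noteq> 0"
  shows "\<exists>v. l (q v) \<noteq> 0"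
proof (rule ccontr)
  assume "\<not> ?thesis"
  then have lq: "l (q v) = 0" for v by simp
  have lq2: "l (q2 x u) = 0" for x u
    using lq[of "x + u"] lq[of x] lq[of u] by (simp add: q_add l_simps)
  have lA: "l (A x u) = 3 / 2 * l x * l u" for x u
  proof -
    have "3 * l x * l u + 3 * l u * l x - 4 * l (A x u) = 0"
      using lq2[of x u] by (simp add: q2_def l_simps)
    then show ?thesis by algebra
  qed
  \<comment> \<open>Proved by contracting with \<open>f v\<close> at a general \<open>v\<close>; the
    terms cancel because \<open>lA\<close> expresses \<open>l\<close> on values of \<open>A\<close>
    through products of values of \<open>l\<close>.\<close>
  have J: "2 *s A x (A x w) = A w (A x x) + (3 / 2 * l w) *s A x x" for x w
  proof -
    define D where "D x = 2 *s A x (A x w) - A w (A x x) - (3 / 2 * l w) *s A x x" for x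
    have pD: "polymap D"
      unfolding D_def[abs_def] by (intro polymap_diff polymap_scale polyfun_const polymap_A polymap_id polymap_const)
    have "D x $ i = 0" for x i
    proof (rule dense[of "\<lambda>x. D x $ i"])
      show "polyfun (\<lambda>x. D x $ i)" using pD by blast
      fix v assume v: "hess v \<noteq> 0"
      have "f v (D v) w' = 0" for w'
      proof -
        have e: "- 2 * f (D v) v w' = f (q2 v (A w v)) v w' - f (A w (q v)) v w' - 3 / 2 * l w * f (q v) v w'"
          by (simp add: D_def q_def q2_def f_simps A_simps lA A_sym[of w v] algebra_simps)
        have "f (q2 v (A w v)) v w' = 3 * l w' * (l w * f v v v) - f (q v) (A w v) w'"
          using f_q2[of v "A w v" w'] f_A[of v w] by (simp add: algebra_simps)
        moreover have "f (A w (q v)) v w' = 3 * l w * (l w' * f v v v) - f (q v) (A w v) w' - l (A w w') * f v v v"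
          using f_A_polarized[of w "q v" v w'] by (simp add: f_q algebra_simps)
        moreover have "f (q v) v w' = l w' * f v v v" by (rule f_q)
        ultimately have "- 2 * f (D v) v w' = 0" using e lA[of w w'] by algebra
        then show ?thesis using sym12 by simp
      qed
      then show "D v $ i = 0" using hess_nondegenerate[OF v, of "D v"] by simp
    qed
    then have "D x = 0" by (simp add: vec_eq_iff)
    then show ?thesis by (simp add: D_def vec_eq_iff algebra_simps)
  qed
  have J2: "A x (A y w) = (3 / 4 * l w) *s A x y + (3 / 4 * l y) *s A x w" for x y w
  proof -
    have J': "2 *s A x (A y w) + 2 *s A y (A x w) = 2 *s A w (A x y) + (3 * l w) *s A x y" for x y w
    proof -
      have "2 *s A (x + y) (A (x + y) w) = A w (A (x + y) (x + y)) + (3 / 2 * l w) *s A (x + y) (x + y)"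
        by (rule J)
      moreover have "2 *s A (x + y) (A (x + y) w) =
          2 *s A x (A x w) + 2 *s A x (A y w) + 2 *s A y (A x w) + 2 *s A y (A y w)"
        by (simp add: A_simps vec.scale_right_distrib)
      moreover have xy: "A (x + y) (x + y) = A x x + 2 *s A x y + A y y"
        by (simp add: A_simps A_sym[of y x] vec_eq_iff)
      have "A w (A (x + y) (x + y)) = A w (A x x) + 2 *s A w (A x y) + A w (A y y)"
        unfolding xy by (simp add: lmap_add[OF lmap_A] lmap_scale[OF lmap_A])
      ultimately show ?thesis
        using J[of x w] J[of y w] unfolding xy
        by (simp add: vec_eq_iff algebra_simps)
    qed
    show ?thesis
    proof (subst vec_eq_iff, intro allI)
      fix i
      have 1: "2 * A x (A y w) $ i + 2 * A y (A x w) $ i = 2 * A w (A x y) $ i + 3 * l w * A x y $ i"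
        using J'[of x y w] by (simp add: vec_eq_iff)
      have 2: "2 * A x (A y w) $ i + 2 * A w (A x y) $ i = 2 * A y (A x w) $ i + 3 * l y * A x w $ i"
        using J'[of x w y] by (simp add: vec_eq_iff A_sym[of w y])
      have "4 * A x (A y w) $ i = 3 * l w * A x y $ i + 3 * l y * A x w $ i" using 1 2 by algebra
      then show "A x (A y w) $ i = ((3 / 4 * l w) *s A x y + (3 / 4 * l y) *s A x w) $ i"
        by (simp add: field_simps)
    qed
  qed
  have Aq: "A x (q y) = 0" for x y
    using J2[of x y y] by (simp add: q_def A_simps vec_eq_iff algebra_simps)
  define e0 where "e0 = (1 / l w0) *s w0"
  have e0: "l e0 = 1" using nz by (simp add: e0_def l_simps)
  define e where "e = e0 - (1 / 3) *s q e0"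
  have le: "l e = 1" using e0 lq by (simp add: e_def l_simps)
  define M where "M = A e"
  have M: "M x = A e0 x" for x using Aq[of x e0] A_sym[of x] by (simp add: M_def e_def A_simps)
  have MM: "M (M h) = (3 / 4) *s M h" if "l h = 0" for h
    using J2[of e e h] le that by (simp add: M_def)
  \<comment> \<open>\<open>f\<close> can be nonzero on eigenvectors of \<open>M\<close> only if the
    eigenvalues add up to \<open>3 * l e = 3\<close>. On the kernel of \<open>l\<close> the
    components have eigenvalues 3/4 and 0, and three of these stay below 3; hence the form vanishes
    there and \<open>l\<close> divides it.\<close>
  have weight: "(a + b + c - 3) * f x y z = 0" if "M x = a *s x" "M y = b *s y" "M z = c *s z" for a b c x y z
    using f_A_polarized[of e x y z] that le by (simp add: M_def f_simps algebra_simps)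
  have fh: "f h h h = 0" if lh: "l h = 0" for h
  proof -
    define h1 where "h1 = (4 / 3) *s M h"
    define h0 where "h0 = h - h1"
    have h1: "M h1 = (3 / 4) *s h1" using MM[OF lh] by (simp add: h1_def M_def A_simps)
    have h0: "M h0 = 0 *s h0" using MM[OF lh] by (simp add: h0_def h1_def M_def A_simps)
    have h: "h = h1 + h0" by (simp add: h0_def)
    have "f h1 h1 h1 = 0" "f h1 h1 h0 = 0" "f h1 h0 h0 = 0" "f h0 h0 h0 = 0"
      using weight[OF h1 h1 h1] weight[OF h1 h1 h0] weight[OF h1 h0 h0] weight[OF h0 h0 h0] by auto
    then show ?thesis by (simp add: h f_simps f_ac)
  qed
  define g where "g v = 3 * f e (v - l v *s e) (v - l v *s e) + 3 * l v * f e e (v - l v *s e) + l v ^ 2 * f e e e" for v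
  have pg: "polyfun g"
    unfolding g_def[abs_def]
    by (intro polyfun_add polyfun_mult polyfun_power polyfun_const polyfun_f polyfun_l polymap_id polymap_const
        polymap_diff polymap_scale)
  have "f v v v = l v * g v" for v
  proof -
    define h where "h = v - l v *s e"
    have "l h = 0" by (simp add: h_def l_simps le)
    then have "f h h h = 0" by (rule fh)
    moreover have v: "v = h + l v *s e" by (simp add: h_def)
    have "f (h + t *s e) (h + t *s e) (h + t *s e) = f h h h + t * (3 * f e h h + 3 * t * f e e h + t ^ 2 * f e e e)" for t
      by (simp add: f_simps f_ac algebra_simps power2_eq_square)
    then have "f v v v = f h h h + l v * (3 * f e h h + 3 * l v * f e e h + l v ^ 2 * f e e e)"
      using v by metis
    ultimately show ?thesis by (simp add: g_def h_def)
  qed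
  then have "l w0 = 0" using no_factor[OF lfun_l pg] by blast
  then show False using nz by simp
qed

text \<open>For \<open>v\<close> on the cubic, \<open>f (q v) v\<close> vanishes and
  \<open>f (q v) (q v)\<close> is \<open>3 l (q v)\<close> times \<open>f v v\<close>. So
  \<open>v + s q v\<close> is singular for two opposite values of \<open>s\<close>, and
  \<open>l\<close> cannot vanish at both points.\<close>

lemma exists_singular_idempotent:
  assumes nz: "l w0 \<noteq> 0"
  obtains c where "l c = 1" "\<And>w. f c c w = 0"
proof -
  have "\<exists>v. f v v v = 0 \<and> l (q v) \<noteq> 0"
  \<comment> \<open>Otherwise the quadratic form \<open>l (q v)\<close> vanishes on the cubic and is
    a multiple of it, hence zero by degree.\<close>
  proof (rule ccontr)
    assume "\<not> ?thesis"
    then have *: "\<And>v. v \<in> UNIV \<Longrightarrow> f v v v = 0 \<Longrightarrow> l (q v) = 0" by blast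
    have "w0 \<noteq> 0" using nz l_simps by auto
    then obtain g where "polyfun g" "\<And>v. v \<in> UNIV \<Longrightarrow> l (q v) = g v * f v v v"
      using multiple_of_form[OF vec.subspace_UNIV no_linear_factor UNIV_I _ polyfun_l[OF polymap_q] *] by metis
    then have "l (q v) = 0" for v
      by (intro homogeneous_multiple_eq_0[OF vec.subspace_UNIV, of g 2 "\<lambda>v. l (q v)"])
         (auto simp: q_def l_simps A_simps power2_eq_square algebra_simps)
    then show False using l_q_nonzero[OF nz] by blast
  qed
  then obtain v where v: "f v v v = 0" "l (q v) \<noteq> 0" by blast
  have qv: "f (q v) v w = 0" for w using f_q[of v w] v by simp
  have qq: "f (q v) (q v) w = 3 * l (q v) * f v v w" for w
  proof -
    have 1: "f (q2 v (q v)) v w + f (q v) (q v) w = 0"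
      using f_q2[of v "q v" w] qv[of v] by (simp add: f_ac)
    have 2: "f (q2 v (q v)) v w = 3 * l v * f (q v) v w + 3 * l (q v) * f v v w - 4 * f (A v (q v)) v w"
      by (simp add: q2_def f_simps)
    have 3: "f (A v (q v)) v w + f (q v) (A v v) w = 0"
      using f_A_polarized[of v "q v" v w] qv by simp
    have 4: "f (q v) (q v) w = 3 * l v * f (q v) v w - 2 * f (q v) (A v v) w"
      by (subst (2) q_def) (simp add: f_simps)
    show ?thesis using 1 2 3 4 qv[of w] by algebra
  qed
  define t where "t = csqrt (- 1 / (3 * l (q v)))"
  have t2: "t ^ 2 * (3 * l (q v)) = - 1" using v by (simp add: t_def)
  then have t0: "t \<noteq> 0" by auto
  have sing: "f (v + s *s q v) (v + s *s q v) w = 0" if "s ^ 2 = t ^ 2" for s w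
  proof -
    have "f (v + s *s q v) (v + s *s q v) w = f v v w + 2 * s * f (q v) v w + s ^ 2 * f (q v) (q v) w"
      by (simp add: f_simps f_ac algebra_simps power2_eq_square)
    also have "\<dots> = f v v w * (1 + t ^ 2 * (3 * l (q v)))" using qv qq that by (simp add: algebra_simps)
    finally show ?thesis using t2 by simp
  qed
  have "l (v + t *s q v) - l (v + (- t) *s q v) = 2 * t * l (q v)"
    by (simp add: l_simps algebra_simps)
  then have "l (v + t *s q v) \<noteq> 0 \<or> l (v + (- t) *s q v) \<noteq> 0" using t0 v by auto
  then obtain a where a: "l a \<noteq> 0" "\<And>w. f a a w = 0" using sing[of t] sing[of "- t"] by auto
  show thesis
    by (rule that[of "(1 / l a) *s a"]) (use a in \<open>simp_all add: l_simps f_simps\<close>)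
qed

text \<open>The polarized identity at \<open>v\<close>, \<open>v\<close>, \<open>u\<close> gives
  \<open>f (A w v) v u = 0\<close>. Inserted into the identity at \<open>v\<close>,
  \<open>x\<close>, \<open>x\<close>, this puts \<open>A v v - 3 l(v) v\<close> into the radical of
  \<open>f\<close>.\<close>

lemma A_singular:
  assumes "\<And>w. f v v w = 0"
  shows "A v v = (3 * l v) *s v"
proof -
  have 1: "f (A w v) v u = 0" for w u
    using f_A_polarized[of w v v u] assms sym12 sym23 by (simp add: f_ac)
  define G where "G x y z = 0" for x y z :: "complex ^ 'n"
  have xx: "f (A v v - (3 * l v) *s v) x x = 0" for x
  proof -
    have "f (A v v) x x + 2 * f (A v x) v x = 3 * l v * f v x x"
      using f_A_polarized[of v v x x] by (simp add: f_ac add_ac)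
    moreover have "f (A v x) v x = 0" using 1[of x x] by (simp add: A_sym)
    ultimately show ?thesis by (simp add: f_simps)
  qed
  have "f (A v v - (3 * l v) *s v) x y = 0" for x y
  proof -
    let ?d = "A v v - (3 * l v) *s v"
    have "f ?d (x + y) (x + y) = f ?d x x + 2 * f ?d x y + f ?d y y"
      by (simp only: f_simps) (simp add: sym23[of _ y x])
    then show ?thesis using xx[of "x + y"] xx[of x] xx[of y] by simp
  qed
  then have "A v v - (3 * l v) *s v = 0" by (rule f_nondegenerate)
  then show ?thesis by simp
qed

text \<open>Infinitesimal symmetries act on prolongations: this is the derivative of
  \<open>A\<close> along the flow of \<open>A w\<close>, and the linear form is differentiated
  accordingly.\<close>

lemma prol_bracket: "prol (\<lambda>x y. A w (A x y) - A (A w x) y - A x (A w y)) (\<lambda>x. - l (A w x))"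
  unfolding prol_def
proof (intro conjI allI)
  show "lmap (\<lambda>y. A w (A x y) - A (A w x) y - A x (A w y))" for x
    unfolding lmap_def by (auto simp: A_simps vec_eq_iff algebra_simps)
  show "A w (A u v) - A (A w u) v - A u (A w v) = A w (A v u) - A (A w v) u - A v (A w u)" for u v
    using A_sym[of u v] A_sym[of "A w u" v] A_sym[of "A w v" u] by (simp add: algebra_simps)
  show "lfun (\<lambda>x. - l (A w x))" unfolding lfun_def by (simp add: A_simps l_simps algebra_simps)
  fix u x
  have 1: "f (A w (A u x)) x x + 2 * f (A u x) (A w x) x = 3 * l w * f (A u x) x x"
    using f_A_polarized[of w "A u x" x x] by (simp add: f_ac add_ac)
  have 2: "f (A u (A w x)) x x + 2 * f (A u x) (A w x) x = 3 * l u * f (A w x) x x"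
    using f_A_polarized[of u "A w x" x x] by (simp add: f_ac add_ac)
  have 3: "f (A u x) x x = l u * f x x x" "f (A w x) x x = l w * f x x x"
     "f (A (A w u) x) x x = l (A w u) * f x x x"
    using f_A[of x] by (simp_all add: f_ac)
  have "f x x (A w (A u x) - A (A w u) x - A u (A w x)) =
      f (A w (A u x)) x x - f (A (A w u) x) x x - f (A u (A w x)) x x"
    by (simp add: f_simps f_ac)
  then show "f x x (A w (A u x) - A (A w u) x - A u (A w x)) = - l (A w u) * f x x x"
    using 1 2 3 by algebra
qed

text \<open>This is \<open>A_singular\<close> for the prolongation bracketed with
  \<open>A w\<close>.\<close>

lemma A_A_singular:
  assumes v: "\<And>w. f v v w = 0"
  shows "A v (A v w) = (3 / 2) *s (l v *s A v w + l (A v w) *s v)"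
proof -
  interpret B: prolonged_cubic f "\<lambda>x y. A w (A x y) - A (A w x) y - A x (A w y)" "\<lambda>x. - l (A w x)"
    by unfold_locales (rule prol_bracket)
  have "A w (A v v) - A (A w v) v - A v (A w v) = (3 * - l (A w v)) *s v"
    by (rule B.A_singular[OF v])
  then have "(3 * l v) *s A w v - 2 *s A v (A w v) = (- 3 * l (A w v)) *s v"
    by (simp add: A_singular[OF v] A_simps A_sym[of "A w v" v] vec_eq_iff)
  then have "2 *s A v (A v w) = 3 *s (l v *s A v w + l (A v w) *s v)"
    by (simp add: A_sym[of w v] vec_eq_iff algebra_simps)
  then show ?thesis by (simp add: vec_eq_iff field_simps)
qed

end

text \<open>The difference is a prolongation with linear form zero.\<close>

lemma (in nondegenerate_cubic) prol_unique:
  assumes "prol A l" "prol B l"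
  shows "A x y = B x y"
proof -
  interpret A: prolonged_cubic f A l by unfold_locales (rule assms(1))
  interpret B: prolonged_cubic f B l by unfold_locales (rule assms(2))
  have "prol (\<lambda>x y. A x y - B x y) (\<lambda>x. 0)"
    unfolding prol_def lmap_def
    by (auto simp: A.A_simps B.A_simps f_simps A.f_A B.f_A algebra_simps vec_eq_iff A.A_sym B.A_sym)
  then interpret D: prolonged_cubic f "\<lambda>x y. A x y - B x y" "\<lambda>x. 0" by unfold_locales
  show ?thesis using D.A_eq_0_if_l_eq_0[of x y] by simp
qed

section \<open>The normal form\<close>

text \<open>The space is \<open>\<complex>c \<oplus> W\<^sub>1 \<oplus> W\<^sub>0\<close>, the form is \<open>\<tau>(v) Q(v, v) - 2 Q(b(v, v), v)\<close>, where \<open>Q\<close> is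
  a quadratic form on \<open>W\<^sub>0\<close> and \<open>b\<close> maps \<open>W\<^sub>1\<close> quadratically into the isotropic cone of \<open>Q\<close>.\<close>

locale normal_form = nondegenerate_cubic f
  for f :: "complex ^ 'n::finite \<Rightarrow> complex ^ 'n \<Rightarrow> complex ^ 'n \<Rightarrow> complex" +
  fixes \<tau> :: "complex ^ 'n \<Rightarrow> complex" and c :: "complex ^ 'n"
    and P1 P0 :: "complex ^ 'n \<Rightarrow> complex ^ 'n"
    and b :: "complex ^ 'n \<Rightarrow> complex ^ 'n \<Rightarrow> complex ^ 'n"
    and Q :: "complex ^ 'n \<Rightarrow> complex ^ 'n \<Rightarrow> complex"
  assumes lfun_\<tau>: "lfun \<tau>" and lmap_P1: "lmap P1" and lmap_P0: "lmap P0"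
    and decomp: "v = \<tau> v *s c + P1 v + P0 v"
    and \<tau>_c [simp]: "\<tau> c = 1" and P1_c [simp]: "P1 c = 0" and P0_c [simp]: "P0 c = 0"
    and P1_P1 [simp]: "P1 (P1 v) = P1 v" and P0_P1 [simp]: "P0 (P1 v) = 0" and \<tau>_P1 [simp]: "\<tau> (P1 v) = 0"
    and P1_P0 [simp]: "P1 (P0 v) = 0" and P0_P0 [simp]: "P0 (P0 v) = P0 v" and \<tau>_P0 [simp]: "\<tau> (P0 v) = 0"
    and lmap_b: "lmap (b u)" and b_sym: "b u v = b v u" and b_P1: "b u (P1 v) = b u v"
    and P0_b [simp]: "P0 (b u v) = b u v"
    and lfun_Q: "lfun (Q u)" and Q_sym: "Q u v = Q v u" and Q_P0: "Q u (P0 v) = Q u v"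
    and Q_nondegenerate: "(\<And>w. Q u w = 0) \<Longrightarrow> P0 u = 0"
    and Q_b_b: "Q (b x u) (b v w) + Q (b x v) (b u w) + Q (b x w) (b u v) = 0"
    and f_normal: "3 * f u v w = \<tau> u * Q v w + \<tau> v * Q u w + \<tau> w * Q u v -
      2 * (Q (b u v) w + Q (b u w) v + Q (b v w) u)"

lemma (in cubic) prol_scale: "prol A l \<Longrightarrow> prol (\<lambda>x y. k *s A x y) (\<lambda>x. k * l x)"
  unfolding prol_def lmap_def lfun_def
  by (simp add: f_simps vec.scale_right_distrib vec.scale_left_commute algebra_simps)

context prolonged_cubic
begin

text \<open>By \<open>A_A_singular\<close> the operator \<open>M = A c\<close> has eigenvalue 3 on
  \<open>c\<close> and satisfies \<open>M (M - 3/2) = 0\<close> on the kernel of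
  \<open>\<tau>\<close>. Everything else follows by comparing weights.\<close>

lemma exists_normal_form:
  assumes nz: "l w0 \<noteq> 0"
  obtains \<tau> c P1 P0 b Q where "normal_form f \<tau> c P1 P0 b Q"
proof -
  obtain c where c: "l c = 1" "\<And>w. f c c w = 0"
    using exists_singular_idempotent[OF nz] by metis
  define M where "M = A c"
  have lM: "lmap M" unfolding M_def by (rule lmap_A)
  note M_simps = lmap_add[OF lM] lmap_scale[OF lM] lmap_0[OF lM] lmap_minus[OF lM] lmap_diff[OF lM]
  define \<tau> where "\<tau> x = l (M x) / 3" for x
  have Mc: "M c = 3 *s c" using A_singular[OF c(2)] c(1) by (simp add: M_def)
  have MM: "M (M x) = (3 / 2) *s M x + (9 / 2 * \<tau> x) *s c" for x
    using A_A_singular[OF c(2), of x] c(1) by (simp add: M_def \<tau>_def vec_eq_iff algebra_simps)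
  have l\<tau>: "lfun \<tau>" unfolding lfun_def \<tau>_def by (simp add: M_simps l_simps add_divide_distrib)
  note \<tau>_simps = lfun_add[OF l\<tau>] lfun_scale[OF l\<tau>] lfun_0[OF l\<tau>] lfun_minus[OF l\<tau>] lfun_diff[OF l\<tau>]
  have \<tau>c: "\<tau> c = 1" by (simp add: \<tau>_def Mc l_simps c)
  have \<tau>M: "\<tau> (M x) = 3 * \<tau> x" for x
  proof -
    have "\<tau> (M x) = (3 / 2 * l (M x) + 9 / 2 * \<tau> x) / 3"
      unfolding \<tau>_def[of "M x"] MM by (simp add: l_simps c)
    then show ?thesis by (simp add: \<tau>_def)
  qed
  \<comment> \<open>The bracket with \<open>A c\<close> is a prolongation whose linear form is the
    eigenform \<open>\<tau>\<close>. Bracketing once more reproduces it up to a factor by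
    \<open>prol_unique\<close>, so \<open>B\<close> sends weights \<open>r\<close>, \<open>s\<close>
    to \<open>r + s - 3\<close>.\<close>
  define B where "B x y = (- 1 / 3) *s (A c (A x y) - A (A c x) y - A x (A c y))" for x y
  have "prol B \<tau>"
    using prol_scale[OF prol_bracket[of c], of "- 1 / 3"]
    by (simp add: B_def[abs_def] \<tau>_def[abs_def] M_def)
  then interpret B: prolonged_cubic f B \<tau> by unfold_locales
  have Bc: "B c x = M x" for x
  proof -
    have "B c x = (- 1 / 3) *s (M (M x) - 3 *s M x - M (M x))"
      unfolding B_def by (simp add: Mc[unfolded M_def] A_simps M_def)
    then show ?thesis by (simp add: vec_eq_iff)
  qed
  have BB: "M (B x y) - B (M x) y - B x (M y) = (- 3) *s B x y" for x y
  proof -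
    have 1: "prol (\<lambda>x y. B c (B x y) - B (B c x) y - B x (B c y)) (\<lambda>x. - \<tau> (B c x))" by (rule B.prol_bracket)
    have 2: "prol (\<lambda>x y. (- 1 / 3) *s (B c (B x y) - B (B c x) y - B x (B c y))) \<tau>"
      using prol_scale[OF 1, of "- 1 / 3"] by (simp add: Bc \<tau>M)
    have "(- 1 / 3) *s (B c (B x y) - B (B c x) y - B x (B c y)) = B x y"
      by (rule prol_unique[OF 2 \<open>prol B \<tau>\<close>])
    then have "B x y = (- 1 / 3) *s (M (B x y) - B (M x) y - B x (M y))" by (simp add: Bc)
    then show ?thesis by (simp add: vec_eq_iff)
  qed
  \<comment> \<open>Solved from \<open>M x = 3 \<tau>(x) c + 3/2 P1 x\<close>.\<close>
  define P1 where "P1 x = (2 / 3) *s (M x - (3 * \<tau> x) *s c)" for x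
  define P0 where "P0 x = x - \<tau> x *s c - P1 x" for x
  have lP1: "lmap P1" unfolding lmap_def P1_def by (auto simp: M_simps \<tau>_simps vec_eq_iff algebra_simps)
  have lP0: "lmap P0" unfolding lmap_def P0_def
    by (auto simp: lmap_add[OF lP1] lmap_scale[OF lP1] \<tau>_simps vec_eq_iff algebra_simps)
  have MP1: "M (P1 x) = (3 / 2) *s P1 x" for x
    by (simp add: P1_def M_simps MM Mc vec_eq_iff algebra_simps)
  have \<tau>P1: "\<tau> (P1 x) = 0" for x by (simp add: P1_def \<tau>_simps \<tau>M \<tau>c)
  have MP0: "M (P0 x) = 0" for x
    unfolding P0_def by (simp add: M_simps MP1 Mc) (simp add: P1_def vec_eq_iff algebra_simps)
  have \<tau>P0: "\<tau> (P0 x) = 0" for x by (simp add: P0_def \<tau>_simps \<tau>c \<tau>P1)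
  have P1c: "P1 c = 0" by (simp add: P1_def Mc \<tau>c)
  have P0c: "P0 c = 0" by (simp add: P0_def P1c \<tau>c)
  have P11: "P1 (P1 x) = P1 x" for x by (subst (1) P1_def) (simp add: MP1 \<tau>P1)
  have P10: "P1 (P0 x) = 0" for x by (subst (1) P1_def) (simp add: MP0 \<tau>P0)
  have P01: "P0 (P1 x) = 0" for x by (simp add: P0_def P11 \<tau>P1)
  have P00: "P0 (P0 x) = P0 x" for x by (subst (1) P0_def) (simp add: P10 \<tau>P0)
  have dec: "v = \<tau> v *s c + P1 v + P0 v" for v by (simp add: P0_def)
  have ker: "P0 x = x" if "M x = 0" for x
  proof -
    have "\<tau> x = 0" using that by (simp add: \<tau>_def l_simps)
    then show ?thesis using that by (simp add: P0_def P1_def)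
  qed
  \<comment> \<open>The weights -3 and -3/2 do not occur, so \<open>B\<close> vanishes on pairs
    whose product would land there.\<close>
  have eig: "x = 0" if Mx: "M x = a *s x" and a: "a = - 3 \<or> a = - 3 / 2" for a x
  proof -
    have "a * \<tau> x = 3 * \<tau> x" using \<tau>M[of x] Mx by (simp add: \<tau>_simps)
    then have "(a - 3) * \<tau> x = 0" by (simp add: algebra_simps)
    moreover have "a - 3 \<noteq> 0" "a * a - 3 / 2 * a \<noteq> 0" using a by (elim disjE; simp)+
    ultimately have "\<tau> x = 0" by simp
    then have "(a * a) *s x = (3 / 2 * a) *s x" using MM[of x] Mx by (simp add: M_simps)
    then have "(a * a - 3 / 2 * a) *s x = 0" by (simp add: vec.scale_left_diff_distrib)
    then show ?thesis using \<open>a * a - 3 / 2 * a \<noteq> 0\<close> by simp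
  qed
  have MB: "M (B x y) = (r + s - 3) *s B x y" if "M x = r *s x" "M y = s *s y" for r s x y
    using BB[of x y] that by (simp add: B.A_simps vec_eq_iff algebra_simps)
  have MP0': "M (P0 x) = 0 *s P0 x" for x by (simp add: MP0)
  have B00: "B (P0 x) (P0 y) = 0" for x y
    by (rule eig[of _ "- 3"]) (use MB[OF MP0' MP0'] in simp_all)
  have B10: "B (P1 x) (P0 y) = 0" for x y
    by (rule eig[of _ "- 3 / 2"]) (use MB[OF MP1 MP0'] in simp_all)
  have B11: "P0 (B (P1 x) (P1 y)) = B (P1 x) (P1 y)" for x y
    by (rule ker) (use MB[OF MP1 MP1] in simp)
  \<comment> \<open>The weights 3, 3/2, 0 have to add up to 3, so only \<open>f c W0 W0\<close> and
    \<open>f W1 W1 W0\<close> survive.\<close>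
  have weight: "(r + s + t - 3) * f x y z = 0" if "M x = r *s x" "M y = s *s y" "M z = t *s z" for r s t x y z
    using B.f_A_polarized[of c x y z] that \<tau>c by (simp add: Bc f_simps algebra_simps)
  have f11: "f c (P1 x) (P1 y) = 0" for x y using weight[OF Mc MP1 MP1] by simp
  have f10: "f c (P1 x) (P0 y) = 0" for x y using weight[OF Mc MP1 MP0'] by simp
  have f111: "f (P1 x) (P1 y) (P1 z) = 0" for x y z using weight[OF MP1 MP1 MP1] by simp
  have f100: "f (P1 x) (P0 y) (P0 z) = 0" for x y z using weight[OF MP1 MP0' MP0'] by simp
  have f000: "f (P0 x) (P0 y) (P0 z) = 0" for x y z using weight[OF MP0' MP0' MP0'] by simp
  define Q where "Q u v = 3 * f c u v" for u v
  define b where "b u v = (1 / 3) *s B (P1 u) (P1 v)" for u v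
  have Q_P00: "Q u v = Q (P0 u) (P0 v)" for u v
  proof -
    have "Q u v = Q (\<tau> u *s c + P1 u + P0 u) (\<tau> v *s c + P1 v + P0 v)" using dec by metis
    also have "\<dots> = Q (P0 u) (P0 v)"
    proof -
      have z: "f c v c = 0" "f c (P0 u) (P1 v) = 0" for u v
        using c(2)[of v] f10[of v u] sym23 by metis+
      show ?thesis unfolding Q_def by (simp add: f_simps c f11 f10 z)
    qed
    finally show ?thesis .
  qed
  have Q_P0: "Q u (P0 v) = Q u v" for u v
    using Q_P00[of u v] Q_P00[of u "P0 v"] P00 by simp
  have Q_sym: "Q u v = Q v u" for u v by (simp add: Q_def sym23)
  have f110: "f (P1 x) (P1 y) (P0 z) = - (2 / 3) * Q (b x y) z" for x y z
  proof -
    have "f (B (P1 x) c) (P1 y) (P0 z) + f c (B (P1 x) (P1 y)) (P0 z) + f c (P1 y) (B (P1 x) (P0 z)) = 0"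
      using B.f_A_polarized[of "P1 x" c "P1 y" "P0 z"] \<tau>P1 by simp
    then have "3 / 2 * f (P1 x) (P1 y) (P0 z) + f c (B (P1 x) (P1 y)) (P0 z) = 0"
      by (simp add: B.A_sym[of "P1 x" c] Bc MP1 B10 f_simps)
    moreover have "f c (B (P1 x) (P1 y)) (P0 z) = Q (b x y) z"
      using Q_P0[of "b x y" z] by (simp add: Q_def b_def f_simps)
    ultimately show ?thesis by algebra
  qed
  have "normal_form f \<tau> c P1 P0 b Q"
  proof unfold_locales
    show "lmap (b u)" for u
      unfolding b_def lmap_def by (simp add: B.A_simps lmap_add[OF lP1] lmap_scale[OF lP1] vec_eq_iff algebra_simps)
    show "b u v = b v u" for u v by (simp add: b_def B.A_sym)
    show "b u (P1 v) = b u v" for u v by (simp add: b_def P11)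
    show "P0 (b u v) = b u v" for u v by (simp add: b_def B11 lmap_scale[OF lP0])
    show "lfun (Q u)" for u unfolding Q_def[abs_def] by (intro lfun_cmultI lin3)
    show "P0 u = 0" if "\<And>w. Q u w = 0" for u
    proof (rule f_nondegenerate)
      fix v w
      have Qz: "Q (P0 u) w = 0" for w
        using that[of w] Q_P0[of w u] Q_sym by simp
      have Qz': "Q w (P0 u) = 0" for w using Qz Q_sym by simp
      have z: "f c (P0 u) w = 0" "f (P0 u) c w = 0" for w using Qz[of w] by (simp_all add: Q_def sym12)
      have z2: "f (P0 u) (P1 v) (P1 w) = 0"
        using f110[of v w u] Qz'[of "b v w"] Q_P0[of "b v w" u] sym12 sym23 by (metis mult_zero_right)
      have "f (P0 u) v w = f (P0 u) (\<tau> v *s c + P1 v + P0 v) (\<tau> w *s c + P1 w + P0 w)" using dec by metis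
      also have "\<dots> = 0"
      proof -
        have "f (P0 u) v c = 0" for v using z(2)[of v] sym23 by metis
        moreover have "f (P0 u) (P1 v) (P0 w) = 0" "f (P0 u) (P0 w) (P1 v) = 0" for v w
          using f100[of v u w] sym12 sym23 by metis+
        ultimately show ?thesis by (simp add: f_simps z z2 f000)
      qed
      finally show "f (P0 u) v w = 0" .
    qed
    \<comment> \<open>The polarized invariance of \<open>f\<close> under \<open>B (P1 x)\<close>,
      evaluated on three vectors of weight 3/2.\<close>
    show "Q (b x u) (b v w) + Q (b x v) (b u w) + Q (b x w) (b u v) = 0" for x u v w
    proof -
      have t: "f (B (P1 x) (P1 y)) (P1 z) (P1 z') = - (2 / 3) * Q (b z z') (3 *s b x y)" for y z z'
      proof -
        have "3 *s b x y = B (P1 x) (P1 y)" by (simp add: b_def)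
        then show ?thesis using f110[of z z' "B (P1 x) (P1 y)"] by (simp add: B11 f_ac)
      qed
      have "f (B (P1 x) (P1 u)) (P1 v) (P1 w) + f (B (P1 x) (P1 v)) (P1 u) (P1 w) + f (B (P1 x) (P1 w)) (P1 u) (P1 v) = 0"
        using B.f_A_polarized[of "P1 x" "P1 u" "P1 v" "P1 w"] \<tau>P1
          sym12[of "P1 u" "B (P1 x) (P1 v)" "P1 w"] sym23[of "P1 u" "P1 v" "B (P1 x) (P1 w)"]
          sym12[of "P1 u" "B (P1 x) (P1 w)" "P1 v"] by simp
      moreover have "Q u (3 *s v) = 3 * Q u v" for u v by (simp add: Q_def f_simps)
      ultimately have "(- 2) * (Q (b v w) (b x u) + Q (b u w) (b x v) + Q (b u v) (b x w)) = 0"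
        unfolding t by (simp add: algebra_simps)
      then have "Q (b v w) (b x u) + Q (b u w) (b x v) + Q (b u v) (b x w) = 0"
        by (simp only: mult_eq_0_iff) simp
      then show ?thesis
        using Q_sym[of "b x u" "b v w"] Q_sym[of "b x v" "b u w"] Q_sym[of "b x w" "b u v"] by simp
    qed
    show "3 * f u v w = \<tau> u * Q v w + \<tau> v * Q u w + \<tau> w * Q u v -
      2 * (Q (b u v) w + Q (b u w) v + Q (b v w) u)" for u v w
    proof -
      have fc: "f c v w = Q v w / 3" for v w by (simp add: Q_def)
      have r: "f (P0 x) c y = f c (P0 x) y" "f (P1 x) c y = f c (P1 x) y"
        "f (P0 x) (P0 y) c = f c (P0 x) (P0 y)" "f (P0 x) (P1 y) c = f c (P0 x) (P1 y)"
        "f (P1 x) (P0 y) c = f c (P1 x) (P0 y)" "f (P1 x) (P1 y) c = f c (P1 x) (P1 y)"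
        "f c c y = 0" "f c y c = 0" for x y
        using c by (metis f_ac)+
      have r2: "f (P0 x) (P1 y) (P1 z) = - (2 / 3) * Q (b y z) x"
         "f (P1 x) (P0 y) (P1 z) = - (2 / 3) * Q (b x z) y" for x y z
        using f110[of y z x] f110[of x z y] by (metis f_ac)+
      have r3: "f (P0 x) (P1 y) (P0 z) = 0" "f (P0 x) (P0 y) (P1 z) = 0" for x y z
        using f100[of y x z] f100[of z x y] by (metis f_ac)+
      have r4: "f c (P0 x) (P0 y) = Q x y / 3" "f c (P0 x) (P1 y) = 0" for x y
        using Q_P0[of "P0 x" y] Q_P0[of y x] f10[of y x] by (auto simp: Q_def sym23[of c])
      have "f u v w = f (\<tau> u *s c + P1 u + P0 u) (\<tau> v *s c + P1 v + P0 v) (\<tau> w *s c + P1 w + P0 w)"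
        using dec by metis
      also have "\<dots> = \<tau> u * (Q v w / 3) + \<tau> v * (Q u w / 3) + \<tau> w * (Q u v / 3)
         - (2 / 3) * Q (b u v) w - (2 / 3) * Q (b u w) v - (2 / 3) * Q (b v w) u"
        by (simp only: f_simps r r2 r3 r4 f11 f10 f111 f100 f000 f110) (simp add: algebra_simps)
      finally show ?thesis by algebra
    qed
  qed (fact l\<tau> lP1 lP0 dec \<tau>c P1c P0c P11 P01 \<tau>P1 P10 P00 \<tau>P0 Q_sym Q_P0)+
  then show thesis by (rule that)
qed

end

section \<open>Tangent spaces and local dimension\<close>

definition dd :: "(complex ^ 'n::finite \<Rightarrow> complex) \<Rightarrow> complex ^ 'n \<Rightarrow> complex ^ 'n \<Rightarrow> complex" where
  "dd g v u = deriv (\<lambda>t. g (v + t *s u)) 0"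

lemma dd_peval: "dd (peval p) v u = (\<Sum>i\<in>UNIV. peval (partial i p) v * u $ i)"
proof -
  have "((\<lambda>t. (v + t *s u) $ i) has_field_derivative u $ i) (at 0)" for i
    by (auto intro!: derivative_eq_intros)
  from peval_curve_deriv[of "\<lambda>t. v + t *s u", OF this, of p] show ?thesis
    unfolding dd_def by (intro DERIV_imp_deriv) simp
qed

lemma dd_curve:
  assumes "polyfun g" "\<And>i. ((\<lambda>t. \<gamma> t $ i) has_field_derivative d $ i) (at t0)"
  shows "((\<lambda>t. g (\<gamma> t)) has_field_derivative dd g (\<gamma> t0) d) (at t0)"
proof -
  obtain p where p: "g = peval p" using assms(1) by (auto simp: polyfun_def)
  show ?thesis using peval_curve_deriv[OF assms(2), of p] by (simp add: p dd_peval)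
qed

lemma dd_line: "polyfun g \<Longrightarrow> ((\<lambda>t. g (v + t *s u)) has_field_derivative dd g v u) (at 0)"
proof -
  assume g: "polyfun g"
  have "((\<lambda>t. (v + t *s u) $ i) has_field_derivative u $ i) (at 0)" for i
    by (auto intro!: derivative_eq_intros)
  from dd_curve[OF g, of "\<lambda>t. v + t *s u", OF this] show ?thesis by simp
qed

lemma lfun_dd: "polyfun g \<Longrightarrow> lfun (dd g v)"
  unfolding polyfun_def by (auto simp: dd_peval[abs_def] intro!: lfun_sumI lfun_cmultI lfun_axis)

lemma polyfun_dd:
  assumes "polyfun g" "polymap h" "polymap k"
  shows "polyfun (\<lambda>x. dd g (h x) (k x))"
proof -
  obtain p where "g = peval p" using assms(1) by (auto simp: polyfun_def)
  then show ?thesis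
    using assms polyfun_comp[OF polyfun_peval(1) assms(2)] by (simp add: dd_peval)
qed

lemma dd_add: "polyfun g \<Longrightarrow> polyfun h \<Longrightarrow> dd (\<lambda>x. g x + h x) v u = dd g v u + dd h v u"
  unfolding dd_def[of "\<lambda>x. g x + h x"] by (intro DERIV_imp_deriv DERIV_add dd_line)

lemma dd_cmult: "polyfun g \<Longrightarrow> dd (\<lambda>x. c * g x) v u = c * dd g v u"
  unfolding dd_def[of "\<lambda>x. c * g x"] by (intro DERIV_imp_deriv DERIV_cmult dd_line)

lemma in_tangent_space:
  "u \<in> tangent_space S v \<longleftrightarrow> (\<forall>g. polyfun g \<longrightarrow> (\<forall>a\<in>S. g a = 0) \<longrightarrow> dd g v u = 0)"
  unfolding tangent_space_def vanishing_ideal_def polyfun_def by (auto simp: dd_peval)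

lemma subspace_tangent_space: "vec.subspace (tangent_space S v)"
proof -
  have "tangent_space S v = {u \<in> UNIV. \<forall>l\<in>(\<lambda>g. dd g v) ` {g. polyfun g \<and> (\<forall>a\<in>S. g a = 0)}. l u = 0}"
    by (auto simp: in_tangent_space)
  also have "vec.subspace \<dots>"
    by (rule subspace_lfun_eq_0) (auto intro: lfun_dd)
  finally show ?thesis .
qed

text \<open>The second order term leaves the velocity unchanged but allows the curve to stay in
  \<open>S\<close>.\<close>

lemma tangent_curve:
  assumes "\<And>t. v + t *s d + t ^ 2 *s d2 \<in> S"
  shows "d \<in> tangent_space S v"
  unfolding in_tangent_space
proof (intro allI impI)
  fix g assume g: "polyfun g" "\<forall>a\<in>S. g a = 0"
  have "((\<lambda>t. g (v + t *s d + t ^ 2 *s d2)) has_field_derivative dd g (v + 0 *s d + 0 ^ 2 *s d2) d) (at 0)"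
    by (rule dd_curve[OF g(1)]) (auto intro!: derivative_eq_intros)
  moreover have "(\<lambda>t. g (v + t *s d + t ^ 2 *s d2)) = (\<lambda>t. 0)" using g(2) assms by auto
  ultimately have "((\<lambda>t::complex. 0) has_field_derivative dd g v d) (at 0)" by simp
  then show "dd g v d = 0" using DERIV_unique DERIV_const by blast
qed

lemma irreducible_closed_subtopology:
  assumes S: "closedin X S"
  shows "irreducible_closed (subtopology X S) Z \<longleftrightarrow> irreducible_closed X Z \<and> Z \<subseteq> S"
  (is "?l \<longleftrightarrow> ?r")
proof
  assume l: ?l
  then have Z: "closedin X Z" "Z \<subseteq> S" "Z \<noteq> {}"
    using closedin_closed_subtopology[OF S] by (auto simp: irreducible_closed_def)
  have "Z \<subseteq> A \<or> Z \<subseteq> B" if "closedin X A" "closedin X B" "Z \<subseteq> A \<union> B" for A B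
  proof -
    have "closedin (subtopology X S) (A \<inter> S)" "closedin (subtopology X S) (B \<inter> S)"
      using that S closedin_closed_subtopology[OF S] closedin_Int by blast+
    moreover have "Z \<subseteq> (A \<inter> S) \<union> (B \<inter> S)" using that Z by blast
    ultimately have "Z \<subseteq> A \<inter> S \<or> Z \<subseteq> B \<inter> S" using l unfolding irreducible_closed_def by blast
    then show ?thesis by blast
  qed
  then show ?r using Z unfolding irreducible_closed_def by blast
next
  assume ?r
  then show ?l
    unfolding irreducible_closed_def using closedin_closed_subtopology[OF S] by auto
qed

lemma krull_dim_subtopology:
  assumes "closedin X S"
  shows "krull_dim (subtopology X S) = Sup {enat k | k. \<exists>Z.
     (\<forall>i\<le>k. irreducible_closed X (Z i) \<and> Z i \<subseteq> S) \<and> (\<forall>i<k. Z i \<subset> Z (Suc i))}"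
  unfolding krull_dim_def irreducible_closed_subtopology[OF assms] ..

lemma krull_dim_zariski:
  "closedin zariski S \<Longrightarrow> krull_dim (subtopology zariski S) = Sup {enat k | k. has_chain S k}"
  by (simp add: krull_dim_subtopology has_chain_def)

text \<open>The bound is a successor because the supremum of the empty set is 0, so a lower bound 0
  would provide no witness.\<close>

lemma enat_le_Sup_obtain:
  assumes "enat (Suc d) \<le> Sup A"
  obtains a where "a \<in> A" "enat (Suc d) \<le> a"
proof -
  have "\<exists>a\<in>A. enat (Suc d) \<le> a"
  proof (rule ccontr)
    assume "\<not> ?thesis"
    then have "a \<le> enat d" if "a \<in> A" for a
      using that by (metis not_le enat_ord_simps(2) eSuc_enat ileI1 iless_Suc_eq linorder_not_less)
    then have "Sup A \<le> enat d" by (rule Sup_least)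
    then show False using assms by (metis dual_order.trans enat_ord_simps(1) not_less_eq_eq order_refl)
  qed
  then show thesis using that by blast
qed

lemma local_dim_zariski:
  assumes S: "closedin zariski S"
  shows "local_dim (subtopology zariski S) v =
     Sup {Sup {enat k | k. has_chain Z k} | Z. irr Z \<and> Z \<subseteq> S \<and> v \<in> Z}"
proof -
  have "{krull_dim (subtopology (subtopology zariski S) Z) |Z. irreducible_closed (subtopology zariski S) Z \<and> v \<in> Z} =
     {Sup {enat k | k. has_chain Z k} | Z. irr Z \<and> Z \<subseteq> S \<and> v \<in> Z}"
  proof -
    have "krull_dim (subtopology (subtopology zariski S) Z) = Sup {enat k | k. has_chain Z k}"
      if "irr Z" "Z \<subseteq> S" for Z
    proof -
      have "subtopology (subtopology zariski S) Z = subtopology zariski Z"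
        using that by (simp add: subtopology_subtopology Int_absorb1)
      then show ?thesis using krull_dim_zariski[of Z] that by (simp add: irreducible_closed_def)
    qed
    then have "(\<exists>Z. x = krull_dim (subtopology (subtopology zariski S) Z) \<and> irr Z \<and> Z \<subseteq> S \<and> v \<in> Z) \<longleftrightarrow>
       (\<exists>Z. x = Sup {enat k | k. has_chain Z k} \<and> irr Z \<and> Z \<subseteq> S \<and> v \<in> Z)" for x
      by (intro arg_cong[where f = Ex] ext) (metis (no_types, lifting))
    then show ?thesis unfolding irreducible_closed_subtopology[OF S] conj_assoc by simp
  qed
  then show ?thesis by (simp add: local_dim_def)
qed

lemma smooth_point_obtain_chain:
  assumes S: "closedin zariski S" and sm: "smooth_point S v" and d: "vec.dim (tangent_space S v) = Suc d"
  obtains Z where "irr Z" "Z \<subseteq> S" "v \<in> Z" "has_chain Z (Suc d)"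
proof -
  have "enat (Suc d) \<le> Sup {Sup {enat k | k. has_chain Z k} | Z. irr Z \<and> Z \<subseteq> S \<and> v \<in> Z}"
    using sm d unfolding smooth_point_def local_dim_zariski[OF S] by simp
  then obtain Z where Z: "irr Z" "Z \<subseteq> S" "v \<in> Z" "enat (Suc d) \<le> Sup {enat k | k. has_chain Z k}"
    by (rule enat_le_Sup_obtain) blast
  from Z(4) obtain k where "has_chain Z k" "enat (Suc d) \<le> enat k"
    by (rule enat_le_Sup_obtain) blast
  then have "has_chain Z (Suc d)" using has_chain_le by simp
  then show thesis using that Z by blast
qed

section \<open>The tangent spaces along the isotropic cone\<close>

lemma span_Int_complement:
  assumes "vec.independent B" "B0 \<subseteq> B" "u \<in> vec.span B0" "u \<in> vec.span (B - B0)"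
  shows "u = (0 :: complex ^ 'n::finite)"
proof -
  let ?S = "vec.span B0" and ?T = "vec.span (B - B0)"
  have ind: "vec.independent B0" "vec.independent (B - B0)"
    using assms vec.independent_mono by blast+
  have "{x + y |x y. x \<in> ?S \<and> y \<in> ?T} = vec.span B"
    using vec.span_Un[of B0 "B - B0"] assms(2) by (simp add: Un_absorb1)
  then have "vec.dim (vec.span B) + vec.dim (?S \<inter> ?T) = vec.dim ?S + vec.dim ?T"
    using vec.dim_sums_Int[of ?S ?T] by simp
  moreover have "vec.dim (vec.span B) = card B" "vec.dim ?S = card B0" "vec.dim ?T = card (B - B0)"
    using assms(1) ind by (simp_all add: vec.dim_eq_card_independent)
  moreover have "card B = card B0 + card (B - B0)"
    using assms vec.finiteI_independent[OF assms(1)] by (simp add: card_Diff_subset card_mono finite_subset)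
  ultimately have "vec.dim (?S \<inter> ?T) = 0" by linarith
  then show ?thesis using assms by auto
qed

context normal_form
begin

lemmas nf_simps =
  lfun_add[OF lfun_\<tau>] lfun_scale[OF lfun_\<tau>] lfun_0[OF lfun_\<tau>] lfun_minus[OF lfun_\<tau>] lfun_diff[OF lfun_\<tau>]
  lmap_add[OF lmap_P1] lmap_scale[OF lmap_P1] lmap_0[OF lmap_P1] lmap_minus[OF lmap_P1] lmap_diff[OF lmap_P1]
  lmap_add[OF lmap_P0] lmap_scale[OF lmap_P0] lmap_0[OF lmap_P0] lmap_minus[OF lmap_P0] lmap_diff[OF lmap_P0]

lemma lfun_Q': "lfun (\<lambda>u. Q u v)"
proof -
  have "(\<lambda>u. Q u v) = Q v" using Q_sym by blast
  then show ?thesis using lfun_Q by simp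
qed

lemma lmap_b': "lmap (\<lambda>u. b u v)"
proof -
  have "(\<lambda>u. b u v) = b v" using b_sym by blast
  then show ?thesis using lmap_b by simp
qed

lemmas Q_simps =
  lfun_add[OF lfun_Q] lfun_scale[OF lfun_Q] lfun_0[OF lfun_Q] lfun_minus[OF lfun_Q] lfun_diff[OF lfun_Q]
  lfun_add[OF lfun_Q'] lfun_scale[OF lfun_Q'] lfun_0[OF lfun_Q'] lfun_minus[OF lfun_Q'] lfun_diff[OF lfun_Q']

lemmas b_simps =
  lmap_add[OF lmap_b] lmap_scale[OF lmap_b] lmap_0[OF lmap_b] lmap_minus[OF lmap_b] lmap_diff[OF lmap_b]
  lmap_add[OF lmap_b'] lmap_scale[OF lmap_b'] lmap_0[OF lmap_b'] lmap_minus[OF lmap_b'] lmap_diff[OF lmap_b']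

lemma Q_P0' [simp]: "Q (P0 u) v = Q u v" and Q_P0'' [simp]: "Q u (P0 v) = Q u v"
  using Q_P0 Q_sym by metis+

lemma Q_c [simp]: "Q c v = 0" "Q v c = 0"
  using Q_P0[of v c] Q_sym by (simp_all add: Q_simps)

lemma Q_P1 [simp]: "Q (P1 u) v = 0" "Q v (P1 u) = 0"
  using Q_P0[of v "P1 u"] Q_sym by (simp_all add: Q_simps)

lemma b_P1_1 [simp]: "b (P1 u) v = b u v" and b_P1_2 [simp]: "b u (P1 v) = b u v"
  using b_P1 b_sym by metis+

lemma b_P0 [simp]: "b (P0 u) v = 0" "b v (P0 u) = 0"
  using b_P1[of v "P0 u"] b_sym by (simp_all add: b_simps)

lemma b_c [simp]: "b c v = 0" "b v c = 0"
  using b_P1[of v c] b_sym by (simp_all add: b_simps)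

lemma \<tau>_b [simp]: "\<tau> (b u v) = 0" and P1_b [simp]: "P1 (b u v) = 0"
  using \<tau>_P0[of "b u v"] P1_P0[of "b u v"] by simp_all

lemma polymap_b: "polymap g \<Longrightarrow> polymap h \<Longrightarrow> polymap (\<lambda>x. b (g x) (h x))"
proof -
  assume gh: "polymap g" "polymap h"
  have "b (g x) (h x) = (\<Sum>i\<in>UNIV. g x $ i *s b (axis i 1) (h x))" for x
    using lmap_sum[OF lmap_b', of "\<lambda>i. g x $ i *s axis i 1" UNIV "h x"] basis_expansion[of "g x"]
    by (simp add: b_simps)
  moreover have "polymap (\<lambda>x. b (axis i 1) (h x))" for i
    using polymap_comp[OF lmap_polymap[OF lmap_b] gh(2)] .
  ultimately show ?thesis using gh by simp
qed

lemma polyfun_Q: "polymap g \<Longrightarrow> polymap h \<Longrightarrow> polyfun (\<lambda>x. Q (g x) (h x))"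
proof -
  assume gh: "polymap g" "polymap h"
  have "Q (g x) (h x) = (\<Sum>i\<in>UNIV. g x $ i * Q (axis i 1) (h x))" for x
    using lfun_expand[OF lfun_Q', of "g x" "h x"] .
  moreover have "polyfun (\<lambda>x. Q (axis i 1) (h x))" for i
    using polyfun_comp[OF lfun_polyfun[OF lfun_Q] gh(2)] .
  ultimately show ?thesis using gh by simp
qed

lemma polymap_P: "polymap g \<Longrightarrow> polymap (\<lambda>x. P0 (g x))" "polymap g \<Longrightarrow> polymap (\<lambda>x. P1 (g x))"
  using polymap_comp lmap_polymap lmap_P0 lmap_P1 by blast+

lemma polyfun_\<tau>: "polymap g \<Longrightarrow> polyfun (\<lambda>x. \<tau> (g x))"
  using polyfun_comp lfun_polyfun lfun_\<tau> by blast

section \<open>The eigenspaces and the equations of the singular cone\<close>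

definition W1 :: "(complex ^ 'n) set" where "W1 = {v. P1 v = v}"
definition W0 :: "(complex ^ 'n) set" where "W0 = {v. P0 v = v}"

lemma subspace_W1: "vec.subspace W1" and subspace_W0: "vec.subspace W0"
  by (auto intro!: vec.subspaceI simp: W1_def W0_def nf_simps)

lemma P1_in [simp]: "P1 v \<in> W1" and P0_in [simp]: "P0 v \<in> W0" and b_in [simp]: "b u v \<in> W0"
  by (simp_all add: W1_def W0_def)

lemma W1D: "v \<in> W1 \<Longrightarrow> P1 v = v" "v \<in> W1 \<Longrightarrow> P0 v = 0" "v \<in> W1 \<Longrightarrow> \<tau> v = 0"
  using P0_P1[of v] \<tau>_P1[of v] by (auto simp: W1_def)

lemma W0D: "v \<in> W0 \<Longrightarrow> P0 v = v" "v \<in> W0 \<Longrightarrow> P1 v = 0" "v \<in> W0 \<Longrightarrow> \<tau> v = 0"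
  using P1_P0[of v] \<tau>_P0[of v] by (auto simp: W0_def)

lemma Q_nondegenerate_W0: "u \<in> W0 \<Longrightarrow> (\<And>w. w \<in> W0 \<Longrightarrow> Q u w = 0) \<Longrightarrow> u = 0"
  using Q_nondegenerate[of u] W0D(1)[of u] by (metis P0_in Q_P0'')

definition Sh :: "(complex ^ 'n) set" where "Sh = {v. \<forall>w. f v v w = 0}"

text \<open>The three conditions are the values of \<open>f v v w\<close> for \<open>w\<close> equal
  to \<open>c\<close>, in \<open>W0\<close> and in \<open>W1\<close>.\<close>

lemma in_Sh: "v \<in> Sh \<longleftrightarrow> Q v v = 0 \<and> \<tau> v *s P0 v = b v v \<and> (\<forall>u. Q (b v u) v = 0)"
proof -
  have f: "3 * f v v w = 2 * \<tau> v * Q v w + \<tau> w * Q v v - 2 * Q (b v v) w - 4 * Q (b v w) v" for w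
    using f_normal[of v v w] by simp
  show ?thesis
  proof
    assume "v \<in> Sh"
    then have z: "2 * \<tau> v * Q v w + \<tau> w * Q v v - 2 * Q (b v v) w - 4 * Q (b v w) v = 0" for w
      using f[of w] by (simp add: Sh_def)
    have "Q v v = 0" using z[of c] by (simp add: Q_simps)
    moreover have "\<tau> v *s P0 v - b v v = 0"
    proof -
      have "Q (\<tau> v *s P0 v - b v v) w = 0" for w
        using z[of "P0 w"] by (simp add: Q_simps)
      then have "P0 (\<tau> v *s P0 v - b v v) = 0" by (rule Q_nondegenerate)
      then show ?thesis by (simp add: nf_simps)
    qed
    moreover have "Q (b v u) v = 0" for u using z[of "P1 u"] by (simp add: Q_simps)
    ultimately show "Q v v = 0 \<and> \<tau> v *s P0 v = b v v \<and> (\<forall>u. Q (b v u) v = 0)" by simp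
  next
    assume *: "Q v v = 0 \<and> \<tau> v *s P0 v = b v v \<and> (\<forall>u. Q (b v u) v = 0)"
    have "Q (b v v) w = \<tau> v * Q v w" for w
    proof -
      have "Q (b v v) w = Q (\<tau> v *s P0 v) w" using * by simp
      then show ?thesis by (simp add: Q_simps)
    qed
    then show "v \<in> Sh" using * f by (simp add: Sh_def)
  qed
qed

lemma closedin_Sh: "closedin zariski Sh"
proof (rule closedin_zariskiI)
  fix v assume "v \<notin> Sh"
  then obtain w where "f v v w \<noteq> 0" by (auto simp: Sh_def)
  then show "\<exists>g. polyfun g \<and> (\<forall>a\<in>Sh. g a = 0) \<and> g v \<noteq> 0"
    by (intro exI[of _ "\<lambda>v. f v v w"]) (auto simp: Sh_def intro: polyfun_f)
qed

lemma Q_b_b_diag: "Q (b x x) (b x u) = 0" and Q_b_b_quadratic: "Q (b x x) (b u w) = - 2 * Q (b x u) (b x w)"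
proof -
  have "Q (b x x) (b x u) + Q (b x x) (b x u) + Q (b x u) (b x x) = 0" using Q_b_b[of x x x u] by simp
  then show "Q (b x x) (b x u) = 0" using Q_sym[of "b x u"] by simp
  have "Q (b x x) (b u w) + Q (b x u) (b x w) + Q (b x w) (b x u) = 0" using Q_b_b[of x x u w] by simp
  then show "Q (b x x) (b u w) = - 2 * Q (b x u) (b x w)" 
    using Q_sym[of "b x w" "b x u"] by algebra
qed

text \<open>Multiplying the remaining equations by \<open>\<tau> v\<close> replaces the
  \<open>W0\<close>-component by \<open>b v v\<close>, where \<open>Q_b_b_diag\<close>
  applies.\<close>

lemma Sh_if_\<tau>:
  assumes "\<tau> v \<noteq> 0" "\<tau> v *s P0 v = b v v"
  shows "v \<in> Sh"
proof -
  have Q: "\<tau> v * Q v w = Q (b v v) w" for w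
  proof -
    have "Q (b v v) w = Q (\<tau> v *s P0 v) w" using assms(2) by simp
    then show ?thesis by (simp add: Q_simps)
  qed
  have "\<tau> v * (\<tau> v * Q v v) = Q (b v v) (b v v)"
    unfolding Q[of v, unfolded Q_sym[of "b v v" v]] using Q[of "b v v"] by simp
  then have "Q v v = 0" using Q_b_b_diag[of v v] assms(1) by simp
  moreover have "Q (b v u) v = 0" for u
    using Q[of "b v u"] Q_b_b_diag[of v u] assms(1) Q_sym[of v "b v u"] by simp
  ultimately show ?thesis using assms(2) by (simp add: in_Sh)
qed

section \<open>Isotropic vectors\<close>

definition E :: "(complex ^ 'n) set" where "E = {y \<in> W0. Q y y = 0}"

lemma E_W0: "y \<in> E \<Longrightarrow> y \<in> W0" and E_Q: "y \<in> E \<Longrightarrow> Q y y = 0"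
  by (auto simp: E_def)

lemma b_W0: "y \<in> W0 \<Longrightarrow> b y u = 0" "y \<in> W0 \<Longrightarrow> b u y = 0"
  using b_P0 W0D(1) by metis+

lemma b_b [simp]: "b (b u v) w = 0" "b w (b u v) = 0"
  by (simp_all add: b_W0)

lemma E_Sh: "y \<in> E \<Longrightarrow> y \<in> Sh"
  using b_W0[of y] by (simp add: in_Sh E_def W0D Q_simps)

lemma E_scale: "y \<in> E \<Longrightarrow> t *s y \<in> E"
  using subspace_W0 by (auto simp: E_def Q_simps vec.subspace_scale)

lemma b_E: "b x x \<in> E"
  using Q_b_b_diag[of x x] by (simp add: E_def)

lemma b_polar: "b (x + y) (x + y) = b x x + 2 *s b x y + b y y"
  by (simp add: b_simps b_sym[of y x] vec_eq_iff)

text \<open>Otherwise the form is \<open>\<tau> v * Q v v\<close> and has a linear factor.\<close>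

lemma exists_b_nonzero: obtains x where "x \<in> W1" "b x x \<noteq> 0"
proof -
  have "\<exists>x. b x x \<noteq> 0"
  proof (rule ccontr)
    assume "\<not> ?thesis"
    then have "f v v v = \<tau> v * Q v v" for v
      using f_normal[of v v v] by (simp add: Q_simps)
    then have "\<tau> c = 0"
      by (intro no_factor[OF lfun_\<tau>, of "\<lambda>v. Q v v"] polyfun_Q polymap_id)
    then show False by simp
  qed
  then obtain x where "b (P1 x) (P1 x) \<noteq> 0" by auto
  then show thesis by (intro that[of "P1 x"]) simp_all
qed

text \<open>If \<open>Q\<close> were a product of two linear forms, one of them would vanish on all
  the isotropic vectors \<open>b x x\<close>, since a product of polynomial functions is zero only
  if a factor is. That linear form would divide the cubic.\<close>

lemma not_hyperbolic_plane:
  assumes y: "y \<in> E" "y0 \<in> E" "Q y y0 \<noteq> 0"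
  shows "\<exists>z. Q z z * Q y y0 \<noteq> 2 * Q z y * Q z y0"
proof (rule ccontr)
  assume "\<not> ?thesis"
  then have diag: "Q z z * Q y y0 = 2 * Q z y * Q z y0" for z by simp
  have polar: "Q z w * Q y y0 = Q z y * Q w y0 + Q w y * Q z y0" for z w
  proof -
    have "Q (z + w) (z + w) * Q y y0 = Q z z * Q y y0 + 2 * (Q z w * Q y y0) + Q w w * Q y y0"
      by (simp add: Q_simps Q_sym[of w z] algebra_simps)
    moreover have "2 * Q (z + w) y * Q (z + w) y0 = 2 * Q z y * Q z y0 + 2 * (Q z y * Q w y0 + Q w y * Q z y0) + 2 * Q w y * Q w y0"
      by (simp add: Q_simps algebra_simps)
    ultimately have "2 * (Q z w * Q y y0) = 2 * (Q z y * Q w y0 + Q w y * Q z y0)"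
      using diag[of z] diag[of w] diag[of "z + w"] by algebra
    then show ?thesis by algebra
  qed
  have "Q (b x x) y * Q (b x x) y0 = 0" for x
    using diag[of "b x x"] Q_b_b_diag[of x x] by simp
  then have "(\<forall>x\<in>UNIV. Q (b x x) y = 0) \<or> (\<forall>x\<in>UNIV. Q (b x x) y0 = 0)"
    by (intro polyfun_mult_eq_0_on[OF vec.subspace_UNIV] polyfun_Q polymap_b polymap_id polymap_const) blast
  moreover have False
    if h: "\<And>x. Q (b x x) y = 0" "\<And>z w. Q z w * Q y y0 = Q z y * Q w y0 + Q w y * Q z y0" "Q y y0 \<noteq> 0" for y y0
  proof -
    have "f v v v = Q y v * ((2 * \<tau> v * Q v y0 - 2 * Q (b v v) y0) / Q y y0)" for v
    proof -
      have "Q y y0 * f v v v = Q v y * (2 * \<tau> v * Q v y0 - 2 * Q (b v v) y0)"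
        using f_normal[of v v v] h(1)[of v] h(2)[of v v] h(2)[of "b v v" v] by algebra
      then show ?thesis using h(3) Q_sym[of v y] by (simp add: field_simps)
    qed
    then have "Q y y0 = 0"
      by (intro no_factor[OF lfun_Q, of "\<lambda>v. (2 * \<tau> v * Q v y0 - 2 * Q (b v v) y0) / Q y y0"]
          polyfun_divide_const polyfun_diff polyfun_mult polyfun_const polyfun_\<tau> polyfun_Q polymap_b polymap_id polymap_const)
    then show False using h(3) by simp
  qed
  ultimately show False
    using polar y(3) Q_sym[of y0 y] by (metis UNIV_I add.commute mult.commute)
qed

text \<open>Up to the factor \<open>- Q z z\<close>, the reflection of \<open>g\<close> in the
  hyperplane orthogonal to \<open>z\<close>. It parametrises isotropic vectors by a quadratic
  map.\<close>

definition psi :: "complex ^ 'n \<Rightarrow> complex ^ 'n \<Rightarrow> complex ^ 'n" where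
  "psi g z = (2 * Q z g) *s P0 z - Q z z *s g"

lemma psi_E: "g \<in> E \<Longrightarrow> psi g z \<in> E"
  using subspace_W0
  by (simp add: psi_def E_def Q_simps vec.subspace_diff vec.subspace_scale Q_sym[of g z])

lemma Q_psi: "g \<in> E \<Longrightarrow> Q (psi g z) g = 2 * Q z g ^ 2"
  by (simp add: psi_def E_def Q_simps power2_eq_square)

lemma polymap_psi: "polymap h \<Longrightarrow> polymap (\<lambda>z. psi g (h z))"
  unfolding psi_def by (intro polymap_diff polymap_scale polyfun_mult polyfun_const polyfun_Q polymap_const polymap_P)

text \<open>A whole line of preimages is recorded: a suitable multiple of \<open>g\<close> later
  moves the preimage into the orthogonal complement of a given vector.\<close>

lemma psi_surj:
  assumes g: "g \<in> E" and y: "y \<in> E" "Q y g \<noteq> 0"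
  obtains s where "\<And>\<alpha>. psi g (s *s (y + \<alpha> *s g)) = y"
proof -
  define s where "s = csqrt (1 / (2 * Q y g))"
  have s: "s ^ 2 * (2 * Q y g) = 1" using y by (simp add: s_def)
  have "psi g (s *s (y + \<alpha> *s g)) = (s ^ 2 * (2 * Q y g)) *s y" for \<alpha>
  proof -
    have 1: "P0 (s *s (y + \<alpha> *s g)) = s *s (y + \<alpha> *s g)"
      using E_W0[OF g] E_W0[OF y(1)] by (simp add: nf_simps W0D)
    have 2: "Q (s *s (y + \<alpha> *s g)) g = s * Q y g"
      using E_Q[OF g] by (simp add: Q_simps)
    have 3: "Q (s *s (y + \<alpha> *s g)) (s *s (y + \<alpha> *s g)) = s ^ 2 * (2 * \<alpha> * Q y g)"
      using E_Q[OF g] E_Q[OF y(1)] Q_sym[of g y] by (simp add: Q_simps power2_eq_square algebra_simps)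
    show ?thesis unfolding psi_def 1 2 3 by (simp add: vec_eq_iff power2_eq_square algebra_simps)
  qed
  then have "psi g (s *s (y + \<alpha> *s g)) = y" for \<alpha> using s by simp
  then show thesis by (rule that)
qed

text \<open>The products of \<open>psi y z\<close> with \<open>y\<close> and \<open>y0\<close> are
  polynomials in \<open>z\<close>. Neither is identically zero, the second one by
  \<open>not_hyperbolic_plane\<close> if \<open>Q y y0\<close> is nonzero.\<close>

lemma exists_isotropic_partner:
  assumes y: "y \<in> E" "y \<noteq> 0" and y0: "y0 \<in> E" "y0 \<noteq> 0"
  obtains g where "g \<in> E" "Q y g \<noteq> 0" "Q y0 g \<noteq> 0"
proof -
  have ne: "\<exists>z. Q z y \<noteq> 0" if "y \<in> E" "y \<noteq> 0" for y
    using that Q_nondegenerate_W0[of y] by (metis E_W0 Q_sym)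
  have "\<exists>z. Q z z * Q y y0 - 2 * Q z y * Q z y0 \<noteq> 0"
  proof (cases "Q y y0 = 0")
    case True
    have "\<exists>z. Q z y * Q z y0 \<noteq> 0"
    proof (rule ccontr)
      assume "\<not> ?thesis"
      then have "(\<forall>z\<in>UNIV. Q z y = 0) \<or> (\<forall>z\<in>UNIV. Q z y0 = 0)"
        by (intro polyfun_mult_eq_0_on[OF vec.subspace_UNIV] polyfun_Q polymap_const polymap_id) blast
      then show False using ne[OF y] ne[OF y0] by auto
    qed
    then show ?thesis using True by auto
  next
    case False
    then show ?thesis using not_hyperbolic_plane[OF y(1) y0(1)] by auto
  qed
  then have "\<exists>z. Q z y * (Q z z * Q y y0 - 2 * Q z y * Q z y0) \<noteq> 0"
  proof (rule contrapos_pp)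
    assume "\<not> (\<exists>z. Q z y * (Q z z * Q y y0 - 2 * Q z y * Q z y0) \<noteq> 0)"
    then have "(\<forall>z\<in>UNIV. Q z y = 0) \<or> (\<forall>z\<in>UNIV. Q z z * Q y y0 - 2 * Q z y * Q z y0 = 0)"
      by (intro polyfun_mult_eq_0_on[OF vec.subspace_UNIV] polyfun_diff polyfun_mult polyfun_const polyfun_Q
          polymap_const polymap_id) blast
    then show "\<not> (\<exists>z. Q z z * Q y y0 - 2 * Q z y * Q z y0 \<noteq> 0)" using ne[OF y] by auto
  qed
  then obtain z where z: "Q z y \<noteq> 0" "Q z z * Q y y0 - 2 * Q z y * Q z y0 \<noteq> 0" by auto
  show thesis
  proof (rule that[of "psi y z"])
    show "psi y z \<in> E" by (rule psi_E[OF y(1)])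
    show "Q y (psi y z) \<noteq> 0" using Q_psi[OF y(1), of z] z Q_sym[of y "psi y z"] by simp
    have "Q y0 (psi y z) = - (Q z z * Q y y0 - 2 * Q z y * Q z y0)"
      using Q_sym[of y0 y] Q_sym[of y0 z] by (simp add: psi_def Q_simps)
    then show "Q y0 (psi y z) \<noteq> 0" using z by simp
  qed
qed

section \<open>Tangent spaces of the singular cone at isotropic vectors\<close>

abbreviation "p \<equiv> vec.dim W1"
abbreviation "r \<equiv> vec.dim W0"

definition T1 :: "complex ^ 'n \<Rightarrow> (complex ^ 'n) set" where "T1 y = W1 \<inter> tangent_space Sh y"

lemma subspace_T1: "vec.subspace (T1 y)"
  unfolding T1_def using subspace_W1 subspace_tangent_space by (rule vec.subspace_inter)

text \<open>Scaling the components along \<open>c\<close>, \<open>W1\<close>, \<open>W0\<close> by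
  \<open>t ^ 2\<close>, \<open>t\<close>, 1 respects the equations of \<open>Sh\<close>, which gives
  a curve from \<open>P0 v\<close> with velocity \<open>P1 v\<close>.\<close>

lemma Sh_T1:
  assumes "v \<in> Sh"
  shows "P1 v \<in> T1 (P0 v)"
proof -
  have "P1 v \<in> tangent_space Sh (P0 v)"
  proof (rule tangent_curve)
    fix t
    have v: "Q v v = 0" "\<tau> v *s P0 v = b v v" "\<And>u. Q (b v u) v = 0" using assms by (auto simp: in_Sh)
    define x where "x = P0 v + t *s P1 v + t ^ 2 *s (\<tau> v *s c)"
    have x: "\<tau> x = t ^ 2 * \<tau> v" "P0 x = P0 v" "\<And>u. b x u = t *s b v u" "\<And>u. b u x = t *s b u v"
      "\<And>u. Q x u = Q v u" "\<And>u. Q u x = Q u v"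
      by (simp_all add: x_def nf_simps Q_simps b_simps)
    have "x \<in> Sh"
      unfolding in_Sh x
    proof (intro conjI allI)
      have "(t ^ 2 * \<tau> v) *s P0 v = t ^ 2 *s (\<tau> v *s P0 v)" by simp
      then show "(t ^ 2 * \<tau> v) *s P0 v = t *s (t *s b v v)" unfolding v(2) by (simp add: power2_eq_square)
      show "Q (t *s b v u) v = 0" for u using v(3) by (simp add: Q_simps)
    qed (rule v(1))
    then show "P0 v + t *s P1 v + t ^ 2 *s (\<tau> v *s c) \<in> Sh" by (simp add: x_def)
  qed
  then show ?thesis by (simp add: T1_def)
qed

lemma subspace_perp: "vec.subspace {z \<in> W0. Q y z = 0}"
  using subspace_lfun_eq_0[OF subspace_W0, of "{Q y}"] lfun_Q by simp

lemma dim_perp: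
  assumes "y \<in> W0" "y \<noteq> 0"
  shows "r = vec.dim {z \<in> W0. Q y z = 0} + 1"
proof -
  obtain w where "w \<in> W0" "Q y w \<noteq> 0" using Q_nondegenerate_W0 assms by blast
  then show ?thesis using dim_subspace_lker[OF subspace_W0 lfun_Q] by blast
qed

lemma perp_tangent:
  assumes y: "y \<in> E" "y \<noteq> 0" and w: "w \<in> W0" "Q y w = 0"
  shows "w \<in> tangent_space Sh y"
proof -
  obtain g0 where g0: "g0 \<in> E" "Q y g0 \<noteq> 0" using exists_isotropic_partner[OF y y] by metis
  define g where "g = (1 / Q y g0) *s g0"
  have g: "g \<in> E" "Q y g = 1" using g0 by (simp_all add: g_def E_scale Q_simps)
  define w' where "w' = w - Q w g *s y"
  have w': "w' \<in> W0" "Q y w' = 0" "Q w' g = 0"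
    using w y g subspace_W0 by (simp_all add: w'_def E_def Q_simps vec.subspace_diff vec.subspace_scale)
  have "w' \<in> tangent_space Sh y"
  proof (rule tangent_curve)
    fix t
    \<comment> \<open>The term in \<open>g\<close> makes the curve exactly isotropic, since
      \<open>w'\<close> is orthogonal to \<open>y\<close> and \<open>g\<close>, and
      \<open>Q y g = 1\<close>.\<close>
    have "y + t *s w' + t ^ 2 *s ((- Q w' w' / 2) *s g) \<in> E"
      using y g w' subspace_W0
        Q_sym[of w' y] Q_sym[of g y] Q_sym[of g w']
      by (simp add: E_def Q_simps vec.subspace_add vec.subspace_diff vec.subspace_scale power2_eq_square algebra_simps)
    then show "y + t *s w' + t ^ 2 *s ((- Q w' w' / 2) *s g) \<in> Sh" by (rule E_Sh)
  qed
  moreover have "y \<in> tangent_space Sh y"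
  proof (rule tangent_curve)
    fix t
    have "y + t *s y + t ^ 2 *s 0 = (1 + t) *s y" by (simp add: vec.scale_left_distrib)
    then show "y + t *s y + t ^ 2 *s 0 \<in> Sh" using E_Sh[OF E_scale[OF y(1), of "1 + t"]] by metis
  qed
  ultimately have "w' + Q w g *s y \<in> tangent_space Sh y"
    using subspace_tangent_space by (intro vec.subspace_add vec.subspace_scale)
  then show ?thesis by (simp add: w'_def)
qed

text \<open>The linear terms at \<open>y\<close> of the equations
  \<open>\<tau> v *s P0 v = b v v\<close> and \<open>Q v v = 0\<close> force
  \<open>\<tau> u = 0\<close> and \<open>Q y u = 0\<close>.\<close>

lemma tangent_space_E:
  assumes y: "y \<in> E" "y \<noteq> 0"
  shows "tangent_space Sh y = {u1 + u0 | u1 u0. u1 \<in> T1 y \<and> u0 \<in> {z \<in> W0. Q y z = 0}}"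
proof
  show "{u1 + u0 | u1 u0. u1 \<in> T1 y \<and> u0 \<in> {z \<in> W0. Q y z = 0}} \<subseteq> tangent_space Sh y"
    using perp_tangent[OF y] subspace_tangent_space by (auto simp: T1_def intro!: vec.subspace_add)
  show "tangent_space Sh y \<subseteq> {u1 + u0 | u1 u0. u1 \<in> T1 y \<and> u0 \<in> {z \<in> W0. Q y z = 0}}"
  proof
    fix u assume u: "u \<in> tangent_space Sh y"
    have Wy: "y \<in> W0" using y by (simp add: E_def)
    have "\<tau> u *s y = 0"
    proof (subst vec_eq_iff, intro allI)
      fix i
      let ?g = "\<lambda>v. (\<tau> v *s P0 v - b v v) $ i"
      have "polyfun ?g" by (intro polyfun_nth polymap_diff polymap_scale polyfun_\<tau> polymap_P polymap_b polymap_id)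
      moreover have "\<forall>a\<in>Sh. ?g a = 0" by (auto simp: in_Sh)
      ultimately have "dd ?g y u = 0" using u in_tangent_space by blast
      moreover have "((\<lambda>t. ?g (y + t *s u)) has_field_derivative (\<tau> u * y $ i)) (at 0)"
      proof -
        have "?g (y + t *s u) = t * \<tau> u * y $ i + t ^ 2 * (\<tau> u * P0 u $ i - b u u $ i)" for t
          by (simp add: nf_simps b_simps b_W0[OF Wy] W0D[OF Wy] algebra_simps power2_eq_square)
        then show ?thesis by (auto intro!: derivative_eq_intros)
      qed
      ultimately show "(\<tau> u *s y) $ i = 0 $ i" by (simp add: dd_def DERIV_imp_deriv)
    qed
    then have \<tau>u: "\<tau> u = 0" using y by simp
    let ?h = "\<lambda>v. Q v v"
    have "polyfun ?h" by (intro polyfun_Q polymap_id)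
    moreover have "\<forall>a\<in>Sh. ?h a = 0" by (auto simp: in_Sh)
    ultimately have "dd ?h y u = 0" using u in_tangent_space by blast
    moreover have "((\<lambda>t. ?h (y + t *s u)) has_field_derivative (2 * Q y u)) (at 0)"
    proof -
      have "?h (y + t *s u) = t * (2 * Q y u) + t ^ 2 * Q u u" for t
        using y by (simp add: Q_simps E_def Q_sym[of u y] algebra_simps power2_eq_square)
      then show ?thesis by (auto intro!: derivative_eq_intros)
    qed
    ultimately have Qu: "Q y u = 0" by (simp add: dd_def DERIV_imp_deriv)
    have u': "u = P1 u + P0 u"
      by (rule trans[OF decomp]) (simp add: \<tau>u)
    have "P0 u \<in> {z \<in> W0. Q y z = 0}" using Qu by simp
    moreover have "P1 u \<in> T1 y"
    proof -
      have "P1 u = u - P0 u" using u' by (metis add_diff_cancel_right')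
      moreover have "P0 u \<in> tangent_space Sh y" using perp_tangent[OF y, of "P0 u"] Qu by simp
      ultimately have "P1 u \<in> tangent_space Sh y"
        using u subspace_tangent_space vec.subspace_diff by metis
      then show ?thesis by (simp add: T1_def)
    qed
    ultimately show "u \<in> {u1 + u0 | u1 u0. u1 \<in> T1 y \<and> u0 \<in> {z \<in> W0. Q y z = 0}}" using u' by blast
  qed
qed

lemma dim_tangent_space_E:
  assumes y: "y \<in> E" "y \<noteq> 0"
  shows "vec.dim (tangent_space Sh y) + 1 = vec.dim (T1 y) + r"
proof -
  have "T1 y \<inter> {z \<in> W0. Q y z = 0} \<subseteq> {0}" using W0D(2) W1D(1) by (fastforce simp: T1_def)
  then have "vec.dim (T1 y \<inter> {z \<in> W0. Q y z = 0}) = 0" by simp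
  then show ?thesis
    using vec.dim_sums_Int[OF subspace_T1 subspace_perp, of y y] dim_perp[OF E_W0[OF y(1)] y(2)]
    unfolding tangent_space_E[OF y, symmetric] by linarith
qed


section \<open>The parametrisation and chains not contained in \<open>\<tau> = 0\<close>\<close>

definition Psi1 :: "complex ^ 'n \<Rightarrow> complex ^ 'n" where
  "Psi1 v = \<tau> v ^ 2 *s c + \<tau> v *s P1 v + b v v"

lemma polymap_Psi1: "polymap Psi1"
  unfolding Psi1_def[abs_def]
  by (intro polymap_add polymap_scale polyfun_power polyfun_\<tau> polymap_b polymap_P polymap_id polymap_const)

definition U1 :: "(complex ^ 'n) set" where "U1 = {v. P0 v = 0}"

lemma subspace_U1: "vec.subspace U1"
  by (auto intro!: vec.subspaceI simp: U1_def nf_simps)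

lemma c_in_U1: "c \<in> U1"
  by (simp add: U1_def)

lemma W1_eq: "W1 = {v \<in> U1. \<tau> v = 0}"
proof -
  have "P1 v = v" if "P0 v = 0" "\<tau> v = 0" for v
  proof -
    have "P1 v = \<tau> v *s c + P1 v + P0 v" by (simp add: that)
    also have "\<dots> = v" by (rule decomp[symmetric])
    finally show ?thesis .
  qed
  then show ?thesis
    using W1D(2,3) unfolding U1_def by (intro set_eqI) (auto simp only: mem_Collect_eq W1_def)
qed

lemma dim_U1: "vec.dim U1 = p + 1"
  using dim_subspace_lker[OF subspace_U1 lfun_\<tau> c_in_U1] by (simp add: W1_eq)

lemma Sh_Psi1:
  assumes "v \<in> Sh" "\<tau> v \<noteq> 0"
  shows "v \<in> Psi1 ` U1"
proof -
  \<comment> \<open>A square root is needed because the coordinate of \<open>Psi1 u\<close> along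
    \<open>c\<close> is \<open>\<tau> u ^ 2\<close>.\<close>
  define s where "s = csqrt (\<tau> v)"
  have s: "s ^ 2 = \<tau> v" "s \<noteq> 0" using assms by (auto simp: s_def)
  define u where "u = s *s c + (1 / s) *s P1 v"
  have u: "\<tau> u = s" "P1 u = (1 / s) *s P1 v" "P0 u = 0" "b u u = (1 / s ^ 2) *s b v v"
    by (simp_all add: u_def nf_simps b_simps power2_eq_square)
  have "b v v = \<tau> v *s P0 v" using assms by (simp add: in_Sh)
  then have "b u u = P0 v" using assms by (simp add: u s)
  then have "Psi1 u = \<tau> v *s c + P1 v + P0 v" by (simp add: Psi1_def u s(1)) (simp add: s)
  then have "Psi1 u = v" by (rule trans[OF _ decomp[symmetric]])
  moreover have "u \<in> U1" using u(3) by (simp add: U1_def)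
  ultimately show ?thesis by blast
qed

lemma Psi1_Sh: "Psi1 v \<in> Sh"
proof (cases "\<tau> v = 0")
  case True
  then show ?thesis using E_Sh[OF b_E[of v]] by (simp add: Psi1_def)
next
  case False
  have "\<tau> (Psi1 v) = \<tau> v ^ 2" "P0 (Psi1 v) = b v v" "b (Psi1 v) (Psi1 v) = \<tau> v ^ 2 *s b v v"
    by (simp_all add: Psi1_def nf_simps b_simps power2_eq_square)
  then show ?thesis using False by (intro Sh_if_\<tau>) simp_all
qed

text \<open>An irreducible set not inside \<open>\<tau> = 0\<close> is the closure of its part with
  \<open>\<tau>\<close> nonzero, which is covered by \<open>Psi1\<close> on a space of dimension
  \<open>p + 1\<close>.\<close>

lemma has_chain_Sh_\<tau>:
  assumes Z: "irr Z" "Z \<subseteq> Sh" and v: "v \<in> Z" "\<tau> v \<noteq> 0" and k: "has_chain Z k"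
  shows "k \<le> p + 1"
proof -
  have "Z \<subseteq> zcl (Psi1 ` U1)"
  proof
    fix z assume z: "z \<in> Z"
    show "z \<in> zcl (Psi1 ` U1)"
      unfolding in_zcl
    proof (intro allI impI)
      fix g assume g: "polyfun g" "\<forall>a\<in>Psi1 ` U1. g a = 0"
      have "(\<forall>z\<in>Z. g z = 0) \<or> (\<forall>z\<in>Z. \<tau> z = 0)"
      proof (rule irr_mult[OF Z(1) g(1) lfun_polyfun[OF lfun_\<tau>]])
        fix x assume "x \<in> Z"
        then show "g x * \<tau> x = 0" using g(2) Sh_Psi1[of x] Z(2) by (cases "\<tau> x = 0") auto
      qed
      then show "g z = 0" using z v by blast
    qed
  qed
  then have "has_chain (zcl (Psi1 ` U1)) k" using k has_chain_mono by blast
  then show ?thesis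
    using has_chain_zcl_image_le[OF subspace_U1 polymap_Psi1] dim_U1 by simp
qed

text \<open>Near \<open>y\<close> the equations of \<open>Sh\<close> that are linear in the \<open>W\<^sub>1\<close>-component are solved by Cramer's
  rule, with coefficients depending on the \<open>W\<^sub>0\<close>-component.\<close>

lemma T1_family:
  obtains \<Delta> \<Psi> M where
    "polyfun \<Delta>" "\<Delta> y \<noteq> 0"
    "\<And>y'. \<Delta> y' \<noteq> 0 \<Longrightarrow> vec.dim (T1 y') \<le> vec.dim (T1 y)"
    "\<And>y'. \<Delta> y' \<noteq> 0 \<Longrightarrow> vec.dim (T1 y) \<le> vec.dim {x \<in> W1. M y' x \<in> T1 y}"
    "\<And>x. x \<in> W1 \<Longrightarrow> M y x = x"
    "\<And>y' x. x \<in> T1 y' \<Longrightarrow> M y' x \<in> T1 y"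
    "\<And>h k :: complex ^ 'n \<Rightarrow> complex ^ 'n. polymap h \<Longrightarrow> polymap k \<Longrightarrow> polymap (\<lambda>v. \<Psi> (h v) (k v))"
    "\<And>y' x. \<Delta> y' \<noteq> 0 \<Longrightarrow> x \<in> W1 \<Longrightarrow> M y' x \<in> T1 y \<Longrightarrow> \<exists>\<zeta>\<in>T1 y. \<Psi> y' \<zeta> = x"
    "\<And>y'. vec.subspace {x \<in> W1. M y' x \<in> T1 y}"
proof -
  obtain B0 B where B: "B0 \<subseteq> B" "B0 \<subseteq> T1 y" "B \<subseteq> W1" "vec.independent B" "vec.span B0 = T1 y" "vec.span B = W1"
    "card B0 = vec.dim (T1 y)" "card B = p" "finite B"
    using basis_extend[OF subspace_T1 subspace_W1, of y] by (metis T1_def inf_le1)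
  define C where "C = B - B0"
  have C: "finite C" "vec.independent C" "C \<subseteq> W1" "card C + vec.dim (T1 y) = p"
    using B vec.independent_mono[of B C] card_mono[of B B0] by (auto simp: C_def card_Diff_subset finite_subset)
  \<comment> \<open>Differentials at \<open>y\<close> of equations of \<open>Sh\<close>, composed
    with \<open>P1\<close>. Their common kernel in \<open>W1\<close> is \<open>T1 y\<close>, so a
    complement of \<open>T1 y\<close> has a dual basis among them.\<close>
  define \<Phi> where "\<Phi> = {\<lambda>u. dd g y (P1 u) | g. polyfun g \<and> (\<forall>a\<in>Sh. g a = 0)}"
  have "\<exists>h. \<forall>c\<in>C. h c \<in> \<Phi> \<and> (\<forall>c'\<in>C. h c c' = (if c = c' then 1 else 0))"
  proof (rule dual_basis[OF C(1,2)])
    fix l assume "l \<in> \<Phi>"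
    then show "lfun l" by (auto simp: \<Phi>_def intro!: lfun_compI[OF lfun_dd lmap_P1])
  next
    have "dd (\<lambda>_. 0) y = (\<lambda>_. 0)" by (auto simp: dd_def fun_eq_iff)
    then show "(\<lambda>_. 0) \<in> \<Phi>" unfolding \<Phi>_def by (intro CollectI exI[of _ "\<lambda>_. 0"]) auto
  next
    fix l k assume "l \<in> \<Phi>" "k \<in> \<Phi>"
    then obtain g h where "polyfun g" "polyfun h" "\<forall>a\<in>Sh. g a = 0" "\<forall>a\<in>Sh. h a = 0"
       "l = (\<lambda>u. dd g y (P1 u))" "k = (\<lambda>u. dd h y (P1 u))" by (auto simp: \<Phi>_def)
    then show "(\<lambda>x. l x + k x) \<in> \<Phi>"
      unfolding \<Phi>_def by (intro CollectI exI[of _ "\<lambda>x. g x + h x"]) (simp add: dd_add)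
  next
    fix a l assume "l \<in> \<Phi>"
    then obtain g where "polyfun g" "\<forall>a\<in>Sh. g a = 0" "l = (\<lambda>u. dd g y (P1 u))" by (auto simp: \<Phi>_def)
    then show "(\<lambda>x. a * l x) \<in> \<Phi>"
      unfolding \<Phi>_def by (intro CollectI exI[of _ "\<lambda>x. a * g x"]) (simp add: dd_cmult)
  next
    fix u assume u: "u \<in> vec.span C" "\<And>g. g \<in> \<Phi> \<Longrightarrow> g u = 0"
    have uW: "u \<in> W1" using u(1) C(3) subspace_W1 vec.span_minimal by blast
    have "u \<in> T1 y"
      unfolding T1_def
    proof (intro IntI uW, unfold in_tangent_space, intro allI impI)
      fix g assume "polyfun g" "\<forall>a\<in>Sh. g a = 0"
      then have "(\<lambda>u. dd g y (P1 u)) \<in> \<Phi>" by (auto simp: \<Phi>_def)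
      then show "dd g y u = 0" using u(2)[of "\<lambda>u. dd g y (P1 u)"] W1D(1)[OF uW] by simp
    qed
    then show "u = 0" using span_Int_complement[OF B(4,1)] u(1) B(5) by (simp add: C_def)
  qed
  then obtain h where h: "\<And>c. c \<in> C \<Longrightarrow> h c \<in> \<Phi>"
     "\<And>c c'. c \<in> C \<Longrightarrow> c' \<in> C \<Longrightarrow> h c c' = (if c = c' then 1 else 0)" by blast
  have "\<exists>g. \<forall>c\<in>C. polyfun (g c) \<and> (\<forall>a\<in>Sh. g c a = 0) \<and> h c = (\<lambda>u. dd (g c) y (P1 u))"
    by (rule bchoice) (use h(1) in \<open>auto simp: \<Phi>_def\<close>)
  then obtain g where g: "\<And>c. c \<in> C \<Longrightarrow> polyfun (g c)" "\<And>c a. c \<in> C \<Longrightarrow> a \<in> Sh \<Longrightarrow> g c a = 0"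
     "\<And>c u. c \<in> C \<Longrightarrow> h c u = dd (g c) y (P1 u)" by metis
  have T1_iff: "u \<in> T1 y \<longleftrightarrow> (\<forall>c\<in>C. dd (g c) y u = 0)" if u: "u \<in> W1" for u
  proof
    assume "u \<in> T1 y"
    then show "\<forall>c\<in>C. dd (g c) y u = 0" using g by (auto simp: T1_def in_tangent_space)
  next
    assume z: "\<forall>c\<in>C. dd (g c) y u = 0"
    have "u \<in> vec.span (B0 \<union> C)" using u B(1,6) by (simp add: C_def Un_absorb1)
    then obtain u0 u1 where u01: "u = u0 + u1" "u0 \<in> vec.span B0" "u1 \<in> vec.span C"
      unfolding vec.span_Un by blast
    obtain a where a: "u1 = (\<Sum>c\<in>C. a c *s c)" using u01(3) vec.span_finite[OF C(1)] by auto
    have "a c = 0" if c: "c \<in> C" for c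
    proof -
      have l: "lfun (h c)" using h(1)[OF c] by (auto simp: \<Phi>_def intro!: lfun_compI[OF lfun_dd lmap_P1])
      have "u0 \<in> T1 y" using u01(2) B(5) by simp
      then have "dd (g c) y u0 = 0" using g(1,2)[OF c] by (auto simp: T1_def in_tangent_space)
      moreover have "u0 \<in> W1" using \<open>u0 \<in> T1 y\<close> by (simp add: T1_def)
      ultimately have "h c u0 = 0" using g(3)[OF c] W1D(1) by simp
      moreover have "h c u = 0" using z c g(3)[OF c] W1D(1)[OF u] by simp
      ultimately have "h c u1 = 0" using u01(1) lfun_add[OF l] by simp
      moreover have "h c u1 = (\<Sum>c'\<in>C. if c = c' then a c' else 0)"
        unfolding a lfun_sum[OF l] by (rule sum.cong) (use h(2)[OF c] in \<open>auto simp: lfun_scale[OF l]\<close>)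
      ultimately show ?thesis using c C(1) by simp
    qed
    then have "u1 = 0" using a by simp
    then show "u \<in> T1 y" using u01 B(5) by simp
  qed
  \<comment> \<open>\<open>M y'\<close> modifies the identity so that the chosen differentials at
    \<open>y\<close>, applied to \<open>M y' v\<close>, equal those at \<open>y'\<close> applied to
    \<open>v\<close>. Thus \<open>M y' x \<in> T1 y\<close> is a linear system attached to
    \<open>y'\<close>, which the elements of \<open>T1 y'\<close> satisfy.\<close>
  define M where "M y' v = v + (\<Sum>c\<in>C. (dd (g c) y' (P1 v) - dd (g c) y (P1 v)) *s c)" for y' v
  have lM: "lmap (M y')" for y'
  proof -
    have "lfun (\<lambda>v. M y' v $ i)" for i
    proof -
      have eq: "(\<lambda>v. M y' v $ i) = (\<lambda>v. v $ i + (\<Sum>c\<in>C. c $ i * (dd (g c) y' (P1 v) - dd (g c) y (P1 v))))"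
        unfolding M_def by (intro ext) (simp add: algebra_simps)
      show ?thesis
        unfolding eq using g(1) by (intro lfun_addI lfun_axis lfun_sumI lfun_cmultI lfun_diffI lfun_compI[OF lfun_dd lmap_P1])
    qed
    then show ?thesis by (simp add: lmap_def lfun_def vec_eq_iff)
  qed
  have MW1: "M y' v \<in> W1" if "v \<in> W1" for y' v
    unfolding M_def using that C(3) subspace_W1
    by (intro vec.subspace_add vec.subspace_sum vec.subspace_scale) auto
  have hM: "dd (g c) y (M y' v) = dd (g c) y' v" if v: "v \<in> W1" and c: "c \<in> C" for y' v c
  proof -
    have l: "lfun (dd (g c) y)" using lfun_dd[OF g(1)[OF c]] .
    have \<delta>: "dd (g c) y c' = (if c = c' then 1 else 0)" if "c' \<in> C" for c'
      using h(2)[OF c that] g(3)[OF c, of c'] W1D(1)[of c'] C(3) that by auto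
    have "dd (g c) y (M y' v) = dd (g c) y v + (\<Sum>c'\<in>C. (dd (g c') y' v - dd (g c') y v) * dd (g c) y c')"
      unfolding M_def W1D(1)[OF v] by (simp only: lfun_add[OF l] lfun_sum[OF l] lfun_scale[OF l])
    also have "(\<Sum>c'\<in>C. (dd (g c') y' v - dd (g c') y v) * dd (g c) y c') =
       (\<Sum>c'\<in>C. if c = c' then dd (g c') y' v - dd (g c') y v else 0)"
      by (rule sum.cong) (use \<delta> in auto)
    finally have "dd (g c) y (M y' v) = dd (g c) y v +
       (\<Sum>c'\<in>C. if c = c' then dd (g c') y' v - dd (g c') y v else 0)" .
    then show ?thesis using c C(1) by simp
  qed
  define A where "A y' = (\<chi> i j. M y' (axis j 1) $ i)" for y'
  have A: "A y' *v v = M y' v" for y' v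
    using lfun_expand[OF lmap_nth[OF lM[of y']], of v]
    by (simp add: A_def vec_eq_iff matrix_vector_mult_def mult.commute)
  have pA: "polyfun (\<lambda>v. A (k v) $ i $ j)" if "polymap k" for k :: "complex ^ 'n \<Rightarrow> complex ^ 'n" and i j
    unfolding A_def M_def using that g(1)
    by (auto intro!: polyfun_add polyfun_sum polyfun_mult polyfun_diff polyfun_dd)
  define \<Delta> where "\<Delta> y' = det (A y')" for y'
  have Myy: "M y v = v" for v by (simp add: M_def)
  have "A y = mat 1" unfolding A_def Myy by (simp add: vec_eq_iff mat_def axis_def)
  then have \<Delta>y: "\<Delta> y \<noteq> 0" by (simp add: \<Delta>_def)
  have p\<Delta>: "polyfun \<Delta>" unfolding \<Delta>_def[abs_def] by (intro polyfun_cramer pA polymap_id)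
  \<comment> \<open>Cramer's numerators: \<open>\<Psi> y'\<close> is the adjugate of
    \<open>A y'\<close>, hence polynomial in \<open>y'\<close>, and inverts \<open>M y'\<close> up
    to the factor \<open>\<Delta> y'\<close>.\<close>
  define \<Psi> where "\<Psi> y' \<zeta> = (\<chi> k. det (\<chi> i j. if j = k then \<zeta> $ i else A y' $ i $ j))" for y' \<zeta>
  have p\<Psi>: "polymap (\<lambda>v. \<Psi> (h v) (k v))" if "polymap h" "polymap k" for h k :: "complex ^ 'n \<Rightarrow> complex ^ 'n"
  proof (rule polymapI)
    fix l
    have "polyfun (\<lambda>v. if j = l then k v $ i else A (h v) $ i $ j)" for i j
      using pA[OF that(1)] that(2) by (cases "j = l") auto
    then show "polyfun (\<lambda>v. \<Psi> (h v) (k v) $ l)"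
      unfolding \<Psi>_def by (simp add: polyfun_cramer)
  qed
  have MT1: "M y' x \<in> T1 y" if "x \<in> T1 y'" for y' x
  proof -
    have x: "x \<in> W1" using that by (simp add: T1_def)
    have "dd (g c) y' x = 0" if "c \<in> C" for c
      using \<open>x \<in> T1 y'\<close> g(1,2)[OF that] by (auto simp: T1_def in_tangent_space)
    then show ?thesis using T1_iff[OF MW1[OF x]] hM[OF x] by simp
  qed
  have inj: "inj (M y')" if "\<Delta> y' \<noteq> 0" for y'
  proof -
    have "invertible (A y')" using that by (simp add: \<Delta>_def invertible_det_nz)
    then have "inj ((*v) (A y'))"
      by (simp add: inj_matrix_vector_mult)
    moreover have "(*v) (A y') = M y'" using A by blast
    ultimately show ?thesis by simp
  qed
  show thesis
  proof (rule that[of \<Delta> M \<Psi>])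
    show "polyfun \<Delta>" by (rule p\<Delta>)
    show "\<Delta> y \<noteq> 0" by (rule \<Delta>y)
    show "M y' x \<in> T1 y" if "x \<in> T1 y'" for y' x using MT1[OF that] .
    show "M y x = x" for x by (rule Myy)
    show "polymap (\<lambda>v. \<Psi> (h v) (k v))" if "polymap h" "polymap k" for h k :: "complex ^ 'n \<Rightarrow> complex ^ 'n" using p\<Psi>[OF that] .
    show "vec.dim (T1 y') \<le> vec.dim (T1 y)" if "\<Delta> y' \<noteq> 0" for y'
    proof -
      have "vec.dim (M y' ` T1 y') = vec.dim (T1 y')"
        using lM[of y'] inj[OF that] by (intro vec.dim_image_eq) (auto simp: lmap_iff_linear intro: inj_on_subset)
      then show ?thesis using vec.dim_subset[of "M y' ` T1 y'" "T1 y"] MT1 by auto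
    qed
    have eq: "{x \<in> W1. M y' x \<in> T1 y} = {x \<in> W1. \<forall>l\<in>(\<lambda>c. dd (g c) y') ` C. l x = 0}" for y'
      using T1_iff MW1 hM by auto
    show "vec.subspace {x \<in> W1. M y' x \<in> T1 y}" for y'
      unfolding eq by (rule subspace_lfun_eq_0[OF subspace_W1]) (use lfun_dd g(1) in auto)
    show "vec.dim (T1 y) \<le> vec.dim {x \<in> W1. M y' x \<in> T1 y}" for y'
    proof -
      have "p \<le> vec.dim {x \<in> W1. M y' x \<in> T1 y} + card ((\<lambda>c. dd (g c) y') ` C)"
        unfolding eq by (rule dim_le_lkers[OF _ subspace_W1]) (use C(1) lfun_dd g(1) in auto)
      moreover have "card ((\<lambda>c. dd (g c) y') ` C) \<le> card C" using C(1) by (rule card_image_le)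
      ultimately show ?thesis using C(4) by linarith
    qed
    show "\<exists>\<zeta>\<in>T1 y. \<Psi> y' \<zeta> = x" if d: "\<Delta> y' \<noteq> 0" and x: "x \<in> W1" "M y' x \<in> T1 y" for y' x
    proof (intro bexI)
      let ?\<zeta> = "(1 / \<Delta> y') *s M y' x"
      show "?\<zeta> \<in> T1 y" using x subspace_T1 by (simp add: vec.subspace_scale)
      have d': "det (A y') \<noteq> 0" using d by (simp add: \<Delta>_def)
      have "A y' *v ((1 / \<Delta> y') *s x) = ?\<zeta>" by (simp add: A lmap_scale[OF lM])
      from iffD1[OF cramer[OF d'] this] have "(1 / \<Delta> y') *s x = (\<chi> k. det (\<chi> i j. if j = k then ?\<zeta> $ i else A y' $ i $ j) / det (A y'))"
        .
      then show "\<Psi> y' ?\<zeta> = x" using d by (simp add: \<Psi>_def vec_eq_iff flip: \<Delta>_def)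
    qed
  qed
qed

lemma smooth_E_obtain:
  assumes sm: "\<And>v. v \<in> Sh \<Longrightarrow> v \<noteq> 0 \<Longrightarrow> smooth_point Sh v" and y: "y \<in> E" "y \<noteq> 0"
  obtains Z where "irr Z" "Z \<subseteq> Sh" "y \<in> Z" "has_chain Z (vec.dim (tangent_space Sh y))"
proof -
  \<comment> \<open>Since \<open>y\<close> itself is tangent, the dimension is a successor, and the
    supremum defining the local dimension has a witness.\<close>
  have "y \<in> tangent_space Sh y" using perp_tangent[OF y E_W0[OF y(1)]] y by (simp add: E_def)
  then have "vec.dim (tangent_space Sh y) \<noteq> 0" using y(2) by auto
  then obtain d where d: "vec.dim (tangent_space Sh y) = Suc d" by (cases "vec.dim (tangent_space Sh y)") auto
  show thesis
    using smooth_point_obtain_chain[OF closedin_Sh sm[OF E_Sh[OF y(1)] y(2)] d] that d by metis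
qed

text \<open>Near \<open>y\<close> such a component consists of points \<open>x + y'\<close> with
  \<open>y'\<close> isotropic and \<open>x\<close> solving the system at \<open>y'\<close>, so it
  lies in the closure of an image of the tangent space at \<open>y\<close>. Its chain is as long as
  that tangent space permits, so it fills this closure and contains all such points.\<close>

lemma tau_zero_component:
  assumes y: "y \<in> E" "y \<noteq> 0" and g: "g \<in> E" "Q y g \<noteq> 0"
    and Z: "irr Z" "Z \<subseteq> Sh" "y \<in> Z" "\<And>v. v \<in> Z \<Longrightarrow> \<tau> v = 0"
    and k: "has_chain Z (vec.dim (tangent_space Sh y))"
    and fam: "polyfun \<Delta>" "\<Delta> y \<noteq> 0" "\<And>y' x. x \<in> T1 y' \<Longrightarrow> M y' x \<in> T1 y"
    "\<And>h k :: complex ^ 'n \<Rightarrow> complex ^ 'n. polymap h \<Longrightarrow> polymap k \<Longrightarrow> polymap (\<lambda>v. \<Psi> (h v) (k v))"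
    "\<And>y' x. \<Delta> y' \<noteq> 0 \<Longrightarrow> x \<in> W1 \<Longrightarrow> M y' x \<in> T1 y \<Longrightarrow> \<exists>\<zeta>\<in>T1 y. \<Psi> y' \<zeta> = x"
    and y': "y' \<in> E" "Q y' g \<noteq> 0" "\<Delta> y' \<noteq> 0" "x \<in> W1" "M y' x \<in> T1 y"
  shows "x + y' \<in> Z"
proof -
  let ?U = "tangent_space Sh y"
  define \<Theta> where "\<Theta> v = psi g (P0 v) + \<Psi> (psi g (P0 v)) (P1 v)" for v
  have p\<Theta>: "polymap \<Theta>"
    unfolding \<Theta>_def[abs_def] by (intro polymap_add fam(4)[of "\<lambda>v. psi g (P0 v)" P1] polymap_psi polymap_P polymap_id)
  have img: "x' + y'' \<in> \<Theta> ` ?U"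
    if y'': "y'' \<in> E" "Q y'' g \<noteq> 0" "\<Delta> y'' \<noteq> 0" "x' \<in> W1" "M y'' x' \<in> T1 y" for x' y''
  proof -
    obtain s where s: "\<And>\<alpha>. psi g (s *s (y'' + \<alpha> *s g)) = y''" using psi_surj[OF g(1) y''(1,2)] by metis
    \<comment> \<open>The multiple of \<open>g\<close> makes \<open>z\<close> orthogonal to
      \<open>y\<close>, so that \<open>\<zeta> + z\<close> belongs to the tangent space at
      \<open>y\<close>.\<close>
    define z where "z = s *s (y'' + (- Q y y'' / Q y g) *s g)"
    have zp: "z \<in> W0" "Q y z = 0"
      using y''(1) g subspace_W0
      by (simp_all add: z_def E_def vec.subspace_add vec.subspace_diff vec.subspace_scale Q_simps)
    obtain \<zeta> where \<zeta>: "\<zeta> \<in> T1 y" "\<Psi> y'' \<zeta> = x'" using fam(5)[OF y''(3-5)] by blast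
    have "\<zeta> + z \<in> ?U" unfolding tangent_space_E[OF y] using \<zeta> zp by blast
    moreover have "\<Theta> (\<zeta> + z) = x' + y''"
    proof -
      have "\<zeta> \<in> W1" using \<zeta> by (simp add: T1_def)
      then have "P0 (\<zeta> + z) = z" "P1 (\<zeta> + z) = \<zeta>" using zp by (simp_all add: nf_simps W0D W1D)
      then show ?thesis using s[of "- Q y y'' / Q y g"] \<zeta>(2) by (simp add: \<Theta>_def z_def add.commute)
    qed
    ultimately show ?thesis by (metis image_eqI)
  qed
  have sub: "Z \<subseteq> zcl (\<Theta> ` ?U)"
  proof
    fix z assume z: "z \<in> Z"
    show "z \<in> zcl (\<Theta> ` ?U)"
      unfolding in_zcl
    proof (intro allI impI)
      fix h assume h: "polyfun h" "\<forall>a\<in>\<Theta> ` ?U. h a = 0"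
      let ?k = "\<lambda>v. \<Delta> (P0 v) * Q (P0 v) g"
      have pk: "polyfun ?k"
        by (intro polyfun_mult polyfun_Q polymap_P polymap_id polymap_const polyfun_comp[OF fam(1)])
      have "(\<forall>z\<in>Z. h z = 0) \<or> (\<forall>z\<in>Z. ?k z = 0)"
      proof (rule irr_mult[OF Z(1) h(1) pk])
        fix v assume v: "v \<in> Z"
        show "h v * ?k v = 0"
        proof (cases "?k v = 0")
          case False
          have vS: "v \<in> Sh" using v Z(2) by blast
          then have "P0 v \<in> E" by (simp add: E_def in_Sh)
          moreover have "M (P0 v) (P1 v) \<in> T1 y" using fam(3)[OF Sh_T1[OF vS]] .
          ultimately have "P1 v + P0 v \<in> \<Theta> ` ?U" using False by (intro img) auto
          moreover have "P1 v + P0 v = v"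
            by (rule trans[OF _ decomp[symmetric]]) (simp add: Z(4)[OF v])
          ultimately show ?thesis using h(2) by force
        qed simp
      qed
      moreover have "?k y \<noteq> 0" using fam(2) g(2) W0D(1)[OF E_W0[OF y(1)]] by simp
      ultimately show "h z = 0" using Z(3) z by blast
    qed
  qed
  have irr: "irr (zcl (\<Theta> ` ?U))" by (rule irr_zcl_image[OF subspace_tangent_space p\<Theta>])
  have "Z = zcl (\<Theta> ` ?U)"
  proof (rule ccontr)
    assume "Z \<noteq> zcl (\<Theta> ` ?U)"
    then have "has_chain (zcl (\<Theta> ` ?U)) (Suc (vec.dim ?U))"
      using has_chain_Suc[OF k _ irr] sub by blast
    then show False using has_chain_zcl_image_le[OF subspace_tangent_space p\<Theta>] by fastforce
  qed
  then show ?thesis using img[OF y'] zcl_superset by blast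
qed

lemma b_T1: "x \<in> W1 \<Longrightarrow> x \<in> T1 (b x x)"
proof -
  assume x: "x \<in> W1"
  have "x \<in> tangent_space Sh (b x x)"
  proof (rule tangent_curve)
    fix t
    have "Psi1 (t *s c + x) = b x x + t *s x + t ^ 2 *s c"
      using x by (simp add: Psi1_def nf_simps b_simps W1D add_ac)
    then show "b x x + t *s x + t ^ 2 *s c \<in> Sh" using Psi1_Sh by metis
  qed
  then show ?thesis using x by (simp add: T1_def)
qed

text \<open>A component of full tangent dimension with \<open>\<tau>\<close> not identically zero
  yields the bound by \<open>has_chain_Sh_\<tau>\<close>. One inside \<open>\<tau> = 0\<close> is
  contradictory: at \<open>b x0 x0\<close> it would contain \<open>x0 + b x0 x0\<close>, and at a
  \<open>y\<close> with larger \<open>T1 y\<close> it would contain some \<open>x + y'\<close> with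
  \<open>x\<close> outside \<open>T1 y'\<close>.\<close>

theorem dim_T1_le:
  assumes sm: "\<And>v. v \<in> Sh \<Longrightarrow> v \<noteq> 0 \<Longrightarrow> smooth_point Sh v" and y: "y \<in> E" "y \<noteq> 0"
  shows "vec.dim (T1 y) + r \<le> p + 2"
proof -
  obtain x0 where x0: "x0 \<in> W1" "b x0 x0 \<noteq> 0" using exists_b_nonzero .
  let ?y0 = "b x0 x0"
  have y0: "?y0 \<in> E" "?y0 \<noteq> 0" using b_E x0 by auto
  have case_\<tau>: "vec.dim (T1 y) + r \<le> p + 2"
    if "y \<in> E" "y \<noteq> 0" "irr Z" "Z \<subseteq> Sh" "has_chain Z (vec.dim (tangent_space Sh y))" "v \<in> Z" "\<tau> v \<noteq> 0" for y Z v
    using has_chain_Sh_\<tau>[OF that(3,4,6,7,5)] dim_tangent_space_E[OF that(1,2)] by linarith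
  have le0: "vec.dim (T1 ?y0) + r \<le> p + 2"
  proof -
    obtain Z where Z: "irr Z" "Z \<subseteq> Sh" "?y0 \<in> Z" "has_chain Z (vec.dim (tangent_space Sh ?y0))"
      using smooth_E_obtain[OF sm y0] by blast
    show ?thesis
    proof (cases "\<exists>v\<in>Z. \<tau> v \<noteq> 0")
      case True
      then show ?thesis using case_\<tau>[OF y0 Z(1,2,4)] by blast
    next
      case False
      obtain g where g: "g \<in> E" "Q ?y0 g \<noteq> 0" using exists_isotropic_partner[OF y0 y0] by metis
      obtain \<Delta> \<Psi> M where fam: "polyfun \<Delta>" "\<Delta> ?y0 \<noteq> 0" "\<And>y' x. x \<in> T1 y' \<Longrightarrow> M y' x \<in> T1 ?y0"
        "\<And>h k :: complex ^ 'n \<Rightarrow> complex ^ 'n. polymap h \<Longrightarrow> polymap k \<Longrightarrow> polymap (\<lambda>v. \<Psi> (h v) (k v))"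
        "\<And>y' x. \<Delta> y' \<noteq> 0 \<Longrightarrow> x \<in> W1 \<Longrightarrow> M y' x \<in> T1 ?y0 \<Longrightarrow> \<exists>\<zeta>\<in>T1 ?y0. \<Psi> y' \<zeta> = x"
        and My: "\<And>x. x \<in> W1 \<Longrightarrow> M ?y0 x = x"
        by (rule T1_family[of ?y0]) blast
      have "M ?y0 x0 \<in> T1 ?y0" unfolding My[OF x0(1)] by (rule b_T1[OF x0(1)])
      then have inZ: "x0 + ?y0 \<in> Z"
        using False by (intro tau_zero_component[where M = M and \<Psi> = \<Psi> and \<Delta> = \<Delta>, OF y0 g Z(1-3) _ Z(4) fam y0(1) g(2) fam(2) x0(1)]) blast
      then have "x0 + ?y0 \<in> Sh" "\<tau> (x0 + ?y0) = 0" using Z(2) False by blast+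
      then have "b (x0 + ?y0) (x0 + ?y0) = 0 *s P0 (x0 + ?y0)" using in_Sh[of "x0 + ?y0"] by simp
      then have "b (x0 + ?y0) (x0 + ?y0) = 0" by simp
      then have "b x0 x0 = 0" by (simp add: b_simps b_W0)
      then show ?thesis using x0 by simp
    qed
  qed
  show ?thesis
  proof (cases "vec.dim (T1 y) \<le> vec.dim (T1 ?y0)")
    case True
    then show ?thesis using le0 by simp
  next
    case bigger: False
    obtain Z where Z: "irr Z" "Z \<subseteq> Sh" "y \<in> Z" "has_chain Z (vec.dim (tangent_space Sh y))"
      using smooth_E_obtain[OF sm y] by blast
    show ?thesis
    proof (cases "\<exists>v\<in>Z. \<tau> v \<noteq> 0")
      case True
      then show ?thesis using case_\<tau>[OF y Z(1,2,4)] by blast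
    next
      case False
      obtain g where g: "g \<in> E" "Q y g \<noteq> 0" "Q ?y0 g \<noteq> 0" using exists_isotropic_partner[OF y y0] by metis
      obtain \<Delta> \<Psi> M where fam: "polyfun \<Delta>" "\<Delta> y \<noteq> 0" "\<And>y' x. x \<in> T1 y' \<Longrightarrow> M y' x \<in> T1 y"
        "\<And>h k :: complex ^ 'n \<Rightarrow> complex ^ 'n. polymap h \<Longrightarrow> polymap k \<Longrightarrow> polymap (\<lambda>v. \<Psi> (h v) (k v))"
        "\<And>y' x. \<Delta> y' \<noteq> 0 \<Longrightarrow> x \<in> W1 \<Longrightarrow> M y' x \<in> T1 y \<Longrightarrow> \<exists>\<zeta>\<in>T1 y. \<Psi> y' \<zeta> = x"
        and Mdim: "\<And>y'. \<Delta> y' \<noteq> 0 \<Longrightarrow> vec.dim (T1 y) \<le> vec.dim {x \<in> W1. M y' x \<in> T1 y}"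
        by (rule T1_family[of y]) blast
      obtain \<Delta>0 where \<Delta>0: "polyfun \<Delta>0" "\<Delta>0 ?y0 \<noteq> 0" "\<And>y'. \<Delta>0 y' \<noteq> 0 \<Longrightarrow> vec.dim (T1 y') \<le> vec.dim (T1 ?y0)"
        by (rule T1_family[of ?y0]) blast
      have pp: "polyfun (\<lambda>z. \<Delta> (psi g z))" "polyfun (\<lambda>z. \<Delta>0 (psi g z))" "polyfun (\<lambda>z. Q z g)"
        by (rule polyfun_comp[OF fam(1) polymap_psi[OF polymap_id]], rule polyfun_comp[OF \<Delta>0(1) polymap_psi[OF polymap_id]])
           (rule polyfun_Q[OF polymap_id polymap_const])
      obtain s1 where s1: "\<And>\<alpha>. psi g (s1 *s (y + \<alpha> *s g)) = y" using psi_surj[OF g(1) y(1) g(2)] by metis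
      obtain s2 where s2: "\<And>\<alpha>. psi g (s2 *s (?y0 + \<alpha> *s g)) = ?y0" using psi_surj[OF g(1) y0(1) g(3)] by metis
      \<comment> \<open>Both \<open>y\<close> and \<open>b x0 x0\<close> are values of
        \<open>psi g\<close>, so some value of \<open>psi g\<close> is general for both families at
        once.\<close>
      have "\<exists>z. \<Delta> (psi g z) * \<Delta>0 (psi g z) \<noteq> 0"
      proof (rule ccontr)
        assume "\<not> ?thesis"
        then have "(\<forall>z\<in>UNIV. \<Delta> (psi g z) = 0) \<or> (\<forall>z\<in>UNIV. \<Delta>0 (psi g z) = 0)"
          by (intro polyfun_mult_eq_0_on[OF vec.subspace_UNIV] pp) auto
        then show False using s1[of 0] s2[of 0] fam(2) \<Delta>0(2) by (metis UNIV_I)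
      qed
      then have "\<exists>z. (\<Delta> (psi g z) * \<Delta>0 (psi g z)) * Q z g \<noteq> 0"
      proof (rule contrapos_pp)
        assume "\<not> (\<exists>z. (\<Delta> (psi g z) * \<Delta>0 (psi g z)) * Q z g \<noteq> 0)"
        then have "(\<forall>z\<in>UNIV. \<Delta> (psi g z) * \<Delta>0 (psi g z) = 0) \<or> (\<forall>z\<in>UNIV. Q z g = 0)"
          by (intro polyfun_mult_eq_0_on[OF vec.subspace_UNIV] polyfun_mult pp) auto
        then show "\<not> (\<exists>z. \<Delta> (psi g z) * \<Delta>0 (psi g z) \<noteq> 0)" using g(2) by blast
      qed
      then obtain z where z: "\<Delta> (psi g z) \<noteq> 0" "\<Delta>0 (psi g z) \<noteq> 0" "Q z g \<noteq> 0" by auto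
      let ?y' = "psi g z"
      have y': "?y' \<in> E" "Q ?y' g \<noteq> 0" using psi_E[OF g(1)] Q_psi[OF g(1), of z] z by simp_all
      \<comment> \<open>At \<open>?y'\<close> the space \<open>T1\<close> is at most as large as at
        \<open>b x0 x0\<close>, whereas the linear system has at least as many solutions as at
        \<open>y\<close>.\<close>
      have "\<not> {x \<in> W1. M ?y' x \<in> T1 y} \<subseteq> T1 ?y'"
        using vec.dim_subset[of "{x \<in> W1. M ?y' x \<in> T1 y}" "T1 ?y'"] Mdim[OF z(1)] \<Delta>0(3)[OF z(2)] bigger
        by linarith
      then obtain x where x: "x \<in> W1" "M ?y' x \<in> T1 y" "x \<notin> T1 ?y'" by blast
      have "x + ?y' \<in> Z"
        using False by (intro tau_zero_component[where M = M and \<Psi> = \<Psi> and \<Delta> = \<Delta>, OF y g(1,2) Z(1-3) _ Z(4) fam y' z(1) x(1,2)]) blast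
      then have "P1 (x + ?y') \<in> T1 (P0 (x + ?y'))" using Sh_T1 Z(2) by blast
      then have "x \<in> T1 ?y'" using x(1) E_W0[OF y'(1)] by (simp add: nf_simps W0D W1D)
      then show ?thesis using x(3) by simp
    qed
  qed
qed

end

section \<open>The structure of the quadratic map\<close>

locale smooth_normal_form = normal_form f \<tau> c P1 P0 b Q
  for f :: "complex ^ 'n::finite \<Rightarrow> complex ^ 'n \<Rightarrow> complex ^ 'n \<Rightarrow> complex" and \<tau> c P1 P0 b Q +
  assumes smooth: "v \<in> Sh \<Longrightarrow> v \<noteq> 0 \<Longrightarrow> smooth_point Sh v"
begin

definition phi :: "complex ^ 'n \<Rightarrow> complex ^ 'n \<Rightarrow> complex ^ 'n \<Rightarrow> complex" where
  "phi y u w = Q (b u w) y"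

lemma phi_sym: "phi y u w = phi y w u"
  by (simp add: phi_def b_sym[of u w])

lemma lfun_phi: "lfun (phi y u)" "lfun (\<lambda>u. phi y u w)" "lfun (\<lambda>y. phi y u w)"
  by (simp_all add: lfun_def phi_def b_simps Q_simps)

lemma phi_P1 [simp]: "phi y (P1 u) w = phi y u w" "phi y u (P1 w) = phi y u w"
  by (simp_all add: phi_def)

lemmas phi_simps =
  lfun_add[OF lfun_phi(1)] lfun_scale[OF lfun_phi(1)] lfun_0[OF lfun_phi(1)] lfun_diff[OF lfun_phi(1)]
  lfun_add[OF lfun_phi(2)] lfun_scale[OF lfun_phi(2)] lfun_0[OF lfun_phi(2)] lfun_diff[OF lfun_phi(2)]
  lfun_add[OF lfun_phi(3)] lfun_scale[OF lfun_phi(3)] lfun_0[OF lfun_phi(3)] lfun_diff[OF lfun_phi(3)]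

lemma all_W1_phi: "(\<forall>w\<in>W1. phi y u w = 0) \<longleftrightarrow> (\<forall>w. phi y u w = 0)"
  by (metis P1_in phi_P1(2))

definition K :: "complex ^ 'n \<Rightarrow> (complex ^ 'n) set" where "K y = {u \<in> W1. \<forall>w. phi y u w = 0}"
definition N :: "complex ^ 'n \<Rightarrow> (complex ^ 'n) set" where "N x = {u \<in> W1. b x u = 0}"
text \<open>The orthogonal complement in \<open>W0\<close> of the image of \<open>b x\<close>. For
  \<open>x\<close> in \<open>W1\<close> and \<open>z\<close> in \<open>W0\<close>,
  \<open>z \<in> J x\<close> is the same incidence as \<open>x \<in> K z\<close>, seen from the
  other side.\<close>

definition J :: "complex ^ 'n \<Rightarrow> (complex ^ 'n) set" where "J x = {z \<in> W0. \<forall>u. Q (b x u) z = 0}"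

lemma subspace_K: "vec.subspace (K y)"
  unfolding K_def using subspace_W1 by (auto intro!: vec.subspaceI simp: vec.subspace_0 vec.subspace_add vec.subspace_scale phi_simps)

lemma subspace_N: "vec.subspace (N x)"
  unfolding N_def using subspace_W1 by (auto intro!: vec.subspaceI simp: vec.subspace_0 vec.subspace_add vec.subspace_scale b_simps)

lemma subspace_J: "vec.subspace (J x)"
  unfolding J_def using subspace_W0 by (auto intro!: vec.subspaceI simp: vec.subspace_0 vec.subspace_add vec.subspace_scale Q_simps)

lemma dim_phi_perp:
  assumes "vec.subspace M"
  shows "p + vec.dim {m \<in> M. \<forall>w. phi y m w = 0} = vec.dim M + vec.dim {v \<in> W1. \<forall>m\<in>M. phi y v m = 0}"
proof -
  have "{m \<in> M. \<forall>v\<in>W1. phi y v m = 0} = {m \<in> M. \<forall>w. phi y m w = 0}"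
    using all_W1_phi phi_sym by auto
  then show ?thesis
    using dim_pairing[of "phi y", OF lfun_phi(2) lfun_phi(1) subspace_W1 assms] by simp
qed

text \<open>Both \<open>p - dim N x\<close> and \<open>r - dim J x\<close> are the rank of the
  pairing \<open>Q (b x u) z\<close> of \<open>W1\<close> with \<open>W0\<close>.\<close>

lemma dim_N_J: "p + vec.dim (J x) = r + vec.dim (N x)"
proof -
  have "{z \<in> W0. \<forall>u\<in>W1. Q (b x u) z = 0} = J x"
    unfolding J_def by (metis (no_types, lifting) P1_in b_P1_2)
  moreover have "{u \<in> W1. \<forall>z\<in>W0. Q (b x u) z = 0} = N x"
    unfolding N_def using Q_nondegenerate_W0[OF b_in] by (auto simp: Q_simps)
  ultimately show ?thesis
    using dim_pairing[of "\<lambda>u z. Q (b x u) z", OF _ lfun_Q subspace_W1 subspace_W0] lfun_compI[OF lfun_Q' lmap_b]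
    by simp
qed

text \<open>At \<open>t ^ 2 c + t x + b x x\<close> with \<open>t\<close> nonzero,
  \<open>b x n = 0\<close> allows a curve in direction \<open>n\<close> to be corrected within
  \<open>W0\<close> at second order. The vanishing of the differentials on \<open>n\<close> is
  polynomial in \<open>t\<close> and extends to \<open>t = 0\<close>.\<close>

lemma N_T1:
  assumes x: "x \<in> W1" and n: "n \<in> N x"
  shows "n \<in> T1 (b x x)"
proof -
  have nW: "n \<in> W1" and bn: "b x n = 0" "b n x = 0" using n b_sym[of n x] by (simp_all add: N_def)
  have "n \<in> tangent_space Sh (b x x)"
    unfolding in_tangent_space
  proof (intro allI impI)
    fix g assume g: "polyfun g" "\<forall>a\<in>Sh. g a = 0"
    define h where "h v = \<tau> v ^ 2 *s c + \<tau> v *s x + b x x" for v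
    have ph: "polymap h"
      unfolding h_def[abs_def] by (intro polymap_add polymap_scale polyfun_power polyfun_\<tau> polymap_id polymap_const)
    have z: "dd g (h v) n = 0" if v: "\<tau> v \<noteq> 0" for v
    proof -
      let ?e = "\<tau> v"
      have "n \<in> tangent_space Sh (h v)"
      proof (rule tangent_curve)
        fix t
        define u where "u = h v + t *s n + t ^ 2 *s ((1 / ?e ^ 2) *s b n n)"
        have "\<tau> u = ?e ^ 2" "P0 u = b x x + (t ^ 2 / ?e ^ 2) *s b n n"
          using x nW by (simp_all add: u_def h_def nf_simps W1D)
        moreover have "b u u = ?e ^ 2 *s b x x + t ^ 2 *s b n n"
          using bn by (simp add: u_def h_def b_simps power2_eq_square)
        ultimately have "u \<in> Sh" using v by (intro Sh_if_\<tau>) (simp_all add: vec.scale_right_distrib)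
        then show "h v + t *s n + t ^ 2 *s ((1 / ?e ^ 2) *s b n n) \<in> Sh" by (simp add: u_def)
      qed
      then show ?thesis using g by (simp add: in_tangent_space)
    qed
    have "dd g (h 0) n = 0"
    proof (rule polyfun_eq_0_dense[OF vec.subspace_UNIV _ lfun_polyfun[OF lfun_\<tau>], of "\<lambda>v. dd g (h v) n" c])
      show "polyfun (\<lambda>v. dd g (h v) n)" using g(1) ph by (intro polyfun_dd polymap_const)
    qed (use z in auto)
    then show "dd g (b x x) n = 0" by (simp add: h_def nf_simps)
  qed
  then show ?thesis using nW by (simp add: T1_def)
qed

lemma dim_N_less:
  assumes x: "x \<in> W1" "b x x \<noteq> 0"
  shows "vec.dim (N x) + 1 + r \<le> p + 2"
proof -
  have "x \<notin> vec.span (N x)"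
    using x(2) subspace_N by (simp add: vec.span_eq_iff[THEN iffD2]) (simp add: N_def)
  then have "vec.dim (insert x (N x)) = vec.dim (N x) + 1" by (simp add: vec.dim_insert)
  moreover have "vec.dim (insert x (N x)) \<le> vec.dim (T1 (b x x))"
    using N_T1[OF x(1)] b_T1[OF x(1)] by (intro vec.dim_subset) auto
  ultimately show ?thesis using dim_T1_le[OF smooth b_E x(2)] by simp
qed

text \<open>Smoothness bounds \<open>N x\<close>, hence bounds the dimension of \<open>J x\<close>
  by 1, and \<open>b x x\<close> lies in \<open>J x\<close>.\<close>

lemma J_eq:
  assumes x: "x \<in> W1" "b x x \<noteq> 0"
  shows "J x = range (\<lambda>a. a *s b x x)" and "vec.dim (N x) + r = p + 1"
proof -
  have J1: "vec.dim (J x) \<le> 1" using dim_N_J[of x] dim_N_less[OF x] by linarith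
  have bJ: "b x x \<in> J x" using Q_b_b_diag[of x] Q_sym by (simp add: J_def)
  have sub: "vec.span {b x x} \<subseteq> J x" using bJ subspace_J by (intro vec.span_minimal) auto
  have d: "vec.dim (vec.span {b x x}) = 1" using x(2) by simp
  have "vec.span {b x x} = J x"
    by (rule vec.subspace_dim_equal[OF vec.subspace_span subspace_J sub]) (use d J1 in simp)
  then show "J x = range (\<lambda>a. a *s b x x)" by (auto simp: vec.span_singleton)
  have "vec.dim (J x) = 1" using J1 d vec.dim_subset[OF sub] by linarith
  then show "vec.dim (N x) + r = p + 1" using dim_N_J[of x] by linarith
qed

text \<open>If \<open>u\<close> is in the radical of \<open>phi y\<close>, then \<open>y\<close>
  lies in \<open>J u\<close>, which is the line of \<open>b u u\<close> when that vector is
  nonzero.\<close>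

lemma b_K:
  assumes u: "u \<in> K y" and y: "y \<in> E" "y \<noteq> 0"
  obtains a where "b u u = a *s y"
proof (cases "b u u = 0")
  case True
  then show ?thesis using that[of 0] by simp
next
  case False
  have uW: "u \<in> W1" using u by (simp add: K_def)
  have "y \<in> J u" using u E_W0[OF y(1)] by (simp add: K_def J_def phi_def)
  then obtain a where a: "y = a *s b u u" using J_eq(1)[OF uW False] by auto
  then have "a \<noteq> 0" using y by auto
  then have "b u u = (1 / a) *s y" using a by simp
  then show ?thesis by (rule that)
qed

lemma b_K2:
  assumes uv: "u \<in> K y" "v \<in> K y" and y: "y \<in> E" "y \<noteq> 0"
  obtains a where "b u v = a *s y"
proof -
  obtain a1 where a1: "b u u = a1 *s y" using b_K[OF uv(1) y] .
  obtain a2 where a2: "b v v = a2 *s y" using b_K[OF uv(2) y] .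
  obtain a3 where a3: "b (u + v) (u + v) = a3 *s y"
    using b_K[OF _ y] vec.subspace_add[OF subspace_K uv] by metis
  have "2 *s b u v = (a3 - a1 - a2) *s y"
    using a3 b_polar[of u v] by (simp add: a1 a2 vec_eq_iff algebra_simps)
  then have "b u v = ((a3 - a1 - a2) / 2) *s y" by (simp add: vec_eq_iff field_simps)
  then show thesis by (rule that)
qed

text \<open>By \<open>b_K\<close> the curve \<open>y + t u + t ^ 2 a c\<close> stays in
  \<open>Sh\<close>, so the radical of \<open>phi y\<close> is tangent at \<open>y\<close>.\<close>

lemma dim_K_le:
  assumes y: "y \<in> E" "y \<noteq> 0"
  shows "vec.dim (K y) + r \<le> p + 2"
proof -
  have "K y \<subseteq> T1 y"
  proof
    fix u assume u: "u \<in> K y"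
    then have uW: "u \<in> W1" by (simp add: K_def)
    obtain a where a: "b u u = a *s y" using b_K[OF u y] .
    have "u \<in> tangent_space Sh y"
    proof (rule tangent_curve)
      fix t
      define x where "x = y + t *s u + t ^ 2 *s (a *s c)"
      have yW: "y \<in> W0" using y by (simp add: E_def)
      have Qu: "Q u w = 0" "Q w u = 0" for w
        using Q_P1(1)[of u w] Q_P1(2)[of w u] W1D(1)[OF uW] by simp_all
      have x: "\<tau> x = t ^ 2 * a" "P0 x = y" "\<And>w. b x w = t *s b u w" "\<And>w. b w x = t *s b w u"
        "\<And>w. Q x w = Q y w" "\<And>w. Q w x = Q w y"
        using yW uW Qu
        by (simp_all add: x_def nf_simps b_simps Q_simps W1D W0D b_W0)
      have "x \<in> Sh"
        unfolding in_Sh x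
      proof (intro conjI allI)
        show "Q y y = 0" using y by (simp add: E_def)
        show "(t ^ 2 * a) *s y = t *s (t *s b u u)" by (simp add: a power2_eq_square)
        show "Q (t *s b u w) y = 0" for w using u by (simp add: K_def phi_def Q_simps)
      qed
      then show "y + t *s u + t ^ 2 *s (a *s c) \<in> Sh" by (simp add: x_def)
    qed
    then show "u \<in> T1 y" using uW by (simp add: T1_def)
  qed
  then show ?thesis using vec.dim_subset[of "K y" "T1 y"] dim_T1_le[OF smooth y] by simp
qed

text \<open>The radical contains \<open>x\<close> and \<open>N x\<close>, which together already
  reach the maximal dimension.\<close>

lemma dim_K_b:
  assumes x: "x \<in> W1" "b x x \<noteq> 0"
  shows "vec.dim (K (b x x)) + r = p + 2"
proof -
  have "x \<notin> vec.span (N x)"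
    using x(2) subspace_N by (simp add: vec.span_eq_iff[THEN iffD2]) (simp add: N_def)
  then have "vec.dim (insert x (N x)) = vec.dim (N x) + 1" by (simp add: vec.dim_insert)
  moreover have "insert x (N x) \<subseteq> K (b x x)"
  proof
    fix u assume u: "u \<in> insert x (N x)"
    have "phi (b x x) u w = 0" for w
    proof (cases "u = x")
      case True
      then show ?thesis using Q_b_b_diag[of x w] Q_sym[of "b x w"] by (simp add: phi_def)
    next
      case False
      then have "b x u = 0" using u by (simp add: N_def)
      then show ?thesis
        using Q_b_b_quadratic[of x u w] Q_sym[of "b u w" "b x x"] by (simp add: phi_def Q_simps)
    qed
    then show "u \<in> K (b x x)" using u x(1) by (auto simp: K_def N_def)
  qed
  then have "vec.dim (insert x (N x)) \<le> vec.dim (K (b x x))" by (rule vec.dim_subset)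
  ultimately show ?thesis using J_eq(2)[OF x] dim_K_le[OF b_E x(2)] by linarith
qed

text \<open>Since \<open>Q\<close> is not a hyperbolic plane, some vector of \<open>W0\<close> keeps
  a nonzero part after its components along \<open>b x0 x0\<close> and an isotropic partner are
  removed.\<close>

lemma r_ge_3: "3 \<le> r"
proof -
  obtain x0 where x0: "x0 \<in> W1" "b x0 x0 \<noteq> 0" using exists_b_nonzero .
  let ?y = "b x0 x0"
  obtain g where g: "g \<in> E" "Q ?y g \<noteq> 0" using exists_isotropic_partner[OF b_E x0(2) b_E x0(2)] by metis
  obtain z where z: "Q z z * Q ?y g \<noteq> 2 * Q z ?y * Q z g" using not_hyperbolic_plane[OF b_E g] by blast
  let ?V = "{z \<in> W0. Q ?y z = 0}"
  let ?V' = "{z \<in> ?V. Q g z = 0}"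
  have yV: "?y \<in> ?V" "Q g ?y \<noteq> 0" using b_E[of x0] g(2) Q_sym by (simp_all add: E_def)
  have d: "r = vec.dim ?V + 1" "vec.dim ?V = vec.dim ?V' + 1"
    using dim_perp[OF b_in x0(2)] dim_subspace_lker[OF subspace_perp lfun_Q yV] by auto
  define z' where "z' = P0 z - (Q z g / Q ?y g) *s ?y - (Q z ?y / Q ?y g) *s g"
  have "z' \<in> ?V'"
    using g b_E[of x0] subspace_W0
    by (simp add: z'_def E_def vec.subspace_diff vec.subspace_scale Q_simps Q_sym[of g ?y] Q_sym[of g z] Q_sym[of ?y z])
  moreover have "z' \<noteq> 0"
  proof
    assume "z' = 0"
    then have "P0 z = (Q z g / Q ?y g) *s ?y + (Q z ?y / Q ?y g) *s g" by (simp add: z'_def algebra_simps)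
    then have "Q z z = Q z ((Q z g / Q ?y g) *s ?y + (Q z ?y / Q ?y g) *s g)" using Q_P0''[of z z] by simp
    then have "Q z z * Q ?y g = 2 * Q z ?y * Q z g" using g(2) by (simp add: Q_simps field_simps)
    then show False using z by simp
  qed
  ultimately have "vec.dim ?V' \<noteq> 0" by auto
  then show ?thesis using d by linarith
qed

text \<open>Otherwise \<open>phi y\<close> vanishes and its radical is all of \<open>W1\<close>, too
  large for \<open>dim_K_le\<close> since \<open>r \<ge> 3\<close>.\<close>

lemma exists_transversal:
  assumes y: "y \<in> E" "y \<noteq> 0"
  obtains x where "x \<in> W1" "Q y (b x x) \<noteq> 0" "b x x \<noteq> 0"
proof -
  have "\<exists>x. Q y (b x x) \<noteq> 0"
  proof (rule ccontr)
    assume "\<not> ?thesis"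
    then have z: "Q y (b x x) = 0" for x by simp
    have "phi y u w = 0" for u w
    proof -
      have "Q y (b (u + w) (u + w)) = Q y (b u u) + 2 * Q y (b u w) + Q y (b w w)"
        by (simp add: b_polar Q_simps)
      then show ?thesis using z Q_sym by (simp add: phi_def)
    qed
    then have "K y = W1" by (simp add: K_def)
    then show False using dim_K_le[OF y] r_ge_3 by simp
  qed
  then obtain x where "Q y (b (P1 x) (P1 x)) \<noteq> 0" by auto
  then show thesis by (intro that[of "P1 x"]) (auto simp: Q_simps)
qed

lemma dim_span_insert:
  assumes "vec.subspace V" "s \<notin> V"
  shows "vec.dim (vec.span (insert s V)) = vec.dim V + 1"
proof -
  have "vec.span V = V" by (rule vec.span_eq_iff[THEN iffD2, OF assms(1)])
  then have "s \<notin> vec.span V" using assms(2) by (rule ssubst)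
  then show ?thesis by (simp add: vec.dim_insert)
qed

lemma phi_span_eq_0:
  assumes "\<And>u v. u \<in> A \<Longrightarrow> v \<in> B \<Longrightarrow> phi y u v = 0" "u \<in> vec.span A" "v \<in> vec.span B"
  shows "phi y u v = 0"
proof -
  have "phi y u v = 0" if "u \<in> A" for u
    by (rule span_lfun_eq_0[OF lfun_phi(1) _ assms(3)]) (rule assms(1)[OF that])
  then show ?thesis using span_lfun_eq_0[OF lfun_phi(2) _ assms(2)] by blast
qed

text \<open>The orthogonal complement of \<open>M\<close> has dimension
  \<open>p - dim M + dim (M \<inter> K y)\<close>.\<close>

lemma isotropic_dim_le:
  assumes "vec.subspace M" "M \<subseteq> W1" "M' \<subseteq> W1" "\<And>u v. u \<in> M \<Longrightarrow> v \<in> M' \<Longrightarrow> phi y u v = 0"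
  shows "vec.dim M + vec.dim M' \<le> p + vec.dim (K y)"
proof -
  have "phi y v m = 0" if "v \<in> M'" "m \<in> M" for v m
    using assms(4)[OF that(2,1)] phi_sym[of y m v] by simp
  then have "vec.dim M' \<le> vec.dim {v \<in> W1. \<forall>m\<in>M. phi y v m = 0}"
    using assms(3) by (intro vec.dim_subset) blast
  moreover have "vec.dim {m \<in> M. \<forall>w. phi y m w = 0} \<le> vec.dim (K y)"
    using assms(2) by (intro vec.dim_subset) (auto simp: K_def)
  ultimately show ?thesis using dim_phi_perp[OF assms(1), of y] by linarith
qed

lemma b_nonzero:
  assumes "x \<in> W1" "x \<noteq> 0"
  obtains s where "s \<in> W1" "b x s \<noteq> 0"
proof -
  have "\<exists>s. b x s \<noteq> 0"
  proof (rule ccontr)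
    assume "\<not> ?thesis"
    then have z: "b x s = 0" for s by simp
    have Qx: "Q x w = 0" "Q w x = 0" for w using Q_P1(1)[of x w] Q_P1(2)[of w x] W1D(1)[OF assms(1)] by simp_all
    have "f x v w = 0" for v w
    proof -
      have "3 * f x v w = 0" unfolding f_normal using W1D(3)[OF assms(1)] z Qx by (simp add: Q_simps)
      then show ?thesis by simp
    qed
    then show False using f_nondegenerate assms(2) by blast
  qed
  then obtain s where "b x (P1 s) \<noteq> 0" by auto
  then show thesis by (intro that[of "P1 s"]) simp_all
qed

section \<open>Vectors of \<open>W1\<close> on which the quadratic map vanishes\<close>

context
  fixes x :: "complex ^ 'n"
  assumes x: "x \<in> W1" "x \<noteq> 0" "b x x = 0"
begin

text \<open>The derivative of the quadratic map at \<open>x\<close>; its values are isotropic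
  because \<open>Q (b x s) (b x s)\<close> is a multiple of
  \<open>Q (b x x) (b s s)\<close>.\<close>

lemma b_x_E: "2 *s b x s \<in> E"
  using Q_b_b_quadratic[of x s s] x(3) subspace_W0
  by (simp add: E_def vec.subspace_scale Q_simps)

lemma phi_N:
  assumes "n \<in> N x"
  shows "phi (2 *s b x s) n n' = - phi (2 *s b x n') n s" and "phi (2 *s b x s) n s = 0"
proof -
  have bn: "b x n = 0" "b n x = 0" using assms b_sym[of n x] by (simp_all add: N_def)
  have "Q (b n n') (b x s) + Q (b n x) (b n' s) + Q (b n s) (b n' x) = 0"
    using Q_b_b[of n n' x s] by simp
  then show 1: "phi (2 *s b x s) n n' = - phi (2 *s b x n') n s"
    using bn by (simp add: phi_def Q_simps b_sym[of n' x] eq_neg_iff_add_eq_0 flip: distrib_left)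
  have "Q (b n s) (b x s) + Q (b n x) (b s s) + Q (b n s) (b s x) = 0"
    using Q_b_b[of n s x s] by simp
  then show "phi (2 *s b x s) n s = 0"
    using bn by (simp add: phi_def Q_simps b_sym[of s x])
qed

lemma phi_N_N:
  assumes "n \<in> N x" "n' \<in> N x"
  shows "phi (2 *s b x s) n n' = 0"
  using phi_N(1)[OF assms(1), of s n'] assms(2) by (simp add: N_def phi_simps)

lemma phi_s_s: "phi (2 *s b x s) s s = 0"
  using Q_b_b_diag[of s x] by (simp add: phi_def Q_simps b_sym[of s x])

lemma insert_isotropic:
  assumes "s \<in> W1" "u \<in> vec.span (insert s (N x))" "v \<in> vec.span (insert s (N x))"
  shows "phi (2 *s b x s) u v = 0"
  using phi_N(2) phi_N_N phi_s_s phi_sym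
  by (intro phi_span_eq_0[OF _ assms(2,3)]) (metis insert_iff)

lemma span_insert_W1: "s \<in> W1 \<Longrightarrow> vec.span (insert s (N x)) \<subseteq> W1"
  using subspace_W1 by (intro vec.span_minimal) (auto simp: N_def)

lemma not_in_N: "s \<in> W1 \<Longrightarrow> 2 *s b x s \<noteq> 0 \<Longrightarrow> s \<notin> N x"
  by (auto simp: N_def)

text \<open>The span of \<open>s\<close> and \<open>N x\<close> is isotropic for
  \<open>phi (2 b x s)\<close>, so the bound on radicals gives \<open>2 dim J x \<le> r\<close>.
  Conversely the image of \<open>b x\<close> is isotropic, hence contained in its complement
  \<open>J x\<close>.\<close>

lemma J_range: "J x = range (b x)" and r_eq: "r = 2 * vec.dim (J x)"
proof -
  obtain s where s: "s \<in> W1" "b x s \<noteq> 0" using b_nonzero[OF x(1,2)] .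
  let ?y = "2 *s b x s"
  have y: "?y \<in> E" "?y \<noteq> 0" using b_x_E s by auto
  have "vec.dim (vec.span (insert s (N x))) + vec.dim (vec.span (insert s (N x))) \<le> p + vec.dim (K ?y)"
    by (rule isotropic_dim_le[OF vec.subspace_span span_insert_W1 span_insert_W1])
       (use s insert_isotropic in auto)
  then have 1: "2 * vec.dim (J x) \<le> r"
    using dim_span_insert[OF subspace_N not_in_N[OF s(1) y(2)]] dim_K_le[OF y] dim_N_J[of x] by linarith
  have sI: "vec.subspace (range (b x))"
  proof (rule vec.subspaceI)
    show "0 \<in> range (b x)" using lmap_0[OF lmap_b, of x] by (rule range_eqI[OF sym])
    fix u v a assume "u \<in> range (b x)" "v \<in> range (b x)"
    then obtain u' v' where "u = b x u'" "v = b x v'" by blast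
    then show "u + v \<in> range (b x)" "a *s u \<in> range (b x)"
      using lmap_add[OF lmap_b, of x u' v'] lmap_scale[OF lmap_b, of x a u'] by (simp_all add: range_eqI[OF sym])
  qed
  have "r + vec.dim {m \<in> range (b x). \<forall>v\<in>W0. Q v m = 0} = vec.dim (range (b x)) + vec.dim {v \<in> W0. \<forall>m\<in>range (b x). Q v m = 0}"
    using dim_pairing[of Q, OF lfun_Q' lfun_Q subspace_W0 sI] .
  moreover have "{m \<in> range (b x). \<forall>v\<in>W0. Q v m = 0} \<subseteq> {0}"
    using Q_nondegenerate_W0[OF b_in] Q_sym by auto
  then have "vec.dim {m \<in> range (b x). \<forall>v\<in>W0. Q v m = 0} = 0" by simp
  moreover have "{v \<in> W0. \<forall>m\<in>range (b x). Q v m = 0} = J x"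
    using Q_sym by (auto simp: J_def)
  ultimately have d: "r = vec.dim (range (b x)) + vec.dim (J x)" by simp
  have sub: "range (b x) \<subseteq> J x"
    using Q_b_b_quadratic[of x] x(3) by (auto simp: J_def Q_simps)
  have le: "vec.dim (range (b x)) \<le> vec.dim (J x)" using sub by (rule vec.dim_subset)
  then show "r = 2 * vec.dim (J x)" using 1 d by linarith
  have "range (b x) = J x"
    by (rule vec.subspace_dim_equal[OF sI subspace_J sub]) (use 1 d in linarith)
  then show "J x = range (b x)" by simp
qed

text \<open>If the kernel of \<open>phi y\<close> were contained in \<open>N x\<close>, the determinant of the pencil \<open>phi\<close> on the
  two-dimensional quotient of the orthogonal complement of \<open>N x\<close> by \<open>N x\<close> would be minus the square of
  a linear form, so \<open>phi\<close> would drop rank at a zero of that linear form.\<close>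

lemma K_not_subset_N:
  assumes s: "s \<in> W1" and y0: "2 *s b x s \<noteq> 0"
  shows "\<not> K (2 *s b x s) \<subseteq> N x"
proof
  let ?y = "2 *s b x s" and ?j = "vec.dim (J x)"
  assume KN: "K ?y \<subseteq> N x"
  have y: "?y \<in> E" by (rule b_x_E)
  let ?M = "vec.span (insert s (N x))"
  have sN: "s \<notin> N x" by (rule not_in_N[OF s y0])
  have dM: "vec.dim ?M = vec.dim (N x) + 1" by (rule dim_span_insert[OF subspace_N sN])
  have "vec.dim ?M + vec.dim ?M \<le> p + vec.dim (K ?y)"
    by (rule isotropic_dim_le[OF vec.subspace_span span_insert_W1 span_insert_W1])
       (use s insert_isotropic in auto)
  then have dK: "vec.dim (K ?y) + r = p + 2"
    using dM dim_K_le[OF y y0] dim_N_J[of x] r_eq by linarith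
  let ?Np = "{v \<in> W1. \<forall>m\<in>N x. phi ?y v m = 0}"
  have Kint: "{m \<in> X. \<forall>w. phi ?y m w = 0} = K ?y" if "N x \<subseteq> X" "X \<subseteq> W1" for X
    using that KN by (auto simp: K_def)
  have NW: "N x \<subseteq> W1" by (auto simp: N_def)
  have dNp: "vec.dim ?Np = vec.dim (N x) + 2"
    using dim_phi_perp[OF subspace_N, of x ?y] Kint[OF order_refl NW] dK dim_N_J[of x] r_eq by simp
  have sNp: "vec.subspace ?Np"
    using subspace_lfun_eq_0[OF subspace_W1, of "(\<lambda>m v. phi ?y v m) ` N x"] lfun_phi(2) by auto
  have NM: "N x \<subseteq> ?M" "s \<in> ?M" by (auto intro: vec.span_base)
  have MNp: "?M \<subseteq> ?Np"
    using insert_isotropic[OF s] span_insert_W1[OF s] NM by blast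
  have "\<not> ?Np \<subseteq> ?M" using vec.dim_subset[of ?Np ?M] dNp dM by auto
  then obtain s' where s': "s' \<in> ?Np" "s' \<notin> ?M" by blast
  have s'W: "s' \<in> W1" and s'N: "\<And>n. n \<in> N x \<Longrightarrow> phi ?y n s' = 0" using s' phi_sym by auto
  let ?M2 = "vec.span (insert s' ?M)"
  have dM2: "vec.dim ?M2 = vec.dim (N x) + 2"
    using dim_span_insert[OF vec.subspace_span s'(2)] dM by simp
  have M2Np: "?M2 = ?Np"
  proof (rule vec.subspace_dim_equal[OF vec.subspace_span sNp])
    show "?M2 \<subseteq> ?Np" using s'(1) MNp sNp by (intro vec.span_minimal) auto
  qed (use dM2 dNp in simp)
  \<comment> \<open>On the quotient with basis \<open>s\<close>, \<open>s'\<close> the form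
    \<open>phi ?y\<close> has matrix entries \<open>0, a, d\<close>; by \<open>Q_b_b\<close> the
    form of \<open>2 b x s'\<close> has entries \<open>- 2 a, - d / 2, 0\<close>.\<close>
  define a where "a = phi ?y s s'"
  define d where "d = phi ?y s' s'"
  \<comment> \<open>For \<open>a = 0\<close> the complement of \<open>?M\<close> would be as large
    as that of \<open>N x\<close>, although both spaces contain the radical and \<open>?M\<close> is
    larger.\<close>
  have a0: "a \<noteq> 0"
  proof
    assume "a = 0"
    have z: "phi ?y u v = 0" if "u \<in> ?M" "v \<in> ?M2" for u v
    proof (rule phi_span_eq_0[OF _ that])
      fix u v assume "u \<in> insert s (N x)" "v \<in> insert s' ?M"
      then show "phi ?y u v = 0"
        using s'N \<open>a = 0\<close> insert_isotropic[OF s, of u v] by (auto simp: a_def intro: vec.span_base)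
    qed
    have "?Np \<subseteq> {v \<in> W1. \<forall>m\<in>?M. phi ?y v m = 0}"
    proof
      fix v assume v: "v \<in> ?Np"
      then have "phi ?y v m = 0" if "m \<in> ?M" for m
        using z[OF that, of v] M2Np phi_sym[of ?y v m] by simp
      then show "v \<in> {v \<in> W1. \<forall>m\<in>?M. phi ?y v m = 0}" using v by simp
    qed
    then have "vec.dim ?Np \<le> vec.dim {v \<in> W1. \<forall>m\<in>?M. phi ?y v m = 0}" by (rule vec.dim_subset)
    then show False
      using dim_phi_perp[OF vec.subspace_span, of "insert s (N x)" ?y] Kint[OF NM(1) span_insert_W1[OF s]]
        dNp dM dK dim_N_J[of x] r_eq by simp
  qed
  let ?w = "2 *s b x s'"
  have ws: "phi ?w s s = - 2 * a" "phi ?w s s' = - d / 2" "phi ?w s' s' = 0"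
  proof -
    have "Q (b s s) (b x s') + Q (b s x) (b s s') + Q (b s s') (b s x) = 0" using Q_b_b[of s s x s'] by simp
    then show "phi ?w s s = - 2 * a"
      unfolding a_def phi_def by (simp add: Q_simps b_sym[of s x] Q_sym[of "b x s"] eq_neg_iff_add_eq_0) algebra
    have "Q (b s' s') (b x s) + Q (b s' x) (b s' s) + Q (b s' s) (b s' x) = 0" using Q_b_b[of s' s' x s] by simp
    then show "phi ?w s s' = - d / 2"
      unfolding d_def phi_def
      by (simp add: Q_simps b_sym[of s' x] b_sym[of s' s] Q_sym[of "b x s'"] eq_neg_iff_add_eq_0 add.commute)
    show "phi ?w s' s' = 0" by (rule phi_s_s)
  qed
  \<comment> \<open>The form of \<open>2 b x t\<close> is \<open>d\<close> times that of
    \<open>?y\<close> minus \<open>2 a\<close> times that of \<open>?w\<close>, with entries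
    \<open>4 a^2, 2 a d, d^2\<close>: the square of a linear form whose zero is \<open>t\<close>
    itself.\<close>
  define t where "t = d *s s + (- 2 * a) *s s'"
  have tW: "t \<in> W1" using s s'W subspace_W1 by (auto simp: t_def intro!: vec.subspace_diff vec.subspace_add vec.subspace_scale)
  have ty: "2 *s b x t = d *s ?y + (- 2 * a) *s ?w" by (simp add: t_def b_simps vec_eq_iff)
  have tN: "t \<notin> ?M"
  proof
    assume "t \<in> ?M"
    then have "(- 1 / (2 * a)) *s (t - d *s s) \<in> ?M" using NM(2) by (intro vec.span_scale vec.span_diff)
    moreover have "(- 1 / (2 * a)) *s (t - d *s s) = s'" using a0 by (simp add: t_def)
    ultimately show False using s'(2) by simp
  qed
  have tN': "t \<notin> N x" using tN NM(1) by blast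
  then have t0: "2 *s b x t \<noteq> 0" using tW by (simp add: N_def)
  let ?T = "vec.span (insert t (N x))" and ?V = "vec.span (insert s' (insert s (N x)))"
  \<comment> \<open>Orthogonal subspaces of dimensions \<open>dim (N x) + 1\<close> and
    \<open>dim (N x) + 2\<close> exceed by one what \<open>dim_K_le\<close> permits.\<close>
  have "phi (2 *s b x t) u v = 0" if "u \<in> ?T" "v \<in> ?V" for u v
  proof (rule phi_span_eq_0[OF _ that])
    have ys: "phi ?y s s = 0" "phi ?y s s' = a" "phi ?y s' s = a" "phi ?y s' s' = d"
      using phi_s_s phi_sym[of ?y s' s] by (simp_all only: a_def d_def)
    have ws': "phi ?w s' s = - d / 2" using ws(2) phi_sym[of ?w s' s] by simp
    have expand: "phi (k *s u + l *s v) (m *s u' + n *s v') z =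
        k * (m * phi u u' z + n * phi u v' z) + l * (m * phi v u' z + n * phi v v' z)" for k l m n u v u' v' z
      by (simp add: phi_simps algebra_simps)
    have ts: "phi (2 *s b x t) t s = 0"
      unfolding ty unfolding t_def expand ys ws ws' by (simp add: field_simps)
    have ts': "phi (2 *s b x t) t s' = 0"
      unfolding ty unfolding t_def expand ys ws by (simp add: field_simps)
    have tn: "phi (2 *s b x t) t n = 0" "phi (2 *s b x t) n t = 0" if "n \<in> N x" for n
      using phi_N(2)[OF that, of t] phi_sym by simp_all
    have nn: "phi (2 *s b x t) n s = 0" "phi (2 *s b x t) n s' = 0" if n: "n \<in> N x" for n
    proof -
      have ns: "phi ?y n s = 0" "phi ?y n s' = 0" "phi ?w n s' = 0" "phi ?w n s = 0"
        using phi_N(2)[OF n] s'N[OF n] phi_N(1)[OF n, of s' s] by simp_all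
      then show "phi (2 *s b x t) n s = 0" "phi (2 *s b x t) n s' = 0" unfolding ty by (simp_all add: phi_simps)
    qed
    fix u v assume "u \<in> insert t (N x)" "v \<in> insert s' (insert s (N x))"
    then show "phi (2 *s b x t) u v = 0" using ts ts' tn nn phi_N_N by auto
  qed
  moreover have "?V \<subseteq> W1" using s s'W NW subspace_W1 by (intro vec.span_minimal) auto
  ultimately have "vec.dim ?T + vec.dim ?V \<le> p + vec.dim (K (2 *s b x t))"
    by (intro isotropic_dim_le[OF vec.subspace_span span_insert_W1[OF tW]]) auto
  moreover have "vec.dim ?T = vec.dim (N x) + 1" by (rule dim_span_insert[OF subspace_N tN'])
  moreover have "?V = ?M2"
  proof
    show "?V \<subseteq> ?M2" by (intro vec.span_mono) (auto intro: vec.span_base)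
    have "?M \<subseteq> ?V" by (intro vec.span_mono) auto
    then show "?M2 \<subseteq> ?V" by (intro vec.span_minimal) (auto intro: vec.span_base)
  qed
  ultimately show False
    using dim_K_le[OF b_x_E t0] dM2 dim_N_J[of x] r_eq by simp
qed

end

text \<open>A vector \<open>x\<close> in the radical puts \<open>Y\<close> into \<open>J x\<close>,
  but \<open>J x\<close> consists of isotropic vectors: it is the line of \<open>b x x\<close>, or
  the image of \<open>b x\<close> if \<open>b x x = 0\<close>.\<close>

lemma phi_nondegenerate:
  assumes Y: "Y \<in> W0" "Q Y Y \<noteq> 0" and x: "x \<in> W1" "\<And>w. phi Y x w = 0"
  shows "x = 0"
proof (rule ccontr)
  assume x0: "x \<noteq> 0"
  have YJ: "Y \<in> J x" using Y x by (simp add: J_def phi_def)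
  show False
  proof (cases "b x x = 0")
    case True
    then obtain u where u: "Y = b x u" using YJ J_range[OF x(1) x0] by blast
    then have "Q Y Y = 0" using Q_b_b_quadratic[of x u u] True by (simp add: Q_simps)
    then show ?thesis using Y by simp
  next
    case False
    then obtain a where "Y = a *s b x x" using YJ J_eq(1)[OF x(1)] by blast
    then show ?thesis using Y Q_b_b_diag[of x x] by (simp add: Q_simps)
  qed
qed

text \<open>A nonzero \<open>x\<close> annihilated by \<open>b\<close> on \<open>K y\<close> has
  \<open>b x x = 0\<close>, \<open>K y \<subseteq> N x\<close> and \<open>y\<close> in
  \<open>J x\<close>, the image of \<open>b x\<close>; this is what \<open>K_not_subset_N\<close>
  excludes.\<close>

lemma K_b_nondegenerate:
  assumes y: "y \<in> E" "y \<noteq> 0" and x: "x \<in> K y" "\<And>u. u \<in> K y \<Longrightarrow> b x u = 0"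
  shows "x = 0"
proof (rule ccontr)
  assume x0: "x \<noteq> 0"
  have xW: "x \<in> W1" and xx: "b x x = 0" using x by (auto simp: K_def)
  have "y \<in> J x" using x E_W0[OF y(1)] by (simp add: K_def J_def phi_def)
  then obtain u where u: "y = b x u" using J_range[OF xW x0 xx] by blast
  define s where "s = (1 / 2) *s P1 u"
  have s: "s \<in> W1" "2 *s b x s = y" using subspace_W1 by (simp_all add: s_def u b_simps vec.subspace_scale)
  have "K y \<subseteq> N x" using x(2) by (auto simp: N_def K_def)
  then show False using K_not_subset_N[OF xW x0 xx s(1)] s(2) y(2) by simp
qed

text \<open>As \<open>phi (y + y')\<close> is nondegenerate, it represents \<open>phi y\<close> by
  an operator \<open>T\<close>, which preserves the space of all such \<open>x\<close>. An
  eigenvector lies in the radical of a member of the pencil, hence in \<open>K y\<close> or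
  \<open>K y'\<close>, the other members being nondegenerate. Each radical meets this space only in
  0.\<close>

lemma pencil_complement:
  assumes y: "y \<in> E" "y' \<in> E" and yy': "Q y y' \<noteq> 0"
    and x: "x \<in> W1" "\<And>u. u \<in> K y \<Longrightarrow> phi y' x u = 0" "\<And>u. u \<in> K y' \<Longrightarrow> phi y x u = 0"
  shows "x = 0"
proof (rule ccontr)
  assume x0: "x \<noteq> 0"
  have y0: "y \<noteq> 0" "y' \<noteq> 0" using yy' by (auto simp: Q_simps)
  define M where "M = {x \<in> W1. (\<forall>u\<in>K y. phi y' x u = 0) \<and> (\<forall>u\<in>K y'. phi y x u = 0)}"
  have sM: "vec.subspace M"
    unfolding M_def using subspace_W1
    by (auto intro!: vec.subspaceI simp: vec.subspace_0 vec.subspace_add vec.subspace_scale phi_simps)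
  \<comment> \<open>On \<open>K y\<close> the map \<open>b\<close> takes values in multiples of
    \<open>y\<close>, so \<open>phi y'\<close> restricts there to \<open>Q y y'\<close> times the
    coefficient form, which is nondegenerate.\<close>
  have trivial: "x = 0" if t: "y \<in> E" "y \<noteq> 0" "Q y y' \<noteq> 0" "x \<in> K y" "\<And>u. u \<in> K y \<Longrightarrow> phi y' x u = 0" for x y y'
  proof (rule K_b_nondegenerate[OF t(1,2,4)])
    fix u assume u: "u \<in> K y"
    obtain a where a: "b x u = a *s y" using b_K2[OF t(4) u t(1,2)] .
    then have "a * Q y y' = 0" using t(5)[OF u] by (simp add: phi_def Q_simps)
    then show "b x u = 0" using a t(3) by simp
  qed
  let ?Y = "y + y'"
  have Y: "?Y \<in> W0" "Q ?Y ?Y \<noteq> 0"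
    using y yy' subspace_W0 Q_sym[of y' y] by (simp_all add: E_def Q_simps vec.subspace_add)
  obtain C where C: "C \<subseteq> W1" "vec.independent C" "W1 \<subseteq> vec.span C" "card C = p"
    using vec.basis_exists by blast
  have finC: "finite C" using C(2) vec.finiteI_independent by blast
  have spanC: "vec.span C = W1" using C subspace_W1 vec.span_minimal by blast
  have "\<exists>h. \<forall>c\<in>C. h c \<in> phi ?Y ` W1 \<and> (\<forall>c'\<in>C. h c c' = (if c = c' then 1 else 0))"
  proof (rule dual_basis[OF finC C(2)])
    show "lfun g" if "g \<in> phi ?Y ` W1" for g using that lfun_phi by auto
    have "phi ?Y 0 = (\<lambda>_. 0)" by (auto simp: phi_simps)
    then show "(\<lambda>_. 0) \<in> phi ?Y ` W1" using vec.subspace_0[OF subspace_W1] by (metis image_eqI)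
    show "(\<lambda>x. g x + h x) \<in> phi ?Y ` W1" if gh: "g \<in> phi ?Y ` W1" "h \<in> phi ?Y ` W1" for g h
    proof -
      obtain u v where "u \<in> W1" "g = phi ?Y u" "v \<in> W1" "h = phi ?Y v" using gh by blast
      then show ?thesis using subspace_W1
        by (intro image_eqI[of _ _ "u + v"]) (auto simp: phi_simps vec.subspace_add)
    qed
    show "(\<lambda>x. a * g x) \<in> phi ?Y ` W1" if g: "g \<in> phi ?Y ` W1" for a g
    proof -
      obtain u where "u \<in> W1" "g = phi ?Y u" using g by blast
      then show ?thesis using subspace_W1
        by (intro image_eqI[of _ _ "a *s u"]) (auto simp: phi_simps vec.subspace_scale)
    qed
    fix u assume u: "u \<in> vec.span C" "\<And>g. g \<in> phi ?Y ` W1 \<Longrightarrow> g u = 0"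
    have uW: "u \<in> W1" using u(1) spanC by simp
    have "phi ?Y u w = 0" for w
      using u(2)[of "phi ?Y (P1 w)"] phi_sym[of ?Y w u] by simp
    then show "u = 0" by (rule phi_nondegenerate[OF Y uW])
  qed
  then obtain h where h: "\<And>c. c \<in> C \<Longrightarrow> h c \<in> phi ?Y ` W1"
     "\<And>c c'. c \<in> C \<Longrightarrow> c' \<in> C \<Longrightarrow> h c c' = (if c = c' then 1 else 0)" by blast
  have "\<forall>c\<in>C. \<exists>z. z \<in> W1 \<and> h c = phi ?Y z" using h(1) by (simp add: image_iff Bex_def)
  then obtain z where "\<forall>c\<in>C. z c \<in> W1 \<and> h c = phi ?Y (z c)"
    by (rule bchoice[THEN exE])
  then have z: "\<And>c. c \<in> C \<Longrightarrow> z c \<in> W1" "\<And>c. c \<in> C \<Longrightarrow> h c = phi ?Y (z c)" by simp_all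
  define T where "T x = (\<Sum>c\<in>C. phi y x c *s z c)" for x
  have lT: "lmap T"
    unfolding lmap_def T_def
    by (simp add: phi_simps vec.scale_left_distrib sum.distrib vec.scale_sum_right)
  have TW: "T x \<in> W1" for x
    unfolding T_def using z(1) subspace_W1 by (intro vec.subspace_sum vec.subspace_scale)
  have T: "phi ?Y (T x) w = phi y x w" for x w
  proof -
    have "phi ?Y (T x) c - phi y x c = 0" if c: "c \<in> C" for c
    proof -
      have "phi ?Y (T x) c = (\<Sum>c'\<in>C. phi y x c' * phi ?Y (z c') c)"
        unfolding T_def by (simp add: lfun_sum[OF lfun_phi(2)] lfun_scale[OF lfun_phi(2)])
      also have "\<dots> = (\<Sum>c'\<in>C. if c' = c then phi y x c' else 0)"
        by (rule sum.cong) (use h(2)[OF _ c] z(2) in auto)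
      finally show ?thesis using c finC by simp
    qed
    then have "phi ?Y (T x) (P1 w) - phi y x (P1 w) = 0"
      using span_lfun_eq_0[OF lfun_diffI[OF lfun_phi(1) lfun_phi(1)], of C ?Y "T x" y x "P1 w"] spanC by simp
    then show ?thesis by simp
  qed
  have TM: "T v \<in> M" if v: "v \<in> M" for v
  proof -
    have "phi y' (T v) u = 0" if u: "u \<in> K y" for u
    proof -
      have "phi y (T v) u = 0" using u phi_sym[of y u] by (simp add: K_def)
      moreover have "phi ?Y (T v) u = 0" using T[of v u] u phi_sym[of y u] by (simp add: K_def)
      ultimately show ?thesis by (simp add: phi_simps)
    qed
    moreover have "phi y (T v) u = 0" if u: "u \<in> K y'" for u
    proof -
      have "phi y' (T v) u = 0" using u phi_sym[of y' u] by (simp add: K_def)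
      moreover have "phi ?Y (T v) u = 0" using T[of v u] v u by (simp add: M_def)
      ultimately show ?thesis by (simp add: phi_simps)
    qed
    ultimately show ?thesis using TW by (simp add: M_def)
  qed
  have "x \<in> M" using x by (simp add: M_def)
  then obtain v \<mu> where v: "v \<in> M" "v \<noteq> 0" "T v = \<mu> *s v"
    using exists_eigenvector[OF lT sM TM _ x0] by blast
  have vW: "v \<in> W1" using v by (simp add: M_def)
  have eq: "phi y v w = \<mu> * (phi y v w + phi y' v w)" for w
    using T[of v w] by (simp add: v(3) phi_simps)
  have z: "phi ((1 - \<mu>) *s y + (- \<mu>) *s y') v w = 0" for w
    using eq[of w] by (simp add: phi_simps algebra_simps)
  have "Q ((1 - \<mu>) *s y + (- \<mu>) *s y') ((1 - \<mu>) *s y + (- \<mu>) *s y') = - (2 * \<mu> * (1 - \<mu>) * Q y y')"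
    using y Q_sym[of y' y] by (simp add: E_def Q_simps algebra_simps)
  moreover have "(1 - \<mu>) *s y + (- \<mu>) *s y' \<in> W0"
    using y subspace_W0 by (intro vec.subspace_add vec.subspace_scale) (simp_all add: E_def)
  ultimately have "\<mu> = 0 \<or> \<mu> = 1"
    using phi_nondegenerate[OF _ _ vW z] v(2) yy' by auto
  then show False
  proof
    assume "\<mu> = 0"
    then have "v \<in> K y" using eq vW by (simp add: K_def)
    then show False using trivial[OF y(1) y0(1) yy'] v(1,2) by (auto simp: M_def)
  next
    assume "\<mu> = 1"
    then have "v \<in> K y'" using eq vW by (simp add: K_def)
    then show False using trivial[OF y(2) y0(2), of y v] yy' Q_sym[of y y'] v(1,2) by (auto simp: M_def)
  qed
qed

text \<open>The conditions imposed by the two radicals have only the zero solution, and each radical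
  imposes at most as many as its dimension.\<close>

lemma p_le:
  assumes y: "y \<in> E" "y' \<in> E" and yy': "Q y y' \<noteq> 0"
  shows "p \<le> vec.dim (K y) + vec.dim (K y')"
proof -
  let ?V = "{v \<in> W1. \<forall>u\<in>K y. phi y' v u = 0}"
  let ?V' = "{v \<in> ?V. \<forall>u\<in>K y'. phi y v u = 0}"
  have sV: "vec.subspace ?V"
    using subspace_lfun_eq_0[OF subspace_W1, of "(\<lambda>m v. phi y' v m) ` K y"] lfun_phi(2) by auto
  have "p \<le> vec.dim (K y) + vec.dim ?V"
    using dim_pairing[of "phi y'", OF lfun_phi(2) lfun_phi(1) subspace_W1 subspace_K, of y] by linarith
  moreover have "vec.dim ?V \<le> vec.dim (K y') + vec.dim ?V'"
    using dim_pairing[of "phi y", OF lfun_phi(2) lfun_phi(1) sV subspace_K, of y'] by linarith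
  moreover have "?V' \<subseteq> {0}" using pencil_complement[OF y yy'] by auto
  then have "vec.dim ?V' = 0" by simp
  ultimately show ?thesis by linarith
qed

text \<open>For \<open>y\<close>, \<open>y'\<close> in the image of \<open>b\<close> with
  \<open>Q y y'\<close> nonzero, the radicals have dimension \<open>p + 2 - r\<close> and meet in 0
  because \<open>y + y'\<close> is not isotropic. With \<open>p_le\<close> this gives
  \<open>p = 2 (p + 2 - r)\<close>.\<close>

theorem p_eq: "p + 4 = 2 * r"
proof -
  obtain x1 where x1: "x1 \<in> W1" "b x1 x1 \<noteq> 0" using exists_b_nonzero .
  let ?y = "b x1 x1"
  obtain x2 where x2: "x2 \<in> W1" "Q ?y (b x2 x2) \<noteq> 0" "b x2 x2 \<noteq> 0" using exists_transversal[OF b_E x1(2)] .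
  let ?y' = "b x2 x2"
  have "K ?y \<inter> K ?y' \<subseteq> {0}"
  proof
    fix u assume u: "u \<in> K ?y \<inter> K ?y'"
    have Y: "?y + ?y' \<in> W0" "Q (?y + ?y') (?y + ?y') \<noteq> 0"
      using x2(2) subspace_W0 Q_sym[of ?y' ?y] E_Q[OF b_E] by (simp_all add: Q_simps vec.subspace_add)
    have "u = 0" by (rule phi_nondegenerate[OF Y]) (use u in \<open>auto simp: K_def phi_simps\<close>)
    then show "u \<in> {0}" by simp
  qed
  then have "vec.dim (K ?y \<inter> K ?y') = 0" by simp
  moreover have "vec.dim {u + v |u v. u \<in> K ?y \<and> v \<in> K ?y'} \<le> p"
    using subspace_W1 by (intro vec.dim_subset) (auto simp: K_def vec.subspace_add)
  ultimately have "vec.dim (K ?y) + vec.dim (K ?y') \<le> p"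
    using vec.dim_sums_Int[OF subspace_K subspace_K, of ?y ?y'] by linarith
  then show ?thesis
    using p_le[OF b_E b_E x2(2)] dim_K_b[OF x1] dim_K_b[OF x2(1,3)] by linarith
qed

text \<open>\<open>p_le\<close> against a \<open>y'\<close> in the image of \<open>b\<close> shows
  \<open>K y\<close> to be nonzero. By \<open>K_b_nondegenerate\<close> some \<open>b u u\<close>
  with \<open>u\<close> in \<open>K y\<close> is nonzero; it is a multiple of \<open>y\<close>, and
  a square root adjusts the scalar.\<close>

theorem b_surj:
  assumes y: "y \<in> E" "y \<noteq> 0"
  obtains x where "x \<in> W1" "b x x = y"
proof -
  obtain x2 where x2: "x2 \<in> W1" "Q y (b x2 x2) \<noteq> 0" "b x2 x2 \<noteq> 0" using exists_transversal[OF y] .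
  have "vec.dim (K y) \<noteq> 0"
    using p_le[OF y(1) b_E x2(2)] dim_K_b[OF x2(1,3)] r_ge_3 by linarith
  then obtain v where v: "v \<in> K y" "v \<noteq> 0" by auto
  have "\<exists>u\<in>K y. b u u \<noteq> 0"
  proof (rule ccontr)
    assume "\<not> ?thesis"
    then have z: "b u u = 0" if "u \<in> K y" for u using that by blast
    have "b v u = 0" if "u \<in> K y" for u
    proof -
      have "b (v + u) (v + u) = 0" using z vec.subspace_add[OF subspace_K v(1) that] by blast
      then have "2 *s b v u = 0" using b_polar[of v u] z[OF v(1)] z[OF that] by simp
      then show ?thesis by simp
    qed
    then show False using K_b_nondegenerate[OF y v(1)] v(2) by blast
  qed
  then obtain u where u: "u \<in> K y" "b u u \<noteq> 0" by blast
  obtain a where a: "b u u = a *s y" using b_K[OF u(1) y] .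
  then have a0: "a \<noteq> 0" using u(2) by auto
  define s where "s = csqrt (1 / a)"
  have s: "s ^ 2 * a = 1" using a0 by (simp add: s_def)
  show thesis
  proof (rule that[of "s *s u"])
    show "s *s u \<in> W1" using u(1) subspace_W1 by (simp add: K_def vec.subspace_scale)
    show "b (s *s u) (s *s u) = y" using s by (simp add: b_simps a power2_eq_square mult.assoc)
  qed
qed

end

section \<open>Cones and projective varieties\<close>

definition homogeneous_part :: "nat \<Rightarrow> 'n::finite cpoly \<Rightarrow> 'n cpoly" where
  "homogeneous_part d p = (\<Sum>m | m \<in> Poly_Mapping.keys p \<and> (\<Sum>i\<in>UNIV. Poly_Mapping.lookup m i) = d.
     Poly_Mapping.single m (Poly_Mapping.lookup p m))"

lemma homogeneous_homogeneous_part: "homogeneous d (homogeneous_part d p)"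
  unfolding homogeneous_def
proof
  fix m assume "m \<in> Poly_Mapping.keys (homogeneous_part d p)"
  then have "(\<Sum>m' | m' \<in> Poly_Mapping.keys p \<and> (\<Sum>i\<in>UNIV. Poly_Mapping.lookup m' i) = d.
      Poly_Mapping.lookup (Poly_Mapping.single m' (Poly_Mapping.lookup p m')) m) \<noteq> 0"
    by (simp add: homogeneous_part_def in_keys_iff lookup_sum)
  then obtain m' where "(\<Sum>i\<in>UNIV. Poly_Mapping.lookup m' i) = d"
      "Poly_Mapping.lookup (Poly_Mapping.single m' (Poly_Mapping.lookup p m')) m \<noteq> 0"
    by (rule sum.not_neutral_contains_not_neutral) auto
  then show "(\<Sum>i\<in>UNIV. Poly_Mapping.lookup m i) = d"
    by (auto simp: lookup_single when_def split: if_splits)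
qed

lemma peval_eq_sum_homogeneous_part:
  "\<exists>D. (\<forall>d v. d > D \<longrightarrow> peval (homogeneous_part d p) v = 0) \<and>
     (\<forall>v s. peval p (s *s v) = (\<Sum>d\<le>D. s ^ d * peval (homogeneous_part d p) v))"
proof -
  define deg where "deg m = (\<Sum>i\<in>UNIV. Poly_Mapping.lookup m i)" for m :: "'a \<Rightarrow>\<^sub>0 nat"
  define D where "D = (\<Sum>m\<in>Poly_Mapping.keys p. deg m)"
  have le: "deg m \<le> D" if "m \<in> Poly_Mapping.keys p" for m
    unfolding D_def by (rule member_le_sum) (use that in auto)
  show ?thesis
  proof (intro exI[of _ D] conjI allI impI)
    show "peval (homogeneous_part d p) v = 0" if "d > D" for d v
    proof -
      have none: "{m \<in> Poly_Mapping.keys p. deg m = d} = {}" using le that by fastforce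
      show ?thesis
        unfolding homogeneous_part_def deg_def[symmetric] none by simp
    qed
    fix v :: "complex ^ 'a" and s
    let ?t = "\<lambda>m. Poly_Mapping.lookup p m * (\<Prod>i\<in>UNIV. v $ i ^ Poly_Mapping.lookup m i)"
    have "peval p (s *s v) = (\<Sum>m\<in>Poly_Mapping.keys p. s ^ deg m * ?t m)"
      unfolding peval_def deg_def power_sum
      by (simp add: power_mult_distrib prod.distrib mult_ac)
    also have "\<dots> = (\<Sum>d\<le>D. \<Sum>m | m \<in> Poly_Mapping.keys p \<and> deg m = d. s ^ deg m * ?t m)"
      by (rule sum.group[symmetric]) (use le in auto)
    also have "\<dots> = (\<Sum>d\<le>D. s ^ d * peval (homogeneous_part d p) v)"
      by (rule sum.cong) (auto simp: homogeneous_part_def peval_sum peval_single deg_def sum_distrib_left)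
    finally show "peval p (s *s v) = (\<Sum>d\<le>D. s ^ d * peval (homogeneous_part d p) v)" .
  qed
qed

lemma peval_homogeneous_part_eq_0:
  assumes "\<And>s. peval p (s *s v) = 0"
  shows "peval (homogeneous_part d p) v = 0"
proof -
  obtain D where D: "\<forall>d v. d > D \<longrightarrow> peval (homogeneous_part d p) v = 0"
      "\<forall>v s. peval p (s *s v) = (\<Sum>d\<le>D. s ^ d * peval (homogeneous_part d p) v)"
    using peval_eq_sum_homogeneous_part[of p] by (elim exE conjE)
  let ?P = "\<Sum>d\<le>D. monom (peval (homogeneous_part d p) v) d"
  have "poly ?P s = 0" for s
    using assms[of s] D(2) by (simp add: poly_sum poly_monom mult.commute)
  then have "?P = 0" by (intro poly_all_0_iff_0[THEN iffD1] allI)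
  then have "coeff ?P d = 0" by simp
  then show ?thesis
    using D(1) by (cases "d \<le> D") (auto simp: coeff_sum coeff_monom)
qed

section \<open>Cones and the lines contained in them\<close>

definition is_cone :: "(complex ^ 'n::finite) set \<Rightarrow> bool" where
  "is_cone C \<longleftrightarrow> 0 \<in> C \<and> (\<forall>v\<in>C. \<forall>s. s *s v \<in> C)"

definition lines_in :: "(complex ^ 'n::finite) set \<Rightarrow> (complex ^ 'n) set set" where
  "lines_in C = {L \<in> proj_space. L \<subseteq> C}"

lemma line_in_proj_space: "v \<noteq> 0 \<Longrightarrow> range (\<lambda>s. s *s v) \<in> proj_space"
  using vec.subspace_span[of "{v}"] vec.dim_span[of "{v}"]
  by (simp add: proj_space_def vec.span_singleton[symmetric])

lemma in_line: "v \<in> range (\<lambda>s. s *s v)"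
  for v :: "complex ^ 'n"
  using rangeI[of "\<lambda>s. s *s v" 1] by simp

lemma proj_space_eq_line:
  assumes "L \<in> proj_space" "v \<in> L" "v \<noteq> 0"
  shows "L = range (\<lambda>s. s *s v)"
proof -
  obtain w where w: "w \<noteq> 0" "L = range (\<lambda>s. s *s w)" using proj_space_cases[OF assms(1)] .
  obtain a where a: "v = a *s w" using assms(2) w(2) by blast
  then have "a \<noteq> 0" using assms(3) by auto
  show ?thesis
  proof
    show "range (\<lambda>s. s *s v) \<subseteq> L" using assms(1,2) by (auto simp: proj_space_def vec.subspace_scale)
    have "s *s w = (s / a) *s v" for s using a \<open>a \<noteq> 0\<close> by simp
    then show "L \<subseteq> range (\<lambda>s. s *s v)" unfolding w(2) by blast
  qed
qed

lemma line_subset_cone: "is_cone C \<Longrightarrow> v \<in> C \<Longrightarrow> range (\<lambda>s. s *s v) \<subseteq> C"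
  by (auto simp: is_cone_def)

lemma line_in_lines_in: "is_cone C \<Longrightarrow> v \<in> C \<Longrightarrow> v \<noteq> 0 \<Longrightarrow> range (\<lambda>s. s *s v) \<in> lines_in C"
  using line_in_proj_space[of v] line_subset_cone[of C v] by (simp add: lines_in_def)

lemma affine_cone_lines_in:
  assumes "is_cone C"
  shows "affine_cone (lines_in C) = C"
proof
  show "affine_cone (lines_in C) \<subseteq> C"
    using assms by (auto simp: affine_cone_def lines_in_def is_cone_def)
  show "C \<subseteq> affine_cone (lines_in C)"
  proof
    fix v assume "v \<in> C"
    then show "v \<in> affine_cone (lines_in C)"
      using line_in_lines_in[OF assms, of v] in_line[of v] by (cases "v = 0") (auto simp: affine_cone_def)
  qed
qed

lemma lines_in_affine_cone:
  assumes "Z \<subseteq> proj_space"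
  shows "lines_in (affine_cone Z) = Z"
proof
  show "Z \<subseteq> lines_in (affine_cone Z)" using assms by (auto simp: affine_cone_def lines_in_def)
  show "lines_in (affine_cone Z) \<subseteq> Z"
  proof
    fix L assume L: "L \<in> lines_in (affine_cone Z)"
    then have LP: "L \<in> proj_space" by (simp add: lines_in_def)
    then obtain v where v: "v \<noteq> 0" "L = range (\<lambda>c. c *s v)" using proj_space_cases by blast
    have "v \<in> L" using in_line v(2) by simp
    then have "v \<in> \<Union>Z" using L v(1) by (auto simp: lines_in_def affine_cone_def)
    then obtain M where M: "M \<in> Z" "v \<in> M" by blast
    then have "M = L" using proj_space_eq_line[of M v] assms v by blast
    then show "L \<in> Z" using M by simp
  qed
qed

lemma affine_cone_mono: "Z \<subseteq> Z' \<Longrightarrow> affine_cone Z \<subseteq> affine_cone Z'"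
  by (auto simp: affine_cone_def)

lemma lines_in_mono: "C \<subseteq> C' \<Longrightarrow> lines_in C \<subseteq> lines_in C'"
  by (auto simp: lines_in_def)

text \<open>On a cone each homogeneous part of an equation vanishes as well, so the homogeneous
  parts define it.\<close>

lemma closedin_lines_in:
  assumes C: "closedin zariski C" "is_cone C"
  shows "closedin proj_zariski (lines_in C)"
proof -
  obtain P where P: "C = zeros P" using C(1) by (auto simp: closedin_zariski)
  let ?P = "{homogeneous_part d p |d p. p \<in> P}"
  have "C = zeros ?P"
  proof
    show "C \<subseteq> zeros ?P"
    proof
      fix v assume "v \<in> C"
      then have "peval p (s *s v) = 0" if "p \<in> P" for p s
        using C(2) that unfolding is_cone_def P zeros_def by blast
      then show "v \<in> zeros ?P" by (auto simp: zeros_def peval_homogeneous_part_eq_0)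
    qed
    show "zeros ?P \<subseteq> C"
    proof
      fix v assume v: "v \<in> zeros ?P"
      have "peval p v = 0" if p: "p \<in> P" for p
      proof -
        obtain D where "\<forall>v s. peval p (s *s v) = (\<Sum>d\<le>D. s ^ d * peval (homogeneous_part d p) v)"
          using peval_eq_sum_homogeneous_part[of p] by (elim exE conjE)
        then have "peval p (1 *s v) = (\<Sum>d\<le>D. 1 ^ d * peval (homogeneous_part d p) v)" by blast
        moreover have "peval (homogeneous_part d p) v = 0" for d using v p by (auto simp: zeros_def)
        ultimately show ?thesis by simp
      qed
      then show "v \<in> C" by (simp add: P zeros_def)
    qed
  qed
  then have "lines_in C = proj_zeros ?P" unfolding lines_in_def proj_zeros_def by (rule arg_cong)
  moreover have "\<forall>f\<in>?P. \<exists>d. homogeneous d f" using homogeneous_homogeneous_part by blast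
  ultimately show ?thesis unfolding closedin_proj_zariski by (intro exI[of _ ?P] conjI)
qed

lemma closedin_affine_cone:
  assumes "closedin proj_zariski Z"
  shows "closedin zariski (affine_cone Z)"
proof -
  obtain P where P: "\<forall>f\<in>P. \<exists>d. homogeneous d f" "Z = proj_zeros P"
    using assms by (auto simp: closedin_proj_zariski)
  have "affine_cone Z = {0} \<union> zeros P"
  proof
    show "affine_cone Z \<subseteq> {0} \<union> zeros P" by (auto simp: affine_cone_def P(2) proj_zeros_def)
    show "{0} \<union> zeros P \<subseteq> affine_cone Z"
    proof
      fix v assume v: "v \<in> {0} \<union> zeros P"
      show "v \<in> affine_cone Z"
      proof (cases "v = 0")
        case False
        have "peval f (s *s v) = 0" if "f \<in> P" for f s
          using v False P(1) that peval_scale by (fastforce simp: zeros_def)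
        then have "range (\<lambda>s. s *s v) \<in> Z"
          using line_in_proj_space[OF False] by (auto simp: P(2) proj_zeros_def zeros_def)
        then show ?thesis using in_line[of v] by (auto simp: affine_cone_def)
      qed (simp add: affine_cone_def)
    qed
  qed
  moreover have "closedin zariski {0 :: complex ^ 'a}" by (rule closedin_subspace) simp
  moreover have "closedin zariski (zeros P)" by (auto simp: closedin_zariski)
  ultimately show ?thesis using closedin_Un by metis
qed

lemma closedin_proj_subset: "closedin proj_zariski Z \<Longrightarrow> Z \<subseteq> proj_space"
  using closedin_subset by fastforce

lemma irreducible_closed_lines_in:
  assumes C: "irr C" "is_cone C" "C \<noteq> {0}"
  shows "irreducible_closed proj_zariski (lines_in C)"
  unfolding irreducible_closed_def
proof (intro conjI allI impI)
  show "closedin proj_zariski (lines_in C)"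
    using C closedin_lines_in by (auto simp: irreducible_closed_def)
  obtain v where "v \<in> C" "v \<noteq> 0" using C(2,3) by (auto simp: is_cone_def)
  then show "lines_in C \<noteq> {}" using line_in_lines_in[OF C(2)] by blast
  fix A B assume AB: "closedin proj_zariski A \<and> closedin proj_zariski B \<and> lines_in C \<subseteq> A \<union> B"
  have "affine_cone (lines_in C) \<subseteq> affine_cone A \<union> affine_cone B"
    using AB by (fastforce simp: affine_cone_def)
  then have "C \<subseteq> affine_cone A \<union> affine_cone B" by (simp only: affine_cone_lines_in[OF C(2)])
  then have "C \<subseteq> affine_cone A \<or> C \<subseteq> affine_cone B"
    using C(1) AB closedin_affine_cone unfolding irreducible_closed_def by blast
  then have "lines_in C \<subseteq> lines_in (affine_cone A) \<or> lines_in C \<subseteq> lines_in (affine_cone B)"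
    using lines_in_mono by blast
  then show "lines_in C \<subseteq> A \<or> lines_in C \<subseteq> B"
    using AB by (simp only: lines_in_affine_cone[OF closedin_proj_subset])
qed

text \<open>A line is irreducible and thus lies in one of two covering closed sets. A covering of
  the cone therefore becomes a covering of \<open>Z\<close> by projective closed sets.\<close>

lemma irr_affine_cone:
  assumes Z: "irreducible_closed proj_zariski Z"
  shows "irr (affine_cone Z)" "{0} \<subset> affine_cone Z"
proof -
  have cl: "closedin proj_zariski Z" and ne: "Z \<noteq> {}" using Z by (auto simp: irreducible_closed_def)
  have sub: "Z \<subseteq> proj_space" using closedin_proj_subset[OF cl] .
  obtain L where L: "L \<in> Z" using ne by blast
  obtain v where v: "v \<noteq> 0" "L = range (\<lambda>c. c *s v)" using proj_space_cases L sub by blast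
  then show "{0} \<subset> affine_cone Z" using L in_line[of v] by (auto simp: affine_cone_def)
  show "irr (affine_cone Z)"
    unfolding irreducible_closed_def
  proof (intro conjI allI impI)
    show "closedin zariski (affine_cone Z)" by (rule closedin_affine_cone[OF cl])
    show "affine_cone Z \<noteq> {}" by (simp add: affine_cone_def)
    fix A B :: "(complex ^ 'a) set"
    assume AB: "closedin zariski A \<and> closedin zariski B \<and> affine_cone Z \<subseteq> A \<union> B"
    \<comment> \<open>The part of \<open>A\<close> stable under scaling. It is empty if
      \<open>A\<close> misses 0, so 0 is inserted before passing to lines.\<close>
    define core where "core A = {v. \<forall>s. s *s v \<in> A}" for A :: "(complex ^ 'a) set"
    have core: "closedin zariski (core A)" if A: "closedin zariski A" for A
    proof (rule closedin_zariskiI)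
      fix v assume "v \<notin> core A"
      then obtain s where "s *s v \<notin> A" by (auto simp: core_def)
      then obtain f where f: "polyfun f" "\<And>a. a \<in> A \<Longrightarrow> f a = 0" "f (s *s v) \<noteq> 0"
        using not_in_closed[OF A] by metis
      have "polyfun (\<lambda>v. f (s *s v))"
        by (rule polyfun_comp[OF f(1)]) (intro polymap_scale polyfun_const polymap_id)
      then show "\<exists>g. polyfun g \<and> (\<forall>a\<in>core A. g a = 0) \<and> g v \<noteq> 0"
        using f(2,3) by (intro exI[of _ "\<lambda>v. f (s *s v)"]) (auto simp: core_def)
    qed
    have sub_core: "M \<subseteq> core A" if "M \<in> proj_space" "M \<subseteq> A" for M A
      using that by (auto simp: core_def proj_space_def vec.subspace_scale subset_iff)
    have "Z \<subseteq> lines_in (insert 0 (core A)) \<union> lines_in (insert 0 (core B))"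
    proof
      fix M assume M: "M \<in> Z"
      then have MP: "M \<in> proj_space" using sub by blast
      then have "irr M" by (intro irr_subspace) (simp add: proj_space_def)
      moreover have "M \<subseteq> A \<union> B" using AB M by (auto simp: affine_cone_def)
      ultimately have "M \<subseteq> A \<or> M \<subseteq> B" using AB unfolding irreducible_closed_def by blast
      then show "M \<in> lines_in (insert 0 (core A)) \<union> lines_in (insert 0 (core B))"
        using sub_core[OF MP] MP by (auto simp: lines_in_def)
    qed
    moreover have "closedin proj_zariski (lines_in (insert 0 (core X)))" if "closedin zariski X" for X
    proof (rule closedin_lines_in)
      have "closedin zariski ({0} \<union> core X)"
        by (intro closedin_Un closedin_subspace core that) simp
      then show "closedin zariski (insert 0 (core X))" by simp
      show "is_cone (insert 0 (core X))" by (auto simp: is_cone_def core_def)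
    qed
    ultimately have "Z \<subseteq> lines_in (insert 0 (core A)) \<or> Z \<subseteq> lines_in (insert 0 (core B))"
      using Z AB unfolding irreducible_closed_def by blast
    moreover have "affine_cone Z \<subseteq> X" if X: "Z \<subseteq> lines_in (insert 0 (core X))" for X
    proof -
      have "v \<in> insert 0 (core X)" using X L in_line[of v] v by (auto simp: lines_in_def)
      then have "0 *s v \<in> X" unfolding core_def using v by blast
      then have 0: "0 \<in> X" by simp
      have "u \<in> X" if "u \<in> core X" for u
      proof -
        have "1 *s u \<in> X" using that unfolding core_def by blast
        then show ?thesis by simp
      qed
      then show ?thesis using X 0 by (auto simp: affine_cone_def lines_in_def)
    qed
    ultimately show "affine_cone Z \<subseteq> A \<or> affine_cone Z \<subseteq> B" by blast
  qed
qed

lemma exists_flag: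
  fixes U :: "(complex ^ 'n::finite) set"
  assumes "vec.subspace U"
  shows "\<exists>X. (\<forall>i\<le>vec.dim U. vec.subspace (X i) \<and> X i \<subseteq> U) \<and> (\<forall>i<vec.dim U. X i \<subset> X (Suc i))"
  using assms
proof (induction "vec.dim U" arbitrary: U)
  case 0
  show ?case using 0(2) unfolding 0(1)[symmetric] by (intro exI[of _ "\<lambda>_. U"]) simp
next
  case (Suc d)
  then obtain v where v: "v \<in> U" "v \<noteq> 0"
    using vec.dim_eq_0[of U] by (metis insertCI nat.distinct(1) subsetI)
  then obtain i where i: "v $ i \<noteq> 0" by (auto simp: vec_eq_iff)
  let ?V = "{u \<in> U. u $ i = 0}"
  have V: "vec.subspace ?V" using subspace_lfun_eq_0[OF Suc.prems, of "{\<lambda>x. x $ i}"] lfun_axis[of i] by simp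
  have d: "d = vec.dim ?V"
    using dim_subspace_lker[OF Suc.prems lfun_axis v(1), of i] i Suc(2) by simp
  from Suc(1)[OF d V] obtain X where X: "\<forall>j\<le>d. vec.subspace (X j) \<and> X j \<subseteq> ?V" "\<forall>j<d. X j \<subset> X (Suc j)"
    unfolding d[symmetric] by blast
  let ?X = "\<lambda>j. if j \<le> d then X j else U"
  have "vec.subspace (?X j) \<and> ?X j \<subseteq> U" if "j \<le> Suc d" for j using X(1) Suc.prems by auto
  moreover have "?X j \<subset> ?X (Suc j)" if "j < Suc d" for j
  proof (cases "j = d")
    case True
    then show ?thesis using X(1) v i by auto
  next
    case False
    then show ?thesis using that X(2) by simp
  qed
  ultimately show ?case unfolding Suc(2)[symmetric] by (intro exI[of _ ?X]) blast
qed

lemma exists_nonzero_vector: "\<exists>v :: complex ^ 'n::finite. v \<noteq> 0"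
  by (rule exI[of _ "axis undefined 1"]) (simp add: axis_eq_0_iff)

lemma (in nondegenerate_cubic) irr_Yh: "irr Yh"
proof -
  obtain e :: "complex ^ 'n" where "e \<noteq> 0" using exists_nonzero_vector by blast
  then show ?thesis using irr_zero_set[OF vec.subspace_UNIV no_linear_factor, of e] by simp
qed

lemma dim_UNIV_eq: "vec.dim (UNIV :: (complex ^ 'm::finite) set) = CARD('m)"
  by (simp only: vec.dim_UNIV card_cart_basis)

section \<open>The singular locus is a Severi variety\<close>

lemma (in cubic) is_cone_Yh: "is_cone Yh"
  by (simp add: is_cone_def Yh_def f_simps)

lemma (in normal_form) is_cone_Sh: "is_cone Sh"
  by (simp add: is_cone_def Sh_def f_simps)

lemma (in normal_form) Sh_subset_Yh: "Sh \<subseteq> Yh"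
  by (auto simp: Sh_def Yh_def)

context smooth_normal_form
begin

lemma c_in_Sh: "c \<in> Sh"
  using Psi1_Sh[of c] by (simp add: Psi1_def)

text \<open>If the \<open>W1\<close>-component \<open>x\<close> is 0, this is surjectivity of
  \<open>b\<close> onto \<open>E\<close>. Otherwise \<open>J_range\<close> writes the
  \<open>W0\<close>-component as \<open>2 b x u\<close>, and \<open>v + e (c + u + b u u)\<close>
  are points of \<open>Sh\<close> with \<open>\<tau>\<close> equal to \<open>e\<close> that
  degenerate to \<open>v\<close>.\<close>

lemma Sh_tau_0:
  assumes v: "v \<in> Sh" "\<tau> v = 0"
  shows "v \<in> zcl (Psi1 ` U1)"
proof -
  define x y where "x = P1 v" and "y = P0 v"
  have vxy: "v = x + y"
    by (rule trans[OF decomp]) (simp add: v(2) x_def y_def)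
  have xW: "x \<in> W1" and yW: "y \<in> W0" by (simp_all add: x_def y_def)
  have S: "Q v v = 0" "b v v = 0" "\<And>u. Q (b v u) v = 0" using v by (simp_all add: in_Sh)
  have xx: "b x x = 0" using S(2) by (simp add: x_def)
  have yE: "y \<in> E" using S(1) by (simp add: E_def y_def)
  have yJ: "y \<in> J x" using S(3) by (simp add: J_def x_def y_def)
  show ?thesis
  proof (cases "x = 0")
    case True
    have "\<exists>x'\<in>W1. b x' x' = y"
    proof (cases "y = 0")
      case True
      then show ?thesis using vec.subspace_0[OF subspace_W1] by (intro bexI[of _ 0]) (simp_all add: b_simps)
    next
      case False
      then show ?thesis using b_surj[OF yE] by blast
    qed
    then obtain x' where x': "x' \<in> W1" "b x' x' = y" by blast
    have "Psi1 x' = y" unfolding Psi1_def x'(2) W1D(3)[OF x'(1)] by simp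
    also have "y = v" unfolding vxy True by simp
    finally have "Psi1 x' = v" .
    moreover have "x' \<in> U1" using x'(1) by (simp add: U1_def W1D)
    ultimately show ?thesis using zcl_superset by blast
  next
    case False
    then obtain u0 where u0: "y = b x u0" using J_range[OF xW False xx] yJ by blast
    define u where "u = (1 / 2) *s P1 u0"
    have u: "u \<in> W1" "y = 2 *s b x u"
      using subspace_W1 by (simp_all add: u_def u0 b_simps vec.subspace_scale)
    have z: "v + e *s (c + u + b u u) \<in> zcl (Psi1 ` U1)" if e: "e \<noteq> 0" for e
    proof -
      let ?w = "v + e *s (c + u + b u u)"
      have w: "\<tau> ?w = e" "P0 ?w = y + e *s b u u"
        using v(2) u(1) by (simp_all add: nf_simps W1D y_def)
      have "b ?w ?w = 2 *s (e *s b x u) + (e ^ 2) *s b u u"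
      proof -
        have "b ?w ?w = b (x + e *s u) (x + e *s u)"
          unfolding vxy by (simp add: b_simps b_W0[OF yW])
        also have "\<dots> = 2 *s (e *s b x u) + (e ^ 2) *s b u u"
          unfolding b_polar xx by (simp add: b_simps power2_eq_square)
        finally show ?thesis .
      qed
      also have "\<dots> = e *s (y + e *s b u u)"
        by (simp add: u(2) vec_eq_iff power2_eq_square algebra_simps)
      finally have bw: "b ?w ?w = e *s (y + e *s b u u)" .
      have "?w \<in> Sh" by (rule Sh_if_\<tau>) (simp_all only: w bw e not_False_eq_True)
      then show ?thesis using Sh_Psi1[of ?w] e w(1) zcl_superset[of "Psi1 ` U1"] by auto
    qed
    show ?thesis
      unfolding in_zcl
    proof (intro allI impI)
      fix g assume g: "polyfun g" "\<forall>a\<in>Psi1 ` U1. g a = 0"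
      define h where "h z = v + \<tau> z *s (c + u + b u u)" for z
      have "polymap h"
        unfolding h_def[abs_def] by (intro polymap_add polymap_scale polyfun_\<tau> polymap_id polymap_const)
      then have pg: "polyfun (\<lambda>z. g (h z))" by (rule polyfun_comp[OF g(1)])
      have "g (h 0) = 0"
      proof (rule polyfun_eq_0_dense[OF vec.subspace_UNIV pg lfun_polyfun[OF lfun_\<tau>], of c])
        show "g (h z) = 0" if "\<tau> z \<noteq> 0" for z
          unfolding h_def by (rule zclD[OF z[OF that] g(1)]) (use g(2) in blast)
      qed simp_all
      then show "g v = 0" by (simp add: h_def nf_simps)
    qed
  qed
qed

lemma Sh_eq: "Sh = zcl (Psi1 ` U1)"
proof
  show "Sh \<subseteq> zcl (Psi1 ` U1)"
    using Sh_Psi1 Sh_tau_0 zcl_superset by blast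
  show "zcl (Psi1 ` U1) \<subseteq> Sh"
    by (rule zcl_minimal[OF _ closedin_Sh]) (use Psi1_Sh in blast)
qed

lemma irr_Sh: "irr Sh"
  unfolding Sh_eq by (rule irr_zcl_image[OF subspace_U1 polymap_Psi1])

lemma has_chain_Sh_le: "has_chain Sh k \<Longrightarrow> k \<le> p + 1"
  using has_chain_zcl_image_le[OF subspace_U1 polymap_Psi1] unfolding Sh_eq dim_U1 by blast

lemma c_nonzero: "c \<noteq> 0"
proof
  assume "c = 0"
  then have "\<tau> c = 0" using lfun_0[OF lfun_\<tau>] by (simp only:)
  then show False by simp
qed

lemma exists_E_nonzero: obtains y where "y \<in> E" "y \<noteq> 0"
  using exists_b_nonzero b_E by metis

lemma irreducible_closed_lines_Sh: "irreducible_closed proj_zariski (lines_in Sh)"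
  using irr_Sh is_cone_Sh c_in_Sh c_nonzero by (intro irreducible_closed_lines_in) auto

text \<open>Subspaces \<open>X\<close> of \<open>W\<^sub>1\<close> give the irreducible cones \<open>zcl (Psi1 ` (\<complex>c + X))\<close>, whose projections to
  \<open>W\<^sub>1\<close> remember \<open>X\<close>.\<close>

lemma chain_of_cones:
  obtains C where "\<And>i. i \<le> p \<Longrightarrow> irr (C i) \<and> is_cone (C i) \<and> C i \<noteq> {0} \<and> C i \<subseteq> Sh"
    "\<And>i. i < p \<Longrightarrow> C i \<subset> C (Suc i)"
proof -
  obtain X where X: "\<forall>i\<le>p. vec.subspace (X i) \<and> X i \<subseteq> W1" "\<forall>i<p. X i \<subset> X (Suc i)"
    using exists_flag[OF subspace_W1] by blast
  define UX where "UX Y = {v. P0 v = 0 \<and> P1 v \<in> Y}" for Y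
  define C where "C i = zcl (Psi1 ` UX (X i))" for i
  have sUX: "vec.subspace (UX Y)" if "vec.subspace Y" for Y
    using that by (auto intro!: vec.subspaceI simp: UX_def nf_simps vec.subspace_0 vec.subspace_add vec.subspace_scale)
  have inC: "c + x + b x x \<in> C i" if "x \<in> X i" "i \<le> p" for x i
  proof -
    have "x \<in> W1" using X that by blast
    then have "Psi1 (c + x) = c + x + b x x" "c + x \<in> UX (X i)"
      using that by (simp_all add: Psi1_def UX_def nf_simps b_simps W1D)
    then show ?thesis unfolding C_def using zcl_superset by (metis image_eqI subsetD)
  qed
  have P1C: "P1 v \<in> X i" if "v \<in> C i" "i \<le> p" for v i
  proof -
    have sX: "vec.subspace (X i)" using X(1) that by blast
    have "closedin zariski {v. P1 v \<in> X i}"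
      using sX by (intro closedin_subspace) (auto intro!: vec.subspaceI simp: nf_simps vec.subspace_0 vec.subspace_add vec.subspace_scale)
    moreover have "Psi1 ` UX (X i) \<subseteq> {v. P1 v \<in> X i}"
      using sX by (auto simp: Psi1_def UX_def nf_simps vec.subspace_scale)
    ultimately have "C i \<subseteq> {v. P1 v \<in> X i}" unfolding C_def by (intro zcl_minimal)
    then show ?thesis using that by blast
  qed
  show thesis
  proof (rule that[of C])
    fix i assume i: "i \<le> p"
    have sU: "vec.subspace (UX (X i))" using sUX X(1) i by blast
    have scale: "s *s v \<in> C i" if v: "v \<in> C i" for s v
      unfolding C_def in_zcl
    proof (intro allI impI)
      fix g assume g: "polyfun g" "\<forall>a\<in>Psi1 ` UX (X i). g a = 0"
      \<comment> \<open>\<open>Psi1\<close> is quadratic, so scaling by \<open>s\<close> is realised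
        on the parameters by a square root of \<open>s\<close>.\<close>
      have "Psi1 (csqrt s *s w) = s *s Psi1 w" for w
      proof -
        have "Psi1 (t *s w) = t ^ 2 *s Psi1 w" for t
          by (simp add: Psi1_def nf_simps b_simps vec_eq_iff power2_eq_square algebra_simps)
        then show ?thesis by simp
      qed
      then have z: "g (s *s Psi1 w) = 0" if "w \<in> UX (X i)" for w
        using g(2) vec.subspace_scale[OF sU that, of "csqrt s"] by (simp flip: \<open>\<And>w. Psi1 (csqrt s *s w) = s *s Psi1 w\<close>)
      have "polyfun (\<lambda>v. g (s *s v))"
        by (rule polyfun_comp[OF g(1)]) (intro polymap_scale polyfun_const polymap_id)
      then show "g (s *s v) = 0"
        using v[unfolded C_def] z by (intro zclD[where f = "\<lambda>v. g (s *s v)" and v = v]) blast+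
    qed
    have cC: "c \<in> C i" using inC[of 0 i] i X(1) by (simp add: b_simps vec.subspace_0)
    have "0 *s c \<in> C i" by (rule scale[OF cC])
    then have "is_cone (C i)" using scale by (simp add: is_cone_def)
    moreover have "C i \<subseteq> Sh"
      unfolding C_def by (rule zcl_minimal[OF _ closedin_Sh]) (use Psi1_Sh in blast)
    ultimately show "irr (C i) \<and> is_cone (C i) \<and> C i \<noteq> {0} \<and> C i \<subseteq> Sh"
      using irr_zcl_image[OF sU polymap_Psi1] cC c_nonzero by (auto simp: C_def)
  next
    fix i assume i: "i < p"
    have "UX (X i) \<subseteq> UX (X (Suc i))" using X(2) i by (auto simp: UX_def)
    then have "C i \<subseteq> C (Suc i)" unfolding C_def by (intro zcl_mono image_mono)
    moreover obtain x where x: "x \<in> X (Suc i)" "x \<notin> X i" using X(2) i by blast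
    have "Suc i \<le> p" using i by simp
    then have "x \<in> W1" using X(1) x(1) by blast
    then have "P1 (c + x + b x x) = x" by (simp add: nf_simps W1D)
    then have "c + x + b x x \<notin> C i" using P1C[of "c + x + b x x" i] x(2) i by auto
    moreover have "c + x + b x x \<in> C (Suc i)" using inC[OF x(1)] i by simp
    ultimately show "C i \<subset> C (Suc i)" by blast
  qed
qed

text \<open>The cones over a projective chain, with \<open>{0}\<close> added below, form an affine
  chain longer by one; so the affine bound \<open>p + 1\<close> becomes \<open>p\<close>.\<close>

lemma krull_dim_lines_Sh: "krull_dim (subtopology proj_zariski (lines_in Sh)) = enat p"
proof -
  have cl: "closedin proj_zariski (lines_in Sh)" by (rule closedin_lines_in[OF closedin_Sh is_cone_Sh])
  show ?thesis
    unfolding krull_dim_subtopology[OF cl]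
  proof (rule antisym)
    show "Sup {enat k |k. \<exists>Z. (\<forall>i\<le>k. irreducible_closed proj_zariski (Z i) \<and> Z i \<subseteq> lines_in Sh) \<and>
        (\<forall>i<k. Z i \<subset> Z (Suc i))} \<le> enat p"
    proof (rule Sup_least)
      fix e assume "e \<in> {enat k |k. \<exists>Z. (\<forall>i\<le>k. irreducible_closed proj_zariski (Z i) \<and> Z i \<subseteq> lines_in Sh) \<and>
        (\<forall>i<k. Z i \<subset> Z (Suc i))}"
      then obtain k Z where k: "e = enat k" "\<forall>i\<le>k. irreducible_closed proj_zariski (Z i) \<and> Z i \<subseteq> lines_in Sh"
          "\<forall>i<k. Z i \<subset> Z (Suc i)" by blast
      define D where "D i = (case i of 0 \<Rightarrow> {0} | Suc j \<Rightarrow> affine_cone (Z j))" for i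
      have Zp: "Z i \<subseteq> proj_space" if "i \<le> k" for i using k(2) that by (auto simp: lines_in_def)
      have "irr (D i) \<and> D i \<subseteq> Sh" if i: "i \<le> Suc k" for i
      proof (cases i)
        case 0
        then show ?thesis using irr_subspace[of "{0}"] is_cone_Sh by (simp add: D_def is_cone_def)
      next
        case (Suc j)
        then have j: "irreducible_closed proj_zariski (Z j)" "Z j \<subseteq> lines_in Sh" using k(2) i by simp_all
        show ?thesis
          using irr_affine_cone(1)[OF j(1)] affine_cone_mono[OF j(2)] affine_cone_lines_in[OF is_cone_Sh]
          by (simp add: D_def Suc)
      qed
      moreover have "D i \<subset> D (Suc i)" if i: "i < Suc k" for i
      proof (cases i)
        case 0
        then show ?thesis using irr_affine_cone(2)[of "Z 0"] k(2) by (simp add: D_def)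
      next
        case (Suc j)
        then have j: "Z j \<subset> Z (Suc j)" "Z j \<subseteq> proj_space" "Z (Suc j) \<subseteq> proj_space" using k(3) i Zp by simp_all
        have "affine_cone (Z j) \<noteq> affine_cone (Z (Suc j))"
        proof
          assume "affine_cone (Z j) = affine_cone (Z (Suc j))"
          then have "lines_in (affine_cone (Z j)) = lines_in (affine_cone (Z (Suc j)))" by (rule arg_cong)
          then show False unfolding lines_in_affine_cone[OF j(2)] lines_in_affine_cone[OF j(3)] using j(1) by blast
        qed
        then show ?thesis using affine_cone_mono[of "Z j" "Z (Suc j)"] j(1) by (auto simp: D_def Suc)
      qed
      ultimately have "has_chain Sh (Suc k)" unfolding has_chain_def by (intro exI[of _ D]) blast
      then show "e \<le> enat p" using has_chain_Sh_le k(1) by fastforce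
    qed
    obtain C where C: "\<And>i. i \<le> p \<Longrightarrow> irr (C i) \<and> is_cone (C i) \<and> C i \<noteq> {0} \<and> C i \<subseteq> Sh"
        "\<And>i. i < p \<Longrightarrow> C i \<subset> C (Suc i)" by (rule chain_of_cones) blast
    have "irreducible_closed proj_zariski (lines_in (C i)) \<and> lines_in (C i) \<subseteq> lines_in Sh" if "i \<le> p" for i
      using irreducible_closed_lines_in lines_in_mono C(1)[OF that] by blast
    moreover have "lines_in (C i) \<subset> lines_in (C (Suc i))" if i: "i < p" for i
    proof -
      have cone: "is_cone (C i)" "is_cone (C (Suc i))" using C(1)[of i] C(1)[of "Suc i"] i by simp_all
      have "lines_in (C i) \<noteq> lines_in (C (Suc i))"
      proof
        assume "lines_in (C i) = lines_in (C (Suc i))"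
        then have "affine_cone (lines_in (C i)) = affine_cone (lines_in (C (Suc i)))" by (rule arg_cong)
        then show False unfolding affine_cone_lines_in[OF cone(1)] affine_cone_lines_in[OF cone(2)] using C(2)[OF i] by blast
      qed
      then show ?thesis using lines_in_mono C(2)[OF i] by blast
    qed
    ultimately show "enat p \<le> Sup {enat k |k. \<exists>Z. (\<forall>i\<le>k. irreducible_closed proj_zariski (Z i) \<and> Z i \<subseteq> lines_in Sh) \<and>
        (\<forall>i<k. Z i \<subset> Z (Suc i))}"
      by (intro Sup_upper CollectI exI[of _ p] conjI refl exI[of _ "\<lambda>i. lines_in (C i)"]) blast+
  qed
qed

lemma card_eq: "CARD('n) = p + 1 + r"
proof -
  have "{u + v |u v. u \<in> U1 \<and> v \<in> W0} = UNIV"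
  proof -
    have "\<exists>u v. w = u + v \<and> u \<in> U1 \<and> v \<in> W0" for w
      by (rule exI[of _ "\<tau> w *s c + P1 w"], rule exI[of _ "P0 w"])
         (use decomp[of w] in \<open>simp add: U1_def nf_simps\<close>)
    then show ?thesis by blast
  qed
  moreover have "U1 \<inter> W0 \<subseteq> {0}" by (auto simp: U1_def W0_def)
  then have "vec.dim (U1 \<inter> W0) = 0" by simp
  ultimately have "vec.dim (UNIV :: (complex ^ 'n) set) = vec.dim U1 + r"
    using vec.dim_sums_Int[OF subspace_U1 subspace_W0] by (simp only: add_0_right)
  then show ?thesis by (simp only: dim_U1 dim_UNIV_eq)
qed

text \<open>The span of \<open>Sh\<close> contains \<open>c\<close> and \<open>E\<close>, hence also
  the \<open>W1\<close>-components of the points \<open>c + x + b x x\<close>. \<open>E\<close>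
  spans \<open>W0\<close>, as \<open>z\<close> is a combination of \<open>psi g z\<close> and
  \<open>g\<close> whenever \<open>Q z g\<close> is nonzero.\<close>

lemma nondegenerate_lines_Sh: "nondegenerate (lines_in Sh)"
  unfolding nondegenerate_def
proof
  assume "\<exists>H. vec.subspace H \<and> vec.dim H + 1 = CARD('n) \<and> (\<forall>L\<in>lines_in Sh. L \<subseteq> H)"
  then obtain H where H: "vec.subspace H" "vec.dim H + 1 = CARD('n)" "\<And>L. L \<in> lines_in Sh \<Longrightarrow> L \<subseteq> H" by blast
  have SH: "v \<in> H" if "v \<in> Sh" for v
    using H(3)[OF line_in_lines_in[OF is_cone_Sh that]] in_line[of v] vec.subspace_0[OF H(1)] by (cases "v = 0") auto
  have EH: "y \<in> H" if "y \<in> E" for y using SH[OF E_Sh[OF that]] .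
  have W1H: "x \<in> H" if x: "x \<in> W1" for x
  proof -
    have "c + x + b x x \<in> Sh" using Psi1_Sh[of "c + x"] x by (simp add: Psi1_def nf_simps b_simps W1D)
    then have "(c + x + b x x) - c - b x x \<in> H"
      using SH c_in_Sh EH[OF b_E] by (intro vec.subspace_diff[OF H(1)])
    then show ?thesis by simp
  qed
  obtain y where y: "y \<in> E" "y \<noteq> 0" using exists_E_nonzero .
  obtain g where g: "g \<in> E" "Q y g \<noteq> 0" using exists_isotropic_partner[OF y y] by metis
  have z: "z \<in> H" if z: "z \<in> W0" "Q z g \<noteq> 0" for z
  proof -
    have "(1 / (2 * Q z g)) *s (psi g z + Q z z *s g) \<in> H"
      using EH[OF psi_E[OF g(1)]] EH[OF g(1)] by (intro vec.subspace_scale[OF H(1)] vec.subspace_add[OF H(1)])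
    then show ?thesis using z by (simp add: psi_def W0D)
  qed
  have W0H: "z \<in> H" if zW: "z \<in> W0" for z
  proof (cases "Q z g = 0")
    case True
    have "(z + y) - y \<in> H"
      using z[of "z + y"] True g(2) zW E_W0[OF y(1)] EH[OF y(1)]
      by (intro vec.subspace_diff[OF H(1)]) (simp_all add: Q_simps vec.subspace_add[OF subspace_W0])
    then show ?thesis by simp
  qed (use z zW in blast)
  have "v \<in> H" for v
  proof -
    have "\<tau> v *s c + P1 v + P0 v \<in> H"
      using SH[OF c_in_Sh] W1H[OF P1_in] W0H[OF P0_in] by (intro vec.subspace_add[OF H(1)] vec.subspace_scale[OF H(1)])
    then show ?thesis by (rule back_subst[OF _ decomp[symmetric]])
  qed
  then have "H = UNIV" by blast
  then have "vec.dim H = CARD('n)" by (simp only: dim_UNIV_eq)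
  then show False using H(2) by simp
qed

text \<open>A cubic that is singular at two points vanishes on their line. Conversely the points of
  \<open>Yh\<close> with \<open>\<tau>\<close> nonzero lie on secants, and these points are dense
  because \<open>Yh\<close> is irreducible.\<close>

lemma secant_lines_Sh: "secant_variety (lines_in Sh) = lines_in Yh"
proof -
  let ?D = "{K \<in> proj_space. \<exists>L\<in>lines_in Sh. \<exists>M\<in>lines_in Sh. L \<noteq> M \<and> K \<subseteq> vec.span (L \<union> M)}"
  have sub: "?D \<subseteq> lines_in Yh"
  proof
    fix K assume "K \<in> ?D"
    then obtain L M where K: "K \<in> proj_space" "L \<in> lines_in Sh" "M \<in> lines_in Sh" "K \<subseteq> vec.span (L \<union> M)" by blast
    have "v \<in> Yh" if "v \<in> K" for v
    proof -
      have "vec.subspace L" "vec.subspace M"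
        using K(2,3) by (auto simp: lines_in_def proj_space_def)
      then have "vec.span L = L" "vec.span M = M" by (simp_all only: vec.span_eq_iff)
      moreover have "v \<in> {x + y |x y. x \<in> vec.span L \<and> y \<in> vec.span M}"
        using that K(4) unfolding vec.span_Un by blast
      ultimately have "v \<in> {x + y |x y. x \<in> L \<and> y \<in> M}" by (simp only:)
      then obtain x y where v: "v = x + y" "x \<in> L" "y \<in> M" by blast
      have z: "f u u w = 0" "f u w u = 0" "f w u u = 0" if "u \<in> Sh" for u w
        using that sym23[of u w u] sym12[of w u u] unfolding Sh_def by simp_all
      have "x \<in> Sh" "y \<in> Sh" using v(2,3) K(2,3) by (auto simp: lines_in_def)
      then show "v \<in> Yh" unfolding v(1) Yh_def by (simp add: f_simps z)
    qed
    then show "K \<in> lines_in Yh" using K(1) by (auto simp: lines_in_def)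
  qed
  have "closedin proj_zariski (lines_in Yh)" by (rule closedin_lines_in[OF closedin_Yh is_cone_Yh])
  then have 1: "secant_variety (lines_in Sh) \<subseteq> lines_in Yh"
    unfolding secant_variety_def by (rule closure_of_minimal[OF sub])
  have cl: "closedin proj_zariski (secant_variety (lines_in Sh))"
    unfolding secant_variety_def by (rule closedin_closure_of)
  have DS: "?D \<subseteq> secant_variety (lines_in Sh)"
    unfolding secant_variety_def by (rule closure_of_subset) auto
  let ?T = "affine_cone (secant_variety (lines_in Sh))"
  have in_T: "v \<in> ?T" if v: "v \<in> Yh" "\<tau> v \<noteq> 0" for v
  proof -
    define s where "s = \<tau> v *s c + P1 v + (1 / \<tau> v) *s b v v"
    \<comment> \<open>\<open>\<tau> v * Q e e\<close> equals \<open>f v v v\<close>, so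
      \<open>e\<close> is isotropic because \<open>v\<close> is on the cubic.\<close>
    define e where "e = P0 v - (1 / \<tau> v) *s b v v"
    have vse: "v = s + e"
      by (rule trans[OF decomp]) (simp add: s_def e_def)
    have ts: "\<tau> s = \<tau> v" by (simp add: s_def nf_simps)
    have s: "s \<in> Sh"
    proof (rule Sh_if_\<tau>)
      show "\<tau> s \<noteq> 0" using v ts by simp
      have "b s s = b v v" by (simp add: s_def b_simps)
      moreover have "P0 s = (1 / \<tau> v) *s b v v" by (simp add: s_def nf_simps)
      ultimately show "\<tau> s *s P0 s = b s s" using v(2) by (simp add: ts)
    qed
    have s0: "s \<noteq> 0" using ts v(2) by (auto simp: nf_simps)
    have "e \<in> E"
    proof -
      have "\<tau> v * Q v v = 2 * Q (b v v) v"
        using f_normal[of v v v] v(1) by (simp add: Yh_def)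
      moreover have "Q e e = Q v v - 2 / \<tau> v * Q (b v v) v"
        using Q_b_b_diag[of v v] Q_sym[of v "b v v"] by (simp add: e_def Q_simps)
      ultimately have "Q e e = 0" using v(2) by (simp add: field_simps)
      moreover have "e \<in> W0"
        unfolding e_def by (intro vec.subspace_diff[OF subspace_W0] vec.subspace_scale[OF subspace_W0]) simp_all
      ultimately show ?thesis by (simp add: E_def)
    qed
    then obtain e' where e': "e' \<in> E" "e' \<noteq> 0" "e \<in> range (\<lambda>a. a *s e')"
    \<comment> \<open>A secant needs two distinct points: if \<open>v\<close> is singular itself,
      any nonzero vector of \<open>E\<close> serves as the second one.\<close>
    proof (cases "e = 0")
      case True
      obtain y where "y \<in> E" "y \<noteq> 0" using exists_E_nonzero .
      then show thesis using that[of y] True by (auto simp: image_iff intro: exI[of _ 0])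
    next
      case False
      then show thesis using that[of e] \<open>e \<in> E\<close> in_line[of e] by blast
    qed
    let ?L = "range (\<lambda>a. a *s s)" and ?M = "range (\<lambda>a. a *s e')" and ?K = "range (\<lambda>a. a *s v)"
    have LM: "?L \<in> lines_in Sh" "?M \<in> lines_in Sh"
      using line_in_lines_in[OF is_cone_Sh] s s0 E_Sh[OF e'(1)] e'(2) by blast+
    have "s \<notin> ?M"
      using ts v(2) E_W0[OF e'(1)] by (auto simp: nf_simps W0D)
    then have ne: "?L \<noteq> ?M" using in_line[of s] by blast
    have "v \<in> vec.span (?L \<union> ?M)"
      unfolding vse using in_line[of s] e'(3) by (intro vec.span_add) (auto intro: vec.span_base)
    then have "?K \<subseteq> vec.span (?L \<union> ?M)" by (auto intro: vec.span_scale)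
    moreover have "?K \<in> proj_space" using v(2) by (intro line_in_proj_space) (auto simp: nf_simps)
    ultimately have "?K \<in> ?D" using LM ne by (intro CollectI conjI bexI[of _ ?L] bexI[of _ ?M])
    then have "?K \<in> secant_variety (lines_in Sh)" by (rule subsetD[OF DS])
    then show ?thesis using in_line[of v] by (auto simp: affine_cone_def)
  qed
  have "Yh \<subseteq> ?T"
  proof (rule ccontr)
    assume "\<not> Yh \<subseteq> ?T"
    then obtain v where v: "v \<in> Yh" "v \<notin> ?T" by blast
    obtain g where g: "polyfun g" "\<And>a. a \<in> ?T \<Longrightarrow> g a = 0" "g v \<noteq> 0"
      using not_in_closed[OF closedin_affine_cone[OF cl] v(2)] by metis
    have "g u * \<tau> u = 0" if "u \<in> Yh" for u using in_T[OF that] g(2) by auto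
    then have "(\<forall>v\<in>Yh. g v = 0) \<or> (\<forall>v\<in>Yh. \<tau> v = 0)"
      by (rule irr_mult[OF irr_Yh g(1) lfun_polyfun[OF lfun_\<tau>]])
    moreover have "c \<in> Yh" using c_in_Sh Sh_subset_Yh by blast
    ultimately show False using v(1) g(3) \<tau>_c by auto
  qed
  then have "lines_in Yh \<subseteq> lines_in ?T" by (rule lines_in_mono)
  then show ?thesis using 1 lines_in_affine_cone[OF closedin_proj_subset[OF cl]] by blast
qed

theorem severi_lines_Sh:
  assumes "proj_smooth (lines_in Sh)"
  shows "severi_variety (lines_in Sh)"
proof -
  obtain v where v: "f v v v \<noteq> 0" using polarization[of c] f_nondegenerate[of c] c_nonzero by blast
  then have v0: "v \<noteq> 0" by (auto simp: f_simps)
  have "range (\<lambda>s. s *s v) \<notin> lines_in Yh"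
    using v in_line[of v] by (auto simp: lines_in_def Yh_def)
  then have "secant_variety (lines_in Sh) \<noteq> proj_space"
    using line_in_proj_space[OF v0] unfolding secant_lines_Sh by blast
  moreover have "\<exists>m N. N + 1 = CARD('n) \<and> krull_dim (subtopology proj_zariski (lines_in Sh)) = enat m \<and>
        real m = (2 * real N - 4) / 3"
  proof (intro exI conjI)
    show "(p + r) + 1 = CARD('n)" using card_eq by simp
    show "krull_dim (subtopology proj_zariski (lines_in Sh)) = enat p" by (rule krull_dim_lines_Sh)
    \<comment> \<open>With \<open>N = p + r\<close> the Severi condition
      \<open>3 p = 2 N - 4\<close> becomes \<open>p + 4 = 2 r\<close>.\<close>
    have "real (p + 4) = real (2 * r)" using p_eq by (rule arg_cong)
    then show "real p = (2 * real (p + r) - 4) / 3" by simp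
  qed
  ultimately show ?thesis
    unfolding severi_variety_def
    using irreducible_closed_lines_Sh nondegenerate_lines_Sh assms by blast
qed

end

section \<open>Smooth points of the cubic cone\<close>

context cubic
begin

lemma dd_form: "dd (\<lambda>v. f v v v) v u = 3 * f v v u"
proof -
  have "f (v + t *s u) (v + t *s u) (v + t *s u) =
      f v v v + t * (3 * f v v u) + t ^ 2 * (3 * f v u u) + t ^ 3 * f u u u" for t
    by (simp add: f_simps sym12[of u v] sym23[of u u v] sym23[of v u v] power2_eq_square power3_eq_cube algebra_simps)
  moreover have "((\<lambda>t. f v v v + t * (3 * f v v u) + t ^ 2 * (3 * f v u u) + t ^ 3 * f u u u)
      has_field_derivative 3 * f v v u) (at 0)"
    by (auto intro!: derivative_eq_intros)
  ultimately show ?thesis unfolding dd_def by (simp add: DERIV_imp_deriv)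
qed

lemma dd_form2: "dd (\<lambda>v. 3 * f v v w) v u = 6 * f v u w"
proof -
  have "3 * f (v + t *s u) (v + t *s u) w = 3 * f v v w + t * (6 * f v u w) + t ^ 2 * (3 * f u u w)" for t
    by (simp add: f_simps sym12[of u v] power2_eq_square algebra_simps)
  moreover have "((\<lambda>t. 3 * f v v w + t * (6 * f v u w) + t ^ 2 * (3 * f u u w))
      has_field_derivative 6 * f v u w) (at 0)"
    by (auto intro!: derivative_eq_intros)
  ultimately show ?thesis unfolding dd_def by (simp add: DERIV_imp_deriv)
qed

end

text \<open>\<open>0 ^ k\<close> covers two uses: for \<open>k = 0\<close> the value at 0 is
  \<open>a\<close>, and for positive \<open>k\<close> it is 0.\<close>

lemma polyfun_scale_eq_power:
  assumes g: "polyfun g" and a: "\<And>s. s \<noteq> 0 \<Longrightarrow> g (s *s v) = s ^ k * a"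
  shows "g 0 = 0 ^ k * a"
proof -
  obtain P where P: "\<And>s. g (0 + s *s v) = poly P s" using polyfun_on_line[OF g, of 0 v] by metis
  \<comment> \<open>The factor \<open>[:0, 1:]\<close> absorbs the point \<open>s = 0\<close>, where
    nothing is assumed.\<close>
  have "poly ([:0, 1:] * (P - monom a k)) s = 0" for s
    using a[of s] P[of s] by (cases "s = 0") (simp_all add: poly_monom mult.commute[of a])
  then have "[:0, 1:] * (P - monom a k) = 0" by (intro poly_all_0_iff_0[THEN iffD1] allI)
  then have "P = monom a k" by simp
  then show ?thesis using P[of 0] by (simp add: poly_monom mult.commute)
qed

context nondegenerate_cubic
begin

lemma obtain_multiple:
  assumes "polyfun g" "\<And>v. v \<in> Yh \<Longrightarrow> g v = 0"
  obtains q where "polyfun q" "\<And>v. g v = q v * f v v v"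
proof -
  obtain e :: "complex ^ 'n" where "e \<noteq> 0" using exists_nonzero_vector by blast
  then show thesis
    using multiple_of_form[OF vec.subspace_UNIV no_linear_factor UNIV_I _ assms(1), of e] assms(2) that
    by (auto simp: Yh_def)
qed

text \<open>Functions vanishing on \<open>Yh\<close> are multiples of the form, so at a zero of the
  form their differentials are multiples of its differential.\<close>

lemma tangent_space_Yh:
  assumes v: "v \<in> Yh"
  shows "tangent_space Yh v = {u. f v v u = 0}"
proof -
  have pf: "polyfun (\<lambda>v. f v v v)" by (intro polyfun_f polymap_id)
  have "dd g v u = 0" if u: "f v v u = 0" and g: "polyfun g" "\<forall>a\<in>Yh. g a = 0" for u g
  proof -
    obtain q where q: "polyfun q" "\<And>v. g v = q v * f v v v" using obtain_multiple[of g] g by blast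
    have "((\<lambda>t. q (v + t *s u) * f (v + t *s u) (v + t *s u) (v + t *s u)) has_field_derivative
        dd q v u * f (v + 0 *s u) (v + 0 *s u) (v + 0 *s u) + dd (\<lambda>v. f v v v) v u * q (v + 0 *s u)) (at 0)"
      by (rule DERIV_mult[OF dd_line[OF q(1)] dd_line[OF pf]])
    moreover have "dd q v u * f (v + 0 *s u) (v + 0 *s u) (v + 0 *s u) + dd (\<lambda>v. f v v v) v u * q (v + 0 *s u) = 0"
      using v u by (simp add: dd_form Yh_def)
    ultimately have "((\<lambda>t. g (v + t *s u)) has_field_derivative 0) (at 0)" unfolding q(2) by simp
    then show ?thesis unfolding dd_def by (rule DERIV_imp_deriv)
  qed
  moreover have "f v v u = 0" if u: "u \<in> tangent_space Yh v" for u
  proof -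
    have "dd (\<lambda>v. f v v v) v u = 0" using u pf unfolding in_tangent_space by (auto simp: Yh_def)
    then show ?thesis by (simp add: dd_form)
  qed
  ultimately show ?thesis by (auto simp: in_tangent_space)
qed

lemma exists_f_nonzero: obtains e where "f e e e \<noteq> 0"
  using polarization f_nondegenerate exists_nonzero_vector by metis

lemma local_dim_Yh:
  assumes v: "v \<in> Yh"
  shows "local_dim (subtopology zariski Yh) v = enat (CARD('n) - 1)"
  unfolding local_dim_zariski[OF closedin_Yh]
proof (rule antisym)
  have le: "k \<le> CARD('n) - 1" if k: "has_chain Z k" and Z: "Z \<subseteq> Yh" for Z k
  proof -
    obtain e where "f e e e \<noteq> 0" using exists_f_nonzero .
    then have "Yh \<subset> UNIV" by (auto simp: Yh_def)
    then have "has_chain (UNIV :: (complex ^ 'n) set) (Suc k)"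
      using has_chain_Suc[OF has_chain_mono[OF k Z]] irr_subspace[OF vec.subspace_UNIV] by blast
    then show ?thesis using has_chain_subspace_le[OF vec.subspace_UNIV] dim_UNIV_eq[where 'm = 'n] by fastforce
  qed
  show "Sup {Sup {enat k |k. has_chain Z k} |Z. irr Z \<and> Z \<subseteq> Yh \<and> v \<in> Z} \<le> enat (CARD('n) - 1)"
    using le by (auto intro!: Sup_least)
  have "vec.dim (UNIV :: (complex ^ 'n) set) = Suc (CARD('n) - 1)"
    using dim_UNIV_eq[where 'm = 'n] zero_less_card_finite[where 'a = 'n] by simp
  from has_chain_zero_set[OF vec.subspace_UNIV this]
  have "has_chain Yh (CARD('n) - 1)" by simp
  then have "enat (CARD('n) - 1) \<le> Sup {enat k |k. has_chain Yh k}" by (intro Sup_upper) blast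
  also have "\<dots> \<le> Sup {Sup {enat k |k. has_chain Z k} |Z. irr Z \<and> Z \<subseteq> Yh \<and> v \<in> Z}"
    using irr_Yh v by (intro Sup_upper) blast
  finally show "enat (CARD('n) - 1) \<le> Sup {Sup {enat k |k. has_chain Z k} |Z. irr Z \<and> Z \<subseteq> Yh \<and> v \<in> Z}" .
qed

lemma smooth_point_Yh:
  assumes v: "v \<in> Yh"
  shows "smooth_point Yh v \<longleftrightarrow> (\<exists>u. f v v u \<noteq> 0)"
proof (cases "\<exists>u. f v v u \<noteq> 0")
  case True
  then obtain u where u: "f v v u \<noteq> 0" by blast
  have "vec.dim (UNIV :: (complex ^ 'n) set) = vec.dim {u \<in> UNIV. f v v u = 0} + 1"
    by (rule dim_subspace_lker[OF vec.subspace_UNIV lin3, of u]) (use u in auto)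
  then have "vec.dim {u. f v v u = 0} = CARD('n) - 1" using dim_UNIV_eq[where 'm = 'n] by simp
  then show ?thesis
    using True v by (simp only: smooth_point_def tangent_space_Yh[OF v] local_dim_Yh[OF v] simp_thms)
next
  case False
  then have "{u. f v v u = 0} = UNIV" by blast
  then have "vec.dim {u. f v v u = 0} = CARD('n)" using dim_UNIV_eq[where 'm = 'n] by simp
  moreover have "CARD('n) \<noteq> CARD('n) - 1" using zero_less_card_finite[where 'a = 'n] by linarith
  ultimately have "vec.dim {u. f v v u = 0} \<noteq> CARD('n) - 1" by simp
  then show ?thesis
    using False by (simp only: smooth_point_def tangent_space_Yh[OF v] local_dim_Yh[OF v] enat.inject simp_thms)
qed

text \<open>\<open>f v v (A w v)\<close> vanishes on \<open>Yh\<close>, at smooth points by tangency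
  and at singular points trivially. So it is a multiple of the form; both are homogeneous of degree
  3, which makes the quotient a constant \<open>l w\<close>.\<close>

lemma exists_prol:
  assumes "aut1 Yh \<noteq> {\<lambda>_ _. 0}"
  obtains A l w0 where "prol A l" "l w0 \<noteq> 0"
proof -
  have "(\<lambda>_ _. 0) \<in> aut1 Yh"
    by (auto simp: aut1_def aut_def vec.subspace_0[OF subspace_tangent_space] lmap_iff_linear[symmetric] lmap_def)
  then obtain A where A: "A \<in> aut1 Yh" "A \<noteq> (\<lambda>_ _. 0)" using assms by blast
  have sym: "A u w = A w u" for u w using A(1) unfolding aut1_def by blast
  have lA: "lmap (A w)" for w using A(1) by (simp add: aut1_def aut_def lmap_iff_linear)
  have lA': "lmap (\<lambda>w. A w x)" for x unfolding sym[of _ x] by (rule lA)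
  have zero: "f v v (A w v) = 0" if v: "v \<in> Yh" for v w
  proof (cases "smooth_point Yh v")
    case True
    then have "A w v \<in> tangent_space Yh v" using A(1) unfolding aut1_def aut_def by blast
    then show ?thesis unfolding tangent_space_Yh[OF v] by simp
  next
    case False
    then show ?thesis using smooth_point_Yh[OF v] by blast
  qed
  obtain e where e: "f e e e \<noteq> 0" using exists_f_nonzero .
  define l where "l w = f e e (A w e) / f e e e" for w
  have "f x x (A w x) = l w * f x x x" for x w
  proof -
    have "polyfun (\<lambda>v. f v v (A w v))" by (intro polyfun_f polymap_id lmap_polymap[OF lA])
    then obtain q where q: "polyfun q" "\<And>v. f v v (A w v) = q v * f v v v"
      using obtain_multiple[of "\<lambda>v. f v v (A w v)"] zero by blast
    have const: "q v = q 0" if v: "f v v v \<noteq> 0" for v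
    proof -
      have "q (s *s v) = s ^ 0 * q v" if s: "s \<noteq> 0" for s
      proof -
        have "s ^ 3 * f v v (A w v) = q (s *s v) * (s ^ 3 * f v v v)"
          using q(2)[of "s *s v"] by (simp add: f_simps lmap_scale[OF lA] power3_eq_cube mult_ac)
        then have "s ^ 3 * ((q v - q (s *s v)) * f v v v) = 0" unfolding q(2)[of v] by (simp add: algebra_simps)
        then show ?thesis using s v by simp
      qed
      from polyfun_scale_eq_power[OF q(1) this] show ?thesis by simp
    qed
    have "l w = q 0" using const[OF e] e q(2)[of e] by (simp add: l_def)
    then show ?thesis using q(2)[of x] const[of x] by (cases "f x x x = 0") simp_all
  qed
  moreover have "lfun l"
    unfolding lfun_def l_def
    by (simp add: lmap_add[OF lA'] lmap_scale[OF lA'] f_simps add_divide_distrib)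
  ultimately have prol: "prol A l" unfolding prol_def using lA sym by blast
  then interpret prolonged_cubic f A l by unfold_locales
  have "\<exists>w0. l w0 \<noteq> 0"
  proof (rule ccontr)
    assume "\<not> ?thesis"
    then have "A x y = 0" for x y using A_eq_0_if_l_eq_0 by blast
    then show False using A(2) by blast
  qed
  then show thesis using that[OF prol] by blast
qed

end

section \<open>From polynomials to symmetric trilinear forms\<close>

lemma monomial_Suc:
  fixes m :: "'n::finite \<Rightarrow> nat"
  assumes "(\<Sum>i\<in>UNIV. m i) = Suc d"
  shows "\<exists>a m'. (\<Sum>i\<in>UNIV. m' i) = d \<and>
     (\<forall>v :: complex ^ 'n. (\<Prod>i\<in>UNIV. v $ i ^ m i) = v $ a * (\<Prod>i\<in>UNIV. v $ i ^ m' i))"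
proof -
  have "(\<Sum>i\<in>UNIV. m i) \<noteq> 0" using assms by simp
  then obtain a where a: "m a \<noteq> 0" by (rule sum.not_neutral_contains_not_neutral)
  show ?thesis
  proof (intro exI[of _ a] exI[of _ "m(a := m a - 1)"] conjI allI)
    show "(\<Sum>i\<in>UNIV. (m(a := m a - 1)) i) = d"
      using assms a by (simp add: sum.remove[of UNIV a])
    fix v :: "complex ^ 'n"
    have "v $ a ^ m a = v $ a * v $ a ^ (m a - 1)" using a by (simp flip: power_Suc)
    then show "(\<Prod>i\<in>UNIV. v $ i ^ m i) = v $ a * (\<Prod>i\<in>UNIV. v $ i ^ (m(a := m a - 1)) i)"
      by (simp add: prod.remove[of UNIV a])
  qed
qed

lemma monomial_3:
  fixes m :: "'n::finite \<Rightarrow> nat"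
  assumes "(\<Sum>i\<in>UNIV. m i) = 3"
  shows "\<exists>a b c. \<forall>v :: complex ^ 'n. (\<Prod>i\<in>UNIV. v $ i ^ m i) = v $ a * (v $ b * v $ c)"
proof -
  have "(\<Sum>i\<in>UNIV. m i) = Suc (Suc (Suc 0))" using assms by simp
  from monomial_Suc[OF this] obtain a m1 where 1: "(\<Sum>i\<in>UNIV. m1 i) = Suc (Suc 0)"
      "\<forall>v :: complex ^ 'n. (\<Prod>i\<in>UNIV. v $ i ^ m i) = v $ a * (\<Prod>i\<in>UNIV. v $ i ^ m1 i)"
    by (elim exE conjE)
  from monomial_Suc[OF 1(1)] obtain b m2 where 2: "(\<Sum>i\<in>UNIV. m2 i) = Suc 0"
      "\<forall>v :: complex ^ 'n. (\<Prod>i\<in>UNIV. v $ i ^ m1 i) = v $ b * (\<Prod>i\<in>UNIV. v $ i ^ m2 i)"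
    by (elim exE conjE)
  from monomial_Suc[OF 2(1)] obtain c m3 where 3: "(\<Sum>i\<in>UNIV. m3 i) = 0"
      "\<forall>v :: complex ^ 'n. (\<Prod>i\<in>UNIV. v $ i ^ m2 i) = v $ c * (\<Prod>i\<in>UNIV. v $ i ^ m3 i)"
    by (elim exE conjE)
  have "m3 i = 0" for i using 3(1) by simp
  then show ?thesis
    by (intro exI[of _ a] exI[of _ b] exI[of _ c] allI) (simp add: 1(2) 2(2) 3(2))
qed

lemma exists_cubic:
  assumes F: "homogeneous 3 F"
  shows "\<exists>f. cubic f \<and> (\<forall>v. peval F v = f v v v)"
proof -
  have "\<forall>m\<in>Poly_Mapping.keys F. \<exists>k. \<forall>v :: complex ^ 'a.
      (\<Prod>i\<in>UNIV. v $ i ^ Poly_Mapping.lookup m i) = v $ fst k * (v $ fst (snd k) * v $ snd (snd k))"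
  proof
    fix m assume "m \<in> Poly_Mapping.keys F"
    then have "(\<Sum>i\<in>UNIV. Poly_Mapping.lookup m i) = 3" using F by (simp add: homogeneous_def)
    from monomial_3[OF this] obtain a b c
      where "\<forall>v :: complex ^ 'a. (\<Prod>i\<in>UNIV. v $ i ^ Poly_Mapping.lookup m i) = v $ a * (v $ b * v $ c)"
      by (elim exE)
    then show "\<exists>k. \<forall>v :: complex ^ 'a.
      (\<Prod>i\<in>UNIV. v $ i ^ Poly_Mapping.lookup m i) = v $ fst k * (v $ fst (snd k) * v $ snd (snd k))"
      by (intro exI[of _ "(a, b, c)"]) simp
  qed
  then obtain k where k: "\<forall>m\<in>Poly_Mapping.keys F. \<forall>v :: complex ^ 'a.
      (\<Prod>i\<in>UNIV. v $ i ^ Poly_Mapping.lookup m i) = v $ fst (k m) * (v $ fst (snd (k m)) * v $ snd (snd (k m)))"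
    by (rule bchoice[THEN exE])
  define T where "T k u v w = u $ fst k * (v $ fst (snd k) * w $ snd (snd k))" for k and u v w :: "complex ^ 'a"
  \<comment> \<open>The sum over all six orders of the arguments; dividing by 6 in \<open>f\<close>
    restores the value on the diagonal.\<close>
  define S where "S k u v w = T k u v w + T k u w v + T k v u w + T k v w u + T k w u v + T k w v u" for k u v w
  define f where "f u v w = (\<Sum>m\<in>Poly_Mapping.keys F. (Poly_Mapping.lookup F m / 6) * S (k m) u v w)" for u v w
  show ?thesis
  proof (intro exI[of _ f] conjI allI)
    show "cubic f"
    proof
      have "lfun (\<lambda>u. S k u v w)" for k v w
        unfolding lfun_def S_def T_def by (simp add: algebra_simps)
      then show "lfun (\<lambda>u. f u v w)" for v w unfolding f_def by (intro lfun_sumI lfun_cmultI)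
      have "S k u v w = S k v u w" "S k u v w = S k u w v" for k u v w by (simp_all add: S_def)
      then show "f u v w = f v u w" "f u v w = f u w v" for u v w unfolding f_def by metis+
    qed
    fix v
    have "(Poly_Mapping.lookup F m / 6) * S (k m) v v v =
        Poly_Mapping.lookup F m * (\<Prod>i\<in>UNIV. v $ i ^ Poly_Mapping.lookup m i)" if "m \<in> Poly_Mapping.keys F" for m
      using k[rule_format, OF that, of v] by (simp add: S_def T_def)
    then show "peval F v = f v v v" unfolding peval_def f_def by (intro sum.cong refl) (simp only:)
  qed
qed

lemma peval_prod: "peval (\<Prod>a\<in>A. g a) x = (\<Prod>a\<in>A. peval (g a) x)"
  by (induction A rule: infinite_finite_induct) (auto simp: peval_mult)

lemma peval_det: "peval (det M) x = det (\<chi> i j. peval (M $ i $ j) x)"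
proof -
  have "peval (of_int (sign \<pi>)) x = of_int (sign \<pi>)" for \<pi> :: "'b \<Rightarrow> 'b"
    by (simp add: sign_def peval_uminus)
  then show ?thesis by (simp add: det_def peval_sum peval_mult peval_prod)
qed

lemma nondegenerate_cubic_if_irreducible:
  assumes cubic: "cubic f" and F: "\<And>v. peval F v = f v v v"
    and irreducible: "irreducible F" and not_defective: "\<not> polar_defective F"
  shows "nondegenerate_cubic f"
proof -
  interpret cubic f by (rule cubic)
  have Ff: "peval F = (\<lambda>v. f v v v)" using F by blast
  have axis: "dd (peval q) v (axis i 1) = peval (partial i q) v" for q v i
    by (simp add: dd_peval axis_def if_distrib[of "\<lambda>x. _ * x"] cong: if_cong)
  have p1: "peval (partial j F) = (\<lambda>v. 3 * f v v (axis j 1))" for j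
    using axis[of F] unfolding Ff dd_form by (intro ext) simp
  have p2: "peval (partial i (partial j F)) v = 6 * f v (axis i 1) (axis j 1)" for i j v
    using axis[of "partial j F" v i] unfolding p1 dd_form2 by simp
  show ?thesis
  proof
    show "\<exists>v. hess v \<noteq> 0"
    proof (rule ccontr)
      assume "\<not> ?thesis"
      then have hess: "hess v = 0" for v by simp
      have "peval (hessian_det F) v = 0" for v
      proof -
        \<comment> \<open>Each second derivative of the form is 6 times the trilinear form, so every
          row contributes a factor 6.\<close>
        have "peval (hessian_det F) v = det (\<chi> i. 6 *s (\<chi> j. f v (axis i 1) (axis j 1)))"
          unfolding hessian_det_def peval_det by (simp add: p2 vector_scalar_mult_def)
        also have "\<dots> = (\<Prod>i\<in>(UNIV :: 'a set). 6) * hess v"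
          unfolding hess_def by (rule det_rows_mul)
        finally show ?thesis using hess by simp
      qed
      then have "hessian_det F = 0" by (rule peval_eq_0_imp)
      then show False using not_defective by (simp add: polar_defective_def)
    qed
    show "\<not> linear_factor_on UNIV"
    proof
      assume "linear_factor_on UNIV"
      then obtain l g v0 where lg: "lfun l" "l v0 \<noteq> 0" "polyfun g" "\<And>v. f v v v = l v * g v"
        unfolding linear_factor_on_def by blast
      obtain Lp G where LG: "l = peval Lp" "g = peval G"
        using lfun_polyfun[OF lg(1)] lg(3) unfolding polyfun_def by blast
      have "peval F = peval (Lp * G)" using lg(4) by (intro ext) (simp add: F peval_mult LG)
      then have "F = Lp * G" by (simp only: peval_inject)
      then have "Lp dvd 1 \<or> G dvd 1" using irreducible by (rule irreducibleD[rotated])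
      then show False
      proof
        assume "Lp dvd 1"
        then obtain H where "1 = Lp * H" by (rule dvdE)
        then have "peval 1 0 = peval (Lp * H) (0 :: complex ^ 'a)" by simp
        then show False using lfun_0[OF lg(1)] by (simp add: peval_mult LG)
      next
        assume "G dvd 1"
        then obtain H where "1 = G * H" by (rule dvdE)
        then have "peval 1 0 = peval (G * H) (0 :: complex ^ 'a)" by simp
        then have "g 0 \<noteq> 0" by (auto simp: peval_mult LG)
        \<comment> \<open>The cofactor of a linear form in a cubic scales quadratically along
          \<open>v0\<close>, so it vanishes at 0 and is not a unit.\<close>
        moreover have "g 0 = 0 ^ 2 * (f v0 v0 v0 / l v0)"
        proof (rule polyfun_scale_eq_power[OF lg(3)])
          fix s :: complex assume s: "s \<noteq> 0"
          have "s ^ 3 * f v0 v0 v0 = s * l v0 * g (s *s v0)"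
            using lg(4)[of "s *s v0"] by (simp add: f_simps lfun_scale[OF lg(1)] power3_eq_cube mult_ac)
          then show "g (s *s v0) = s ^ 2 * (f v0 v0 v0 / l v0)"
            using s lg(2) by (simp add: field_simps power2_eq_square power3_eq_cube)
        qed
        ultimately show False by simp
      qed
    qed
  qed
qed

theorem mainTheorem1:
  fixes F :: "'n::finite cpoly" and Y :: "(complex ^ 'n) set set"
  assumes "homogeneous 3 F" and "irreducible F" and "Y = proj_zeros {F}"
    and "\<not> polar_defective F"
    and "proj_smooth (sing_locus Y)"
    and "aut1 (affine_cone Y) \<noteq> {\<lambda>_ _. 0}"
  shows "\<exists>V :: (complex ^ 'n) set set. severi_variety V \<and> Y = secant_variety V"
proof -
  obtain f where f: "cubic f" "\<forall>v. peval F v = f v v v" using exists_cubic[OF assms(1)] by (elim exE conjE)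
  interpret nondegenerate_cubic f
    by (rule nondegenerate_cubic_if_irreducible[OF f(1) f(2)[rule_format] assms(2,4)])
  have "zeros {F} = Yh" by (simp add: zeros_def Yh_def f(2))
  then have Y: "Y = lines_in Yh" by (simp add: assms(3) proj_zeros_def lines_in_def)
  have aY: "affine_cone Y = Yh" unfolding Y by (rule affine_cone_lines_in[OF is_cone_Yh])
  obtain A l w0 where A: "prol A l" "l w0 \<noteq> 0" using exists_prol assms(6) unfolding aY by blast
  interpret prolonged_cubic f A l by unfold_locales (rule A(1))
  obtain \<tau> c P1 P0 b Q where nf: "normal_form f \<tau> c P1 P0 b Q" using exists_normal_form[OF A(2)] .
  interpret normal_form f \<tau> c P1 P0 b Q by (rule nf)
  have singular: "v \<in> Sh \<longleftrightarrow> \<not> smooth_point Yh v" if "v \<in> Yh" for v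
    unfolding smooth_point_Yh[OF that] by (simp add: Sh_def)
  \<comment> \<open>A line counts as singular if one of its nonzero vectors is a singular point;
    then all of it is singular because \<open>Sh\<close> is a cone.\<close>
  have sing: "sing_locus Y = lines_in Sh"
  proof
    show "lines_in Sh \<subseteq> sing_locus Y"
    proof
      fix L assume L: "L \<in> lines_in Sh"
      then have "L \<in> Y" unfolding Y using lines_in_mono[OF Sh_subset_Yh] by blast
      obtain v where v: "v \<noteq> 0" "L = range (\<lambda>s. s *s v)" using proj_space_cases L by (auto simp: lines_in_def)
      then have "v \<in> L" using in_line by simp
      moreover have "\<not> smooth_point Yh v" using \<open>v \<in> L\<close> L Sh_subset_Yh singular[of v] by (auto simp: lines_in_def)
      ultimately have "\<not> proj_smooth_at Y L" using v(1) unfolding proj_smooth_at_def aY by blast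
      then show "L \<in> sing_locus Y" using \<open>L \<in> Y\<close> by (simp add: sing_locus_def)
    qed
    show "sing_locus Y \<subseteq> lines_in Sh"
    proof
      fix L assume L: "L \<in> sing_locus Y"
      then obtain v where v: "v \<in> L" "v \<noteq> 0" "\<not> smooth_point Yh v"
        unfolding sing_locus_def proj_smooth_at_def aY by blast
      have LY: "L \<in> proj_space" "L \<subseteq> Yh" using L by (auto simp: sing_locus_def Y lines_in_def)
      then have "v \<in> Sh" using singular[of v] v by blast
      then show "L \<in> lines_in Sh"
        using line_in_lines_in[OF is_cone_Sh _ v(2)] proj_space_eq_line[OF LY(1) v(1,2)] by simp
    qed
  qed
  interpret smooth_normal_form f \<tau> c P1 P0 b Q
  proof
    fix v assume v: "v \<in> Sh" "v \<noteq> 0"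
    then have "proj_smooth_at (lines_in Sh) (range (\<lambda>s. s *s v))"
      using assms(5) line_in_lines_in[OF is_cone_Sh v] unfolding sing proj_smooth_def by blast
    then show "smooth_point Sh v"
      using in_line[of v] v(2) unfolding proj_smooth_at_def affine_cone_lines_in[OF is_cone_Sh] by blast
  qed
  have "severi_variety (lines_in Sh)" using severi_lines_Sh assms(5) unfolding sing by blast
  moreover have "Y = secant_variety (lines_in Sh)" unfolding Y secant_lines_Sh ..
  ultimately show ?thesis by blast
qed

end
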